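(* Let $R$, $R'$ be Hecke symmetries with the same parameter $q$ on finite dimensional spaces $V$, $V'$, both satisfying the $1$-dimensional source condition. Then the graded algebras $A(R',R)$ and $E(R',R)$ are Koszul, and $h_{A(R',R)}(t)\,h_{E(R',R)}(-t)=1$.
   Context: A Hecke symmetry with parameter $0\neq q\in\Bbbk$ on $V$ is a linear operator $R$ on $V\otimes V$ with $(R+\mathrm{id})(R-q\,\mathrm{id})=0$ and $(R\otimes\mathrm{id})(\mathrm{id}\otimes R)(R\otimes\mathrm{id})=(\mathrm{id}\otimes R)(R\otimes\mathrm{id})(\mathrm{id}\otimes R)$; it makes $V^{\otimes n}$ a module over the Hecke algebra $\mathcal H_n(q)$ ($T_i$ acting by $R$ on positions $i,i+1$). $R$ satisfies the $1$-dimensional source condition if for every $n>0$ each indecomposable direct summand of $V^{\otimes n}$ is isomorphic to a direct summand of a module induced from a $1$-dimensional representation of a parabolic subalgebra of $\mathcal H_n(q)$. With $R'^*$ the adjoint of $R'$ on $(V'^* )^{\otimes2}\cong(V'^{\otimes2})^*$, let $\mathcal R$ be the operator on $(V'^*\otimes V)^{\otimes2}$ corresponding to $(R'^* )^{-1}\otimes R$ under $(V'^*\otimes V)^{\otimes2}\cong(V'^* )^{\otimes2}\otimes V^{\otimes2}$. $A(R',R)$, $E(R',R)$ are the quotients of $\mathbb T(V'^*\otimes V)$ by the ideals generated by $\operatorname{Im}(\mathcal R-\mathrm{id})$, resp. $\operatorname{Ker}(\mathcal R-\mathrm{id})$. A quadratic algebra is Koszul if its Koszul complex is a resolution of the trivial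 module $\Bbbk$; $h_A(t)=\sum_n(\dim A_n)t^n$. *)

theory Defs
  imports Main "HOL-Computational_Algebra.Formal_Power_Series"
begin

definition mmul :: "'j set \<Rightarrow> ('i \<Rightarrow> 'j \<Rightarrow> 'k::comm_ring_1) \<Rightarrow> ('j \<Rightarrow> 'l \<Rightarrow> 'k) \<Rightarrow> 'i \<Rightarrow> 'l \<Rightarrow> 'k"
  where "mmul X f g = (\<lambda>u w. \<Sum>v\<in>X. f u v * g v w)"

definition meq :: "'i set \<Rightarrow> 'j set \<Rightarrow> ('i \<Rightarrow> 'j \<Rightarrow> 'k) \<Rightarrow> ('i \<Rightarrow> 'j \<Rightarrow> 'k) \<Rightarrow> bool"
  where "meq A B f g = (\<forall>u\<in>A. \<forall>w\<in>B. f u w = g u w)"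

definition idm :: "'i \<Rightarrow> 'i \<Rightarrow> 'k::comm_ring_1"
  where "idm u w = (if u = w then 1 else 0)"

definition mvec :: "'j set \<Rightarrow> ('i \<Rightarrow> 'j \<Rightarrow> 'k::comm_ring_1) \<Rightarrow> ('j \<Rightarrow> 'k) \<Rightarrow> 'i \<Rightarrow> 'k"
  where "mvec X f v = (\<lambda>u. \<Sum>w\<in>X. f u w * v w)"

definition minv :: "'i set \<Rightarrow> ('i \<Rightarrow> 'i \<Rightarrow> 'k::comm_ring_1) \<Rightarrow> 'i \<Rightarrow> 'i \<Rightarrow> 'k"
  where "minv D M = (THE S. (\<forall>a b. (a \<notin> D \<or> b \<notin> D) \<longrightarrow> S a b = 0)
                           \<and> meq D D (mmul D S M) idm \<and> meq D D (mmul D M S) idm)"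

text \<open>Basis of the n-th tensor power of a space with basis X: words of length n over X.\<close>
definition hk_words :: "nat \<Rightarrow> 'x set \<Rightarrow> 'x list set"
  where "hk_words n X = {w. length w = n \<and> set w \<subseteq> X}"

text \<open>R acting on positions i, i+1 (1-based, 1 \<le> i < n) of V^{\<otimes>n}, V with basis {..<d}:
  this is id^{\<otimes>(i-1)} \<otimes> R \<otimes> id^{\<otimes>(n-i-1)}, i.e. the action of T_i.\<close>
definition Rat :: "(nat \<times> nat \<Rightarrow> nat \<times> nat \<Rightarrow> 'k::comm_ring_1) \<Rightarrow> nat \<Rightarrow> nat list \<Rightarrow> nat list \<Rightarrow> 'k"
  where "Rat R i u w = (if (\<forall>j < length u. j \<noteq> i - 1 \<and> j \<noteq> i \<longrightarrow> u ! j = w ! j)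
                        then R (u ! (i - 1), u ! i) (w ! (i - 1), w ! i) else 0)"

definition hecke_symmetry :: "'k::field \<Rightarrow> nat \<Rightarrow> (nat \<times> nat \<Rightarrow> nat \<times> nat \<Rightarrow> 'k) \<Rightarrow> bool"
  where "hecke_symmetry q d R \<longleftrightarrow> q \<noteq> 0
     \<and> meq (hk_words 2 {..<d}) (hk_words 2 {..<d})
          (mmul (hk_words 2 {..<d}) (\<lambda>u w. Rat R 1 u w + idm u w) (\<lambda>u w. Rat R 1 u w - q * idm u w))
          (\<lambda>u w. 0)
     \<and> meq (hk_words 3 {..<d}) (hk_words 3 {..<d})
          (mmul (hk_words 3 {..<d}) (Rat R 1) (mmul (hk_words 3 {..<d}) (Rat R 2) (Rat R 1)))
          (mmul (hk_words 3 {..<d}) (Rat R 2) (mmul (hk_words 3 {..<d}) (Rat R 1) (Rat R 2)))"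

text \<open>H_n(q) is presented by generators T_1,...,T_{n-1} with the quadratic relations, the braid
  relations and far commutativity; a finite-dimensional module is given by a finite basis B and
  matrices T i (1 \<le> i < n) satisfying these relations.\<close>
definition hecke_mod :: "'k::field \<Rightarrow> nat \<Rightarrow> nat list set \<Rightarrow> (nat \<Rightarrow> nat list \<Rightarrow> nat list \<Rightarrow> 'k) \<Rightarrow> bool"
  where "hecke_mod q n B T \<longleftrightarrow> finite B
     \<and> (\<forall>i\<in>{1..<n}. meq B B (mmul B (\<lambda>u w. T i u w + idm u w) (\<lambda>u w. T i u w - q * idm u w)) (\<lambda>u w. 0))
     \<and> (\<forall>i. 1 \<le> i \<and> i + 1 < n \<longrightarrow>
          meq B B (mmul B (T i) (mmul B (T (i+1)) (T i))) (mmul B (T (i+1)) (mmul B (T i) (T (i+1)))))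
     \<and> (\<forall>i j. i \<in> {1..<n} \<and> j \<in> {1..<n} \<and> i + 2 \<le> j \<longrightarrow> meq B B (mmul B (T i) (T j)) (mmul B (T j) (T i)))"

definition mod_hom :: "nat \<Rightarrow> nat list set \<Rightarrow> (nat \<Rightarrow> nat list \<Rightarrow> nat list \<Rightarrow> 'k::field)
     \<Rightarrow> nat list set \<Rightarrow> (nat \<Rightarrow> nat list \<Rightarrow> nat list \<Rightarrow> 'k) \<Rightarrow> (nat list \<Rightarrow> nat list \<Rightarrow> 'k) \<Rightarrow> bool"
  where "mod_hom n B T B' T' f \<longleftrightarrow> (\<forall>i\<in>{1..<n}. meq B' B (mmul B' (T' i) f) (mmul B f (T i)))"

definition is_summand :: "nat \<Rightarrow> nat list set \<Rightarrow> (nat \<Rightarrow> nat list \<Rightarrow> nat list \<Rightarrow> 'k::field)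
     \<Rightarrow> nat list set \<Rightarrow> (nat \<Rightarrow> nat list \<Rightarrow> nat list \<Rightarrow> 'k) \<Rightarrow> bool"
  where "is_summand n B T B' T' \<longleftrightarrow> (\<exists>f g. mod_hom n B T B' T' f \<and> mod_hom n B' T' B T g
                                          \<and> meq B B (mmul B' g f) idm)"

definition indecomposable :: "nat \<Rightarrow> nat list set \<Rightarrow> (nat \<Rightarrow> nat list \<Rightarrow> nat list \<Rightarrow> 'k::field) \<Rightarrow> bool"
  where "indecomposable n B T \<longleftrightarrow> B \<noteq> {} \<and>
     (\<forall>e. mod_hom n B T B T e \<and> meq B B (mmul B e e) e \<longrightarrow> meq B B e (\<lambda>u w. 0) \<or> meq B B e idm)"

text \<open>A 1-dimensional representation T_i \<mapsto> c i (i \<in> J) of the parabolic subalgebra H_J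
  generated by the T_i, i \<in> J \<subseteq> {1..n-1}.\<close>
definition one_dim_par_rep :: "'k::field \<Rightarrow> nat \<Rightarrow> nat set \<Rightarrow> (nat \<Rightarrow> 'k) \<Rightarrow> bool"
  where "one_dim_par_rep q n J c \<longleftrightarrow> J \<subseteq> {1..<n}
     \<and> (\<forall>i\<in>J. (c i + 1) * (c i - q) = 0)
     \<and> (\<forall>i. i \<in> J \<and> i + 1 \<in> J \<longrightarrow> c i * c (i+1) * c i = c (i+1) * c i * c (i+1))
     \<and> (\<forall>i j. i \<in> J \<and> j \<in> J \<and> i + 2 \<le> j \<longrightarrow> c i * c j = c j * c i)"

text \<open>(B,T) together with v is the induced module H_n(q) \<otimes>_{H_J} k_c with generator v = 1 \<otimes> 1,
  characterised by its universal property (Frobenius reciprocity) among finite-dimensional modules.\<close>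
definition induced_from :: "'k::field \<Rightarrow> nat \<Rightarrow> nat set \<Rightarrow> (nat \<Rightarrow> 'k) \<Rightarrow> nat list set
     \<Rightarrow> (nat \<Rightarrow> nat list \<Rightarrow> nat list \<Rightarrow> 'k) \<Rightarrow> (nat list \<Rightarrow> 'k) \<Rightarrow> bool"
  where "induced_from q n J c B T v \<longleftrightarrow> hecke_mod q n B T
     \<and> (\<forall>i\<in>J. \<forall>u\<in>B. mvec B (T i) v u = c i * v u)
     \<and> (\<forall>B' T' m. hecke_mod q n B' T' \<and> (\<forall>i\<in>J. \<forall>u\<in>B'. mvec B' (T' i) m u = c i * m u) \<longrightarrow>
          (\<exists>f. mod_hom n B T B' T' f \<and> (\<forall>u\<in>B'. mvec B f v u = m u))
        \<and> (\<forall>f g. mod_hom n B T B' T' f \<and> mod_hom n B T B' T' g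
              \<and> (\<forall>u\<in>B'. mvec B f v u = m u) \<and> (\<forall>u\<in>B'. mvec B g v u = m u) \<longrightarrow> meq B' B f g))"

definition one_dim_source :: "'k::field \<Rightarrow> nat \<Rightarrow> (nat \<times> nat \<Rightarrow> nat \<times> nat \<Rightarrow> 'k) \<Rightarrow> bool"
  where "one_dim_source q d R \<longleftrightarrow>
    (\<forall>n>0. \<forall>B T. hecke_mod q n B T \<and> indecomposable n B T
                 \<and> is_summand n B T (hk_words n {..<d}) (Rat R) \<longrightarrow>
       (\<exists>J c B' T' v. one_dim_par_rep q n J c \<and> induced_from q n J c B' T' v \<and> is_summand n B T B' T'))"

text \<open>Elements of W^{\<otimes>n}: functions on words, vanishing off hk_words n X.\<close>
definition vecs :: "nat \<Rightarrow> 'x set \<Rightarrow> ('x list \<Rightarrow> 'k::field) set"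
  where "vecs n X = {f. \<forall>w. w \<notin> hk_words n X \<longrightarrow> f w = 0}"

definition lspan :: "('x list \<Rightarrow> 'k::field) set \<Rightarrow> ('x list \<Rightarrow> 'k) set"
  where "lspan S = {(\<lambda>w. \<Sum>s\<in>F. c s * s w) | F c. finite F \<and> F \<subseteq> S}"

definition ssum :: "('x list \<Rightarrow> 'k::field) set \<Rightarrow> ('x list \<Rightarrow> 'k) set \<Rightarrow> ('x list \<Rightarrow> 'k) set"
  where "ssum U U' = {(\<lambda>w. u w + u' w) | u u'. u \<in> U \<and> u' \<in> U'}"

definition vdim :: "('x list \<Rightarrow> 'k::field) set \<Rightarrow> nat"
  where "vdim U = (LEAST k. \<exists>F. finite F \<and> card F = k \<and> F \<subseteq> U \<and> lspan F = U)"

definition tens :: "nat \<Rightarrow> ('x list \<Rightarrow> 'k::field) \<Rightarrow> ('x list \<Rightarrow> 'k) \<Rightarrow> 'x list \<Rightarrow> 'k"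
  where "tens p f g = (\<lambda>w. f (take p w) * g (drop p w))"

definition tsp :: "nat \<Rightarrow> ('x list \<Rightarrow> 'k::field) set \<Rightarrow> ('x list \<Rightarrow> 'k) set \<Rightarrow> ('x list \<Rightarrow> 'k) set"
  where "tsp p U U' = lspan {tens p f g | f g. f \<in> U \<and> g \<in> U'}"

definition rel_piece :: "'x set \<Rightarrow> ('x list \<Rightarrow> 'k::field) set \<Rightarrow> nat \<Rightarrow> nat \<Rightarrow> ('x list \<Rightarrow> 'k) set"
  where "rel_piece X I2 n j = tsp j (vecs j X) (tsp 2 I2 (vecs (n - 2 - j) X))"

definition qideal :: "'x set \<Rightarrow> ('x list \<Rightarrow> 'k::field) set \<Rightarrow> nat \<Rightarrow> ('x list \<Rightarrow> 'k) set"
  where "qideal X I2 n = lspan (\<Union>j\<in>{j. j + 2 \<le> n}. rel_piece X I2 n j)"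

text \<open>(A^!_n)^* \<subseteq> W^{\<otimes>n}.\<close>
definition kdual :: "'x set \<Rightarrow> ('x list \<Rightarrow> 'k::field) set \<Rightarrow> nat \<Rightarrow> ('x list \<Rightarrow> 'k) set"
  where "kdual X I2 n = (if n < 2 then vecs n X else (\<Inter>j\<in>{j. j + 2 \<le> n}. rel_piece X I2 n j))"

definition hilb :: "'x set \<Rightarrow> ('x list \<Rightarrow> 'k::field) set \<Rightarrow> int fps"
  where "hilb X I2 = Abs_fps (\<lambda>n. int (vdim (vecs n X :: ('x list \<Rightarrow> 'k) set)) - int (vdim (qideal X I2 n)))"

text \<open>Koszul complex K_i = A \<otimes> (A^!_i)^*, d(a \<otimes> x_1...x_i) = a x_1 \<otimes> x_2...x_i.
  Its component of internal degree m and homological degree i is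
  A_{m-i} \<otimes> (A^!_i)^* = (W^{m-i} \<otimes> (A^!_i)^* + I_{m-i} \<otimes> W^i) / (I_{m-i} \<otimes> W^i),
  a subquotient KU/KN of W^{\<otimes>m}, and the differential is induced by the identity of W^{\<otimes>m}.\<close>
definition KN :: "'x set \<Rightarrow> ('x list \<Rightarrow> 'k::field) set \<Rightarrow> nat \<Rightarrow> nat \<Rightarrow> ('x list \<Rightarrow> 'k) set"
  where "KN X I2 m i = (if i \<le> m then tsp (m - i) (qideal X I2 (m - i)) (vecs i X) else {\<lambda>w. 0})"

definition KU :: "'x set \<Rightarrow> ('x list \<Rightarrow> 'k::field) set \<Rightarrow> nat \<Rightarrow> nat \<Rightarrow> ('x list \<Rightarrow> 'k) set"
  where "KU X I2 m i = (if i \<le> m then lspan (tsp (m - i) (vecs (m - i) X) (kdual X I2 i) \<union> KN X I2 m i)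
                        else {\<lambda>w. 0})"

text \<open>Koszul: the augmented complex ... \<rightarrow> K_1 \<rightarrow> K_0 = A \<rightarrow> k \<rightarrow> 0 is exact, degree by degree:
  exactness at K_i (i \<ge> 1) and at K_0 (in positive internal degree; surjectivity of the
  augmentation and degree 0 are automatic).\<close>
definition koszul :: "'x set \<Rightarrow> ('x list \<Rightarrow> 'k::field) set \<Rightarrow> bool"
  where "koszul X I2 \<longleftrightarrow>
     (\<forall>m i. 1 \<le> i \<longrightarrow> KU X I2 m i \<inter> KN X I2 m (i - 1) \<subseteq> ssum (KU X I2 m (i + 1)) (KN X I2 m i))
   \<and> (\<forall>m. 1 \<le> m \<longrightarrow> KU X I2 m 0 \<subseteq> ssum (KU X I2 m 1) (KN X I2 m 0))"

text \<open>Basis of W = V'^* \<otimes> V: pairs (a,i), a < d' (dual basis of V'), i < d.\<close>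
definition Wbasis :: "nat \<Rightarrow> nat \<Rightarrow> (nat \<times> nat) set"
  where "Wbasis d' d = {..<d'} \<times> {..<d}"

text \<open>Matrix of (R'^*)^{-1} on (V'^*)^{\<otimes>2} in the dual basis: inverse of the transpose of R'
  (identification (f \<otimes> g)(x \<otimes> y) = f(x) g(y)).\<close>
definition Rdual_inv :: "nat \<Rightarrow> (nat \<times> nat \<Rightarrow> nat \<times> nat \<Rightarrow> 'k::field) \<Rightarrow> nat \<times> nat \<Rightarrow> nat \<times> nat \<Rightarrow> 'k"
  where "Rdual_inv d' R' = minv ({..<d'} \<times> {..<d'}) (\<lambda>a b. R' b a)"

definition calR :: "nat \<Rightarrow> (nat \<times> nat \<Rightarrow> nat \<times> nat \<Rightarrow> 'k::field) \<Rightarrow> (nat \<times> nat \<Rightarrow> nat \<times> nat \<Rightarrow> 'k)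
     \<Rightarrow> (nat \<times> nat) list \<Rightarrow> (nat \<times> nat) list \<Rightarrow> 'k"
  where "calR d' R' R u w = Rdual_inv d' R' (fst (u ! 0), fst (u ! 1)) (fst (w ! 0), fst (w ! 1))
                            * R (snd (u ! 0), snd (u ! 1)) (snd (w ! 0), snd (w ! 1))"

definition linmap :: "'x list set \<Rightarrow> ('x list \<Rightarrow> 'x list \<Rightarrow> 'k::field) \<Rightarrow> ('x list \<Rightarrow> 'k) \<Rightarrow> 'x list \<Rightarrow> 'k"
  where "linmap Y M f = (\<lambda>u. if u \<in> Y then \<Sum>w\<in>Y. M u w * f w else 0)"

definition calR_minus_id :: "nat \<Rightarrow> (nat \<times> nat \<Rightarrow> nat \<times> nat \<Rightarrow> 'k::field) \<Rightarrow> nat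
     \<Rightarrow> (nat \<times> nat \<Rightarrow> nat \<times> nat \<Rightarrow> 'k) \<Rightarrow> ((nat \<times> nat) list \<Rightarrow> 'k) \<Rightarrow> (nat \<times> nat) list \<Rightarrow> 'k"
  where "calR_minus_id d' R' d R = linmap (hk_words 2 (Wbasis d' d)) (\<lambda>u w. calR d' R' R u w - idm u w)"

definition relA :: "nat \<Rightarrow> (nat \<times> nat \<Rightarrow> nat \<times> nat \<Rightarrow> 'k::field) \<Rightarrow> nat
     \<Rightarrow> (nat \<times> nat \<Rightarrow> nat \<times> nat \<Rightarrow> 'k) \<Rightarrow> ((nat \<times> nat) list \<Rightarrow> 'k) set"
  where "relA d' R' d R = calR_minus_id d' R' d R ` vecs 2 (Wbasis d' d)"

definition relE :: "nat \<Rightarrow> (nat \<times> nat \<Rightarrow> nat \<times> nat \<Rightarrow> 'k::field) \<Rightarrow> nat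
     \<Rightarrow> (nat \<times> nat \<Rightarrow> nat \<times> nat \<Rightarrow> 'k) \<Rightarrow> ((nat \<times> nat) list \<Rightarrow> 'k) set"
  where "relE d' R' d R = {f \<in> vecs 2 (Wbasis d' d). calR_minus_id d' R' d R f = (\<lambda>u. 0)}"

end

theory Submission
  imports Defs "HOL-Library.Product_Lexorder" "HOL-Library.List_Lexorder" "HOL-Library.Multiset"
    "HOL-Library.Function_Algebras"
begin

text \<open>
  Identify \<open>(V'\<^sup>* \<otimes> V)\<^sup>\<otimes>\<^sup>n\<close> with \<open>Hom(V'\<^sup>\<otimes>\<^sup>n, V\<^sup>\<otimes>\<^sup>n)\<close>. The degree \<open>n\<close> pieces of the relations of \<open>E\<close> and \<open>A\<close>
  become the subspaces of maps commuting with \<open>T\<^sub>j\<close>, respectively of commutators with \<open>T\<^sub>j\<close>, and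
  Koszulness becomes a distributivity condition on these subspaces, which passes to direct summands.
  By the source condition \<open>V\<^sup>\<otimes>\<^sup>n\<close> is a summand of a multiple of the module \<open>C\<close> on words in \<open>n\<close> even and
  \<open>n\<close> odd letters, the sum of all modules induced from one-dimensional parabolic representations;
  for \<open>C\<close> the subspaces are spanned by parts of a basis indexed by pairs of words.

  Exactness gives \<open>h\<^sub>E(-t) h(t) = 1\<close>, where the \<open>n\<close>-th coefficient of \<open>h\<close> is the dimension of the
  Hecke homomorphisms \<open>V'\<^sup>\<otimes>\<^sup>n \<rightarrow> V\<^sup>\<otimes>\<^sup>n\<close>. By trace duality \<open>dim A\<^sub>n\<close> counts the homomorphisms in the
  opposite direction. The two dimensions agree because \<open>C\<close> is self-dual and the simple quotients of
  submodules of \<open>Hom(N, C)\<close> over \<open>End(C)\<close> carry invariant symmetric forms, constructed from the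
  lexicographically least weight.
\<close>

section \<open>Linear algebra\<close>

text \<open>Neither semisimplicity nor a decomposition into eigenspaces is at hand: \<open>q\<close>
  may be a root of unity, the characteristic is arbitrary, and for \<open>q = -1\<close> the
  operator \<open>R\<close> may fail to be diagonalizable. The source condition replaces them by one
  explicit module, in which all positions can be treated with a single basis. The Hilbert series
  identity does not follow from Koszulness alone, because \<open>A(R',R)\<close> is not visibly the
  quadratic dual of \<open>E(R',R)\<close>. Under the trace form, the annihilator of commuting maps
  in one direction consists of commutators in the other, so the dual of \<open>E(R',R)\<close> is
  the algebra \<open>A\<close> with \<open>R\<close> and \<open>R'\<close> exchanged. Only the
  dimensions of the two directions of Hom have to be compared, and no isomorphism is constructed.
  The comparison uses that the endomorphism algebra of \<open>C\<close> resembles a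
  \<open>q\<close>-Schur algebra: modulo maps through lexicographically smaller weights, each weight
  has only scalar endomorphisms. Hence the least weight of a simple quotient is a line, on which a
  form can be normalized.\<close>

text \<open>A copy of the locale \<^locale>\<open>vector_space\<close>: names declared in the original locale are captured
  by its unqualified interpretation for real vector spaces.\<close>
locale vspace = vector_space scale for scale :: "'k::field => 'v::ab_group_add => 'v"
begin

text \<open>The subspaces in question lie in infinite-dimensional spaces of functions and matrices,
  so finite dimension is a property of the subspace and not of the type.\<close>

definition fdim :: "'v set => bool"
  where "fdim U \<longleftrightarrow> (\<exists>B. finite B \<and> U \<subseteq> span B)"

lemma fdim_subset: "fdim V ==> U \<subseteq> V ==> fdim U"
  unfolding fdim_def by blast

lemma fdim_independent_finite: "fdim V ==> local.independent B ==> B \<subseteq> V ==> finite B"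
  unfolding fdim_def using independent_span_bound[of _ B] by blast

lemma fdim_basis:
  assumes "subspace U" "fdim U"
  obtains B where "finite B" "local.independent B" "B \<subseteq> U" "span B = U" "card B = dim U"
proof -
  obtain B where B: "B \<subseteq> U" "local.independent B" "U \<subseteq> span B" "card B = dim U"
    using basis_exists by blast
  have "span B = U" using B assms(1) span_minimal by blast
  then show thesis using that B fdim_independent_finite[OF assms(2)] by blast
qed

lemma dim_eq_card_basis: "local.independent B ==> span B = V ==> dim V = card B"
  using dim_eq_card[of B V] span_span[of B] by metis

lemma dim_mono_fdim:
  assumes "subspace U" "subspace V" "fdim V" "U \<subseteq> V"
  shows "dim U \<le> dim V"
proof -
  obtain B where B: "finite B" "span B = V" "card B = dim V"
    using fdim_basis[OF assms(2,3)] by metis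
  obtain A where A: "local.independent A" "A \<subseteq> U" "card A = dim U"
    using fdim_basis[OF assms(1) fdim_subset[OF assms(3,4)]] by metis
  show ?thesis using independent_span_bound[of B A] A B assms(4) by auto
qed

lemma dim_eq_subspace:
  assumes "subspace U" "subspace V" "fdim V" "U \<subseteq> V" "dim V \<le> dim U"
  shows "U = V"
proof -
  obtain A where A: "finite A" "local.independent A" "A \<subseteq> U" "span A = U" "card A = dim U"
    using fdim_basis[OF assms(1) fdim_subset[OF assms(3,4)]] by metis
  obtain B where B: "A \<subseteq> B" "B \<subseteq> V" "local.independent B" "V \<subseteq> span B"
    using maximal_independent_subset_extend[of A V] A assms by blast
  have fB: "finite B" using fdim_independent_finite[OF assms(3)] B by blast
  have "span B = V" using B assms(2) span_minimal by blast
  then have "dim V = card B" using B(3) dim_eq_card_basis by simp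
  then have "A = B" using A B fB assms(5) card_subset_eq[of B A] card_mono[of B A] by auto
  then show ?thesis using A \<open>span B = V\<close> by simp
qed

lemma linear_functional_separating:
  assumes "subspace U" "x \<notin> U"
  obtains g where "Vector_Spaces.linear scale (*) g" "\<And>u. u \<in> U ==> g u = 0" "g x = 1"
proof -
  interpret fd: vector_space_pair scale "(*) :: 'k => 'k => 'k"
    by unfold_locales (simp_all add: algebra_simps)
  obtain B where B: "B \<subseteq> U" "local.independent B" "U \<subseteq> span B" "card B = dim U"
    by (rule basis_exists)
  have sB: "span B = U" using B assms(1) span_minimal by blast
  have ind: "local.independent (insert x B)" using B sB assms(2) by (simp add: independent_insert)
  obtain g where g: "Vector_Spaces.linear scale (*) g" "\<forall>b\<in>insert x B. g b = (if b = x then 1 else 0)"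
    using fd.linear_independent_extend[OF ind, of "\<lambda>b. if b = x then 1 else 0"] by blast
  have "x \<notin> B" using B assms by blast
  have B0: "g b = 0" if "b \<in> B" for b using g(2) that \<open>x \<notin> B\<close> by auto
  show thesis
  proof (rule that[OF g(1)])
    show "g u = 0" if "u \<in> U" for u
      by (rule fd.linear_eq_0_on_span[OF g(1), of B]) (use B0 that sB in auto)
    show "g x = 1" using g(2) by simp
  qed
qed

end

locale vspace_pair = vs1: vspace s1 + vs2: vspace s2
  for s1 :: "'k::field => 'v::ab_group_add => 'v" and s2 :: "'k => 'w::ab_group_add => 'w"
begin

sublocale vector_space_pair s1 s2 by unfold_locales

lemma rank_nullity:
  assumes "Vector_Spaces.linear s1 s2 f" "vs1.subspace U" "vs1.fdim U"
  shows "vs1.dim U = vs1.dim {x\<in>U. f x = 0} + vs2.dim (f ` U)"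
proof -
  interpret f: Vector_Spaces.linear s1 s2 f by fact
  let ?K = "{x\<in>U. f x = 0}"
  have sK: "vs1.subspace ?K" using assms(2) by (auto simp: vs1.subspace_def f.add f.scale)
  obtain A where A: "finite A" "vs1.independent A" "A \<subseteq> ?K" "vs1.span A = ?K" "card A = vs1.dim ?K"
    using vs1.fdim_basis[OF sK vs1.fdim_subset[OF assms(3)]] by blast
  obtain B where B: "A \<subseteq> B" "B \<subseteq> U" "vs1.independent B" "U \<subseteq> vs1.span B"
    using vs1.maximal_independent_subset_extend[of A U] A by blast
  have fB: "finite B" using vs1.fdim_independent_finite[OF assms(3)] B by blast
  have sB: "vs1.span B = U" using B assms(2) vs1.span_minimal by blast
  let ?C = "B - A"
  have zero: "c b = 0" if s: "(\<Sum>b\<in>?C. s2 (c b) (f b)) = 0" and b: "b \<in> ?C" for c b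
  proof -
    have "f (\<Sum>b\<in>?C. s1 (c b) b) = 0" using s by (simp add: f.sum f.scale)
    moreover have "(\<Sum>b\<in>?C. s1 (c b) b) \<in> U"
      using assms(2) B by (intro vs1.subspace_sum) (auto intro: vs1.subspace_scale)
    ultimately have "(\<Sum>b\<in>?C. s1 (c b) b) \<in> vs1.span A" using A by auto
    then obtain d where d: "(\<Sum>b\<in>?C. s1 (c b) b) = (\<Sum>a\<in>A. s1 (d a) a)"
      using A(1) by (auto simp: vs1.span_finite)
    let ?e = "\<lambda>b. if b \<in> A then - d b else c b"
    have "(\<Sum>b\<in>B. s1 (?e b) b) = (\<Sum>b\<in>?C. s1 (?e b) b) + (\<Sum>b\<in>A. s1 (?e b) b)"
      using fB B(1) by (simp add: sum.subset_diff)
    also have "... = (\<Sum>b\<in>?C. s1 (c b) b) - (\<Sum>a\<in>A. s1 (d a) a)"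
      by (simp add: sum_negf)
    finally have "(\<Sum>b\<in>B. s1 (?e b) b) = 0" using d by simp
    then have "?e b = 0" using vs1.independentD[OF B(3) fB order_refl, of ?e b] b by blast
    then show ?thesis using b by simp
  qed
  have inj: "inj_on f ?C"
  proof (rule inj_onI, rule ccontr)
    fix x y assume xy: "x \<in> ?C" "y \<in> ?C" "f x = f y" "x \<noteq> y"
    let ?c = "\<lambda>b. if b = x then 1 else if b = y then - 1 else 0"
    have "(\<Sum>b\<in>?C. s2 (?c b) (f b)) = (\<Sum>b\<in>{x,y}. s2 (?c b) (f b))"
      by (rule sum.mono_neutral_right) (use fB xy in auto)
    also have "... = 0" using xy by simp
    finally show False using zero[of ?c x] xy by auto
  qed
  have ind: "vs2.independent (f ` ?C)"
  proof -
    have "\<not> vs2.dependent (f ` ?C)"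
    proof (subst vs2.dependent_finite)
      show "finite (f ` ?C)" using fB by simp
      show "\<not> (\<exists>u. (\<exists>v\<in>f ` ?C. u v \<noteq> 0) \<and> (\<Sum>v\<in>f ` ?C. s2 (u v) v) = 0)"
      proof
        assume "\<exists>u. (\<exists>v\<in>f ` ?C. u v \<noteq> 0) \<and> (\<Sum>v\<in>f ` ?C. s2 (u v) v) = 0"
        then obtain u b where u: "b \<in> ?C" "u (f b) \<noteq> 0" "(\<Sum>v\<in>f ` ?C. s2 (u v) v) = 0" by auto
        then have "(\<Sum>b\<in>?C. s2 (u (f b)) (f b)) = 0"
          using sum.reindex[OF inj, of "\<lambda>v. s2 (u v) v"] by (simp add: o_def)
        then show False using zero[of "\<lambda>b. u (f b)" b] u by simp
      qed
    qed
    then show ?thesis .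
  qed
  have sp: "vs2.span (f ` ?C) = f ` U"
  proof
    show "vs2.span (f ` ?C) \<subseteq> f ` U"
      using linear_span_image[OF assms(1), of ?C] vs1.span_mono[of ?C B] sB by auto
    show "f ` U \<subseteq> vs2.span (f ` ?C)"
    proof -
      have "f ` B \<subseteq> vs2.span (f ` ?C)"
      proof
        fix y assume "y \<in> f ` B"
        then obtain b where b: "b \<in> B" "y = f b" by auto
        show "y \<in> vs2.span (f ` ?C)"
        proof (cases "b \<in> A")
          case True
          then have "f b = 0" using A(3) by blast
          then show ?thesis using b vs2.span_zero by simp
        next
          case False
          then show ?thesis using b by (auto intro: vs2.span_base)
        qed
      qed
      then have "vs2.span (f ` B) \<subseteq> vs2.span (f ` ?C)"
        by (simp add: vs2.span_minimal)
      then show ?thesis using linear_span_image[OF assms(1), of B] sB by auto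
    qed
  qed
  have d2: "vs2.dim (f ` U) = card ?C"
    using vs2.dim_eq_card_basis[OF ind sp] card_image[OF inj] by simp
  have d1: "vs1.dim U = card B" using vs1.dim_eq_card_basis[OF B(3) sB] .
  have "card B = card A + card ?C"
    using fB B(1) by (simp add: card_Diff_subset card_mono A(1))
  then show ?thesis using d1 d2 A by simp
qed

lemma linear_on_extend:
  assumes "vs1.subspace U"
    and add: "\<And>x y. x \<in> U ==> y \<in> U ==> f (x + y) = f x + f y"
    and scale: "\<And>c x. x \<in> U ==> f (s1 c x) = s2 c (f x)"
  obtains g where "Vector_Spaces.linear s1 s2 g" "\<And>x. x \<in> U ==> g x = f x"
proof -
  obtain B where B: "B \<subseteq> U" "vs1.independent B" "U \<subseteq> vs1.span B" "card B = vs1.dim U"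
    by (rule vs1.basis_exists)
  obtain g where g: "Vector_Spaces.linear s1 s2 g" "\<forall>b\<in>B. g b = f b"
    using linear_independent_extend[OF B(2), of f] by blast
  interpret g: Vector_Spaces.linear s1 s2 g by fact
  have f0: "f 0 = 0" using scale[of 0 0] vs1.subspace_0[OF assms(1)] by simp
  have "x \<in> U \<and> g x = f x" if "x \<in> vs1.span B" for x
    using that
  proof (induct rule: vs1.span_induct_alt)
    case base then show ?case using f0 vs1.subspace_0[OF assms(1)] by simp
  next
    case (step c b y)
    then have "b \<in> U" using B by auto
    then have "s1 c b \<in> U" using assms(1) vs1.subspace_scale by blast
    moreover have "g b = f b" using step g(2) by blast
    moreover have "y \<in> U" "g y = f y" using step by auto
    ultimately show ?case using \<open>b \<in> U\<close>
      by (simp add: g.add g.scale add scale vs1.subspace_add[OF assms(1)])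
  qed
  then show thesis using that g(1) B by blast
qed

text \<open>For maps that are linear only on \<open>U\<close>, such as the map given by a pairing
  that is defined on a subspace.\<close>

lemma rank_nullity_on:
  assumes U: "vs1.subspace U" "vs1.fdim U"
    and add: "\<And>x y. x \<in> U ==> y \<in> U ==> f (x + y) = f x + f y"
    and scale: "\<And>c x. x \<in> U ==> f (s1 c x) = s2 c (f x)"
  shows "vs1.dim U = vs1.dim {x\<in>U. f x = 0} + vs2.dim (f ` U)"
proof -
  obtain g where g: "Vector_Spaces.linear s1 s2 g" "\<And>x. x \<in> U ==> g x = f x"
    using linear_on_extend[OF U(1) add scale] by blast
  have "{x\<in>U. f x = 0} = {x\<in>U. g x = 0}" "f ` U = g ` U" using g by auto
  then show ?thesis using rank_nullity[OF g(1) U] by simp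
qed

lemma dim_image_inj_on:
  assumes U: "vs1.subspace U" "vs1.fdim U"
    and add: "\<And>x y. x \<in> U ==> y \<in> U ==> f (x + y) = f x + f y"
    and scale: "\<And>c x. x \<in> U ==> f (s1 c x) = s2 c (f x)"
    and inj: "\<And>x. x \<in> U ==> f x = 0 ==> x = 0"
  shows "vs2.dim (f ` U) = vs1.dim U"
proof -
  have "f 0 = 0" using scale[of 0 0] vs1.subspace_0[OF U(1)] by simp
  then have "{x\<in>U. f x = 0} = {0}" using inj vs1.subspace_0[OF U(1)] by auto
  moreover have "vs1.dim {0} = 0" using vs1.dim_eq_card[of "{}" "{0}"] vs1.independent_empty by simp
  ultimately show ?thesis using rank_nullity_on[OF U add scale] by simp
qed

end

context vspace
begin

text \<open>Rank-nullity is applied twice to one map \<open>g\<close> that kills \<open>V\<close>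
  and fixes a complement chosen inside \<open>U\<close>: on the sum and on \<open>U\<close>. The
  images agree, and the kernels are \<open>V\<close> and \<open>U \<inter> V\<close>.\<close>

lemma dim_sums_Int_fdim:
  assumes "subspace U" "subspace V" "fdim {x + y | x y. x \<in> U \<and> y \<in> V}"
  shows "dim {x + y | x y. x \<in> U \<and> y \<in> V} + dim (U \<inter> V) = dim U + dim V"
proof -
  interpret p: vspace_pair scale scale by unfold_locales
  let ?S = "{x + y | x y. x \<in> U \<and> y \<in> V}"
  have US: "U \<subseteq> ?S"
  proof
    fix x assume "x \<in> U" then show "x \<in> ?S" using subspace_0[OF assms(2)]
      by (intro CollectI exI[of _ x] exI[of _ 0]) auto
  qed
  have VS: "V \<subseteq> ?S"
  proof
    fix x assume "x \<in> V" then show "x \<in> ?S" using subspace_0[OF assms(1)]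
      by (intro CollectI exI[of _ 0] exI[of _ x]) auto
  qed
  have sS: "subspace ?S" using subspace_sums[OF assms(1,2)] .
  obtain A where A: "finite A" "local.independent A" "A \<subseteq> V" "span A = V"
    using fdim_basis[OF assms(2) fdim_subset[OF assms(3) VS]] by blast
  have "A \<subseteq> A \<union> U" by simp
  then obtain B where B: "A \<subseteq> B" "B \<subseteq> A \<union> U" "local.independent B" "A \<union> U \<subseteq> span B"
    using maximal_independent_subset_extend[of A "A \<union> U"] A by blast
  obtain g where g: "Vector_Spaces.linear scale scale g" "\<forall>b\<in>B. g b = (if b \<in> A then 0 else b)"
    using p.linear_independent_extend[OF B(3), of "\<lambda>b. if b \<in> A then 0 else b"] by blast
  interpret g: Vector_Spaces.linear scale scale g by fact
  have gV: "g v = 0" if "v \<in> V" for v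
  proof -
    have "g x = 0" if "x \<in> A" for x using g(2) that B(1) by auto
    then show ?thesis by (rule p.linear_eq_0_on_span[OF g(1), of A]) (use that A(4) in auto)
  qed
  have dec: "x - g x \<in> V" if "x \<in> span B" for x
    using that
  proof (induct rule: span_induct_alt)
    case base then show ?case using subspace_0[OF assms(2)] by simp
  next
    case (step c b y)
    have "b - g b \<in> V" using step g(2) A subspace_0[OF assms(2)] by auto
    then have "scale c (b - g b) + (y - g y) \<in> V"
      using step assms(2) subspace_add subspace_scale by blast
    then show ?case by (simp add: g.add g.scale scale_right_diff_distrib algebra_simps)
  qed
  have "V \<subseteq> span B" using A B span_mono by metis
  then have SB: "?S \<subseteq> span B" using B span_add by blast
  have ker: "{x\<in>W. g x = 0} = W \<inter> V" if "W \<subseteq> ?S" for W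
  proof -
    have "x \<in> V" if "x \<in> W" "g x = 0" for x
      using dec[OF subsetD[OF SB subsetD[OF \<open>W \<subseteq> ?S\<close>]], of x] that by simp
    then show ?thesis using gV by auto
  qed
  have "g ` ?S = g ` U" using gV US by (auto simp: g.add)
  moreover have "?S \<inter> V = V" using VS by auto
  ultimately show ?thesis
    using p.rank_nullity[OF g(1) sS assms(3)] ker[OF order_refl]
      p.rank_nullity[OF g(1) assms(1) fdim_subset[OF assms(3) US]] ker[OF US]
    by (simp only: ac_simps)
qed

end

definition fsc :: "'k::field => ('a => 'k) => 'a => 'k"
  where "fsc c f = (\<lambda>x. c * f x)"

lemma fun_sum_apply: "(\<Sum>i\<in>I. f i) x = (\<Sum>i\<in>I. f i x)"
  by (induction I rule: infinite_finite_induct) auto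

interpretation fs: vspace "fsc :: 'k::field => ('a => 'k) => 'a => 'k"
  by unfold_locales (auto simp: fsc_def algebra_simps fun_eq_iff)

context vspace
begin

text \<open>Both sides are the rank of the pairing.\<close>
lemma pairing_dim_le:
  fixes \<beta> :: "'v => 'v => 'k"
  assumes A: "subspace A" "fdim A" and A0: "subspace A0" "A0 \<subseteq> A"
    and C: "subspace C" "fdim C" and C0: "C0 \<subseteq> C"
    and add1: "\<And>x x' y. x \<in> A ==> x' \<in> A ==> y \<in> C ==> \<beta> (x + x') y = \<beta> x y + \<beta> x' y"
    and scale1: "\<And>c x y. x \<in> A ==> y \<in> C ==> \<beta> (scale c x) y = c * \<beta> x y"
    and add2: "\<And>x y y'. x \<in> A ==> y \<in> C ==> y' \<in> C ==> \<beta> x (y + y') = \<beta> x y + \<beta> x y'"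
    and scale2: "\<And>c x y. x \<in> A ==> y \<in> C ==> \<beta> x (scale c y) = c * \<beta> x y"
    and rad0: "\<And>x y. x \<in> A0 ==> y \<in> C ==> \<beta> x y = 0"
    and rad: "\<And>y. y \<in> C ==> (\<And>x. x \<in> A ==> \<beta> x y = 0) ==> y \<in> C0"
    and rad': "\<And>x y. x \<in> A ==> y \<in> C0 ==> \<beta> x y = 0"
  shows "dim C + dim A0 \<le> dim C0 + dim A"
proof -
  interpret p: vspace_pair scale "fsc :: 'k => ('v => 'k) => 'v => 'k" by unfold_locales
  obtain B0 where B0: "finite B0" "local.independent B0" "B0 \<subseteq> A0" "span B0 = A0" "card B0 = dim A0"
    using fdim_basis[OF A0(1) fdim_subset[OF A(2) A0(2)]] by blast
  obtain B where B: "B0 \<subseteq> B" "B \<subseteq> A" "local.independent B" "A \<subseteq> span B"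
    using maximal_independent_subset_extend[of B0 A] B0 A0 by blast
  have fB: "finite B" using fdim_independent_finite[OF A(2)] B by blast
  have sB: "span B = A" using B A(1) span_minimal by blast
  have dA: "dim A = card B" using dim_eq_card_basis[OF B(3) sB] .
  \<comment> \<open>\<open>D\<close> is a basis of \<open>A\<close> modulo \<open>A0\<close>. Since
    \<open>A0\<close> pairs to zero with \<open>C\<close>, the values on \<open>D\<close> determine
    the pairing with \<open>y\<close>, so the rank is at most \<open>card D\<close>.\<close>
  define D where "D = B - B0"
  define f where "f = (\<lambda>y b. if b \<in> D then \<beta> b y else 0)"
  have DA: "D \<subseteq> A" using B D_def by auto
  have f_add: "f (x + y) = f x + f y" if "x \<in> C" "y \<in> C" for x y
    using that DA add2 by (auto simp: f_def fun_eq_iff)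
  have f_scale: "f (scale c x) = fsc c (f x)" if "x \<in> C" for c x
    using that DA scale2 by (auto simp: f_def fsc_def fun_eq_iff)
  have ker: "{y\<in>C. f y = 0} = C0"
  proof
    show "C0 \<subseteq> {y\<in>C. f y = 0}" using C0 rad' DA by (auto simp: f_def fun_eq_iff)
    show "{y\<in>C. f y = 0} \<subseteq> C0"
    proof
      fix y assume "y \<in> {y\<in>C. f y = 0}"
      then have y: "y \<in> C" "f y = 0" by auto
      have "x \<in> A \<and> \<beta> x y = 0" if "x \<in> span B" for x
        using that
      proof (induct rule: span_induct_alt)
        case base
        have "\<beta> (scale 0 0) y = 0 * \<beta> 0 y" using scale1 y subspace_0[OF A(1)] by blast
        then show ?case using subspace_0[OF A(1)] by simp
      next
        case (step c b x)
        have b: "b \<in> A" using step B by auto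
        have "\<beta> b y = 0"
        proof (cases "b \<in> B0")
          case True then show ?thesis using rad0 B0 y by auto
        next
          case False
          then have "b \<in> D" using step D_def by auto
          then show ?thesis using fun_cong[OF y(2), of b] by (simp add: f_def)
        qed
        moreover have "scale c b \<in> A" using b A(1) subspace_scale by blast
        ultimately show ?case using step b y subspace_add[OF A(1)] by (simp add: add1 scale1)
      qed
      then show "y \<in> C0" using rad y B by blast
    qed
  qed
  have "f ` C \<subseteq> fs.span ((\<lambda>b x. if x = b then 1 else 0) ` D)"
  proof
    fix g assume "g \<in> f ` C"
    then obtain y where y: "g = f y" by auto
    have "g = (\<Sum>b\<in>D. fsc (g b) (\<lambda>x. if x = b then 1 else 0))"
      using fB by (auto simp: y f_def fsc_def fun_eq_iff D_def fun_sum_apply if_distrib cong: if_cong)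
    also have "... \<in> fs.span ((\<lambda>b x. if x = b then 1 else 0) ` D)"
      by (intro fs.span_sum fs.span_scale fs.span_base) auto
    finally show "g \<in> fs.span ((\<lambda>b x. if x = b then 1 else 0) ` D)" .
  qed
  then have "fs.dim (f ` C) \<le> card ((\<lambda>b x. if x = b then 1 else 0 :: 'k) ` D)"
    using fs.dim_le_card[of "f ` C"] fB D_def by simp
  also have "... \<le> card D" using fB D_def by (intro card_image_le) simp
  finally have "fs.dim (f ` C) \<le> card D" .
  moreover have "card D = dim A - dim A0" "dim A0 \<le> dim A"
    using dA B0 B fB D_def card_mono[of B B0] by (auto simp: card_Diff_subset)
  moreover have "dim C = dim C0 + fs.dim (f ` C)"
    using p.rank_nullity_on[OF C(1,2), of f] f_add f_scale ker by simp
  ultimately show ?thesis by simp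
qed

end

section \<open>Finitely supported matrices\<close>

text \<open>One type holds the matrices of all sizes: finite support makes every product meaningful,
  so blocks of different shapes live in one ring without unit and associativity carries no size
  conditions. The shape is recorded separately by \<open>Mt A B\<close>.\<close>

typedef (overloaded) 'k fmat = "{f :: nat list => nat list => 'k::field. finite {p. f (fst p) (snd p) \<noteq> 0}}"
  morphisms ent Abs_fmat
  by (rule exI[of _ "\<lambda>_ _. 0"]) simp

setup_lifting type_definition_fmat

lemma fmat_eqI: "(\<And>u w. ent f u w = ent g u w) ==> f = g"
  using ent_inject[of f g] by (simp add: fun_eq_iff)

lemma finite_row: "finite {v. ent f u v \<noteq> 0}"
proof -
  have "{v. ent f u v \<noteq> 0} \<subseteq> snd ` {p. ent f (fst p) (snd p) \<noteq> 0}"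
  proof
    fix v assume "v \<in> {v. ent f u v \<noteq> 0}"
    then show "v \<in> snd ` {p. ent f (fst p) (snd p) \<noteq> 0}" by (intro image_eqI[of _ _ "(u, v)"]) auto
  qed
  moreover have "finite {p. ent f (fst p) (snd p) \<noteq> 0}" using ent[of f] by simp
  ultimately show ?thesis using finite_surj by blast
qed

instantiation fmat :: (field) ring
begin

lift_definition zero_fmat :: "'a fmat" is "\<lambda>_ _. 0" by simp

lift_definition plus_fmat :: "'a fmat => 'a fmat => 'a fmat" is "\<lambda>f g u w. f u w + g u w"
proof -
  fix f g :: "nat list => nat list => 'a"
  assume fin: "finite {p. f (fst p) (snd p) \<noteq> 0}" "finite {p. g (fst p) (snd p) \<noteq> 0}"
  have "{p. f (fst p) (snd p) + g (fst p) (snd p) \<noteq> 0} \<subseteq>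
    {p. f (fst p) (snd p) \<noteq> 0} \<union> {p. g (fst p) (snd p) \<noteq> 0}" by auto
  then show "finite {p. f (fst p) (snd p) + g (fst p) (snd p) \<noteq> 0}"
    using fin finite_subset by blast
qed

lift_definition uminus_fmat :: "'a fmat => 'a fmat" is "\<lambda>f u w. - f u w" by simp

definition minus_fmat :: "'a fmat => 'a fmat => 'a fmat" where "minus_fmat f g = f + - g"

lift_definition times_fmat :: "'a fmat => 'a fmat => 'a fmat" is
  "\<lambda>f g u w. \<Sum>v | f u v \<noteq> 0. f u v * g v w"
proof -
  fix f g :: "nat list => nat list => 'a"
  assume fin: "finite {p. f (fst p) (snd p) \<noteq> 0}" "finite {p. g (fst p) (snd p) \<noteq> 0}"
  have "{p. (\<Sum>v | f (fst p) v \<noteq> 0. f (fst p) v * g v (snd p)) \<noteq> 0} \<subseteq>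
    fst ` {p. f (fst p) (snd p) \<noteq> 0} \<times> snd ` {p. g (fst p) (snd p) \<noteq> 0}"
  proof
    fix p assume "p \<in> {p. (\<Sum>v | f (fst p) v \<noteq> 0. f (fst p) v * g v (snd p)) \<noteq> 0}"
    then have "(\<Sum>v | f (fst p) v \<noteq> 0. f (fst p) v * g v (snd p)) \<noteq> 0" by simp
    then obtain v where v: "v \<in> {v. f (fst p) v \<noteq> 0}" "f (fst p) v * g v (snd p) \<noteq> 0"
      by (rule sum.not_neutral_contains_not_neutral)
    then have fg: "(fst p, v) \<in> {p. f (fst p) (snd p) \<noteq> 0}" "(v, snd p) \<in> {p. g (fst p) (snd p) \<noteq> 0}" using v by auto
    show "p \<in> fst ` {p. f (fst p) (snd p) \<noteq> 0} \<times> snd ` {p. g (fst p) (snd p) \<noteq> 0}"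
      using imageI[OF fg(1), of fst] imageI[OF fg(2), of snd] by (simp add: mem_Times_iff)
  qed
  then show "finite {p. (\<Sum>v | f (fst p) v \<noteq> 0. f (fst p) v * g v (snd p)) \<noteq> 0}"
    using fin finite_subset by blast
qed

lemma ent_times_on:
  assumes "finite X" "\<And>v. ent f u v \<noteq> 0 ==> v \<in> X"
  shows "ent (f * g) u w = (\<Sum>v\<in>X. ent f u v * ent g v w)"
  unfolding times_fmat.rep_eq
  by (rule sum.mono_neutral_left) (use assms in auto)

instance
proof
  fix a b c :: "'a fmat"
  show "a + b + c = a + (b + c)" by transfer (simp add: algebra_simps)
  show "a + b = b + a" by transfer (simp add: algebra_simps)
  show "0 + a = a" by transfer simp
  show "- a + a = 0" by transfer simp
  show "a - b = a + - b" by (simp add: minus_fmat_def)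
  show "(a + b) * c = a * c + b * c"
  proof (rule fmat_eqI)
    fix u w
    let ?X = "{v. ent a u v \<noteq> 0} \<union> {v. ent b u v \<noteq> 0}"
    have X: "finite ?X" using finite_row by blast
    have "ent ((a + b) * c) u w = (\<Sum>v\<in>?X. ent (a + b) u v * ent c v w)"
      by (rule ent_times_on[OF X]) (auto simp: plus_fmat.rep_eq)
    moreover have "ent (a * c) u w = (\<Sum>v\<in>?X. ent a u v * ent c v w)"
      by (rule ent_times_on[OF X]) auto
    moreover have "ent (b * c) u w = (\<Sum>v\<in>?X. ent b u v * ent c v w)"
      by (rule ent_times_on[OF X]) auto
    ultimately show "ent ((a + b) * c) u w = ent (a * c + b * c) u w"
      by (simp add: plus_fmat.rep_eq sum.distrib algebra_simps)
  qed
  show "a * (b + c) = a * b + a * c"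
    by (rule fmat_eqI) (simp add: times_fmat.rep_eq plus_fmat.rep_eq sum.distrib algebra_simps)
  show "a * b * c = a * (b * c)"
  proof (rule fmat_eqI)
    fix u w
    let ?X = "{v. ent a u v \<noteq> 0}"
    let ?Y = "\<Union>v\<in>?X. {x. ent b v x \<noteq> 0}"
    have X: "finite ?X" "finite ?Y" by (simp_all add: finite_row)
    have ab: "ent (a * b) u y = (\<Sum>v\<in>?X. ent a u v * ent b v y)" for y
      by (simp add: times_fmat.rep_eq)
    have "ent (a * b * c) u w = (\<Sum>y\<in>?Y. ent (a * b) u y * ent c y w)"
    proof (rule ent_times_on[OF X(2)])
      fix y assume "ent (a * b) u y \<noteq> 0"
      then obtain v where "v \<in> ?X" "ent a u v * ent b v y \<noteq> 0"
        unfolding ab by (rule sum.not_neutral_contains_not_neutral)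
      then show "y \<in> ?Y" by auto
    qed
    also have "... = (\<Sum>v\<in>?X. \<Sum>y\<in>?Y. ent a u v * (ent b v y * ent c y w))"
      unfolding ab sum_distrib_right by (subst sum.swap) (simp add: mult.assoc)
    also have "... = (\<Sum>v\<in>?X. ent a u v * ent (b * c) v w)"
    proof (rule sum.cong[OF refl])
      fix v assume "v \<in> ?X"
      then have "ent (b * c) v w = (\<Sum>y\<in>?Y. ent b v y * ent c y w)"
        by (intro ent_times_on[OF X(2)]) auto
      then show "(\<Sum>y\<in>?Y. ent a u v * (ent b v y * ent c y w)) = ent a u v * ent (b * c) v w"
        by (simp add: sum_distrib_left)
    qed
    also have "... = ent (a * (b * c)) u w" by (simp add: times_fmat.rep_eq)
    finally show "ent (a * b * c) u w = ent (a * (b * c)) u w" .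
  qed
qed

end

lift_definition fsm :: "'k::field => 'k fmat => 'k fmat" (infixr "\<bullet>" 75) is "\<lambda>c f u w. c * f u w"
proof -
  fix c :: 'k and f :: "nat list => nat list => 'k"
  have "{p. c * f (fst p) (snd p) \<noteq> 0} \<subseteq> {p. f (fst p) (snd p) \<noteq> 0}" by auto
  then show "finite {p. f (fst p) (snd p) \<noteq> 0} ==> finite {p. c * f (fst p) (snd p) \<noteq> 0}"
    by (rule finite_subset)
qed

interpretation fm: vspace fsm
proof unfold_locales
  fix a b :: "'a::field" and x y :: "'a fmat"
  show "a \<bullet> (x + y) = a \<bullet> x + a \<bullet> y"
    by (rule fmat_eqI) (simp add: fsm.rep_eq plus_fmat.rep_eq algebra_simps)
  show "(a + b) \<bullet> x = a \<bullet> x + b \<bullet> x"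
    by (rule fmat_eqI) (simp add: fsm.rep_eq plus_fmat.rep_eq algebra_simps)
  show "a \<bullet> b \<bullet> x = (a * b) \<bullet> x"
    by (rule fmat_eqI) (simp add: fsm.rep_eq)
  show "1 \<bullet> x = x"
    by (rule fmat_eqI) (simp add: fsm.rep_eq)
qed

lemma ent_minus [simp]: "ent (f - g) u w = ent f u w - ent g u w"
  unfolding minus_fmat_def plus_fmat.rep_eq uminus_fmat.rep_eq by simp

lemmas ent_simps [simp] = plus_fmat.rep_eq zero_fmat.rep_eq uminus_fmat.rep_eq fsm.rep_eq

lemma ent_sum: "ent (\<Sum>i\<in>I. f i) u w = (\<Sum>i\<in>I. ent (f i) u w)"
  by (induction I rule: infinite_finite_induct) auto

lemma fsm_mult_left [simp]: "(c \<bullet> f) * g = c \<bullet> (f * g)"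
proof (rule fmat_eqI)
  fix u w
  have "ent ((c \<bullet> f) * g) u w = (\<Sum>v\<in>{v. ent f u v \<noteq> 0}. ent (c \<bullet> f) u v * ent g v w)"
    by (rule ent_times_on[OF finite_row]) auto
  then show "ent ((c \<bullet> f) * g) u w = ent (c \<bullet> (f * g)) u w"
    by (simp add: times_fmat.rep_eq sum_distrib_left mult.assoc)
qed

lemma fsm_mult_right [simp]: "f * (c \<bullet> g) = c \<bullet> (f * g)"
  by (rule fmat_eqI) (simp add: times_fmat.rep_eq sum_distrib_left algebra_simps)

lift_definition trp :: "'k::field fmat => 'k fmat" is "\<lambda>f u w. f w u"
proof -
  fix f :: "nat list => nat list => 'k"
  assume "finite {p. f (fst p) (snd p) \<noteq> 0}"
  moreover have "{p. f (snd p) (fst p) \<noteq> 0} = prod.swap ` {p. f (fst p) (snd p) \<noteq> 0}" by force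
  ultimately show "finite {p. f (snd p) (fst p) \<noteq> 0}" by simp
qed

text \<open>Matrix unit. With \<open>b = []\<close> it serves as the basis vector belonging to
  \<open>a\<close>: a vector is a matrix with the single column \<open>[]\<close>, so applying a map
  is ring multiplication.\<close>

lift_definition mu :: "nat list => nat list => 'k::field fmat" is "\<lambda>a b u w. if u = a \<and> w = b then 1 else 0"
proof -
  fix a b :: "nat list"
  have "{p. (if fst p = a \<and> snd p = b then 1 else (0::'k)) \<noteq> 0} \<subseteq> {(a, b)}" by (auto split: if_splits)
  then show "finite {p. (if fst p = a \<and> snd p = b then 1 else (0::'k)) \<noteq> 0}" using finite_subset by blast
qed

lift_definition mk :: "nat list set => nat list set => (nat list => nat list => 'k::field) => 'k fmat" is
  "\<lambda>A B f u w. if finite A \<and> finite B \<and> u \<in> A \<and> w \<in> B then f u w else 0"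
proof -
  fix A B :: "nat list set" and f :: "nat list => nat list => 'k"
  show "finite {p. (if finite A \<and> finite B \<and> fst p \<in> A \<and> snd p \<in> B then f (fst p) (snd p) else 0) \<noteq> 0}"
  proof (cases "finite A \<and> finite B")
    case True
    have "{p. (if finite A \<and> finite B \<and> fst p \<in> A \<and> snd p \<in> B then f (fst p) (snd p) else 0) \<noteq> 0} \<subseteq> A \<times> B"
      by (auto split: if_splits)
    then show ?thesis using True finite_subset by blast
  next
    case False
    then have "{p. (if finite A \<and> finite B \<and> fst p \<in> A \<and> snd p \<in> B then f (fst p) (snd p) else 0) \<noteq> 0} = {}"
      by auto
    then show ?thesis by (simp only: finite.emptyI)
  qed
qed

lemmas [simp] = trp.rep_eq mu.rep_eq

definition idB :: "nat list set => 'k::field fmat"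
  where "idB A = mk A A (\<lambda>u w. if u = w then 1 else 0)"

definition Mt :: "nat list set => nat list set => 'k::field fmat set"
  where "Mt A B = {f. \<forall>u w. ent f u w \<noteq> 0 --> u \<in> A \<and> w \<in> B}"

lemma ent_mk [simp]: "finite A ==> finite B ==> ent (mk A B f) u w = (if u \<in> A \<and> w \<in> B then f u w else 0)"
  by (simp add: mk.rep_eq)

lemma ent_idB [simp]: "finite A ==> ent (idB A) u w = (if u = w \<and> u \<in> A then 1 else 0)"
  by (auto simp: idB_def)

lemma MtD: "f \<in> Mt A B ==> ent f u w \<noteq> 0 ==> u \<in> A \<and> w \<in> B"
  by (auto simp: Mt_def)

lemma Mt_zero: "f \<in> Mt A B ==> u \<notin> A \<or> w \<notin> B ==> ent f u w = 0"
  by (auto simp: Mt_def)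

lemma Mt_eqI:
  "f \<in> Mt A B ==> g \<in> Mt A B ==> (\<And>u w. u \<in> A ==> w \<in> B ==> ent f u w = ent g u w) ==> f = g"
proof (rule fmat_eqI)
  fix u w
  assume a: "f \<in> Mt A B" "g \<in> Mt A B" "\<And>u w. u \<in> A ==> w \<in> B ==> ent f u w = ent g u w"
  show "ent f u w = ent g u w"
    using a(3)[of u w] Mt_zero[OF a(1), of u w] Mt_zero[OF a(2), of u w] by (cases "u \<in> A \<and> w \<in> B") auto
qed

lemma mk_Mt [simp]: "mk A B f \<in> Mt A B"
  by (auto simp: Mt_def mk.rep_eq split: if_splits)

lemma idB_Mt [simp]: "idB A \<in> Mt A A" by (simp add: idB_def)

lemma mu_Mt [simp]: "u \<in> A ==> w \<in> B ==> mu u w \<in> Mt A B"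
  by (auto simp: Mt_def split: if_splits)

lemma subspace_Mt: "fm.subspace (Mt A B)"
proof -
  have *: "ent f u w + ent g u w \<noteq> 0 ==> ent f u w \<noteq> 0 \<or> ent g u w \<noteq> 0" for f g :: "'a fmat" and u w by auto
  show ?thesis unfolding fm.subspace_def Mt_def using * by (simp; blast)
qed

lemma Mt_add: "f \<in> Mt A B ==> g \<in> Mt A B ==> f + g \<in> Mt A B"
  and Mt_diff: "f \<in> Mt A B ==> g \<in> Mt A B ==> f - g \<in> Mt A B"
  and Mt_scale: "f \<in> Mt A B ==> c \<bullet> f \<in> Mt A B"
  and Mt_0 [simp]: "0 \<in> Mt A B"
  by (simp_all add: fm.subspace_add fm.subspace_diff fm.subspace_scale fm.subspace_0 subspace_Mt)

lemma Mt_sum: "(\<And>i. i \<in> I ==> f i \<in> Mt A B) ==> (\<Sum>i\<in>I. f i) \<in> Mt A B"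
  by (rule fm.subspace_sum[OF subspace_Mt])

lemma Mt_mult: "f \<in> Mt A B ==> g \<in> Mt C D ==> f * g \<in> Mt A D"
proof -
  assume fg: "f \<in> Mt A B" "g \<in> Mt C D"
  have "u \<in> A \<and> w \<in> D" if "ent (f * g) u w \<noteq> 0" for u w
  proof -
    have "(\<Sum>v | ent f u v \<noteq> 0. ent f u v * ent g v w) \<noteq> 0" using that by (simp add: times_fmat.rep_eq)
    then obtain v where "v \<in> {v. ent f u v \<noteq> 0}" "ent f u v * ent g v w \<noteq> 0"
      by (rule sum.not_neutral_contains_not_neutral)
    then have "ent f u v \<noteq> 0" "ent g v w \<noteq> 0" by auto
    then show ?thesis using fg MtD by blast
  qed
  then show ?thesis by (auto simp: Mt_def)
qed

lemma ent_times: "finite B ==> f \<in> Mt A B ==> ent (f * g) u w = (\<Sum>v\<in>B. ent f u v * ent g v w)"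
  by (rule ent_times_on) (auto dest: MtD)

lemma ent_times': "finite B ==> g \<in> Mt B C ==> ent (f * g) u w = (\<Sum>v\<in>B. ent f u v * ent g v w)"
proof -
  assume B: "finite B" "g \<in> Mt B C"
  have fin: "finite ({v. ent f u v \<noteq> 0} \<union> B)" using B finite_row by blast
  have "ent (f * g) u w = (\<Sum>v\<in>{v. ent f u v \<noteq> 0} \<union> B. ent f u v * ent g v w)"
    by (rule ent_times_on[OF fin]) auto
  also have "... = (\<Sum>v\<in>B. ent f u v * ent g v w)"
    by (rule sum.mono_neutral_right[OF fin]) (use B in \<open>auto dest: MtD\<close>)
  finally show ?thesis .
qed

lemma trp_mult: "trp (f * g) = trp g * trp f"
proof (rule fmat_eqI)
  fix u w
  let ?X = "{v. ent f w v \<noteq> 0} \<union> {v. ent (trp g) u v \<noteq> 0}"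
  have X: "finite ?X" using finite_row by blast
  have "ent (f * g) w u = (\<Sum>v\<in>?X. ent f w v * ent g v u)"
    by (rule ent_times_on[OF X]) auto
  moreover have "ent (trp g * trp f) u w = (\<Sum>v\<in>?X. ent (trp g) u v * ent (trp f) v w)"
    by (rule ent_times_on[OF X]) auto
  ultimately show "ent (trp (f * g)) u w = ent (trp g * trp f) u w" by (simp add: mult.commute)
qed

lemma trp_trp [simp]: "trp (trp f) = f" by (rule fmat_eqI) simp

lemma trp_add: "trp (f + g) = trp f + trp g" by (rule fmat_eqI) simp

lemma trp_diff: "trp (f - g) = trp f - trp g" by (rule fmat_eqI) simp

lemma trp_scale: "trp (c \<bullet> f) = c \<bullet> trp f" by (rule fmat_eqI) simp

lemma trp_zero [simp]: "trp 0 = 0" by (rule fmat_eqI) simp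

lemma trp_sum: "trp (\<Sum>i\<in>I. f i) = (\<Sum>i\<in>I. trp (f i))"
  by (rule fmat_eqI) (simp add: ent_sum)

lemma trp_Mt: "f \<in> Mt A B ==> trp f \<in> Mt B A" by (auto simp: Mt_def)

lemma trp_idB [simp]: "finite A ==> trp (idB A) = idB A" by (rule fmat_eqI) auto

lemma ent_mult_mu: "ent ((f :: 'a::field fmat) * mu a b) u w = (if w = b then ent f u a else 0)"
proof -
  have "(mu a b :: 'a fmat) \<in> Mt {a} UNIV" by (rule mu_Mt) simp_all
  from ent_times'[OF _ this, of f u w] show ?thesis by auto
qed

lemma mu_mult: "mu a b * mu c d = (if b = c then mu a d else 0)"
  by (rule fmat_eqI) (auto simp: ent_mult_mu)

lemma idB_mult [simp]: "finite A ==> f \<in> Mt A B ==> idB A * f = f"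
proof (rule fmat_eqI)
  fix u w assume A: "finite A" "f \<in> Mt A B"
  have "ent (idB A * f) u w = (\<Sum>v\<in>A. if v = u then ent f v w else 0)"
    unfolding ent_times[OF A(1) idB_Mt] using A by (intro sum.cong) auto
  then show "ent (idB A * f) u w = ent f u w" using A by (auto simp: Mt_zero)
qed

lemma mult_idB [simp]: "finite B ==> f \<in> Mt A B ==> f * idB B = f"
proof (rule fmat_eqI)
  fix u w assume A: "finite B" "f \<in> Mt A B"
  have "ent (f * idB B) u w = (\<Sum>v\<in>B. if v = w then ent f u v else 0)"
    unfolding ent_times[OF A] using A by (intro sum.cong) auto
  then show "ent (f * idB B) u w = ent f u w" using A by (auto simp: Mt_zero)
qed

lemma idB_idB [simp]: "finite A ==> idB A * idB A = idB A"
  by (rule idB_mult[OF _ idB_Mt])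

lemma mk_mult: "finite A ==> finite B ==> finite C ==> mk A B f * mk B C g = mk A C (mmul B f g)"
  by (rule fmat_eqI) (auto simp: ent_times[OF _ mk_Mt] mmul_def intro!: sum.cong)

lemma mk_ent: "finite A ==> finite B ==> f \<in> Mt A B ==> mk A B (ent f) = f"
  by (rule fmat_eqI) (auto simp: Mt_zero)

lemma mk_add: "mk A B f + mk A B g = mk A B (\<lambda>u w. f u w + g u w)"
  by (rule fmat_eqI) (auto simp: mk.rep_eq)

lemma mk_diff: "mk A B f - mk A B g = mk A B (\<lambda>u w. f u w - g u w)"
  by (rule fmat_eqI) (auto simp: mk.rep_eq)

lemma mk_scale: "c \<bullet> mk A B f = mk A B (\<lambda>u w. c * f u w)"
  by (rule fmat_eqI) (auto simp: mk.rep_eq)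

lemma mk_eq_iff: "finite A ==> finite B ==> mk A B f = mk A B g \<longleftrightarrow> meq A B f g"
proof
  assume AB: "finite A" "finite B" "mk A B f = mk A B g"
  show "meq A B f g" unfolding meq_def
  proof (intro ballI)
    fix u w assume "u \<in> A" "w \<in> B"
    then show "f u w = g u w" using AB ent_mk[of A B f u w] ent_mk[of A B g u w] by simp
  qed
qed (auto simp: meq_def intro!: fmat_eqI)

lemma idB_conv: "idB A = mk A A idm"
  by (simp add: idB_def idm_def[abs_def])

lemma Mt_expand:
  assumes "finite A" "finite B" "f \<in> Mt A B"
  shows "f = (\<Sum>u\<in>A. \<Sum>w\<in>B. ent f u w \<bullet> mu u w)"
proof (rule fmat_eqI)
  fix u w
  have "(\<Sum>a\<in>A. \<Sum>b\<in>B. ent f a b * (if u = a \<and> w = b then 1 else 0))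
    = (\<Sum>a\<in>A. if u = a then (\<Sum>b\<in>B. if w = b then ent f a b else 0) else 0)"
    by (intro sum.cong refl) (auto intro!: sum.cong)
  also have "... = ent f u w" using assms by (auto simp: Mt_zero)
  finally show "ent f u w = ent (\<Sum>u\<in>A. \<Sum>w\<in>B. ent f u w \<bullet> mu u w) u w"
    by (simp add: ent_sum)
qed

lemma fdim_Mt: "finite A ==> finite B ==> fm.fdim (Mt A B :: 'k::field fmat set)"
  unfolding fm.fdim_def
proof (rule exI[of _ "(\<lambda>(u,w). mu u w) ` (A \<times> B)"], intro conjI subsetI)
  assume AB: "finite A" "finite B"
  then show "finite ((\<lambda>(u,w). mu u w) ` (A \<times> B))" by simp
  fix f :: "'k fmat" assume "f \<in> Mt A B"
  then have "f = (\<Sum>u\<in>A. \<Sum>w\<in>B. ent f u w \<bullet> mu u w)" using Mt_expand AB by blast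
  also have "... \<in> fm.span ((\<lambda>(u,w). mu u w) ` (A \<times> B))"
    by (intro fm.span_sum fm.span_scale fm.span_base) auto
  finally show "f \<in> fm.span ((\<lambda>(u,w). mu u w) ` (A \<times> B))" .
qed

section \<open>The trace form\<close>

definition tr :: "nat list set => 'k::field fmat => 'k"
  where "tr A f = (\<Sum>u\<in>A. ent f u u)"

lemma tr_add: "tr A (f + g) = tr A f + tr A g" by (simp add: tr_def sum.distrib)
lemma tr_diff: "tr A (f - g) = tr A f - tr A g" by (simp add: tr_def sum_subtractf)
lemma tr_scale: "tr A (c \<bullet> f) = c * tr A f" by (simp add: tr_def sum_distrib_left)
lemma tr_sum: "tr A (\<Sum>i\<in>I. f i) = (\<Sum>i\<in>I. tr A (f i))"
  unfolding tr_def by (subst sum.swap) (simp add: ent_sum)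

lemma tr_commute:
  assumes "finite A" "finite B" "f \<in> Mt A B" "g \<in> Mt B A"
  shows "tr A (f * g) = tr B (g * f)"
proof -
  have "tr A (f * g) = (\<Sum>u\<in>A. \<Sum>v\<in>B. ent f u v * ent g v u)"
    unfolding tr_def by (simp add: ent_times[OF assms(2,3)])
  also have "... = tr B (g * f)"
    unfolding tr_def ent_times[OF assms(1,4)] by (subst sum.swap) (simp add: mult.commute)
  finally show ?thesis .
qed

lemma tr_mult_mu: "finite A ==> u \<in> A ==> tr A (f * mu w u) = ent f u w"
  by (simp add: tr_def ent_mult_mu if_distrib cong: if_cong)

lemma trace_nondegenerate:
  assumes "finite A" "f \<in> Mt A B" "\<And>g. g \<in> Mt B A ==> tr A (f * g) = 0"
  shows "f = 0"
proof (rule Mt_eqI[OF assms(2) Mt_0])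
  fix u w assume "u \<in> A" "w \<in> B"
  then show "ent f u w = ent 0 u w"
    using assms(3)[OF mu_Mt] tr_mult_mu[OF assms(1), of u f w] by auto
qed

text \<open>Every functional on \<open>Mt A B\<close> is the trace against a matrix, namely the
  matrix of its values on the matrix units; here it is applied to a functional that vanishes on
  \<open>U\<close> and not at \<open>f\<close>.\<close>

lemma trace_functional:
  assumes AB: "finite A" "finite B" and U: "fm.subspace U" and f: "f \<in> Mt A B" "f \<notin> U"
  obtains g where "g \<in> Mt B A" "\<And>u. u \<in> U \<inter> Mt A B ==> tr A (u * g) = 0" "tr A (f * g) = 1"
proof -
  obtain \<phi> where \<phi>: "Vector_Spaces.linear fsm (*) \<phi>" "\<And>u. u \<in> U ==> \<phi> u = 0" "\<phi> f = 1"
    using fm.linear_functional_separating[OF U f(2)] by blast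
  interpret l: Vector_Spaces.linear fsm "(*)" \<phi> by fact
  define g where "g = mk B A (\<lambda>w u. \<phi> (mu u w))"
  have eq: "tr A (h * g) = \<phi> h" if "h \<in> Mt A B" for h
  proof -
    have "tr A (h * g) = (\<Sum>u\<in>A. \<Sum>w\<in>B. ent h u w * \<phi> (mu u w))"
      unfolding tr_def using AB that by (simp add: ent_times g_def)
    also have "... = \<phi> (\<Sum>u\<in>A. \<Sum>w\<in>B. ent h u w \<bullet> mu u w)"
      by (simp add: l.sum l.scale)
    finally show ?thesis using Mt_expand[OF AB that] by simp
  qed
  show thesis by (rule that[of g]) (use eq \<phi> f in \<open>auto simp: g_def\<close>)
qed

section \<open>Adjacent swaps and inversions of words\<close>

definition sw :: "nat => 'a list => 'a list"
  where "sw j w = w[j := w ! Suc j, Suc j := w ! j]"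

lemma length_sw [simp]: "length (sw j w) = length w" by (simp add: sw_def)

lemma nth_sw:
  "Suc j < length w ==> k < length w ==>
    sw j w ! k = (if k = j then w ! Suc j else if k = Suc j then w ! j else w ! k)"
  by (auto simp: sw_def nth_list_update)

lemma sw_append: "length pre = j ==> sw j (pre @ x # y # post) = pre @ y # x # post"
  by (auto simp: sw_def nth_append list_update_append)

lemma sw_split:
  assumes "Suc j < length w"
  obtains pre x y post where "length pre = j" "w = pre @ x # y # post" "w ! j = x" "w ! Suc j = y"
proof (rule that[of "take j w" "w ! j" "w ! Suc j" "drop (Suc (Suc j)) w"])
  show "w = take j w @ w ! j # w ! Suc j # drop (Suc (Suc j)) w"
    using assms by (metis Cons_nth_drop_Suc Suc_lessD append_take_drop_id)
qed (use assms in auto)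

lemma sw_sw [simp]: "Suc j < length w ==> sw j (sw j w) = w"
  by (rule nth_equalityI) (auto simp: nth_sw)

lemma sw_same: "Suc j < length w ==> w ! j = w ! Suc j ==> sw j w = w"
  by (rule nth_equalityI) (auto simp: nth_sw)

lemma sw_comm: "Suc j < k ==> Suc k < length w ==> sw j (sw k w) = sw k (sw j w)"
  by (rule nth_equalityI) (auto simp: nth_sw)

lemma sw_braid: "Suc (Suc j) < length w ==> sw j (sw (Suc j) (sw j w)) = sw (Suc j) (sw j (sw (Suc j) w))"
  by (rule nth_equalityI) (auto simp: nth_sw)

lemma mset_sw [simp]: "Suc j < length w ==> mset (sw j w) = mset w"
  by (auto elim!: sw_split simp: sw_append)

lemma set_sw [simp]: "Suc j < length w ==> set (sw j w) = set w"
  using mset_sw mset_eq_setD by metis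

lemma map_sw: "Suc j < length w ==> map f (sw j w) = sw j (map f w)"
  by (rule nth_equalityI) (auto simp: nth_sw)

lemma sw_words: "w \<in> hk_words n X ==> Suc j < n ==> sw j w \<in> hk_words n X"
  by (simp add: hk_words_def)

lemma finite_hk_words [simp]: "finite X ==> finite (hk_words n X)"
  using finite_lists_length_eq[of X n] by (simp add: hk_words_def conj_commute)

fun ninv :: "'a::linorder list => nat"
  where "ninv [] = 0"
  | "ninv (x # xs) = length (filter (\<lambda>y. y < x) xs) + ninv xs"

lemma inv_sw: "Suc j < length w ==> w ! Suc j < w ! j ==> ninv w = Suc (ninv (sw j w))"
proof -
  assume a: "Suc j < length w" "w ! Suc j < w ! j"
  obtain pre x y post where w: "length pre = j" "w = pre @ x # y # post" "w ! j = x" "w ! Suc j = y"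
    using sw_split[OF a(1)] by blast
  have "ninv (pre @ x # y # post) = Suc (ninv (pre @ y # x # post))"
    using a w by (induction pre arbitrary: j w) auto
  then show ?thesis using w by (simp add: sw_append)
qed

lemma sorted_no_desc: "(\<And>j. Suc j < length w ==> w ! j \<le> w ! Suc j) ==> sorted w"
  by (simp add: sorted_iff_nth_Suc)

section \<open>Modules over the Hecke algebra\<close>

text \<open>The conditions of \<open>hecke_mod\<close> as equations in the matrix ring. Generators
  are numbered \<open>T (Suc j)\<close>, so that \<open>j\<close> and \<open>Suc j\<close> are the
  0-based positions on which the generator acts in a tensor power.\<close>

definition hmod :: "'k::field => nat => nat list set => (nat => 'k fmat) => bool"
  where "hmod q n B T \<longleftrightarrow> finite B
     \<and> (\<forall>j. Suc j < n --> T (Suc j) \<in> Mt B B \<and> T (Suc j) * T (Suc j) = (q - 1) \<bullet> T (Suc j) + q \<bullet> idB B)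
     \<and> (\<forall>j. Suc (Suc j) < n -->
          T (Suc j) * (T (Suc (Suc j)) * T (Suc j)) = T (Suc (Suc j)) * (T (Suc j) * T (Suc (Suc j))))
     \<and> (\<forall>j k. Suc j < k \<and> Suc k < n --> T (Suc j) * T (Suc k) = T (Suc k) * T (Suc j))"

text \<open>The source is the first module argument, but the second index of \<open>Mt B' B\<close>,
  as matrices act on columns.\<close>

definition hhom :: "nat => nat list set => (nat => 'k::field fmat) => nat list set => (nat => 'k fmat) => 'k fmat set"
  where "hhom n B T B' T' = {f \<in> Mt B' B. \<forall>j. Suc j < n --> T' (Suc j) * f = f * T (Suc j)}"

lemma quad_iff:
  assumes "finite B" "T \<in> Mt B B"
  shows "(T + idB B) * (T - q \<bullet> idB B) = 0 \<longleftrightarrow> T * T = (q - 1) \<bullet> T + q \<bullet> idB B"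
proof -
  have "(T + idB B) * (T - q \<bullet> idB B) = T * T - ((q - 1) \<bullet> T + q \<bullet> idB B)"
    using assms by (simp add: distrib_left distrib_right right_diff_distrib fm.scale_left_diff_distrib
        fm.scale_right_distrib)
  then show ?thesis by simp
qed

lemma ball_Suc: "(\<forall>i\<in>{1..<n}. P i) \<longleftrightarrow> (\<forall>j. Suc j < n --> P (Suc j))"
proof
  assume a: "\<forall>j. Suc j < n --> P (Suc j)"
  show "\<forall>i\<in>{1..<n}. P i"
  proof
    fix i assume "i \<in> {1..<n}"
    then show "P i" using a[rule_format, of "i - 1"] by auto
  qed
qed auto

lemma hecke_mod_iff: "hecke_mod (q :: 'a::field) n B T \<longleftrightarrow> hmod q n B (\<lambda>i. mk B B (T i))"
proof (cases "finite B")
  case fin: True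
  have 1: "meq B B (mmul B (\<lambda>u w. T i u w + idm u w) (\<lambda>u w. T i u w - q * idm u w)) (\<lambda>u w. 0) \<longleftrightarrow>
    mk B B (T i) * mk B B (T i) = (q - 1) \<bullet> mk B B (T i) + q \<bullet> idB B" for i
  proof -
    have z: "(0 :: 'a fmat) = mk B B (\<lambda>u w. 0)" by (rule fmat_eqI) (simp add: fin)
    have e: "(mk B B (T i) + idB B) * (mk B B (T i) - q \<bullet> idB B) =
      mk B B (mmul B (\<lambda>u w. T i u w + idm u w) (\<lambda>u w. T i u w - q * idm u w))"
      by (simp only: idB_conv mk_add mk_diff mk_scale mk_mult[OF fin fin fin])
    have "(mk B B (T i) + idB B) * (mk B B (T i) - q \<bullet> idB B) = 0 \<longleftrightarrow>
      meq B B (mmul B (\<lambda>u w. T i u w + idm u w) (\<lambda>u w. T i u w - q * idm u w)) (\<lambda>u w. 0)"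
      by (simp only: e z mk_eq_iff[OF fin fin])
    then show ?thesis by (simp only: quad_iff[OF fin mk_Mt])
  qed
  have 2: "meq B B (mmul B (T i) (mmul B (T k) (T i))) (mmul B (T k) (mmul B (T i) (T k))) \<longleftrightarrow>
    mk B B (T i) * (mk B B (T k) * mk B B (T i)) = mk B B (T k) * (mk B B (T i) * mk B B (T k))" for i k
    by (simp add: mk_mult fin mk_eq_iff)
  have 3: "meq B B (mmul B (T i) (T j)) (mmul B (T j) (T i)) \<longleftrightarrow>
    mk B B (T i) * mk B B (T j) = mk B B (T j) * mk B B (T i)" for i j
    by (simp add: mk_mult fin mk_eq_iff)
  have q2: "(\<forall>i. 1 \<le> i \<and> i + 1 < n --> P i (i + 1)) \<longleftrightarrow> (\<forall>j. Suc (Suc j) < n --> P (Suc j) (Suc (Suc j)))" for P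
  proof
    assume a: "\<forall>j. Suc (Suc j) < n --> P (Suc j) (Suc (Suc j))"
    show "\<forall>i. 1 \<le> i \<and> i + 1 < n --> P i (i + 1)"
    proof (intro allI impI)
      fix i assume "1 \<le> i \<and> i + 1 < n"
      then show "P i (i + 1)" using a[rule_format, of "i - 1"] by auto
    qed
  qed auto
  have q3: "(\<forall>i j. i \<in> {1..<n} \<and> j \<in> {1..<n} \<and> i + 2 \<le> j --> P i j) \<longleftrightarrow>
    (\<forall>j k. Suc j < k \<and> Suc k < n --> P (Suc j) (Suc k))" for P
  proof
    assume "\<forall>i j. i \<in> {1..<n} \<and> j \<in> {1..<n} \<and> i + 2 \<le> j --> P i j"
    then show "\<forall>j k. Suc j < k \<and> Suc k < n --> P (Suc j) (Suc k)" by auto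
  next
    assume a: "\<forall>j k. Suc j < k \<and> Suc k < n --> P (Suc j) (Suc k)"
    show "\<forall>i j. i \<in> {1..<n} \<and> j \<in> {1..<n} \<and> i + 2 \<le> j --> P i j"
    proof (intro allI impI)
      fix i j assume "i \<in> {1..<n} \<and> j \<in> {1..<n} \<and> i + 2 \<le> j"
      then show "P i j" using a[rule_format, of "i - 1" "j - 1"] by auto
    qed
  qed
  show ?thesis unfolding hecke_mod_def hmod_def 1 2 3 ball_Suc q3
    using q2[of "\<lambda>i k. mk B B (T i) * (mk B B (T k) * mk B B (T i)) = mk B B (T k) * (mk B B (T i) * mk B B (T k))"]
    by (auto simp: fin)
qed (simp add: hecke_mod_def hmod_def)

lemma mod_hom_iff:
  assumes "finite B" "finite B'"
  shows "mod_hom n B T B' T' f \<longleftrightarrow> mk B' B f \<in> hhom n B (\<lambda>i. mk B B (T i)) B' (\<lambda>i. mk B' B' (T' i))"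
proof -
  show ?thesis unfolding mod_hom_def hhom_def ball_Suc
    by (simp add: mk_mult assms mk_eq_iff)
qed

lemma hmodD:
  assumes "hmod q n B T"
  shows "finite B"
    and "Suc j < n ==> T (Suc j) \<in> Mt B B"
    and "Suc j < n ==> T (Suc j) * T (Suc j) = (q - 1) \<bullet> T (Suc j) + q \<bullet> idB B"
    and "Suc (Suc j) < n ==>
      T (Suc j) * (T (Suc (Suc j)) * T (Suc j)) = T (Suc (Suc j)) * (T (Suc j) * T (Suc (Suc j)))"
    and "Suc j < k ==> Suc k < n ==> T (Suc j) * T (Suc k) = T (Suc k) * T (Suc j)"
  using assms unfolding hmod_def by blast+

lemma hmod_inverse:
  assumes "hmod q n B T" "q \<noteq> 0" "Suc j < n"
  defines "S \<equiv> inverse q \<bullet> (T (Suc j) - (q - 1) \<bullet> idB B)"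
  shows "S \<in> Mt B B" "S * T (Suc j) = idB B" "T (Suc j) * S = idB B"
proof -
  note h = hmodD(1,2)[OF assms(1)] hmodD(3)[OF assms(1,3)]
  have T: "T (Suc j) \<in> Mt B B" using h assms(3) by blast
  show "S \<in> Mt B B" unfolding S_def using T by (intro Mt_scale Mt_diff idB_Mt)
  have "T (Suc j) * T (Suc j) - (q - 1) \<bullet> T (Suc j) = q \<bullet> idB B" using h by simp
  then show "S * T (Suc j) = idB B" "T (Suc j) * S = idB B"
    unfolding S_def using T h(1) assms(2) by (simp_all add: left_diff_distrib right_diff_distrib)
qed

lemma subspace_hhom: "fm.subspace (hhom n B T B' T')"
  unfolding fm.subspace_def hhom_def
  by (auto simp: distrib_left distrib_right intro: Mt_add Mt_scale)

lemma hhom_Mt: "f \<in> hhom n B T B' T' ==> f \<in> Mt B' B" by (simp add: hhom_def)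

lemma hhom_comm: "f \<in> hhom n B T B' T' ==> Suc j < n ==> T' (Suc j) * f = f * T (Suc j)"
  by (simp add: hhom_def)

lemma hhom_mult: "f \<in> hhom n B T B' T' ==> g \<in> hhom n B' T' B'' T'' ==> g * f \<in> hhom n B T B'' T''"
  unfolding hhom_def by (auto intro: Mt_mult) (metis mult.assoc)

lemma idB_hhom: "hmod q n B T ==> idB B \<in> hhom n B T B T"
  unfolding hhom_def using hmodD(1,2) by fastforce

lemma fdim_hhom: "finite B ==> finite B' ==> fm.fdim (hhom n B T B' T')"
  by (rule fm.fdim_subset[OF fdim_Mt[of B' B]]) (auto simp: hhom_def)

section \<open>Transport of vectors along sorting permutations\<close>

definition desc :: "nat => (nat \<times> nat) list => bool"
  where "desc j w \<longleftrightarrow> Suc j < length w \<and> fst (w ! Suc j) < fst (w ! j)"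

lemma desc_inv: "desc j w ==> ninv (map fst w) = Suc (ninv (map fst (sw j w)))"
  unfolding desc_def by (subst inv_sw[of j]) (auto simp: map_sw)

text \<open>\<open>Hf T m w\<close> is \<open>T\<^sub>\<sigma> m(\<sigma>\<^sup>-\<^sup>1 w)\<close>, where \<open>\<sigma>\<close> is the shortest permutation sorting the first components of \<open>w\<close>.\<close>
function Hf :: "(nat => 'k::field fmat) => ((nat \<times> nat) list => 'k fmat) => (nat \<times> nat) list => 'k fmat"
  where "Hf T m w = (if \<exists>j. desc j w then T (Suc (LEAST j. desc j w)) * Hf T m (sw (LEAST j. desc j w) w) else m w)"
  by auto
termination
proof (relation "measure (\<lambda>(T, m, w). ninv (map fst w))")
  fix T :: "nat => 'k fmat" and m and w :: "(nat \<times> nat) list"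
  assume "\<exists>j. desc j w"
  then have "desc (LEAST j. desc j w) w" by (metis LeastI)
  then show "((T, m, sw (LEAST j. desc j w) w), T, m, w) \<in> measure (\<lambda>(T, m, w). ninv (map fst w))"
    using desc_inv by fastforce
qed simp

declare Hf.simps [simp del]

lemma Hf_sorted: "(\<And>j. \<not> desc j w) ==> Hf T m w = m w" by (subst Hf.simps) simp

lemma Hf_least: "desc j w ==> \<exists>k. desc k w \<and> Hf T m w = T (Suc k) * Hf T m (sw k w)"
  by (metis Hf.simps LeastI)

text \<open>Two descents of the same word lead to a common word with fewer inversions: in three
  steps each if they are adjacent, where the braid relation compares the two products, and in two
  steps each if they are distant, where the generators commute. The hypothesis \<open>IH\<close>
  allows any descent at the intermediate words, so the choice of the least descent in
  \<open>Hf\<close> is immaterial.\<close>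

lemma Hf_desc_aux:
  fixes T :: "nat => 'k::field fmat"
  assumes H: "hmod q n B T" and len: "length w = n" and d: "desc j w" "desc k w" "j < k"
    and IH: "\<And>v i. length v = n ==> ninv (map fst v) < ninv (map fst w) ==> desc i v ==>
      Hf T m v = T (Suc i) * Hf T m (sw i v)"
  shows "T (Suc j) * Hf T m (sw j w) = T (Suc k) * Hf T m (sw k w)"
proof (cases "k = Suc j")
  case True
  have l: "Suc (Suc j) < n" using d True len by (simp add: desc_def)
  have lt: "fst (w ! Suc (Suc j)) < fst (w ! Suc j)" "fst (w ! Suc j) < fst (w ! j)"
    using d True by (auto simp: desc_def)
  have a1: "desc (Suc j) (sw j w)" "desc j (sw (Suc j) (sw j w))"
    "desc j (sw (Suc j) w)" "desc (Suc j) (sw j (sw (Suc j) w))"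
    using lt l len by (auto simp: desc_def nth_sw)
  have i: "ninv (map fst (sw j w)) < ninv (map fst w)" "ninv (map fst (sw (Suc j) w)) < ninv (map fst w)"
    "ninv (map fst (sw (Suc j) (sw j w))) < ninv (map fst w)"
    "ninv (map fst (sw j (sw (Suc j) w))) < ninv (map fst w)"
    using desc_inv[OF d(1)] desc_inv[OF d(2)] desc_inv[OF a1(1)] desc_inv[OF a1(3)] True by auto
  have "Hf T m (sw j w) = T (Suc (Suc j)) * (T (Suc j) * Hf T m (sw j (sw (Suc j) (sw j w))))"
    using IH[of "sw j w" "Suc j"] IH[of "sw (Suc j) (sw j w)" j] a1 i len by simp
  moreover have "Hf T m (sw (Suc j) w) = T (Suc j) * (T (Suc (Suc j)) * Hf T m (sw (Suc j) (sw j (sw (Suc j) w))))"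
    using IH[of "sw (Suc j) w" j] IH[of "sw j (sw (Suc j) w)" "Suc j"] a1 i len by simp
  ultimately show ?thesis
    using hmodD(4)[OF H l] sw_braid[of j w] l len True by (simp add: mult.assoc[symmetric])
next
  case False
  then have jk: "Suc j < k" "Suc k < n" using d len by (auto simp: desc_def)
  have a1: "desc k (sw j w)" "desc j (sw k w)" using d jk len by (auto simp: desc_def nth_sw)
  have "Hf T m (sw j w) = T (Suc k) * Hf T m (sw k (sw j w))"
    "Hf T m (sw k w) = T (Suc j) * Hf T m (sw j (sw k w))"
    using IH[of "sw j w" k] IH[of "sw k w" j] a1 desc_inv[OF d(1)] desc_inv[OF d(2)] len by auto
  then show ?thesis
    using hmodD(5)[OF H jk] sw_comm[OF jk(1), of w] jk len by (simp add: mult.assoc[symmetric])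
qed

lemma Hf_desc:
  fixes T :: "nat => 'k::field fmat"
  assumes "hmod q n B T" "length w = n" "desc i w"
  shows "Hf T m w = T (Suc i) * Hf T m (sw i w)"
  using assms(2,3)
proof (induction "ninv (map fst w)" arbitrary: w i rule: less_induct)
  case less
  obtain k where k: "desc k w" "Hf T m w = T (Suc k) * Hf T m (sw k w)" using Hf_least less.prems by blast
  consider "i = k" | "i < k" | "k < i" by linarith
  then show ?case
  proof cases
    case 2
    then show ?thesis using Hf_desc_aux[OF assms(1) less.prems(1) less.prems(2) k(1)] less.hyps k(2) by metis
  next
    case 3
    then show ?thesis using Hf_desc_aux[OF assms(1) less.prems(1) k(1) less.prems(2)] less.hyps k(2) by metis
  qed (use k in simp)
qed

lemma Hf_asc:
  fixes T :: "nat => 'k::field fmat"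
  assumes "hmod q n B T" "length w = n" "Suc i < n" "fst (w ! i) < fst (w ! Suc i)"
  shows "Hf T m (sw i w) = T (Suc i) * Hf T m w"
proof -
  have "desc i (sw i w)" using assms by (auto simp: desc_def nth_sw)
  then show ?thesis using Hf_desc[OF assms(1), of "sw i w" i m] assms by simp
qed

text \<open>Two neighbours with equal first component stay neighbours while the word is sorted. The
  generator at their place can therefore be moved through the product that defines
  \<open>Hf\<close>, changing its index along with the pair, until it meets the sorted word, where
  \<open>base\<close> describes its action.\<close>

lemma Hf_equal:
  fixes T :: "nat => 'k::field fmat" and a b :: "nat \<times> nat => nat \<times> nat => 'k"
  assumes H: "hmod q n B T"
    and base: "\<And>w j. length w = n ==> P (mset w) ==> (\<And>i. \<not> desc i w) ==> Suc j < n ==> fst (w ! j) = fst (w ! Suc j) ==>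
      T (Suc j) * m w = a (w ! j) (w ! Suc j) \<bullet> m w + b (w ! j) (w ! Suc j) \<bullet> m (sw j w)"
    and w: "length w = n" "P (mset w)" "Suc j < n" "fst (w ! j) = fst (w ! Suc j)"
  shows "T (Suc j) * Hf T m w = a (w ! j) (w ! Suc j) \<bullet> Hf T m w + b (w ! j) (w ! Suc j) \<bullet> Hf T m (sw j w)"
  using w
proof (induction "ninv (map fst w)" arbitrary: w j rule: less_induct)
  case less
  note len = less.prems(1) and Pw = less.prems(2) and j = less.prems(3) and eq = less.prems(4)
  note D = Hf_desc[OF H]
  show ?case
  proof (cases "\<exists>k. desc k w")
    case False
    moreover have "\<not> desc i (sw j w)" for i
    proof -
      have "map fst (sw j w) = map fst w" using sw_same[of j "map fst w"] eq j len by (simp add: map_sw)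
      then have "fst (sw j w ! l) = fst (w ! l)" if "l < n" for l
        using that len by (metis length_sw nth_map)
      then show ?thesis using False len by (auto simp: desc_def)
    qed
    ultimately show ?thesis using base[OF len Pw _ j eq] by (simp add: Hf_sorted)
  next
    case True
    then obtain k where k: "desc k w" by blast
    then have kn: "Suc k < n" using len by (simp add: desc_def)
    have "k \<noteq> j" using k eq by (auto simp: desc_def)
    then consider "Suc j < k \<or> Suc k < j" | "k = Suc j" | "j = Suc k" by linarith
    then show ?thesis
    proof cases
      case 1
      have same: "sw k w ! j = w ! j" "sw k w ! Suc j = w ! Suc j" using 1 j kn len by (auto simp: nth_sw)
      have IH: "T (Suc j) * Hf T m (sw k w) = a (w ! j) (w ! Suc j) \<bullet> Hf T m (sw k w)
          + b (w ! j) (w ! Suc j) \<bullet> Hf T m (sw j (sw k w))"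
        using less.hyps[of "sw k w" j] desc_inv[OF k] len j eq same Pw kn by simp
      have com: "T (Suc j) * T (Suc k) = T (Suc k) * T (Suc j)"
        using hmodD(5)[OF H, of j k] hmodD(5)[OF H, of k j] 1 j kn by auto
      have swc: "sw j (sw k w) = sw k (sw j w)" using 1 sw_comm[of j k w] sw_comm[of k j w] j kn len by auto
      have "desc k (sw j w)" using k 1 j len by (auto simp: desc_def nth_sw)
      then have sj: "Hf T m (sw j w) = T (Suc k) * Hf T m (sw k (sw j w))" using D[of "sw j w" k] len by simp
      have "T (Suc j) * Hf T m w = T (Suc k) * (T (Suc j) * Hf T m (sw k w))"
        using D[OF len k, of m] com by (simp add: mult.assoc[symmetric])
      then show ?thesis using IH D[OF len k, of m] sj swc by (simp add: distrib_left)
    next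
      case 2
      \<comment> \<open>A smaller letter passes both equal letters, which move one place to the
        right as a pair; by the braid relation the generator at \<open>j\<close> turns into the one
        at \<open>Suc j\<close>.\<close>
      define v where "v = sw j (sw k w)"
      have n2: "Suc (Suc j) < n" using kn 2 by simp
      have lt: "fst (w ! Suc (Suc j)) < fst (w ! Suc j)" using k 2 by (simp add: desc_def)
      have d2: "desc j (sw k w)" using lt eq 2 n2 len by (auto simp: desc_def nth_sw)
      have w: "Hf T m w = T (Suc (Suc j)) * (T (Suc j) * Hf T m v)"
        using D[OF len k, of m] D[of "sw k w" j m] d2 len 2 by (simp add: v_def)
      have vl: "v ! Suc j = w ! j" "v ! Suc (Suc j) = w ! Suc j" "length v = n"
        using 2 n2 len by (auto simp: v_def nth_sw)
      have mv: "mset v = mset w" using 2 n2 len by (simp add: v_def)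
      have IH: "T (Suc (Suc j)) * Hf T m v = a (w ! j) (w ! Suc j) \<bullet> Hf T m v + b (w ! j) (w ! Suc j) \<bullet> Hf T m (sw (Suc j) v)"
        using less.hyps[of v "Suc j"] desc_inv[OF k] desc_inv[OF d2] vl eq n2 mv Pw v_def by simp
      have s1: "desc (Suc j) (sw j w)" "desc j (sw (Suc j) (sw j w))"
        using lt eq n2 len by (auto simp: desc_def nth_sw)
      have "sw (Suc j) v = sw j (sw (Suc j) (sw j w))" using sw_braid[of j w] n2 len 2 by (simp add: v_def)
      then have sj: "Hf T m (sw j w) = T (Suc (Suc j)) * (T (Suc j) * Hf T m (sw (Suc j) v))"
        using D[of "sw j w" "Suc j" m] D[of "sw (Suc j) (sw j w)" j m] s1 len by simp
      have "T (Suc j) * Hf T m w = T (Suc (Suc j)) * (T (Suc j) * (T (Suc (Suc j)) * Hf T m v))"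
        unfolding w using hmodD(4)[OF H n2] by (simp add: mult.assoc[symmetric])
      then show ?thesis unfolding IH w sj by (simp add: distrib_left)
    next
      case 3
      \<comment> \<open>The mirror image: a larger letter in front passes the pair, which moves one
        place to the left.\<close>
      define v where "v = sw (Suc k) (sw k w)"
      have n2: "Suc (Suc k) < n" using j 3 by simp
      have lt: "fst (w ! Suc k) < fst (w ! k)" using k by (simp add: desc_def)
      have eq': "fst (w ! Suc k) = fst (w ! Suc (Suc k))" using eq 3 by simp
      have d2: "desc (Suc k) (sw k w)" using lt eq' n2 len by (auto simp: desc_def nth_sw)
      have w: "Hf T m w = T (Suc k) * (T (Suc (Suc k)) * Hf T m v)"
        using D[OF len k, of m] D[of "sw k w" "Suc k" m] d2 len by (simp add: v_def)
      have vl: "v ! k = w ! Suc k" "v ! Suc k = w ! Suc (Suc k)" "length v = n"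
        using n2 len by (auto simp: v_def nth_sw)
      have mv: "mset v = mset w" using n2 len by (simp add: v_def)
      have IH: "T (Suc k) * Hf T m v = a (w ! j) (w ! Suc j) \<bullet> Hf T m v + b (w ! j) (w ! Suc j) \<bullet> Hf T m (sw k v)"
        using less.hyps[of v k] desc_inv[OF k] desc_inv[OF d2] vl eq' n2 mv Pw 3 v_def by simp
      have s1: "desc k (sw j w)" "desc (Suc k) (sw k (sw j w))"
        using lt eq' n2 len 3 by (auto simp: desc_def nth_sw)
      have "sw k v = sw (Suc k) (sw k (sw j w))" using sw_braid[of k w] n2 len 3 by (simp add: v_def)
      then have sj: "Hf T m (sw j w) = T (Suc k) * (T (Suc (Suc k)) * Hf T m (sw k v))"
        using D[of "sw j w" k m] D[of "sw k (sw j w)" "Suc k" m] s1 len by simp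
      have "T (Suc j) * Hf T m w = T (Suc k) * (T (Suc (Suc k)) * (T (Suc k) * Hf T m v))"
        unfolding w 3 using hmodD(4)[OF H n2] by (simp add: mult.assoc[symmetric])
      then show ?thesis unfolding IH w sj by (simp add: distrib_left)
    qed
  qed
qed

section \<open>The standard module\<close>

definition cc :: "'k::field => nat => 'k" where "cc q x = (if even x then q else -1)"

lemma cc_square: "cc q x * cc q x = (q - 1) * cc q x + q"
  by (simp add: cc_def algebra_simps)

lemma cc_nonzero: "q \<noteq> 0 ==> cc q x \<noteq> 0" by (simp add: cc_def)

definition CB :: "nat => nat list set" where "CB n = hk_words n {..<2*n}"

text \<open>\<open>V\<^sup>\<otimes>\<^sup>n\<close> for the standard Hecke symmetry on a super vector space: even letters have eigenvalue \<open>q\<close>,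
  odd letters have eigenvalue \<open>-1\<close>. Every module induced from a one-dimensional representation of a
  parabolic subalgebra is a direct summand, spanned by the rearrangements of one word.\<close>
definition tst :: "'k::field => nat => nat list => nat list => 'k"
  where "tst q i u w =
    (if w ! (i - 1) < w ! i then (if u = sw (i - 1) w then 1 else 0)
     else if w ! i < w ! (i - 1) then (if u = sw (i - 1) w then q else if u = w then q - 1 else 0)
     else if u = w then cc q (w ! i) else 0)"

definition TC :: "'k::field => nat => nat => 'k fmat" where "TC q n i = mk (CB n) (CB n) (tst q i)"

lemma finite_CB [simp]: "finite (CB n)" by (simp add: CB_def)

lemma TC_Mt [simp]: "TC q n i \<in> Mt (CB n) (CB n)" by (simp add: TC_def)

lemma CB_length: "w \<in> CB n ==> length w = n" by (simp add: CB_def hk_words_def)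

lemma sw_CB: "w \<in> CB n ==> Suc j < n ==> sw j w \<in> CB n" by (simp add: CB_def sw_words)

lemma CB_mset: "w \<in> CB n ==> mset w = mset w' ==> w' \<in> CB n"
  using mset_eq_length[of w w'] mset_eq_setD[of w w'] by (simp add: CB_def hk_words_def)

lemma TC_mu:
  assumes "w \<in> CB n" "Suc j < n"
  shows "TC q n (Suc j) * mu w x =
    (if w ! j < w ! Suc j then mu (sw j w) x
     else if w ! Suc j < w ! j then q \<bullet> mu (sw j w) x + (q - 1) \<bullet> mu w x
     else cc q (w ! j) \<bullet> mu w x)"
proof (rule fmat_eqI)
  fix u v
  have neq: "sw j w \<noteq> w" if "w ! j \<noteq> w ! Suc j"
  proof
    assume "sw j w = w"
    then show False using nth_sw[of j w j] assms CB_length[OF assms(1)] that by simp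
  qed
  show "ent (TC q n (Suc j) * mu w x) u v = ent (if w ! j < w ! Suc j then mu (sw j w) x
     else if w ! Suc j < w ! j then q \<bullet> mu (sw j w) x + (q - 1) \<bullet> mu w x
     else cc q (w ! j) \<bullet> mu w x) u v"
    using assms neq sw_CB[OF assms]
    by (cases "w ! j" "w ! Suc j" rule: linorder_cases) (auto simp: ent_mult_mu TC_def tst_def)
qed

lemma col_eqI:
  assumes "f \<in> Mt A B" "g \<in> Mt A' B" "\<And>w. w \<in> B ==> f * mu w [] = g * mu w []"
  shows "f = g"
proof (rule fmat_eqI)
  fix u w
  show "ent f u w = ent g u w"
  proof (cases "w \<in> B")
    case True
    then have "ent (f * mu w []) u [] = ent (g * mu w []) u []" using assms(3) by simp
    then show ?thesis by (simp add: ent_mult_mu)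
  next
    case False
    then show ?thesis using Mt_zero[OF assms(1)] Mt_zero[OF assms(2)] by simp
  qed
qed

lemma hmod_TC: "hmod q n (CB n) (TC q n)"
  unfolding hmod_def
proof (intro conjI allI impI)
  show "finite (CB n)" by simp
next
  fix j assume "Suc j < n" then show "TC q n (Suc j) \<in> Mt (CB n) (CB n)" by simp
next
  fix j assume j: "Suc j < n"
  show "TC q n (Suc j) * TC q n (Suc j) = (q - 1) \<bullet> TC q n (Suc j) + q \<bullet> idB (CB n)"
  proof (rule col_eqI)
    show "TC q n (Suc j) * TC q n (Suc j) \<in> Mt (CB n) (CB n)" by (intro Mt_mult[OF TC_Mt TC_Mt])
    show "(q - 1) \<bullet> TC q n (Suc j) + q \<bullet> idB (CB n) \<in> Mt (CB n) (CB n)"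
      by (intro Mt_add Mt_scale TC_Mt idB_Mt)
    fix w assume w: "w \<in> CB n"
    have id: "idB (CB n) * mu w [] = (mu w [] :: 'a fmat)"
      by (rule idB_mult[of _ _ "{[]}"]) (use w in auto)
    note sw = sw_CB[OF w j] and len = CB_length[OF w]
    have nth: "sw j w ! j = w ! Suc j" "sw j w ! Suc j = w ! j" using nth_sw[of j w] j len by auto
    have c: "cc q (w ! j) \<bullet> (cc q (w ! j) \<bullet> x) = (q - 1) \<bullet> (cc q (w ! j) \<bullet> x) + q \<bullet> x" for x :: "'a fmat"
      by (simp only: fm.scale_scale cc_square fm.scale_left_distrib)
    show "TC q n (Suc j) * TC q n (Suc j) * mu w [] = ((q - 1) \<bullet> TC q n (Suc j) + q \<bullet> idB (CB n)) * mu w []"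
      using j len c[of "mu w []"] by (cases "w ! j" "w ! Suc j" rule: linorder_cases)
        (simp_all add: mult.assoc distrib_left distrib_right TC_mu[OF w j] TC_mu[OF sw j] nth id
          fm.scale_right_distrib ac_simps)
  qed
next
  fix j assume j: "Suc (Suc j) < n"
  let ?T = "TC q n"
  show "?T (Suc j) * (?T (Suc (Suc j)) * ?T (Suc j)) = ?T (Suc (Suc j)) * (?T (Suc j) * ?T (Suc (Suc j)))"
  proof (rule col_eqI)
    show "?T (Suc j) * (?T (Suc (Suc j)) * ?T (Suc j)) \<in> Mt (CB n) (CB n)"
      "?T (Suc (Suc j)) * (?T (Suc j) * ?T (Suc (Suc j))) \<in> Mt (CB n) (CB n)"
      by (rule Mt_mult[OF TC_Mt Mt_mult[OF TC_Mt TC_Mt]])+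
    fix w assume w: "w \<in> CB n"
    then have len: "Suc (Suc j) < length w" using CB_length j by simp
    define pre where "pre = take j w"
    define post where "post = drop (Suc (Suc (Suc j))) w"
    obtain a b c where abc: "w = pre @ a # b # c # post"
      unfolding pre_def post_def using len
      by (metis Cons_nth_drop_Suc Suc_lessD append_take_drop_id)
    have lp: "length pre = j" using len by (simp add: pre_def)
    define X where "X = set_mset (mset w)"
    \<comment> \<open>Both sides of the braid relation change only three neighbouring letters.
      Everything else is frozen in \<open>pre\<close> and \<open>post\<close>, and the relation
      becomes a check over the possible orders of \<open>a\<close>, \<open>b\<close>,
      \<open>c\<close>.\<close>
    define E where "E = (\<lambda>a b c. mu (pre @ a # b # c # post) [] :: 'a fmat)"
    define C where "C = (\<lambda>a b c. pre @ a # b # c # post \<in> CB n)"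
    have perm: "C b' a' c'" "C a' c' b'" if "C a' b' c'" for a' b' c'
      using that CB_mset[of "pre @ a' # b' # c' # post" n "pre @ b' # a' # c' # post"]
        CB_mset[of "pre @ a' # b' # c' # post" n "pre @ a' # c' # b' # post"] unfolding C_def by simp_all
    have T1: "?T (Suc j) * E a b c = (if a < b then E b a c else if b < a then q \<bullet> E b a c + (q - 1) \<bullet> E a b c
        else cc q a \<bullet> E a b c)" if "C a b c" for a b c
      using TC_mu[of "pre @ a # b # c # post" n j q "[]"] that j lp
      by (simp add: C_def E_def sw_append nth_append)
    have T2: "?T (Suc (Suc j)) * E a b c = (if b < c then E a c b else if c < b then q \<bullet> E a c b + (q - 1) \<bullet> E a b c
        else cc q b \<bullet> E a b c)" if "C a b c" for a b c
      using TC_mu[of "pre @ a # b # c # post" n "Suc j" q "[]"] that j lp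
        sw_append[of "pre @ [a]" "Suc j" b c post]
      by (simp add: C_def E_def nth_append)
    have Cabc: "C a b c" using w abc by (simp add: C_def)
    note Cs = Cabc perm[OF Cabc] perm[OF perm(1)[OF Cabc]] perm[OF perm(2)[OF Cabc]]
      perm[OF perm(1)[OF perm(2)[OF Cabc]]]
    have sq: "cc q x * (cc q x * y) = (q - 1) * (cc q x * y) + q * y" for x y
      using cc_square[of q x] by (metis (no_types, lifting) distrib_right mult.assoc)
    have "?T (Suc j) * (?T (Suc (Suc j)) * (?T (Suc j) * E a b c)) =
        ?T (Suc (Suc j)) * (?T (Suc j) * (?T (Suc (Suc j)) * E a b c))"
      using Cs
      by (cases a b rule: linorder_cases; cases b c rule: linorder_cases; cases a c rule: linorder_cases)
        (simp_all add: T1 T2 distrib_left fm.scale_right_distrib fm.scale_left_distrib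
          fm.scale_left_diff_distrib fm.scale_right_diff_distrib algebra_simps sq cc_square)
    then show "?T (Suc j) * (?T (Suc (Suc j)) * ?T (Suc j)) * mu w [] =
        ?T (Suc (Suc j)) * (?T (Suc j) * ?T (Suc (Suc j))) * mu w []"
      by (simp add: abc E_def mult.assoc)
  qed
next
  fix j k assume jk: "Suc j < k \<and> Suc k < n"
  show "TC q n (Suc j) * TC q n (Suc k) = TC q n (Suc k) * TC q n (Suc j)"
  proof (rule col_eqI)
    show "TC q n (Suc j) * TC q n (Suc k) \<in> Mt (CB n) (CB n)" "TC q n (Suc k) * TC q n (Suc j) \<in> Mt (CB n) (CB n)"
      by (intro Mt_mult[OF TC_Mt TC_Mt])+
    fix w assume w: "w \<in> CB n"
    have j: "Suc j < n" and k: "Suc k < n" using jk by auto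
    note len = CB_length[OF w]
    have nth: "sw k w ! j = w ! j" "sw k w ! Suc j = w ! Suc j" "sw j w ! k = w ! k" "sw j w ! Suc k = w ! Suc k"
      using jk len nth_sw[of k w] nth_sw[of j w] by auto
    have c: "sw j (sw k w) = sw k (sw j w)" using sw_comm[of j k w] jk len by simp
    show "TC q n (Suc j) * TC q n (Suc k) * mu w [] = TC q n (Suc k) * TC q n (Suc j) * mu w []"
      by (cases "w ! j" "w ! Suc j" rule: linorder_cases; cases "w ! k" "w ! Suc k" rule: linorder_cases)
        (simp_all add: mult.assoc TC_mu[OF w j] TC_mu[OF w k] TC_mu[OF sw_CB[OF w j] k] TC_mu[OF sw_CB[OF w k] j]
          distrib_left distrib_right nth c fm.scale_right_distrib ac_simps)
  qed
qed

text \<open>The rearrangements of one word (a weight of \<open>C\<close>) span a cyclic module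
  generated by the sorted word: each step away from it by an ascent is one application of a
  generator.\<close>

lemma hhom_determined:
  assumes f: "f \<in> hhom n (CB n) (TC q n) B T" and g: "g \<in> hhom n (CB n) (TC q n) B T"
    and w0: "sorted w0" "f * mu w0 [] = g * mu w0 []"
    and u: "u \<in> CB n" "mset u = mset w0"
  shows "f * mu u [] = g * mu u []"
  using u
proof (induction "ninv u" arbitrary: u rule: less_induct)
  case less
  show ?case
  proof (cases "\<exists>j. Suc j < n \<and> u ! Suc j < u ! j")
    case True
    then obtain j where j: "Suc j < n" "u ! Suc j < u ! j" by blast
    note len = CB_length[OF less.prems(1)]
    have "ninv (sw j u) < ninv u" using inv_sw[of j u] j len by simp
    then have IH: "f * mu (sw j u) [] = g * mu (sw j u) []"
      using less.hyps[of "sw j u"] sw_CB[OF less.prems(1) j(1)] less.prems(2) j(1) len by simp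
    have "TC q n (Suc j) * mu (sw j u) [] = mu u []"
      using TC_mu[OF sw_CB[OF less.prems(1) j(1)] j(1)] nth_sw[of j u] j len by simp
    then have "h * mu u [] = T (Suc j) * (h * mu (sw j u) [])" if "h \<in> hhom n (CB n) (TC q n) B T" for h
      using hhom_comm[OF that j(1)] by (simp add: mult.assoc[symmetric]) (simp add: mult.assoc)
    then show ?thesis using f g IH by simp
  next
    case False
    then have "sorted u" using sorted_no_desc[of u] CB_length[OF less.prems(1)] by (metis not_le)
    then have "u = w0" using w0(1) less.prems(2) by (metis properties_for_sort)
    then show ?thesis using w0(2) by simp
  qed
qed

section \<open>Frobenius reciprocity for the weights of the standard module\<close>

definition homv :: "(nat => 'k::field fmat) => nat => nat list => 'k fmat => 'k fmat"
  where "homv T n w0 v =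
    (\<Sum>u\<in>CB n. Hf T (\<lambda>w. if map fst w = w0 then v else 0) (map (\<lambda>x. (x, 0)) u) * mu [] u)"

lemma sum_mult_mu:
  assumes "finite A" "u \<in> A"
  shows "(\<Sum>w\<in>A. f w * mu [] w) * mu u x = (f u :: 'k::field fmat) * mu [] x"
proof -
  have "(\<Sum>w\<in>A. f w * mu [] w) * mu u x = (\<Sum>w\<in>A. if w = u then f u * mu [] x else 0)"
    unfolding sum_distrib_right by (intro sum.cong refl) (auto simp: mult.assoc mu_mult)
  then show ?thesis using assms by simp
qed

lemma Hf_in:
  assumes "hmod q n B T" "length w = n" "\<And>w. m w \<in> Mt B A"
  shows "Hf T m w \<in> Mt B A"
  using assms(2)
proof (induction "ninv (map fst w)" arbitrary: w rule: less_induct)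
  case less
  show ?case
  proof (cases "\<exists>j. desc j w")
    case True
    then obtain j where j: "desc j w" by blast
    then have "Suc j < n" using less.prems by (simp add: desc_def)
    then show ?thesis using less.hyps[of "sw j w"] desc_inv[OF j] Hf_desc[OF assms(1) less.prems j] less.prems
        Mt_mult[OF hmodD(2)[OF assms(1)]] by simp
  next
    case False
    then show ?thesis using assms(3) by (simp add: Hf_sorted)
  qed
qed

lemma Hf_zero:
  assumes "hmod q n B T" "length w = n" "\<And>v. mset v = mset w ==> m v = 0"
  shows "Hf T m w = 0"
  using assms(2,3)
proof (induction "ninv (map fst w)" arbitrary: w rule: less_induct)
  case less
  show ?case
  proof (cases "\<exists>j. desc j w")
    case True
    then obtain j where j: "desc j w" by blast
    then have "Suc j < length w" by (simp add: desc_def)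
    then show ?thesis using less.hyps[of "sw j w"] desc_inv[OF j] Hf_desc[OF assms(1) less.prems(1) j] less.prems
      by simp
  next
    case False
    then show ?thesis using less.prems by (simp add: Hf_sorted)
  qed
qed

text \<open>The span of the rearrangements of \<open>w0\<close> is induced from the character by
  which the generators at repeated letters act on \<open>w0\<close>. A vector \<open>v\<close> with
  the same eigenvalues is therefore a possible image of \<open>w0\<close>. The other columns are
  transported by \<open>Hf\<close> from the sorted word; the second components are dummies here, and
  \<open>Hf_equal\<close> with \<open>b = 0\<close> carries the eigenvalue equation along.\<close>

lemma homv:
  assumes H: "hmod q n B T" and w0: "w0 \<in> CB n" "sorted w0" and v: "v \<in> Mt B {[]}"
    and ev: "\<And>j. Suc j < n ==> w0 ! j = w0 ! Suc j ==> T (Suc j) * v = cc q (w0 ! j) \<bullet> v"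
  shows "homv T n w0 v \<in> hhom n (CB n) (TC q n) B T"
    and "homv T n w0 v * mu w0 [] = v"
    and "u \<in> CB n ==> mset u \<noteq> mset w0 ==> homv T n w0 v * mu u [] = 0"
proof -
  let ?m = "\<lambda>w. if map fst w = w0 then v else (0 :: 'a fmat)"
  let ?p = "map (\<lambda>x. (x, 0::nat))"
  define h where "h = (\<lambda>u. Hf T ?m (?p u))"
  have homv_eq: "homv T n w0 v = (\<Sum>u\<in>CB n. h u * mu [] u)" by (simp add: homv_def h_def)
  have fstp: "map fst (?p u) = u" for u by (simp add: comp_def)
  have hM: "h u \<in> Mt B {[]}" if "u \<in> CB n" for u
    unfolding h_def by (rule Hf_in[OF H]) (use v CB_length[OF that] in auto)
  have M: "homv T n w0 v \<in> Mt B (CB n)"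
    unfolding homv_eq by (intro Mt_sum Mt_mult[of _ _ "{[]}" _ "{[]}"] hM) auto
  have col: "homv T n w0 v * mu u [] = h u" if "u \<in> CB n" for u
  proof -
    have "homv T n w0 v * mu u [] = h u * mu [] []"
      unfolding homv_eq by (rule sum_mult_mu) (use that in auto)
    also have "... = h u"
      by (rule fmat_eqI) (use hM[OF that] in \<open>auto simp: ent_mult_mu Mt_zero\<close>)
    finally show ?thesis .
  qed
  have nd: "\<not> desc i (?p w0)" for i
  proof
    assume d: "desc i (?p w0)"
    then have "Suc i < length w0" by (simp add: desc_def)
    then show False using d w0(2) by (auto simp: desc_def sorted_iff_nth_Suc not_less)
  qed
  show "homv T n w0 v * mu w0 [] = v"
    using col[OF w0(1)] nd by (simp add: h_def Hf_sorted comp_def)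
  show "homv T n w0 v * mu u [] = 0" if "u \<in> CB n" "mset u \<noteq> mset w0"
  proof -
    have "h u = 0" unfolding h_def
    proof (rule Hf_zero[OF H])
      fix w assume "mset w = mset (?p u)"
      then have "mset (map fst w) = mset u" by (metis fstp mset_map)
      then show "?m w = 0" using that by auto
    qed (use CB_length that in simp)
    then show ?thesis using col that by simp
  qed
  have eqs: "T (Suc j) * h u = cc q (u ! j) \<bullet> h u" if u: "u \<in> CB n" "Suc j < n" "u ! j = u ! Suc j" for u j
  proof -
    have "T (Suc j) * Hf T ?m (?p u) = cc q (fst (?p u ! j)) \<bullet> Hf T ?m (?p u) + 0 \<bullet> Hf T ?m (sw j (?p u))"
    proof (rule Hf_equal[OF H, where P = "\<lambda>_. True" and a = "\<lambda>x y. cc q (fst x)" and b = "\<lambda>x y. 0"])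
      fix w :: "(nat \<times> nat) list" and j
      assume "length w = n" "Suc j < n" "fst (w ! j) = fst (w ! Suc j)"
      then show "T (Suc j) * ?m w = cc q (fst (w ! j)) \<bullet> ?m w + 0 \<bullet> ?m (sw j w)"
        using ev[of j] by auto
    qed (use u CB_length in auto)
    then show ?thesis using u CB_length by (simp add: h_def)
  qed
  have asc: "h (sw j u) = T (Suc j) * h u" if u: "u \<in> CB n" "Suc j < n" "u ! j < u ! Suc j" for u j
    using Hf_asc[OF H, of "?p u" j ?m] u CB_length[OF u(1)] unfolding h_def by (simp add: map_sw)
  show "homv T n w0 v \<in> hhom n (CB n) (TC q n) B T"
    unfolding hhom_def
  proof (intro CollectI conjI M allI impI)
    fix j assume j: "Suc j < n"
    show "T (Suc j) * homv T n w0 v = homv T n w0 v * TC q n (Suc j)"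
    proof (rule col_eqI)
      show "T (Suc j) * homv T n w0 v \<in> Mt B (CB n)" using Mt_mult[OF hmodD(2)[OF H j] M] .
      show "homv T n w0 v * TC q n (Suc j) \<in> Mt B (CB n)" using Mt_mult[OF M TC_Mt] .
      fix u assume u: "u \<in> CB n"
      note len = CB_length[OF u]
      have nth: "sw j u ! j = u ! Suc j" "sw j u ! Suc j = u ! j" using nth_sw[of j u] j len by auto
      have "T (Suc j) * h u = homv T n w0 v * (TC q n (Suc j) * mu u [])"
      proof (cases "u ! j" "u ! Suc j" rule: linorder_cases)
        case less
        then show ?thesis using asc[OF u j] TC_mu[OF u j, of q "[]"] col[OF sw_CB[OF u j]] by simp
      next
        case equal
        then show ?thesis using eqs[OF u j] TC_mu[OF u j, of q "[]"] col[OF u] by simp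
      next
        case greater
        have hu: "h u = T (Suc j) * h (sw j u)" using asc[OF sw_CB[OF u j] j] greater nth j len by simp
        have "T (Suc j) * (T (Suc j) * h (sw j u)) = (q - 1) \<bullet> (T (Suc j) * h (sw j u)) + q \<bullet> h (sw j u)"
          using hmodD(3)[OF H j] idB_mult[OF hmodD(1)[OF H] hM[OF sw_CB[OF u j]]]
          by (simp add: mult.assoc[symmetric]) (simp add: distrib_right mult.assoc)
        then show ?thesis using greater hu TC_mu[OF u j, of q "[]"] col[OF u] col[OF sw_CB[OF u j]]
          by (simp add: distrib_left)
      qed
      then show "T (Suc j) * homv T n w0 v * mu u [] = homv T n w0 v * TC q n (Suc j) * mu u []"
        using col[OF u] by (simp add: mult.assoc)
    qed
  qed
qed

section \<open>Modules with one-dimensional source factor through the standard module\<close>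

lemma hmod_cong: "(\<And>j. Suc j < n ==> T (Suc j) = T' (Suc j)) ==> hmod q n B T = hmod q n B T'"
  unfolding hmod_def
  by (intro conj_cong refl all_cong1 imp_cong) auto

lemma hhom_cong:
  "(\<And>j. Suc j < n ==> T (Suc j) = S (Suc j)) ==> (\<And>j. Suc j < n ==> T' (Suc j) = S' (Suc j)) ==>
    hhom n B T B' T' = hhom n B S B' S'"
  unfolding hhom_def by auto

text \<open>The image of \<open>e\<close> is turned into a module of its own by choosing a basis of
  it and naming the basis vectors by one-letter words, since bases of modules have to consist of
  words. The drop in cardinality drives the decomposition into indecomposables.\<close>

lemma idempotent_split:
  fixes T :: "nat => 'k::field fmat"
  assumes H: "hmod q n B T" and e: "e \<in> hhom n B T B T" "e * e = e"
  obtains B1 T1 f g where "hmod q n B1 T1" "f \<in> hhom n B T B1 T1" "g \<in> hhom n B1 T1 B T"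
    "g * f = e" "f * g = idB B1" "e \<noteq> idB B ==> card B1 < card B"
proof -
  note fB = hmodD(1)[OF H]
  have eM: "e \<in> Mt B B" using hhom_Mt[OF e(1)] .
  define V where "V = (Mt B {[]} :: 'k fmat set)"
  define U where "U = {x \<in> V. e * x = x}"
  have sV: "fm.subspace V" "fm.fdim V" unfolding V_def by (rule subspace_Mt, rule fdim_Mt[OF fB]) simp
  have sU: "fm.subspace U" using sV(1) unfolding U_def fm.subspace_def by (auto simp: distrib_left)
  have UV: "U \<subseteq> V" by (auto simp: U_def)
  obtain Bs where Bs: "finite Bs" "fm.independent Bs" "Bs \<subseteq> U" "fm.span Bs = U" "card Bs = fm.dim U"
    using fm.fdim_basis[OF sU fm.fdim_subset[OF sV(2) UV]] by blast
  define r where "r = card Bs"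
  obtain b where b: "bij_betw b {..<r} Bs"
    using ex_bij_betw_nat_finite[OF Bs(1)] by (auto simp: r_def lessThan_atLeast0)
  have bU: "b i \<in> U" if "i < r" for i using b Bs(3) that bij_betwE by blast
  have bV: "b i \<in> Mt B {[]}" "e * b i = b i" if "i < r" for i using bU[OF that] by (auto simp: U_def V_def)
  have co_ex: "\<exists>c. x = (\<Sum>i<r. c i \<bullet> b i)" if x: "x \<in> U" for x
  proof -
    obtain c where "x = (\<Sum>v\<in>Bs. c v \<bullet> v)" using x Bs(1,4) by (auto simp: fm.span_finite)
    also have "... = (\<Sum>i<r. c (b i) \<bullet> b i)" using sum.reindex_bij_betw[OF b, of "\<lambda>v. c v \<bullet> v"] by simp
    finally show ?thesis by (rule exI[of _ "\<lambda>i. c (b i)"])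
  qed
  have ind: "c i = 0" if s: "(\<Sum>i<r. c i \<bullet> b i) = 0" and i: "i < r" for c i
  proof -
    let ?u = "\<lambda>v. c (the_inv_into {..<r} b v)"
    have inj: "inj_on b {..<r}" using b bij_betw_imp_inj_on by blast
    have "(\<Sum>v\<in>Bs. ?u v \<bullet> v) = (\<Sum>i<r. ?u (b i) \<bullet> b i)"
      using sum.reindex_bij_betw[OF b, of "\<lambda>v. ?u v \<bullet> v"] by simp
    also have "... = 0" using s the_inv_into_f_f[OF inj] by simp
    finally have "?u (b i) = 0"
      using fm.independentD[OF Bs(2) Bs(1) order_refl, of ?u "b i"] b i bij_betwE by blast
    then show ?thesis using the_inv_into_f_f[OF inj] i by simp
  qed
  define B1 where "B1 = (\<lambda>i::nat. [i]) ` {..<r}"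
  have fB1: "finite B1" and cB1: "card B1 = r" by (auto simp: B1_def card_image inj_on_def)
  have eU: "e * mu w [] \<in> U" if "w \<in> B" for w
    using that e(2) Mt_mult[OF eM mu_Mt[of w B "[]" "{[]}"]] by (auto simp: U_def V_def mult.assoc[symmetric])
  then have "\<forall>w\<in>B. \<exists>c. e * mu w [] = (\<Sum>i<r. c i \<bullet> b i)" using co_ex by simp
  from bchoice[OF this] obtain co where co: "\<forall>w\<in>B. e * mu w [] = (\<Sum>i<r. co w i \<bullet> b i)" by (rule exE)
  define g where "g = (\<Sum>i<r. b i * mu [] [i])"
  define F where "F = (\<lambda>w. \<Sum>i<r. co w i \<bullet> (mu [i] [] :: 'k fmat))"
  define f where "f = (\<Sum>w\<in>B. F w * mu [] w)"
  have FM: "F w \<in> Mt B1 {[]}" for w unfolding F_def B1_def by (intro Mt_sum Mt_scale mu_Mt) auto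
  have fM: "f \<in> Mt B1 B" unfolding f_def by (intro Mt_sum Mt_mult[OF FM mu_Mt]) auto
  have gM: "g \<in> Mt B B1" unfolding g_def by (intro Mt_sum Mt_mult[OF bV(1) mu_Mt]) (auto simp: B1_def)
  have Vid: "x * mu [] [] = x" if "x \<in> Mt A {[]}" for A and x :: "'k fmat"
    by (rule fmat_eqI) (use that in \<open>auto simp: ent_mult_mu Mt_zero\<close>)
  have gmu: "g * mu [i] [] = b i" if "i < r" for i
  proof -
    have "g * mu [i] [] = (\<Sum>k<r. if k = i then b i else 0)"
      unfolding g_def sum_distrib_right
      by (intro sum.cong refl) (use Vid bV(1) that in \<open>auto simp: mult.assoc mu_mult\<close>)
    then show ?thesis using that by simp
  qed
  have gF: "g * (\<Sum>i<r. c i \<bullet> mu [i] []) = (\<Sum>i<r. c i \<bullet> b i)" for c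
    unfolding sum_distrib_left by (intro sum.cong refl) (simp add: gmu)
  have gf: "g * f = e"
  proof (rule col_eqI[OF Mt_mult[OF gM fM] eM])
    fix w assume w: "w \<in> B"
    have "f * mu w [] = F w" unfolding f_def using sum_mult_mu[OF fB w, of F "[]"] Vid[OF FM] by simp
    then show "g * f * mu w [] = e * mu w []" using gF co w by (simp add: mult.assoc F_def)
  qed
  have ginj: "y = 0" if y: "y \<in> Mt B1 {[]}" "g * y = 0" for y
  proof -
    have "y = (\<Sum>u\<in>B1. \<Sum>w\<in>{[]}. ent y u w \<bullet> mu u w)" by (rule Mt_expand) (use fB1 y in auto)
    also have "... = (\<Sum>i<r. ent y [i] [] \<bullet> mu [i] [])"
      unfolding B1_def by (subst sum.reindex) (auto simp: inj_on_def)
    finally have ye: "y = (\<Sum>i<r. ent y [i] [] \<bullet> mu [i] [])" .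
    then have "(\<Sum>i<r. ent y [i] [] \<bullet> b i) = 0" using gF[of "\<lambda>i. ent y [i] []"] y(2) by simp
    then have "ent y [i] [] = 0" if "i < r" for i using ind[of "\<lambda>i. ent y [i] []"] that by simp
    then show ?thesis using ye by simp
  qed
  have fg: "f * g = idB B1"
  proof (rule col_eqI[OF Mt_mult[OF fM gM] idB_Mt])
    fix w assume w: "w \<in> B1"
    then obtain i where i: "w = [i]" "i < r" by (auto simp: B1_def)
    have id: "idB B1 * mu w [] = (mu w [] :: 'k fmat)" by (rule idB_mult[OF fB1 mu_Mt[of _ _ _ "{[]}"]]) (use w in auto)
    have "g * (f * g * mu w [] - mu w []) = e * (g * mu w []) - g * mu w []"
      using gf by (simp add: right_diff_distrib mult.assoc[symmetric])
    also have "... = 0" using gmu i bV by simp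
    finally have "g * (f * g * mu w [] - mu w []) = 0" .
    moreover have "f * g * mu w [] - mu w [] \<in> Mt B1 {[]}"
      by (intro Mt_diff Mt_mult[OF Mt_mult[OF fM gM] mu_Mt[OF w]] mu_Mt w) auto
    ultimately have "f * g * mu w [] - mu w [] = 0" using ginj by blast
    then show "f * g * mu w [] = idB B1 * mu w []" using id by simp
  qed
  have fe: "f * e = f" using gf fg fM fB1 by (metis idB_mult mult.assoc)
  have eg: "e * g = g" using gf fg gM fB1 by (metis mult_idB mult.assoc)
  define T1 where "T1 = (\<lambda>i. f * (T i * g))"
  have com: "T (Suc j) * e = e * T (Suc j)" if "Suc j < n" for j using hhom_comm[OF e(1) that] .
  have gT: "T (Suc j) * g = g * T1 (Suc j)" if "Suc j < n" for j
  proof -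
    have "g * T1 (Suc j) = e * (T (Suc j) * g)" by (simp add: T1_def gf[symmetric] mult.assoc)
    also have "... = T (Suc j) * (e * g)" using com[OF that] by (simp add: mult.assoc[symmetric])
    finally show ?thesis using eg by simp
  qed
  have fT: "T1 (Suc j) * f = f * T (Suc j)" if "Suc j < n" for j
  proof -
    have "T1 (Suc j) * f = f * (T (Suc j) * e)" by (simp add: T1_def gf[symmetric] mult.assoc)
    also have "... = (f * e) * T (Suc j)" using com[OF that] by (simp add: mult.assoc)
    finally show ?thesis using fe by simp
  qed
  have step: "T1 (Suc j) * (f * x) = f * (T (Suc j) * x)" if "Suc j < n" for j x
    using fT[OF that] by (simp add: mult.assoc[symmetric])
  have T1M: "T1 (Suc j) \<in> Mt B1 B1" if "Suc j < n" for j
    unfolding T1_def using Mt_mult[OF fM Mt_mult[OF hmodD(2)[OF H that] gM]] .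
  have H1: "hmod q n B1 T1"
    unfolding hmod_def
  proof (intro conjI allI impI fB1 T1M)
    fix j assume j: "Suc j < n"
    have "T1 (Suc j) * T1 (Suc j) = f * (T (Suc j) * T (Suc j) * g)"
      using step[OF j, of "T (Suc j) * g"] unfolding T1_def by (simp add: mult.assoc)
    also have "... = (q - 1) \<bullet> T1 (Suc j) + q \<bullet> idB B1"
      using hmodD(3)[OF H j] idB_mult[OF fB gM] fg by (simp add: distrib_left distrib_right T1_def)
    finally show "T1 (Suc j) * T1 (Suc j) = (q - 1) \<bullet> T1 (Suc j) + q \<bullet> idB B1" .
  next
    fix j assume j: "Suc (Suc j) < n"
    then have j': "Suc j < n" by simp
    have "T1 (Suc j) * (T1 (Suc (Suc j)) * T1 (Suc j)) = f * (T (Suc j) * (T (Suc (Suc j)) * T (Suc j)) * g)"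
      using step[OF j, of "T (Suc j) * g"] step[OF j', of "T (Suc (Suc j)) * (T (Suc j) * g)"]
      unfolding T1_def by (simp add: mult.assoc)
    moreover have "T1 (Suc (Suc j)) * (T1 (Suc j) * T1 (Suc (Suc j))) = f * (T (Suc (Suc j)) * (T (Suc j) * T (Suc (Suc j))) * g)"
      using step[OF j', of "T (Suc (Suc j)) * g"] step[OF j, of "T (Suc j) * (T (Suc (Suc j)) * g)"]
      unfolding T1_def by (simp add: mult.assoc)
    ultimately show "T1 (Suc j) * (T1 (Suc (Suc j)) * T1 (Suc j)) = T1 (Suc (Suc j)) * (T1 (Suc j) * T1 (Suc (Suc j)))"
      using hmodD(4)[OF H j] by simp
  next
    fix j k assume "Suc j < k \<and> Suc k < n"
    then have jk: "Suc j < k" "Suc k < n" "Suc j < n" by auto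
    have "T1 (Suc j) * T1 (Suc k) = f * (T (Suc j) * T (Suc k) * g)"
      "T1 (Suc k) * T1 (Suc j) = f * (T (Suc k) * T (Suc j) * g)"
      using step[OF jk(3), of "T (Suc k) * g"] step[OF jk(2), of "T (Suc j) * g"]
      unfolding T1_def by (simp_all add: mult.assoc)
    then show "T1 (Suc j) * T1 (Suc k) = T1 (Suc k) * T1 (Suc j)" using hmodD(5)[OF H jk(1,2)] by simp
  qed
  have fh: "f \<in> hhom n B T B1 T1" and gh: "g \<in> hhom n B1 T1 B T"
    unfolding hhom_def using fM gM fT gT by auto
  have card: "card B1 < card B" if ne: "e \<noteq> idB B"
  proof -
    have "U \<noteq> V"
    proof
      assume UV': "U = V"
      have "e = idB B"
      proof (rule col_eqI[OF eM idB_Mt])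
        fix w assume w: "w \<in> B"
        then have m: "(mu w [] :: 'k fmat) \<in> Mt B {[]}" by (auto intro: mu_Mt)
        then have "mu w [] \<in> U" using UV' V_def by blast
        then show "e * mu w [] = idB B * mu w []" using idB_mult[OF fB m] by (simp add: U_def)
      qed
      then show False using ne by simp
    qed
    then have "fm.dim U < fm.dim V"
      using fm.dim_eq_subspace[OF sU sV(1) sV(2) UV] fm.dim_mono_fdim[OF sU sV(1) sV(2) UV] by linarith
    also have "fm.dim V \<le> card ((\<lambda>w. mu w []) ` B :: 'k fmat set)"
    proof (rule fm.dim_le_card)
      show "V \<subseteq> fm.span ((\<lambda>w. mu w []) ` B)"
      proof
        fix x assume "x \<in> V"
        then have "x = (\<Sum>u\<in>B. \<Sum>w\<in>{[]}. ent x u w \<bullet> mu u w)"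
          by (intro Mt_expand fB) (auto simp: V_def)
        also have "... \<in> fm.span ((\<lambda>w. mu w []) ` B)"
          by (intro fm.span_sum fm.span_scale fm.span_base) auto
        finally show "x \<in> fm.span ((\<lambda>w. mu w []) ` B)" .
      qed
    qed (use fB in simp)
    also have "... \<le> card B" using fB by (rule card_image_le)
    finally show ?thesis using Bs(5) cB1 r_def by simp
  qed
  show thesis using that[OF H1 fh gh gf fg card] .
qed

text \<open>Says that the module is a direct summand of the sum of \<open>a\<close> copies of
  \<open>C\<close>, without forming that sum: \<open>f\<close> and \<open>g\<close> are the
  components of inclusion and projection.\<close>

definition factors :: "'k::field => nat => nat list set => (nat => 'k fmat) => nat => (nat => 'k fmat) => (nat => 'k fmat) => bool"
  where "factors q n B T a f g \<longleftrightarrow>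
    (\<forall>s<a. f s \<in> hhom n B T (CB n) (TC q n) \<and> g s \<in> hhom n (CB n) (TC q n) B T) \<and> (\<Sum>s<a. g s * f s) = idB B"

text \<open>As long as a nontrivial idempotent exists, it and its complement split off smaller
  modules, whose factorizations are concatenated. The maps \<open>i\<close> and \<open>p\<close>
  remember that each piece is still a summand of the original module \<open>B0\<close>, because the
  source condition speaks only of such pieces.\<close>

lemma factors_decompose:
  fixes T :: "nat => 'k::field fmat"
  assumes ind: "\<And>B1 T1 i p. hmod q n B1 T1 ==> B1 \<noteq> {} ==>
      (\<forall>e \<in> hhom n B1 T1 B1 T1. e * e = e --> e = 0 \<or> e = idB B1) ==>
      i \<in> hhom n B1 T1 B0 T0 ==> p \<in> hhom n B0 T0 B1 T1 ==> p * i = idB B1 ==>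
      \<exists>f g. f \<in> hhom n B1 T1 (CB n) (TC q n) \<and> g \<in> hhom n (CB n) (TC q n) B1 T1 \<and> g * f = idB B1"
    and H: "hmod q n B T" and ip: "i \<in> hhom n B T B0 T0" "p \<in> hhom n B0 T0 B T" "p * i = idB B"
  shows "\<exists>a f g. factors q n B T a f g"
  using H ip
proof (induction "card B" arbitrary: B T i p rule: less_induct)
  case less
  note fB = hmodD(1)[OF less.prems(1)]
  show ?case
  proof (cases "B = {}")
    case True
    have "idB {} = (0 :: 'k fmat)" by (rule fmat_eqI) simp
    then show ?thesis using True unfolding factors_def by (intro exI[of _ 0]) simp
  next
    case ne: False
    show ?thesis
    proof (cases "\<forall>e \<in> hhom n B T B T. e * e = e --> e = 0 \<or> e = idB B")
      case True
      obtain f g where "f \<in> hhom n B T (CB n) (TC q n)" "g \<in> hhom n (CB n) (TC q n) B T" "g * f = idB B"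
        using ind[OF less.prems(1) ne True less.prems(2-4)] by blast
      then have "factors q n B T 1 (\<lambda>_. f) (\<lambda>_. g)" by (simp add: factors_def)
      then show ?thesis by blast
    next
      case False
      then obtain e where e: "e \<in> hhom n B T B T" "e * e = e" "e \<noteq> 0" "e \<noteq> idB B" by blast
      have eM: "e \<in> Mt B B" using hhom_Mt[OF e(1)] .
      define e' where "e' = idB B - e"
      have e': "e' \<in> hhom n B T B T" "e' * e' = e'" "e' \<noteq> idB B"
        using fm.subspace_diff[OF subspace_hhom idB_hhom[OF less.prems(1)] e(1)] e eM fB
        by (auto simp: e'_def left_diff_distrib right_diff_distrib)
      have sub: "\<exists>(a::nat) f g. (\<forall>s<a. f s \<in> hhom n B T (CB n) (TC q n) \<and> g s \<in> hhom n (CB n) (TC q n) B T) \<and> (\<Sum>s<a. g s * f s) = x"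
        if x: "x \<in> hhom n B T B T" "x * x = x" "x \<noteq> idB B" for x
      proof -
        obtain B1 T1 f1 g1 where s: "hmod q n B1 T1" "f1 \<in> hhom n B T B1 T1" "g1 \<in> hhom n B1 T1 B T"
          "g1 * f1 = x" "f1 * g1 = idB B1" "card B1 < card B"
          using idempotent_split[OF less.prems(1) x(1,2)] x(3) by metis
        have g1M: "g1 \<in> Mt B B1" using hhom_Mt[OF s(3)] .
        have "f1 * p * (i * g1) = f1 * ((p * i) * g1)" by (simp add: mult.assoc)
        also have "... = idB B1" using less.prems(4) idB_mult[OF fB g1M] s(5) by simp
        finally have pi: "f1 * p * (i * g1) = idB B1" .
        obtain a f g where a: "factors q n B1 T1 a f g"
          using less.hyps[OF s(6,1) hhom_mult[OF s(3) less.prems(2)] hhom_mult[OF less.prems(3) s(2)] pi] by blast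
        have "(\<Sum>t<a. (g1 * g t) * (f t * f1)) = g1 * (\<Sum>t<a. g t * f t) * f1"
          by (simp add: sum_distrib_left sum_distrib_right mult.assoc)
        also have "... = x" using a s(4) mult_idB[OF hmodD(1)[OF s(1)] g1M] by (simp add: factors_def)
        finally have fs: "(\<Sum>t<a. (g1 * g t) * (f t * f1)) = x" . have hs: "\<forall>t<a. f t * f1 \<in> hhom n B T (CB n) (TC q n) \<and> g1 * g t \<in> hhom n (CB n) (TC q n) B T"
          using a s(2,3) hhom_mult unfolding factors_def by blast
        define F where "F = (\<lambda>t. f t * f1)"
        define G where "G = (\<lambda>t. g1 * g t)"
        have "(\<forall>t<a. F t \<in> hhom n B T (CB n) (TC q n) \<and> G t \<in> hhom n (CB n) (TC q n) B T) \<and> (\<Sum>t<a. G t * F t) = x"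
          using hs fs by (simp add: F_def G_def)
        then show ?thesis by blast
      qed
      obtain a :: nat and f g where 1: "\<forall>s<a. f s \<in> hhom n B T (CB n) (TC q n) \<and> g s \<in> hhom n (CB n) (TC q n) B T" "(\<Sum>s<a. g s * f s) = e"
        using sub[OF e(1,2,4)] by blast
      obtain a' :: nat and f' g' where 2: "\<forall>s<a'. f' s \<in> hhom n B T (CB n) (TC q n) \<and> g' s \<in> hhom n (CB n) (TC q n) B T" "(\<Sum>s<a'. g' s * f' s) = e'"
        using sub[OF e'] by blast
      define F where "F = (\<lambda>s. if s < a then f s else f' (s - a))"
      define G where "G = (\<lambda>s. if s < a then g s else g' (s - a))"
      have "(\<Sum>s<a + a'. G s * F s) = (\<Sum>s<a. G s * F s) + (\<Sum>s<a'. G (a + s) * F (a + s))"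
        by (induction a') (simp_all add: add.assoc)
      also have "... = e + e'" using 1(2) 2(2) by (simp add: F_def G_def)
      finally have "(\<Sum>s<a + a'. G s * F s) = idB B" by (simp add: e'_def)
      moreover have "\<forall>s<a + a'. F s \<in> hhom n B T (CB n) (TC q n) \<and> G s \<in> hhom n (CB n) (TC q n) B T"
        using 1(1) 2(1) by (auto simp: F_def G_def)
      ultimately have "factors q n B T (a + a') F G" by (simp add: factors_def)
      then show ?thesis by blast
    qed
  qed
qed

text \<open>The braid relation forces \<open>c\<close> to be constant along each connected run of
  \<open>J\<close>, since its values \<open>q\<close> and \<open>-1\<close> are nonzero. So the
  character is given by a partition of the positions into blocks with one eigenvalue each, which is
  exactly what a sorted word in even and odd letters records.\<close>

lemma par_rep_word:
  assumes "one_dim_par_rep q n J c" "q \<noteq> 0"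
  obtains w0 where "w0 \<in> CB n" "sorted w0"
    "\<And>j. Suc j < n ==> w0 ! j = w0 ! Suc j \<longleftrightarrow> Suc j \<in> J"
    "\<And>j. Suc j \<in> J ==> cc q (w0 ! j) = c (Suc j)"
proof -
  have J: "J \<subseteq> {1..<n}" and c: "\<And>i. i \<in> J ==> c i = -1 \<or> c i = q"
    using assms(1) by (auto simp: one_dim_par_rep_def eq_neg_iff_add_eq_0)
  have adj: "c i = c (Suc i)" if "i \<in> J" "Suc i \<in> J" for i
  proof -
    have "c i * c (Suc i) * c i = c (Suc i) * c i * c (Suc i)"
      using assms(1) that unfolding one_dim_par_rep_def by auto
    then show ?thesis using c[OF that(1)] c[OF that(2)] assms(2) by auto
  qed
  define blk where "blk = (\<lambda>p. card {j \<in> {1..p}. j \<notin> J})"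
  define P where "P = (\<lambda>b. \<exists>j\<in>J. blk j = b \<and> c j \<noteq> q)"
  \<comment> \<open>Twice the block number plus a parity bit: the letter grows strictly from block
    to block whatever the parities are, and \<open>blk p \<le> p\<close> keeps it below
    \<open>2 * n\<close>.\<close>
  define l where "l = (\<lambda>p. 2 * blk p + (if P (blk p) then 1 else 0))"
  have blk_Suc: "blk (Suc p) = (if Suc p \<in> J then blk p else Suc (blk p))" for p
  proof -
    have "{j \<in> {1..Suc p}. j \<notin> J} = (if Suc p \<in> J then {j \<in> {1..p}. j \<notin> J} else insert (Suc p) {j \<in> {1..p}. j \<notin> J})"
      by (auto simp: le_Suc_eq)
    then show ?thesis by (simp add: blk_def)
  qed
  have blk_le: "blk p \<le> p" for p 
  proof (induction p)
    case 0 show ?case by (simp add: blk_def)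
  next
    case (Suc p) then show ?case by (simp add: blk_Suc)
  qed
  have blk_mono: "blk p \<le> blk (p + k)" for p k by (induction k) (auto simp: blk_Suc)
  have same: "c i = c (i + k)" if "i \<in> J" "i + k \<in> J" "blk i = blk (i + k)" for i k
    using that
  proof (induction k)
    case (Suc k)
    have "blk (i + k) \<le> blk (i + Suc k)" using blk_Suc[of "i + k"] by auto
    then have b: "blk i = blk (i + k)" using Suc.prems(3) blk_mono[of i k] by simp
    show ?case
    proof (cases "k = 0")
      case True then show ?thesis using adj Suc.prems by auto
    next
      case False
      have "i + k \<in> J"
      proof (rule ccontr)
        assume n: "i + k \<notin> J"
        have "blk i \<le> blk (i + (k - 1))" using blk_mono by blast
        also have "... < blk (i + k)" using blk_Suc[of "i + (k - 1)"] False n by auto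
        finally show False using b by simp
      qed
      then show ?thesis using Suc.IH[OF Suc.prems(1) _ b] adj[of "i + k"] Suc.prems(2) by auto
    qed
  qed simp
  have same': "c i = c j" if "i \<in> J" "j \<in> J" "blk i = blk j" for i j
  proof (cases "i \<le> j")
    case True
    then obtain k where k: "j = i + k" using le_Suc_ex by blast
    show ?thesis using same[of i k] that unfolding k by simp
  next
    case False
    then obtain k where k: "i = j + k" using le_Suc_ex[of j i] by auto
    show ?thesis using same[of j k] that unfolding k by simp
  qed
  define w0 where "w0 = map l [0..<n]"
  have nth: "w0 ! p = l p" if "p < n" for p using that by (simp add: w0_def)
  have l_Suc: "l p = l (Suc p) \<longleftrightarrow> Suc p \<in> J" "l p \<le> l (Suc p)" for p
    by (auto simp: l_def blk_Suc)
  show thesis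
  proof (rule that[of w0])
    have "l p < 2 * n" if "p < n" for p using blk_le[of p] that by (auto simp: l_def)
    then show "w0 \<in> CB n" by (auto simp: w0_def CB_def hk_words_def)
    show "sorted w0" by (auto simp: sorted_iff_nth_Suc w0_def l_Suc)
    show "w0 ! j = w0 ! Suc j \<longleftrightarrow> Suc j \<in> J" if "Suc j < n" for j using that by (simp add: nth l_Suc)
    show "cc q (w0 ! j) = c (Suc j)" if j: "Suc j \<in> J" for j
    proof -
      have n: "Suc j < n" using J j by auto
      have b: "blk (Suc j) = blk j" using j by (simp add: blk_Suc)
      have "P (blk j) \<longleftrightarrow> c (Suc j) \<noteq> q" unfolding P_def using j b same' by metis
      then show ?thesis using nth[of j] n c[OF j] by (auto simp: l_def cc_def)
    qed
  qed
qed

text \<open>Both modules map to each other: \<open>f\<close> exists by the universal property of the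
  induced module, \<open>g\<close> by \<open>homv\<close> for the word of the character. The
  composite fixes the generator \<open>v\<close>, so the uniqueness part of the universal property
  makes it the identity.\<close>

lemma induced_factors:
  fixes q :: "'k::field"
  assumes q: "q \<noteq> 0" and c: "one_dim_par_rep q n J c" and I: "induced_from q n J c B T v"
  defines "T' \<equiv> \<lambda>i. mk B B (T i)"
  shows "hmod q n B T'"
    and "\<exists>f g. f \<in> hhom n B T' (CB n) (TC q n) \<and> g \<in> hhom n (CB n) (TC q n) B T' \<and> g * f = idB B"
proof -
  have Hm: "hecke_mod q n B T" using I by (simp add: induced_from_def)
  show H: "hmod q n B T'" using Hm hecke_mod_iff T'_def by blast
  note fB = hmodD(1)[OF H]
  have JS: "\<exists>j. i = Suc j \<and> Suc j < n" if "i \<in> J" for i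
    using c that unfolding one_dim_par_rep_def by (cases i) auto
  define vv where "vv = (\<lambda>B m. mk B {[]} (\<lambda>u _. m u) :: 'k fmat)"
  have vvM: "vv B m \<in> Mt B {[]}" for B m by (simp add: vv_def)
  have mv: "mk B' B f * vv B m = vv B' (mvec B f m)" if "finite B" "finite B'" for B B' f m
    unfolding vv_def using that by (simp add: mk_mult mmul_def mvec_def)
  have vv_eq: "vv B m = vv B m' \<longleftrightarrow> (\<forall>u\<in>B. m u = m' u)" if "finite B" for B m m'
    unfolding vv_def using that by (simp add: mk_eq_iff meq_def)
  have vsc: "a \<bullet> vv B m = vv B (\<lambda>u. a * m u)" for a B m unfolding vv_def by (simp add: mk_scale)
  obtain w0 where w0: "w0 \<in> CB n" "sorted w0"
    "\<And>j. Suc j < n ==> w0 ! j = w0 ! Suc j \<longleftrightarrow> Suc j \<in> J"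
    "\<And>j. Suc j \<in> J ==> cc q (w0 ! j) = c (Suc j)"
    using par_rep_word[OF c q] by blast
  have Jv: "T' (Suc j) * vv B v = c (Suc j) \<bullet> vv B v" if "Suc j \<in> J" for j
    using I that unfolding induced_from_def T'_def by (simp add: mv fB vsc vv_eq)
  have ev: "T' (Suc j) * vv B v = cc q (w0 ! j) \<bullet> vv B v" if "Suc j < n" "w0 ! j = w0 ! Suc j" for j
    using Jv[of j] w0(3)[OF that(1)] w0(4)[of j] that(2) by metis
  define g where "g = homv T' n w0 (vv B v)"
  have g: "g \<in> hhom n (CB n) (TC q n) B T'" "g * mu w0 [] = vv B v"
    unfolding g_def using homv(1,2)[OF H w0(1,2) vvM ev] by blast+
  define m where "m = (\<lambda>u. if u = w0 then 1 else 0 :: 'k)"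
  have vm: "vv (CB n) m = mu w0 []"
    by (rule fmat_eqI) (use w0(1) in \<open>auto simp: vv_def m_def\<close>)
  have HC: "hecke_mod q n (CB n) (tst q)" using hmod_TC[of q n] by (simp add: hecke_mod_iff TC_def[abs_def])
  have mC: "\<forall>i\<in>J. \<forall>u\<in>CB n. mvec (CB n) (tst q i) m u = c i * m u"
  proof
    fix i assume i: "i \<in> J"
    then obtain j where j: "i = Suc j" "Suc j < n" using JS by blast
    have "TC q n i * vv (CB n) m = c i \<bullet> vv (CB n) m"
      unfolding vm j(1) using TC_mu[OF w0(1) j(2), of q "[]"] w0(3)[OF j(2)] w0(4)[of j] i j by simp
    then show "\<forall>u\<in>CB n. mvec (CB n) (tst q i) m u = c i * m u"
      unfolding TC_def by (simp add: mv vsc vv_eq)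
  qed
  obtain f0 where f0: "mod_hom n B T (CB n) (tst q) f0" "\<forall>u\<in>CB n. mvec B f0 v u = m u"
    using I HC mC unfolding induced_from_def by blast
  define f where "f = mk (CB n) B f0"
  have f: "f \<in> hhom n B T' (CB n) (TC q n)"
    using f0(1) mod_hom_iff[OF fB finite_CB] unfolding f_def T'_def TC_def[abs_def] by blast
  have fv: "f * vv B v = mu w0 []"
    unfolding f_def mv[OF fB finite_CB] using f0(2) vv_eq[OF finite_CB] vm by metis
  have gf: "g * f \<in> hhom n B T' B T'" using hhom_mult[OF f g(1)] .
  have idh: "idB B \<in> hhom n B T' B T'" using idB_hhom[OF H] .
  have conv: "mod_hom n B T B T (ent x)" if "x \<in> hhom n B T' B T'" for x
    using that mod_hom_iff[OF fB fB, of n T T "ent x"] mk_ent[OF fB fB hhom_Mt[OF that]] unfolding T'_def by simp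
  have val: "\<forall>u\<in>B. mvec B (ent x) v u = v u" if "x \<in> Mt B B" "x * vv B v = vv B v" for x
    using that mv[OF fB fB, of "ent x" v] mk_ent[OF fB fB that(1)] vv_eq[OF fB] by metis
  have v1: "g * f * vv B v = vv B v" using fv g(2) by (simp add: mult.assoc)
  have v2: "idB B * vv B v = vv B v" using idB_mult[OF fB vvM] .
  have uniq: "\<forall>f g. mod_hom n B T B T f \<and> mod_hom n B T B T g
              \<and> (\<forall>u\<in>B. mvec B f v u = v u) \<and> (\<forall>u\<in>B. mvec B g v u = v u) --> meq B B f g"
    using I Hm unfolding induced_from_def by blast
  have "meq B B (ent (g * f)) (ent (idB B))"
    using uniq conv[OF gf] conv[OF idh] val[OF hhom_Mt[OF gf] v1] val[OF idB_Mt v2] by blast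
  then have "g * f = idB B"
    using mk_eq_iff[OF fB fB] mk_ent[OF fB fB hhom_Mt[OF gf]] mk_ent[OF fB fB idB_Mt] by metis
  then show "\<exists>f g. f \<in> hhom n B T' (CB n) (TC q n) \<and> g \<in> hhom n (CB n) (TC q n) B T' \<and> g * f = idB B"
    using f g(1) by blast
qed

lemma source_factors:
  fixes q :: "'k::field"
  assumes q: "q \<noteq> 0" and S: "one_dim_source q d R" and n: "n > 0"
  defines "B0 \<equiv> hk_words n {..<d}"
  defines "T0 \<equiv> \<lambda>i. mk B0 B0 (Rat R i)"
  assumes H: "hmod q n B0 T0"
  shows "\<exists>a f g. factors q n B0 T0 a f g"
proof (rule factors_decompose[OF _ H idB_hhom[OF H] idB_hhom[OF H]])
  have fB0: "finite B0" by (simp add: B0_def)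
  show "idB B0 * idB B0 = (idB B0 :: 'k fmat)" using fB0 by simp
  fix B1 and T1 :: "nat => 'k fmat" and i p
  assume H1: "hmod q n B1 T1" and ne: "B1 \<noteq> {}"
    and ind: "\<forall>e \<in> hhom n B1 T1 B1 T1. e * e = e --> e = 0 \<or> e = idB B1"
    and ip: "i \<in> hhom n B1 T1 B0 T0" "p \<in> hhom n B0 T0 B1 T1" "p * i = idB B1"
  note fB1 = hmodD(1)[OF H1]
  define t1 where "t1 = (\<lambda>i. ent (T1 i))"
  have T1e: "mk B1 B1 (t1 (Suc j)) = T1 (Suc j)" if "Suc j < n" for j
    unfolding t1_def using mk_ent[OF fB1 fB1 hmodD(2)[OF H1 that]] .
  have hm: "hecke_mod q n B1 t1"
    unfolding hecke_mod_iff using H1 hmod_cong[of n "\<lambda>i. mk B1 B1 (t1 i)" T1 q B1] T1e by blast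
  have hh: "hhom n B1 (\<lambda>i. mk B1 B1 (t1 i)) B1 (\<lambda>i. mk B1 B1 (t1 i)) = hhom n B1 T1 B1 T1"
    "hhom n B1 (\<lambda>i. mk B1 B1 (t1 i)) B0 T0 = hhom n B1 T1 B0 T0"
    "hhom n B0 T0 B1 (\<lambda>i. mk B1 B1 (t1 i)) = hhom n B0 T0 B1 T1"
    by (intro hhom_cong T1e refl; assumption)+
  have hh': "hhom n B1 (\<lambda>i. mk B1 B1 (t1 i)) B' T' = hhom n B1 T1 B' T'"
    "hhom n B' T' B1 (\<lambda>i. mk B1 B1 (t1 i)) = hhom n B' T' B1 T1" for B' T'
    by (intro hhom_cong T1e refl; assumption)+
  have indec: "indecomposable n B1 t1"
    unfolding indecomposable_def
  proof (intro conjI ne allI impI)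
    fix e assume "mod_hom n B1 t1 B1 t1 e \<and> meq B1 B1 (mmul B1 e e) e"
    then have e: "mk B1 B1 e \<in> hhom n B1 T1 B1 T1" "mk B1 B1 e * mk B1 B1 e = mk B1 B1 e"
      using mod_hom_iff[OF fB1 fB1] hh(1) mk_mult[OF fB1 fB1 fB1] mk_eq_iff[OF fB1 fB1] by metis+
    have z: "(0 :: 'k fmat) = mk B1 B1 (\<lambda>u w. 0)" by (rule fmat_eqI) (simp add: fB1)
    have "mk B1 B1 e = mk B1 B1 (\<lambda>u w. 0) \<or> mk B1 B1 e = mk B1 B1 idm"
      using ind e z idB_conv by metis
    then show "meq B1 B1 e (\<lambda>u w. 0) \<or> meq B1 B1 e idm" using mk_eq_iff[OF fB1 fB1] by blast
  qed
  have iM: "mk B0 B1 (ent i) = i" "mk B1 B0 (ent p) = p"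
    using mk_ent[OF fB0 fB1 hhom_Mt[OF ip(1)]] mk_ent[OF fB1 fB0 hhom_Mt[OF ip(2)]] by auto
  have "is_summand n B1 t1 B0 (Rat R)"
    unfolding is_summand_def
  proof (rule exI[of _ "ent i"], rule exI[of _ "ent p"], intro conjI)
    show "mod_hom n B1 t1 B0 (Rat R) (ent i)"
      using ip(1) by (simp add: mod_hom_iff[OF fB1 fB0] iM hh'(1) T0_def)
    show "mod_hom n B0 (Rat R) B1 t1 (ent p)"
      using ip(2) by (simp add: mod_hom_iff[OF fB0 fB1] iM hh'(2) T0_def)
    have "mk B1 B1 (mmul B0 (ent p) (ent i)) = mk B1 B1 idm"
      using ip(3) iM mk_mult[OF fB1 fB0 fB1, of "ent p" "ent i"] by (simp add: idB_conv)
    then show "meq B1 B1 (mmul B0 (ent p) (ent i)) idm" using mk_eq_iff[OF fB1 fB1] by blast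
  qed
  then obtain J c B' T' v where ind': "one_dim_par_rep q n J c" "induced_from q n J c B' T' v" "is_summand n B1 t1 B' T'"
    using S n hm indec unfolding one_dim_source_def B0_def by blast
  define S' where "S' = (\<lambda>i. mk B' B' (T' i))"
  have H': "hmod q n B' S'" and ex: "\<exists>f g. f \<in> hhom n B' S' (CB n) (TC q n) \<and> g \<in> hhom n (CB n) (TC q n) B' S' \<and> g * f = idB B'"
    unfolding S'_def using induced_factors[OF q ind'(1,2)] by auto
  note fB' = hmodD(1)[OF H']
  obtain f' g' where fg': "f' \<in> hhom n B' S' (CB n) (TC q n)" "g' \<in> hhom n (CB n) (TC q n) B' S'" "g' * f' = idB B'"
    using ex by blast
  obtain \<phi> \<psi> where s: "mod_hom n B1 t1 B' T' \<phi>" "mod_hom n B' T' B1 t1 \<psi>" "meq B1 B1 (mmul B' \<psi> \<phi>) idm"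
    using ind'(3) unfolding is_summand_def by blast
  have \<phi>: "mk B' B1 \<phi> \<in> hhom n B1 T1 B' S'" using s(1) mod_hom_iff[OF fB1 fB'] hh'(1) S'_def by blast
  have \<psi>: "mk B1 B' \<psi> \<in> hhom n B' S' B1 T1" using s(2) mod_hom_iff[OF fB' fB1] hh'(2) S'_def by blast
  have \<psi>\<phi>: "mk B1 B' \<psi> * mk B' B1 \<phi> = idB B1"
    using s(3) mk_mult[OF fB1 fB' fB1, of \<psi> \<phi>] mk_eq_iff[OF fB1 fB1] idB_conv by metis
  have "(mk B1 B' \<psi> * g') * (f' * mk B' B1 \<phi>) = mk B1 B' \<psi> * ((g' * f') * mk B' B1 \<phi>)" by (simp add: mult.assoc)
  also have "... = idB B1" using fg'(3) \<psi>\<phi> idB_mult[OF fB' mk_Mt, of B1 \<phi>] by simp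
  finally show "\<exists>f g. f \<in> hhom n B1 T1 (CB n) (TC q n) \<and> g \<in> hhom n (CB n) (TC q n) B1 T1 \<and> g * f = idB B1"
    using hhom_mult[OF \<phi> fg'(1)] hhom_mult[OF fg'(2) \<psi>] by blast
qed

section \<open>Adapted bases\<close>

text \<open>In terms of subspaces: the sum of \<open>X 0, ..., X p\<close>, intersected with all
  \<open>X j\<close> for \<open>j > p\<close>, lies in the sum of \<open>X 0, ..., X (p - 1)\<close>
  plus the intersection of all \<open>X j\<close> for \<open>j \<ge> p\<close>. This part of
  distributivity is what the exactness of the Koszul complex uses, and in this elementwise form it
  can be pushed through additive maps.\<close>

definition kcond :: "nat => (nat => 'v::ab_group_add set) => bool"
  where "kcond n X \<longleftrightarrow> (\<forall>p \<phi> x. Suc p < n \<and> (\<forall>j. p < j \<and> Suc j < n --> \<phi> \<in> X j)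
      \<and> (\<forall>j\<le>p. x j \<in> X j) \<and> \<phi> = (\<Sum>j\<le>p. x j) -->
    (\<exists>\<psi> y. \<phi> = \<psi> + (\<Sum>j<p. y j) \<and> (\<forall>j<p. y j \<in> X j) \<and> (\<forall>j. p \<le> j \<and> Suc j < n --> \<psi> \<in> X j)))"

text \<open>Each \<open>X j\<close> is the set of vectors whose coordinates in \<open>Z j\<close>
  vanish, so a decomposition may be made coordinate by coordinate. A coordinate of
  \<open>\<phi>\<close> goes to \<open>y j\<close> for the least \<open>j < p\<close> with
  \<open>w \<notin> Z j\<close>, and to \<open>\<psi>\<close> if there is none.\<close>

lemma adapted_kcond:
  fixes \<kappa> :: "'v::ab_group_add => 'i => 'k::field"
  assumes X: "\<And>j v. Suc j < n ==> v \<in> X j \<longleftrightarrow> v \<in> W \<and> (\<forall>w\<in>I. w \<in> Z j --> \<kappa> v w = 0)"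
    and W: "0 \<in> W" "\<And>u v. u \<in> W ==> v \<in> W ==> u + v \<in> W"
    and add: "\<And>u v w. u \<in> W ==> v \<in> W ==> w \<in> I ==> \<kappa> (u + v) w = \<kappa> u w + \<kappa> v w"
    and inj: "\<And>u v. u \<in> W ==> v \<in> W ==> (\<And>w. w \<in> I ==> \<kappa> u w = \<kappa> v w) ==> u = v"
    and surj: "\<And>c. \<exists>v\<in>W. \<forall>w\<in>I. \<kappa> v w = c w"
  shows "kcond n X"
  unfolding kcond_def
proof (intro allI impI)
  fix p \<phi> x
  assume "Suc p < n \<and> (\<forall>j. p < j \<and> Suc j < n --> \<phi> \<in> X j) \<and> (\<forall>j\<le>p. x j \<in> X j) \<and> \<phi> = (\<Sum>j\<le>p. x j)"
  then have p: "Suc p < n" and \<phi>: "\<And>j. p < j ==> Suc j < n ==> \<phi> \<in> X j"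
    and x: "\<And>j. j \<le> p ==> x j \<in> X j" and \<phi>x: "\<phi> = (\<Sum>j\<le>p. x j)" by auto
  have zero: "\<kappa> 0 w = 0" if "w \<in> I" for w 
  proof -
    have "\<kappa> 0 w = \<kappa> 0 w + \<kappa> 0 w" using add[OF W(1) W(1) that] by (simp only: add_0)
    then show ?thesis by (rule add_cancel_right_right[THEN iffD1])
  qed
  have sums: "(\<Sum>j\<in>J. f j) \<in> W \<and> (\<forall>w\<in>I. \<kappa> (\<Sum>j\<in>J. f j) w = (\<Sum>j\<in>J. \<kappa> (f j) w))"
    if "finite J" "\<And>j. j \<in> J ==> f j \<in> W" for J and f :: "nat => 'v"
    using that by (induction J rule: finite_induct) (auto simp: W zero add)
  have xW: "x j \<in> W" if "j \<le> p" for j using x[OF that] X[of j "x j"] p that by simp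
  have \<phi>W: "\<phi> \<in> W" and \<phi>\<kappa>: "\<And>w. w \<in> I ==> \<kappa> \<phi> w = (\<Sum>j\<le>p. \<kappa> (x j) w)"
    using sums[of "{..p}" x] xW \<phi>x by auto
  have \<phi>0: "\<kappa> \<phi> w = 0" if w: "w \<in> I" "\<And>j. j \<le> p ==> w \<in> Z j" for w
    unfolding \<phi>\<kappa>[OF w(1)] using x X p w by (intro sum.neutral) auto
  obtain \<psi> where \<psi>: "\<psi> \<in> W" "\<And>w. w \<in> I ==> \<kappa> \<psi> w = (if \<forall>j<p. w \<in> Z j then \<kappa> \<phi> w else 0)"
    using surj[of "\<lambda>w. if \<forall>j<p. w \<in> Z j then \<kappa> \<phi> w else 0"] by blast
  define c where "c = (\<lambda>j w. if w \<notin> Z j \<and> (\<forall>i<j. w \<in> Z i) then \<kappa> \<phi> w else 0)"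
  have "\<forall>j. \<exists>v. v \<in> W \<and> (\<forall>w\<in>I. \<kappa> v w = c j w)" using surj by blast
  from choice[OF this] obtain y where y: "\<forall>j. y j \<in> W \<and> (\<forall>w\<in>I. \<kappa> (y j) w = c j w)" by (rule exE)
  have "\<phi> = \<psi> + (\<Sum>j<p. y j)"
  proof (rule inj)
    show "\<phi> \<in> W" by fact
    show "\<psi> + (\<Sum>j<p. y j) \<in> W" using \<psi> sums[of "{..<p}" y] y W by auto
    fix w assume w: "w \<in> I"
    have "\<kappa> (\<psi> + (\<Sum>j<p. y j)) w = \<kappa> \<psi> w + (\<Sum>j<p. c j w)"
      using add[OF \<psi>(1) _ w, of "\<Sum>j<p. y j"] sums[of "{..<p}" y] y w by auto
    also have "... = \<kappa> \<phi> w"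
    proof (cases "\<forall>j<p. w \<in> Z j")
      case True
      then show ?thesis using \<psi>(2)[OF w] by (simp add: c_def)
    next
      case False
      define i where "i = (LEAST i. w \<notin> Z i)"
      have i: "w \<notin> Z i" "\<And>j. j < i ==> w \<in> Z j"
        unfolding i_def using False LeastI[of "\<lambda>i. w \<notin> Z i"] not_less_Least by blast+
      obtain j0 where j0: "j0 < p" "w \<notin> Z j0" using False by blast
      then have "\<not> j0 < i" using i(2) by blast
      then have ip: "i < p" using j0(1) by simp
      have cj: "c j w = (if j = i then \<kappa> \<phi> w else 0)" for j
        unfolding c_def using i by (metis linorder_neqE_nat)
      have "\<kappa> \<psi> w = 0" using \<psi>(2)[OF w] False by (simp only: if_False)
      then show ?thesis using ip by (simp add: cj)
    qed
    finally show "\<kappa> \<phi> w = \<kappa> (\<psi> + (\<Sum>j<p. y j)) w" by simp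
  qed
  moreover have "\<forall>j<p. y j \<in> X j" using y X p by (auto simp: c_def)
  moreover have "\<forall>j. p \<le> j \<and> Suc j < n --> \<psi> \<in> X j"
  proof (intro allI impI)
    fix j assume j: "p \<le> j \<and> Suc j < n"
    have "\<kappa> \<psi> w = 0" if w: "w \<in> I" "w \<in> Z j" for w
    proof (cases "\<forall>j<p. w \<in> Z j")
      case True
      have "\<kappa> \<phi> w = 0"
      proof (cases "j = p")
        case True
        then show ?thesis using \<phi>0[OF w(1)] w(2) \<open>\<forall>j<p. w \<in> Z j\<close> le_neq_implies_less by blast
      next
        case False
        then show ?thesis using \<phi>[of j] X[of j \<phi>] j w by auto
      qed
      then show ?thesis using \<psi>(2)[OF w(1)] by simp
    next
      case False
      then show ?thesis using \<psi>(2)[OF w(1)] by (simp only: if_False)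
    qed
    then show "\<psi> \<in> X j" using X j \<psi>(1) by blast
  qed
  ultimately show "\<exists>\<psi> y. \<phi> = \<psi> + (\<Sum>j<p. y j) \<and> (\<forall>j<p. y j \<in> X j) \<and> (\<forall>j. p \<le> j \<and> Suc j < n --> \<psi> \<in> X j)"
    by blast
qed

lemma list_less_nth:
  fixes v w :: "'a::linorder list"
  assumes "length v = length w" "p < length w" "\<And>k. k < p ==> v ! k = w ! k" "v ! p < w ! p"
  shows "v < w"
proof -
  have "take p v = take p w" using assms by (intro nth_equalityI) auto
  then show ?thesis unfolding list_less_def lexord_take_index_conv using assms by auto
qed

lemma less_sw:
  fixes w :: "'a::linorder list"
  shows "Suc j < length w ==> w ! j < w ! Suc j ==> w < sw j w"
  by (rule list_less_nth[of _ _ j]) (auto simp: nth_sw)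

section \<open>A basis of functions on words adapted to all adjacent swaps\<close>

context
  fixes n :: nat and A :: "'a::linorder set" and bad :: "'a => bool"
  assumes finA: "finite A"
begin

text \<open>What commuting with one Hecke generator amounts to in suitable coordinates, see
  \<open>Phi_comm_iff\<close>: symmetry at the place \<open>j\<close>, with some letters forbidden
  to repeat there.\<close>

definition swinv :: "nat => ('a list => 'k::field) => bool"
  where "swinv j \<alpha> \<longleftrightarrow> (\<forall>w\<in>hk_words n A. \<alpha> (sw j w) = \<alpha> w) \<and>
    (\<forall>w\<in>hk_words n A. w ! j = w ! Suc j \<and> bad (w ! j) --> \<alpha> w = 0)"

text \<open>A repetition counts as a descent when the letter is allowed to repeat, and as an ascent
  otherwise.\<close>

definition Des :: "'a list => nat set"
  where "Des w = {j. Suc j < n \<and> (w ! Suc j < w ! j \<or> w ! j = w ! Suc j \<and> \<not> bad (w ! j))}"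

definition blk :: "'a list => nat => nat"
  where "blk w p = card {k. k < p \<and> k \<notin> Des w}"

definition tagged :: "'a list => 'a list => (nat \<times> 'a) multiset"
  where "tagged w v = mset (map (\<lambda>p. (blk w p, v ! p)) [0..<n])"

text \<open>Indicator function of the words that arise from \<open>w\<close> by permuting letters
  inside its maximal runs of descents; \<open>blk\<close> numbers the runs, and
  \<open>tagged\<close> compares two words run by run as multisets.\<close>

definition orb :: "'a list => 'a list => 'k::field"
  where "orb w v = (if length v = n \<and> tagged w v = tagged w w then 1 else 0)"

lemma blk_Suc: "blk w (Suc p) = (if p \<in> Des w then blk w p else Suc (blk w p))"
proof -
  have "{k. k < Suc p \<and> k \<notin> Des w} = (if p \<in> Des w then {k. k < p \<and> k \<notin> Des w} else insert p {k. k < p \<and> k \<notin> Des w})"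
    by (auto simp: less_Suc_eq)
  then show ?thesis by (simp add: blk_def)
qed

lemma blk_mono: "p \<le> p' ==> blk w p \<le> blk w p'"
  unfolding blk_def by (rule card_mono) auto

lemma blk_eq_descending:
  assumes "p \<le> p'" "blk w p = blk w p'" "p' < n"
  shows "w ! p' \<le> w ! p \<and> (p < p' --> w ! p = w ! p' --> \<not> bad (w ! p))"
  using assms
proof (induction p')
  case (Suc p')
  show ?case
  proof (cases "p = Suc p'")
    case False
    then have le: "p \<le> p'" using Suc.prems by simp
    have b: "blk w p = blk w p'" "blk w p' = blk w (Suc p')"
      using blk_mono[OF le, of w] blk_mono[of p' "Suc p'" w] Suc.prems by auto
    then have D: "p' \<in> Des w" using blk_Suc[of w p'] by (auto split: if_splits)
    then have 1: "w ! Suc p' < w ! p' \<or> w ! p' = w ! Suc p' \<and> \<not> bad (w ! p')" by (simp add: Des_def)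
    have IH: "w ! p' \<le> w ! p \<and> (p < p' --> w ! p = w ! p' --> \<not> bad (w ! p))"
      using Suc.IH[OF le b(1)] Suc.prems by simp
    show ?thesis using 1 IH by auto
  qed simp
qed simp

lemma tagged_count: "size (filter_mset P (tagged w v)) = card {p. p < n \<and> P (blk w p, v ! p)}"
proof -
  have "size (filter_mset P (mset (map f [0..<m]))) = card {p. p < m \<and> P (f p)}" for f :: "nat => nat \<times> 'a" and m
  proof (induction m)
    case (Suc m)
    have "{p. p < Suc m \<and> P (f p)} = (if P (f m) then insert m {p. p < m \<and> P (f p)} else {p. p < m \<and> P (f p)})"
      by (auto simp: less_Suc_eq)
    then show ?case using Suc by simp
  qed simp
  then show ?thesis by (simp add: tagged_def)
qed

text \<open>Inside a run \<open>w\<close> is weakly decreasing, hence \<open>w\<close> is the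
  lexicographically largest word of its orbit. If \<open>v\<close> were larger at the first
  difference \<open>p\<close>, its run would contain more letters \<open>\<ge> v ! p\<close> than
  the same run of \<open>w\<close>.\<close>

lemma orb_le:
  assumes "length w = n" "orb w v \<noteq> (0::'k::field)"
  shows "v \<le> w"
proof (rule ccontr)
  assume nle: "\<not> v \<le> w"
  have v: "length v = n" "tagged w v = tagged w w" using assms by (auto simp: orb_def split: if_splits)
  have "v \<noteq> w" using nle by auto
  then have ex: "\<exists>p. p < n \<and> v ! p \<noteq> w ! p" using assms(1) v(1) by (metis nth_equalityI)
  define p where "p = (LEAST p. p < n \<and> v ! p \<noteq> w ! p)"
  have p: "p < n" "v ! p \<noteq> w ! p" using LeastI_ex[OF ex] by (auto simp: p_def)
  have pk: "v ! k = w ! k" if "k < p" for k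
    using not_less_Least[of k "\<lambda>p. p < n \<and> v ! p \<noteq> w ! p"] that p(1) by (auto simp: p_def)
  have "w ! p < v ! p"
    using nle list_less_nth[of v w p] p pk assms(1) v(1) by (metis linorder_neqE less_imp_le)
  define P where "P = (\<lambda>(b, x). b = blk w p \<and> v ! p \<le> x)"
  have "{k. k < n \<and> P (blk w k, w ! k)} \<subset> {k. k < n \<and> P (blk w k, v ! k)}"
  proof
    show "{k. k < n \<and> P (blk w k, w ! k)} \<subseteq> {k. k < n \<and> P (blk w k, v ! k)}"
    proof
      fix k assume "k \<in> {k. k < n \<and> P (blk w k, w ! k)}"
      then have k: "k < n" "blk w k = blk w p" "v ! p \<le> w ! k" by (auto simp: P_def)
      have "\<not> p \<le> k"
      proof
        assume "p \<le> k"
        then have "w ! k \<le> w ! p" using blk_eq_descending[of p k w] k by simp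
        then show False using k \<open>w ! p < v ! p\<close> by auto
      qed
      then show "k \<in> {k. k < n \<and> P (blk w k, v ! k)}" using k pk[of k] by (auto simp: P_def)
    qed
    have "p \<in> {k. k < n \<and> P (blk w k, v ! k)}" "p \<notin> {k. k < n \<and> P (blk w k, w ! k)}"
      using p \<open>w ! p < v ! p\<close> by (auto simp: P_def)
    then show "{k. k < n \<and> P (blk w k, w ! k)} \<noteq> {k. k < n \<and> P (blk w k, v ! k)}" by blast
  qed
  then have "card {k. k < n \<and> P (blk w k, w ! k)} < card {k. k < n \<and> P (blk w k, v ! k)}"
    by (intro psubset_card_mono) auto
  then show False using tagged_count[of P w w] tagged_count[of P w v] v(2) by simp
qed

lemma orb_words:
  assumes "w \<in> hk_words n A" "orb w v \<noteq> (0::'k::field)"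
  shows "v \<in> hk_words n A"
proof -
  have v: "length v = n" "tagged w v = tagged w w" using assms by (auto simp: orb_def split: if_splits)
  have s: "snd ` set_mset (tagged w x) = set x" if "length x = n" for x
    unfolding tagged_def using that by (auto simp: image_image set_conv_nth)
  have "set v = set w" using s[OF v(1)] s[of w] v(2) assms(1) by (simp add: hk_words_def)
  then show ?thesis using assms(1) v(1) by (simp add: hk_words_def)
qed

text \<open>A swap at a descent of \<open>w\<close> stays inside one run, which gives the symmetry.
  A forbidden letter occurs at most once in a run of \<open>w\<close>, hence at most once in the
  same run of every word of the orbit.\<close>

lemma orb_swinv:
  assumes "w \<in> hk_words n A" "j \<in> Des w"
  shows "swinv j (orb w :: 'a list => 'k::field)"
  unfolding swinv_def
proof (intro conjI ballI impI)
  have j: "Suc j < n" using assms(2) by (simp add: Des_def)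
  fix v assume v: "v \<in> hk_words n A"
  then have len: "length v = n" by (simp add: hk_words_def)
  let ?f = "\<lambda>v. map (\<lambda>p. (blk w p, v ! p)) [0..<n]"
  have "?f (sw j v) = sw j (?f v)"
    by (rule nth_equalityI) (use j len assms(2) in \<open>auto simp: nth_sw blk_Suc\<close>)
  then have "tagged w (sw j v) = tagged w v" unfolding tagged_def using j by simp
  then show "orb w (sw j v) = (orb w v :: 'k)" by (simp add: orb_def)
  assume eq: "v ! j = v ! Suc j \<and> bad (v ! j)"
  show "orb w v = (0::'k)"
  proof (rule ccontr)
    assume "orb w v \<noteq> (0::'k)"
    then have t: "tagged w v = tagged w w" by (auto simp: orb_def split: if_splits)
    define P where "P = (\<lambda>y. y = (blk w j, v ! j))"
    have "{j, Suc j} \<subseteq> {p. p < n \<and> P (blk w p, v ! p)}"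
      using j eq assms(2) by (auto simp: P_def blk_Suc)
    then have "2 \<le> card {p. p < n \<and> P (blk w p, v ! p)}"
      using card_mono[of "{p. p < n \<and> P (blk w p, v ! p)}" "{j, Suc j}"] by simp
    then have c: "2 \<le> card {p. p < n \<and> P (blk w p, w ! p)}"
      using tagged_count[of P w w] tagged_count[of P w v] t by simp
    then have "\<not> card {p. p < n \<and> P (blk w p, w ! p)} \<le> Suc 0" by simp
    then obtain p p' where pp: "p < n" "p' < n" "P (blk w p, w ! p)" "P (blk w p', w ! p')" "p \<noteq> p'"
      using card_le_Suc0_iff_eq[of "{p. p < n \<and> P (blk w p, w ! p)}"] by auto
    have e: "blk w p = blk w p'" "w ! p = w ! p'" "bad (w ! p)" "bad (w ! p')"
      using pp(3,4) eq unfolding P_def by auto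
    show False
    proof (cases "p < p'")
      case True
      then show False using blk_eq_descending[of p p' w] e pp(2) by simp
    next
      case False
      then have "p' < p" using pp(5) by simp
      then show False using blk_eq_descending[of p' p w] e pp(1) by simp
    qed
  qed
qed

lemma orb_self: "length w = n ==> orb w w = (1 :: 'k::field)" by (simp add: orb_def)

lemma swinv_max:
  assumes "swinv j (\<alpha> :: 'a list => 'k::field)" "w \<in> hk_words n A" "\<alpha> w \<noteq> 0" "Suc j < n"
    "\<And>v. v \<in> hk_words n A ==> \<alpha> v \<noteq> 0 ==> v \<le> w"
  shows "j \<in> Des w"
proof (rule ccontr)
  assume "j \<notin> Des w"
  then have "w ! j < w ! Suc j \<or> w ! j = w ! Suc j \<and> bad (w ! j)" using assms(4) by (auto simp: Des_def)
  then show False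
  proof
    assume "w ! j < w ! Suc j"
    then have "w < sw j w" using less_sw[of j w] assms(2,4) by (simp add: hk_words_def)
    moreover have "\<alpha> (sw j w) \<noteq> 0" using assms(1-3) by (simp add: swinv_def)
    ultimately show False using assms(5)[OF sw_words[OF assms(2,4)]] by simp
  next
    assume "w ! j = w ! Suc j \<and> bad (w ! j)"
    then show False using assms(1-3) unfolding swinv_def by blast
  qed
qed

text \<open>Elimination by the largest word \<open>m\<close> of the support. If
  \<open>\<alpha>\<close> is invariant at \<open>j\<close>, then \<open>j\<close> must be a descent
  of \<open>m\<close>: otherwise a swap would produce a larger word of the support, or
  \<open>\<alpha> m\<close> would vanish. So \<open>orb m\<close> is invariant at the same
  \<open>j\<close>, and the remainder inherits every invariance of \<open>\<alpha>\<close>. Thus one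
  basis serves all positions simultaneously.\<close>

lemma adapted_expand:
  fixes \<alpha> :: "'a list => 'k::field"
  assumes "\<And>w. w \<notin> hk_words n A ==> \<alpha> w = 0"
  shows "\<exists>\<kappa>. (\<forall>v. \<alpha> v = (\<Sum>w\<in>hk_words n A. \<kappa> w * orb w v)) \<and>
    (\<forall>j. Suc j < n --> swinv j \<alpha> --> (\<forall>w\<in>hk_words n A. \<kappa> w \<noteq> 0 --> j \<in> Des w))"
  using assms
proof (induction "card {v\<in>hk_words n A. \<exists>w\<in>hk_words n A. \<alpha> w \<noteq> 0 \<and> v \<le> w}" arbitrary: \<alpha> rule: less_induct)
  case less
  let ?W = "hk_words n A"
  have fW: "finite ?W" using finA by simp
  show ?case
  proof (cases "\<exists>w\<in>?W. \<alpha> w \<noteq> 0")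
    case False
    then have "\<alpha> v = 0" for v using less.prems by blast
    then show ?thesis by (intro exI[of _ "\<lambda>_. 0"]) simp
  next
    case True
    define m where "m = Max {w\<in>?W. \<alpha> w \<noteq> 0}"
    have "m \<in> {w\<in>?W. \<alpha> w \<noteq> 0}" unfolding m_def using True fW by (intro Max_in) auto
    then have m: "m \<in> ?W" "\<alpha> m \<noteq> 0" by auto
    have mmax: "v \<le> m" if "v \<in> ?W" "\<alpha> v \<noteq> 0" for v
      unfolding m_def using that fW by (intro Max_ge) auto
    have lm: "length m = n" using m by (simp add: hk_words_def)
    define \<beta> where "\<beta> = (\<lambda>v. \<alpha> v - \<alpha> m * orb m v)"
    have \<beta>0: "\<beta> v = 0" if "v \<notin> ?W" for v
      unfolding \<beta>_def using less.prems[OF that] orb_words[OF m(1), where 'k='k] that by auto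
    have \<beta>m: "v < m" if "v \<in> ?W" "\<beta> v \<noteq> 0" for v
    proof -
      have "\<alpha> v \<noteq> 0 \<or> orb m v \<noteq> (0::'k)" using that by (auto simp: \<beta>_def)
      then have "v \<le> m" using mmax[OF that(1)] orb_le[OF lm] by blast
      moreover have "v \<noteq> m" using that orb_self[OF lm] by (auto simp: \<beta>_def)
      ultimately show ?thesis by simp
    qed
    have "card {v\<in>?W. \<exists>w\<in>?W. \<beta> w \<noteq> 0 \<and> v \<le> w} < card {v\<in>?W. \<exists>w\<in>?W. \<alpha> w \<noteq> 0 \<and> v \<le> w}"
    proof (rule psubset_card_mono)
      show "finite {v\<in>?W. \<exists>w\<in>?W. \<alpha> w \<noteq> 0 \<and> v \<le> w}" using fW by simp
      have "m \<in> {v\<in>?W. \<exists>w\<in>?W. \<alpha> w \<noteq> 0 \<and> v \<le> w}" using m by auto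
      moreover have "m \<notin> {v\<in>?W. \<exists>w\<in>?W. \<beta> w \<noteq> 0 \<and> v \<le> w}" using \<beta>m by force
      moreover have "{v\<in>?W. \<exists>w\<in>?W. \<beta> w \<noteq> 0 \<and> v \<le> w} \<subseteq> {v\<in>?W. \<exists>w\<in>?W. \<alpha> w \<noteq> 0 \<and> v \<le> w}"
      proof safe
        fix x w assume "x \<in> ?W" "w \<in> ?W" "\<beta> w \<noteq> 0" "x \<le> w"
        then have "x \<le> m" using \<beta>m[of w] by auto
        then show "\<exists>w\<in>?W. \<alpha> w \<noteq> 0 \<and> x \<le> w" using m by blast
      qed
      ultimately show "{v\<in>?W. \<exists>w\<in>?W. \<beta> w \<noteq> 0 \<and> v \<le> w} \<subset> {v\<in>?W. \<exists>w\<in>?W. \<alpha> w \<noteq> 0 \<and> v \<le> w}" by blast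
    qed
    from less.hyps[OF this \<beta>0] obtain \<kappa> where \<kappa>: "\<forall>v. \<beta> v = (\<Sum>w\<in>?W. \<kappa> w * orb w v)"
      "\<forall>j. Suc j < n --> swinv j \<beta> --> (\<forall>w\<in>?W. \<kappa> w \<noteq> 0 --> j \<in> Des w)" by blast
    define \<kappa>' where "\<kappa>' = (\<lambda>w. \<kappa> w + (if w = m then \<alpha> m else 0))"
    have split: "(\<Sum>w\<in>?W. \<kappa>' w * orb w v) = (\<Sum>w\<in>?W. \<kappa> w * orb w v) + (\<Sum>w\<in>?W. if w = m then \<alpha> m * orb m v else 0)" for v
      unfolding \<kappa>'_def sum.distrib[symmetric] by (intro sum.cong) (auto simp: algebra_simps)
    have 1: "\<forall>v. \<alpha> v = (\<Sum>w\<in>?W. \<kappa>' w * orb w v)"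
    proof (intro allI)
      fix v
      have "\<alpha> v = \<beta> v + \<alpha> m * orb m v" by (simp add: \<beta>_def)
      then show "\<alpha> v = (\<Sum>w\<in>?W. \<kappa>' w * orb w v)"
        using \<kappa>(1) fW m(1) split[of v] by simp
    qed
    have 2: "j \<in> Des w" if j: "Suc j < n" "swinv j \<alpha>" and w: "w \<in> ?W" "\<kappa>' w \<noteq> 0" for j w
    proof -
      have jm: "j \<in> Des m" using swinv_max[OF j(2) m j(1) mmax] by simp
      have sb: "swinv j \<beta>"
        unfolding swinv_def
      proof (intro conjI ballI impI)
        fix w assume w: "w \<in> ?W"
        show "\<beta> (sw j w) = \<beta> w"
          using j(2) orb_swinv[OF m(1) jm, where 'k='k] w unfolding swinv_def \<beta>_def by simp
        assume "w ! j = w ! Suc j \<and> bad (w ! j)"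
        then have "\<alpha> w = 0" "orb m w = (0::'k)"
          using j(2) orb_swinv[OF m(1) jm, where 'k='k] w unfolding swinv_def by blast+
        then show "\<beta> w = 0" by (simp add: \<beta>_def)
      qed
      show ?thesis
      proof (cases "w = m")
        case False
        then have "\<kappa> w \<noteq> 0" using w(2) by (simp add: \<kappa>'_def)
        then show ?thesis using \<kappa>(2) j(1) sb w(1) by blast
      qed (use jm in simp)
    qed
    show ?thesis using 1 2 by blast
  qed
qed

lemma adapted_unique:
  fixes \<kappa> :: "'a list => 'k::field"
  assumes "\<And>v. v \<in> hk_words n A ==> (\<Sum>w\<in>hk_words n A. \<kappa> w * orb w v) = 0" "w \<in> hk_words n A"
  shows "\<kappa> w = 0"
proof (rule ccontr)
  let ?W = "hk_words n A"
  have fW: "finite ?W" using finA by simp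
  assume "\<kappa> w \<noteq> 0"
  define m where "m = Max {w\<in>?W. \<kappa> w \<noteq> 0}"
  have "m \<in> {w\<in>?W. \<kappa> w \<noteq> 0}" unfolding m_def using \<open>\<kappa> w \<noteq> 0\<close> assms(2) fW by (intro Max_in) auto
  then have m: "m \<in> ?W" "\<kappa> m \<noteq> 0" by auto
  have mmax: "v \<le> m" if "v \<in> ?W" "\<kappa> v \<noteq> 0" for v
    unfolding m_def using that fW by (intro Max_ge) auto
  have "(\<Sum>w\<in>?W. \<kappa> w * orb w m) = (\<Sum>w\<in>?W. if w = m then \<kappa> m else 0)"
  proof (rule sum.cong[OF refl])
    fix w assume w: "w \<in> ?W"
    have lw: "length w = n" using w by (simp add: hk_words_def)
    show "\<kappa> w * orb w m = (if w = m then \<kappa> m else 0)"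
      using mmax[OF w] orb_le[OF lw, of m, where 'k='k] orb_self[OF lw, where 'k='k] by (cases "\<kappa> w = 0"; cases "w = m") auto
  qed
  then show False using assms(1)[OF m(1)] m fW by simp
qed

end

section \<open>Coordinates on the endomorphisms of the standard module\<close>

text \<open>A factor \<open>c / q\<close> for each inversion of the second components among equal
  first components, where \<open>c\<close> is the eigenvalue of the common letter. These are the
  ratios of the coefficients of an eigenvector in \<open>C\<close> (compare
  \<open>eigen_iff\<close>); after rescaling by them, eigenvectors have swap-invariant
  coefficients.\<close>

fun fac :: "'k::field => (nat \<times> nat) list => 'k"
  where "fac q [] = 1"
  | "fac q (p # w) = (cc q (fst p) / q) ^ length (filter (\<lambda>p'. fst p' = fst p \<and> snd p' < snd p) w) * fac q w"

lemma fac_nonzero: "q \<noteq> 0 ==> fac q w \<noteq> 0"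
  by (induction w) (auto simp: cc_nonzero)

lemma fac_sw:
  assumes "Suc j < length w" "fst (w ! j) = fst (w ! Suc j)" "snd (w ! j) < snd (w ! Suc j)"
  shows "fac q (sw j w) = cc q (fst (w ! j)) / q * fac q w"
proof -
  obtain pre x y post where w: "length pre = j" "w = pre @ x # y # post" "w ! j = x" "w ! Suc j = y"
    using sw_split[OF assms(1)] by blast
  have "fst x = fst y" "snd x < snd y" using assms w by auto
  then have "fac q (pre @ y # x # post) = cc q (fst x) / q * fac q (pre @ x # y # post)"
  proof (induction pre)
    case (Cons a pre)
    have "length (filter P (pre @ y # x # post)) = length (filter P (pre @ x # y # post))" for P by simp
    then show ?case using Cons by simp
  qed simp
  then show ?thesis using w by (simp add: sw_append)
qed

text \<open>A word of pairs encodes a position in a square matrix on \<open>CB n\<close>: the first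
  components form the column word, the second ones the row word.\<close>

definition PW :: "nat => (nat \<times> nat) list set" where "PW n = hk_words n ({..<2*n} \<times> {..<2*n})"

lemma finite_PW [simp]: "finite (PW n)" by (simp add: PW_def)

lemma PW_length: "w \<in> PW n ==> length w = n" by (simp add: PW_def hk_words_def)

lemma sw_PW: "w \<in> PW n ==> Suc j < n ==> sw j w \<in> PW n" by (simp add: PW_def sw_words)

lemma PW_fst: "w \<in> PW n ==> map fst w \<in> CB n" and PW_snd: "w \<in> PW n ==> map snd w \<in> CB n"
  by (force simp: PW_def CB_def hk_words_def)+

lemma zip_PW: "u \<in> CB n ==> z \<in> CB n ==> zip u z \<in> PW n"
  by (auto simp: PW_def CB_def hk_words_def dest: set_zip_leftD set_zip_rightD)

context
  fixes q :: "'k::field" and n :: nat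
  assumes q: "q \<noteq> 0"
begin

definition bvec :: "(nat \<times> nat) list => 'k fmat"
  where "bvec w = fac q w \<bullet> mu (map snd w) []"

text \<open>The vectors used as a basis in the column \<open>map fst w\<close>. For a sorted column
  word they are rescaled basis vectors of \<open>C\<close>; for the others they are transported by
  the Hecke generators, in the same way as the columns of a homomorphism are.\<close>

definition hv :: "(nat \<times> nat) list => 'k fmat"
  where "hv = Hf (TC q n) (\<lambda>w. if w \<in> PW n then bvec w else 0)"

definition ca :: "nat \<times> nat => nat \<times> nat => 'k"
  where "ca p p' = (if snd p < snd p' then 0 else if snd p' < snd p then q - 1 else cc q (snd p))"

definition cb :: "nat \<times> nat => nat \<times> nat => 'k"
  where "cb p p' = (if snd p < snd p' then q / cc q (fst p) else if snd p' < snd p then cc q (fst p) else 0)"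

lemma TC_bvec:
  assumes w: "w \<in> PW n" "Suc j < n" "fst (w ! j) = fst (w ! Suc j)"
  shows "TC q n (Suc j) * bvec w = ca (w ! j) (w ! Suc j) \<bullet> bvec w + cb (w ! j) (w ! Suc j) \<bullet> bvec (sw j w)"
proof -
  have len: "length w = n" using PW_length w by blast
  note T = TC_mu[OF PW_snd[OF w(1)] w(2), of q "[]"]
  have ms: "map snd (sw j w) = sw j (map snd w)" using map_sw[of j w] w len by simp
  have nth: "map snd w ! j = snd (w ! j)" "map snd w ! Suc j = snd (w ! Suc j)" using w len by auto
  have c: "cc q x \<noteq> 0" for x using cc_nonzero[OF q] .
  show ?thesis
  proof (cases "snd (w ! j)" "snd (w ! Suc j)" rule: linorder_cases)
    case less
    have "fac q (sw j w) = cc q (fst (w ! j)) / q * fac q w" using fac_sw[of j w q] w len less by simp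
    then show ?thesis using less q c unfolding bvec_def ms by (simp add: T nth ca_def cb_def)
  next
    case equal
    then show ?thesis unfolding bvec_def ms by (simp add: T nth ca_def cb_def mult.commute)
  next
    case greater
    have "fac q w = cc q (fst (w ! j)) / q * fac q (sw j w)"
      using fac_sw[of j "sw j w" q] w len greater by (simp add: nth_sw)
    then have "q * fac q w = cc q (fst (w ! j)) * fac q (sw j w)" using q by simp
    then show ?thesis using greater unfolding bvec_def ms
      by (simp add: T nth ca_def cb_def fm.scale_right_distrib mult.commute add.commute)
  qed
qed

lemma hv_Mt: "w \<in> PW n ==> hv w \<in> Mt (CB n) {[]}"
  unfolding hv_def
  by (rule Hf_in[OF hmod_TC]) (auto simp: PW_length bvec_def PW_snd intro!: Mt_scale mu_Mt)

lemma hv_sorted: "w \<in> PW n ==> sorted (map fst w) ==> hv w = bvec w"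
proof -
  assume w: "w \<in> PW n" "sorted (map fst w)"
  have "\<not> desc i w" for i
  proof
    assume d: "desc i w"
    then show False using w(2) by (auto simp: desc_def sorted_iff_nth_Suc)
  qed
  then show ?thesis unfolding hv_def using w by (simp add: Hf_sorted)
qed

lemma hv_asc: "w \<in> PW n ==> Suc j < n ==> fst (w ! j) < fst (w ! Suc j) ==> hv (sw j w) = TC q n (Suc j) * hv w"
  unfolding hv_def by (rule Hf_asc[OF hmod_TC]) (auto simp: PW_length)

lemma hv_equal:
  assumes "w \<in> PW n" "Suc j < n" "fst (w ! j) = fst (w ! Suc j)"
  shows "TC q n (Suc j) * hv w = ca (w ! j) (w ! Suc j) \<bullet> hv w + cb (w ! j) (w ! Suc j) \<bullet> hv (sw j w)"
  unfolding hv_def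
proof (rule Hf_equal[OF hmod_TC, where P = "\<lambda>M. True"])
  fix w :: "(nat \<times> nat) list" and j
  assume w: "length w = n" "Suc j < n" "fst (w ! j) = fst (w ! Suc j)"
  have "w \<in> PW n \<longleftrightarrow> sw j w \<in> PW n" using w by (simp add: PW_def hk_words_def)
  then show "TC q n (Suc j) * (if w \<in> PW n then bvec w else 0) =
    ca (w ! j) (w ! Suc j) \<bullet> (if w \<in> PW n then bvec w else 0) +
    cb (w ! j) (w ! Suc j) \<bullet> (if sw j w \<in> PW n then bvec (sw j w) else 0)"
    using TC_bvec[OF _ w(2,3)] by simp
qed (use assms PW_length in auto)

definition Wu :: "nat list => (nat \<times> nat) list set" where "Wu u = {w \<in> PW n. map fst w = u}"

lemma finite_Wu [simp]: "finite (Wu u)" by (simp add: Wu_def)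

lemma Wu_sw_bij: "Suc j < n ==> length u = n ==> bij_betw (sw j) (Wu u) (Wu (sw j u))"
proof -
  assume j: "Suc j < n" "length u = n"
  have sub: "sw j ` Wu x \<subseteq> Wu (sw j x)" for x
  proof
    fix v assume "v \<in> sw j ` Wu x"
    then obtain w where w: "v = sw j w" "w \<in> PW n" "map fst w = x" by (auto simp: Wu_def)
    then show "v \<in> Wu (sw j x)" using sw_PW[OF w(2) j(1)] map_sw[of j w fst] PW_length[OF w(2)] j(1) by (simp add: Wu_def)
  qed
  have sw2: "\<forall>w\<in>Wu x. sw j (sw j w) = w" for x
  proof
    fix w assume "w \<in> Wu x"
    then have "length w = n" using PW_length by (simp add: Wu_def)
    then show "sw j (sw j w) = w" using j(1) by simp
  qed
  show ?thesis
    by (rule bij_betw_byWitness[where f' = "sw j", OF sw2 sw2 sub]) (use sub[of "sw j u"] j in simp)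
qed

lemma Wu_sum_sw:
  assumes "Suc j < n" "length u = n"
  shows "(\<Sum>w\<in>Wu (sw j u). f w) = (\<Sum>w\<in>Wu u. f (sw j w))"
  using sum.reindex_bij_betw[OF Wu_sw_bij[OF assms], of f] by simp

text \<open>For sorted \<open>u\<close> the vectors are nonzero multiples of the standard basis. Any
  other column is reached from one with fewer inversions by a generator, which is invertible because
  \<open>q \<noteq> 0\<close>.\<close>

lemma Wu_basis:
  assumes "u \<in> CB n"
  shows "(\<forall>v \<in> Mt (CB n) {[]}. \<exists>\<alpha>. v = (\<Sum>w\<in>Wu u. \<alpha> w \<bullet> hv w)) \<and>
    (\<forall>\<alpha>. (\<Sum>w\<in>Wu u. \<alpha> w \<bullet> hv w) = 0 --> (\<forall>w\<in>Wu u. \<alpha> w = 0))"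
  using assms
proof (induction "ninv u" arbitrary: u rule: less_induct)
  case less
  note len = CB_length[OF less.prems]
  show ?case
  proof (cases "\<exists>j. Suc j < n \<and> u ! Suc j < u ! j")
    case True
    then obtain j where j: "Suc j < n" "u ! Suc j < u ! j" by blast
    let ?u = "sw j u"
    let ?T = "TC q n (Suc j)"
    have swu: "sw j ?u = u" using j len by simp
    have "ninv ?u < ninv u" using inv_sw[of j u] j len by simp
    from less.hyps[OF this sw_CB[OF less.prems j(1)]]
    have IH1: "\<And>v. v \<in> Mt (CB n) {[]} ==> \<exists>\<alpha>. v = (\<Sum>w\<in>Wu ?u. \<alpha> w \<bullet> hv w)"
      and IH2: "\<And>\<alpha>. (\<Sum>w\<in>Wu ?u. \<alpha> w \<bullet> hv w) = 0 ==> (\<forall>w\<in>Wu ?u. \<alpha> w = 0)" by blast+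
    have T: "hv (sw j w) = ?T * hv w" if "w \<in> Wu ?u" for w
    proof (rule hv_asc)
      have w: "w \<in> PW n" "map fst w = ?u" using that by (auto simp: Wu_def)
      then have "fst (w ! j) = ?u ! j" "fst (w ! Suc j) = ?u ! Suc j"
        using j len PW_length[OF w(1)] nth_map[of _ w fst] by (metis Suc_lessD)+
      then show "w \<in> PW n" "fst (w ! j) < fst (w ! Suc j)" using w j len by (auto simp: nth_sw)
    qed (use j in simp)
    have sumT: "(\<Sum>w\<in>Wu u. \<alpha> w \<bullet> hv w) = ?T * (\<Sum>w\<in>Wu ?u. \<alpha> (sw j w) \<bullet> hv w)" for \<alpha>
    proof -
      have "(\<Sum>w\<in>Wu u. \<alpha> w \<bullet> hv w) = (\<Sum>w\<in>Wu ?u. \<alpha> (sw j w) \<bullet> hv (sw j w))"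
        using Wu_sum_sw[of j ?u "\<lambda>w. \<alpha> w \<bullet> hv w"] j len swu by simp
      also have "... = (\<Sum>w\<in>Wu ?u. ?T * (\<alpha> (sw j w) \<bullet> hv w))" using T by simp
      finally show ?thesis by (simp only: sum_distrib_left)
    qed
    define S where "S = inverse q \<bullet> (?T - (q - 1) \<bullet> idB (CB n))"
    have S: "S \<in> Mt (CB n) (CB n)" "S * ?T = idB (CB n)" "?T * S = idB (CB n)"
      unfolding S_def using hmod_inverse[OF hmod_TC q j(1)] by auto
    have invol: "sw j (sw j w) = w" if "w \<in> Wu x" for w x
      using that j(1) PW_length[of w] by (auto simp: Wu_def)
    show ?thesis
    proof (intro conjI ballI allI impI)
      fix v :: "'k fmat" assume v: "v \<in> Mt (CB n) {[]}"
      have "S * v \<in> Mt (CB n) {[]}" using Mt_mult[OF S(1) v] .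
      from IH1[OF this] obtain \<alpha> where \<alpha>: "S * v = (\<Sum>w\<in>Wu ?u. \<alpha> w \<bullet> hv w)" by blast
      have "v = ?T * (S * v)" using S(3) idB_mult[OF finite_CB v] by (simp add: mult.assoc[symmetric])
      also have "... = ?T * (\<Sum>w\<in>Wu ?u. \<alpha> (sw j (sw j w)) \<bullet> hv w)"
        unfolding \<alpha> by (intro arg_cong[of _ _ "(*) ?T"] sum.cong refl) (simp add: invol)
      also have "... = (\<Sum>w\<in>Wu u. \<alpha> (sw j w) \<bullet> hv w)" using sumT[of "\<lambda>w. \<alpha> (sw j w)"] by simp
      finally show "\<exists>\<alpha>. v = (\<Sum>w\<in>Wu u. \<alpha> w \<bullet> hv w)" by (rule exI[of _ "\<lambda>w. \<alpha> (sw j w)"])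
    next
      fix \<alpha> w assume z: "(\<Sum>w\<in>Wu u. \<alpha> w \<bullet> hv w) = 0" and w: "w \<in> Wu u"
      let ?x = "\<Sum>w\<in>Wu ?u. \<alpha> (sw j w) \<bullet> hv w"
      have xM: "?x \<in> Mt (CB n) {[]}" by (intro Mt_sum Mt_scale hv_Mt) (simp add: Wu_def)
      have "S * (?T * ?x) = ?x" using S(2) idB_mult[OF finite_CB xM] by (simp add: mult.assoc[symmetric])
      then have "?x = 0" using z sumT[of \<alpha>] by simp
      then have "\<forall>w\<in>Wu ?u. \<alpha> (sw j w) = 0" by (rule IH2)
      moreover have "sw j w \<in> Wu ?u" using w j len Wu_sw_bij[of j u] bij_betwE by blast
      ultimately show "\<alpha> w = 0" using invol[OF w] by metis
    qed
  next
    case False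
    then have su: "sorted u" using sorted_no_desc[of u] len by (metis not_le)
    have hw: "hv w = fac q w \<bullet> mu (map snd w) []" if "w \<in> Wu u" for w
      using hv_sorted[of w] that su by (simp add: Wu_def bvec_def)
    have bij: "bij_betw (map snd) (Wu u) (CB n)"
    proof (rule bij_betw_byWitness[where f' = "\<lambda>z. zip u z"])
      show "\<forall>w\<in>Wu u. zip u (map snd w) = w" by (auto simp: Wu_def zip_map_fst_snd)
      show "\<forall>z\<in>CB n. map snd (zip u z) = z" using len CB_length by simp
      show "map snd ` Wu u \<subseteq> CB n" using PW_snd by (auto simp: Wu_def)
      show "zip u ` CB n \<subseteq> Wu u" using zip_PW[OF less.prems] len CB_length by (auto simp: Wu_def)
    qed
    have ex: "(\<Sum>w\<in>Wu u. \<alpha> w \<bullet> hv w) = (\<Sum>z\<in>CB n. (\<alpha> (zip u z) * fac q (zip u z)) \<bullet> mu z [])" for \<alpha>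
    proof -
      have "(\<Sum>z\<in>CB n. (\<alpha> (zip u z) * fac q (zip u z)) \<bullet> mu z []) =
        (\<Sum>w\<in>Wu u. (\<alpha> (zip u (map snd w)) * fac q (zip u (map snd w))) \<bullet> mu (map snd w) [])"
        using sum.reindex_bij_betw[OF bij, of "\<lambda>z. (\<alpha> (zip u z) * fac q (zip u z)) \<bullet> mu z []"] by simp
      also have "... = (\<Sum>w\<in>Wu u. \<alpha> w \<bullet> hv w)"
      proof (rule sum.cong[OF refl])
        fix w assume w: "w \<in> Wu u"
        then have "zip u (map snd w) = w" by (auto simp: Wu_def zip_map_fst_snd)
        then show "(\<alpha> (zip u (map snd w)) * fac q (zip u (map snd w))) \<bullet> mu (map snd w) [] = \<alpha> w \<bullet> hv w"
          using hw[OF w] by simp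
      qed
      finally show ?thesis by simp
    qed
    show ?thesis
    proof (intro conjI ballI allI impI)
      fix v :: "'k fmat" assume v: "v \<in> Mt (CB n) {[]}"
      have "v = (\<Sum>z\<in>CB n. \<Sum>w\<in>{[]}. ent v z w \<bullet> mu z w)" by (rule Mt_expand) (use v in auto)
      also have "... = (\<Sum>z\<in>CB n. ent v z [] \<bullet> mu z [])" by simp
      also have "... = (\<Sum>w\<in>Wu u. (ent v (map snd w) [] / fac q w) \<bullet> hv w)"
        unfolding ex using fac_nonzero[OF q] len CB_length by (intro sum.cong refl) simp
      finally show "\<exists>\<alpha>. v = (\<Sum>w\<in>Wu u. \<alpha> w \<bullet> hv w)"
        by (rule exI[of _ "\<lambda>w. ent v (map snd w) [] / fac q w"])
    next
      fix \<alpha> w assume z: "(\<Sum>w\<in>Wu u. \<alpha> w \<bullet> hv w) = 0" and w: "w \<in> Wu u"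
      have zw: "zip u (map snd w) = w" using w by (auto simp: Wu_def zip_map_fst_snd)
      have "ent (\<Sum>z\<in>CB n. (\<alpha> (zip u z) * fac q (zip u z)) \<bullet> mu z [] :: 'k fmat) (map snd w) [] = 0"
        using z ex[of \<alpha>] by simp
      moreover have "map snd w \<in> CB n" using w PW_snd by (simp add: Wu_def)
      ultimately have "\<alpha> (zip u (map snd w)) * fac q (zip u (map snd w)) = 0"
        by (simp add: ent_sum if_distrib cong: if_cong)
      then show "\<alpha> w = 0" using zw fac_nonzero[OF q] by simp
    qed
  qed
qed

definition ebas :: "(nat \<times> nat) list => 'k fmat" where "ebas w = hv w * mu [] (map fst w)"

definition Phi :: "((nat \<times> nat) list => 'k) => 'k fmat" where "Phi \<alpha> = (\<Sum>w\<in>PW n. \<alpha> w \<bullet> ebas w)"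

lemma Phi_Mt: "Phi \<alpha> \<in> Mt (CB n) (CB n)"
  unfolding Phi_def ebas_def by (intro Mt_sum Mt_scale Mt_mult[OF hv_Mt mu_Mt] PW_fst) auto

lemma Phi_col:
  assumes "u \<in> CB n"
  shows "Phi \<alpha> * mu u [] = (\<Sum>w\<in>Wu u. \<alpha> w \<bullet> hv w)"
proof -
  have h: "hv w * mu [] [] = hv w" if "w \<in> PW n" for w
    by (rule fmat_eqI) (use hv_Mt[OF that] in \<open>auto simp: ent_mult_mu Mt_zero\<close>)
  have "Phi \<alpha> * mu u [] = (\<Sum>w\<in>PW n. if map fst w = u then \<alpha> w \<bullet> hv w else 0)"
    unfolding Phi_def ebas_def sum_distrib_right
    by (intro sum.cong refl) (auto simp: mult.assoc mu_mult h)
  also have "... = (\<Sum>w\<in>Wu u. \<alpha> w \<bullet> hv w)"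
    unfolding Wu_def by (subst sum.inter_filter) auto
  finally show ?thesis .
qed

lemma Phi_ex:
  assumes \<phi>: "\<phi> \<in> Mt (CB n) (CB n)"
  shows "\<exists>\<alpha>. (\<forall>w. w \<notin> PW n --> \<alpha> w = 0) \<and> \<phi> = Phi \<alpha>"
proof -
  have "\<forall>u\<in>CB n. \<exists>\<alpha>. \<phi> * mu u [] = (\<Sum>w\<in>Wu u. \<alpha> w \<bullet> hv w)"
  proof
    fix u assume u: "u \<in> CB n"
    have "\<phi> * mu u [] \<in> Mt (CB n) {[]}" by (intro Mt_mult[OF \<phi> mu_Mt[OF u]]) simp
    then show "\<exists>\<alpha>. \<phi> * mu u [] = (\<Sum>w\<in>Wu u. \<alpha> w \<bullet> hv w)" using Wu_basis[OF u] by blast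
  qed
  from bchoice[OF this] obtain a where a: "\<forall>u\<in>CB n. \<phi> * mu u [] = (\<Sum>w\<in>Wu u. a u w \<bullet> hv w)" by (rule exE)
  define \<alpha> where "\<alpha> = (\<lambda>w. if w \<in> PW n then a (map fst w) w else 0)"
  have "\<phi> = Phi \<alpha>"
  proof (rule col_eqI[OF \<phi> Phi_Mt])
    fix u assume u: "u \<in> CB n"
    show "\<phi> * mu u [] = Phi \<alpha> * mu u []"
      unfolding Phi_col[OF u] using a u by (auto simp: \<alpha>_def Wu_def intro!: sum.cong)
  qed
  moreover have "\<forall>w. w \<notin> PW n --> \<alpha> w = 0" by (simp add: \<alpha>_def)
  ultimately show ?thesis by blast
qed

lemma Phi_inj: "Phi \<alpha> = 0 ==> w \<in> PW n ==> \<alpha> w = 0"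
proof -
  assume a: "Phi \<alpha> = 0" "w \<in> PW n"
  have u: "map fst w \<in> CB n" using PW_fst[OF a(2)] .
  have "(\<Sum>v\<in>Wu (map fst w). \<alpha> v \<bullet> hv v) = 0" using Phi_col[OF u, of \<alpha>] a(1) by simp
  then have "\<forall>v\<in>Wu (map fst w). \<alpha> v = 0" using Wu_basis[OF u] by blast
  then show ?thesis using a(2) by (simp add: Wu_def)
qed

lemma Wu_eq_iff:
  assumes "u \<in> CB n"
  shows "(\<Sum>w\<in>Wu u. \<alpha> w \<bullet> hv w) = (\<Sum>w\<in>Wu u. \<beta> w \<bullet> hv w) \<longleftrightarrow> (\<forall>w\<in>Wu u. \<alpha> w = \<beta> w)"
proof
  assume a: "(\<Sum>w\<in>Wu u. \<alpha> w \<bullet> hv w) = (\<Sum>w\<in>Wu u. \<beta> w \<bullet> hv w)"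
  have "(\<Sum>w\<in>Wu u. (\<alpha> w - \<beta> w) \<bullet> hv w) = (\<Sum>w\<in>Wu u. \<alpha> w \<bullet> hv w) - (\<Sum>w\<in>Wu u. \<beta> w \<bullet> hv w)"
    by (simp add: fm.scale_left_diff_distrib sum_subtractf)
  then have z: "(\<Sum>w\<in>Wu u. (\<alpha> w - \<beta> w) \<bullet> hv w) = 0" using a by simp
  have "\<forall>\<gamma>. (\<Sum>w\<in>Wu u. \<gamma> w \<bullet> hv w) = 0 --> (\<forall>w\<in>Wu u. \<gamma> w = 0)" using Wu_basis[OF assms] by (rule conjunct2)
  from this[THEN spec, of "\<lambda>w. \<alpha> w - \<beta> w"] z show "\<forall>w\<in>Wu u. \<alpha> w = \<beta> w" by simp
qed (auto intro: sum.cong)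

lemma Wu_nth: "w \<in> Wu u ==> k < n ==> fst (w ! k) = u ! k"
  by (auto simp: Wu_def PW_length)

lemma col_less:
  assumes u: "u \<in> CB n" "Suc j < n" "u ! j < u ! Suc j"
  shows "Phi \<alpha> * mu (sw j u) [] = TC q n (Suc j) * (Phi \<alpha> * mu u []) \<longleftrightarrow> (\<forall>w\<in>Wu u. \<alpha> (sw j w) = \<alpha> w)"
proof -
  have len: "length u = n" using CB_length[OF u(1)] .
  have su: "sw j u \<in> CB n" using sw_CB[OF u(1,2)] .
  have swu: "sw j (sw j u) = u" using u(2) len by simp
  have sw2: "sw j (sw j w) = w" if "w \<in> Wu x" for w x using that u(2) PW_length[of w n] by (simp add: Wu_def)
  have "TC q n (Suc j) * (Phi \<alpha> * mu u []) = (\<Sum>w\<in>Wu u. \<alpha> w \<bullet> hv (sw j w))"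
    unfolding Phi_col[OF u(1)] sum_distrib_left
  proof (rule sum.cong[OF refl])
    fix w assume w: "w \<in> Wu u"
    then have "hv (sw j w) = TC q n (Suc j) * hv w"
      using hv_asc[of w j] Wu_nth[OF w, of j] Wu_nth[OF w, of "Suc j"] u by (simp add: Wu_def)
    then show "TC q n (Suc j) * (\<alpha> w \<bullet> hv w) = \<alpha> w \<bullet> hv (sw j w)" by simp
  qed
  also have "... = (\<Sum>w\<in>Wu u. (\<lambda>w. \<alpha> (sw j w) \<bullet> hv w) (sw j w))" using sw2 by (intro sum.cong refl) simp
  also have "... = (\<Sum>w\<in>Wu (sw j u). \<alpha> (sw j w) \<bullet> hv w)" using Wu_sum_sw[OF u(2) len, of "\<lambda>w. \<alpha> (sw j w) \<bullet> hv w"] by simp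
  finally have "Phi \<alpha> * mu (sw j u) [] = TC q n (Suc j) * (Phi \<alpha> * mu u []) \<longleftrightarrow> (\<forall>w\<in>Wu (sw j u). \<alpha> w = \<alpha> (sw j w))"
    using Phi_col[OF su] Wu_eq_iff[OF su] by simp
  also have "... \<longleftrightarrow> (\<forall>w\<in>Wu u. \<alpha> (sw j w) = \<alpha> w)"
  proof
    assume a: "\<forall>w\<in>Wu (sw j u). \<alpha> w = \<alpha> (sw j w)"
    show "\<forall>w\<in>Wu u. \<alpha> (sw j w) = \<alpha> w"
    proof
      fix w assume w: "w \<in> Wu u"
      then have "sw j w \<in> Wu (sw j u)" using bij_betwE[OF Wu_sw_bij[OF u(2) len]] by blast
      then show "\<alpha> (sw j w) = \<alpha> w" using a sw2[OF w] by simp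
    qed
  next
    assume a: "\<forall>w\<in>Wu u. \<alpha> (sw j w) = \<alpha> w"
    show "\<forall>w\<in>Wu (sw j u). \<alpha> w = \<alpha> (sw j w)"
    proof
      fix w assume w: "w \<in> Wu (sw j u)"
      then have "sw j w \<in> Wu u" using bij_betwE[OF Wu_sw_bij[OF u(2), of "sw j u"]] len swu by fastforce
      then show "\<alpha> w = \<alpha> (sw j w)" using a sw2[OF w] by fastforce
    qed
  qed
  finally show ?thesis .
qed

definition mism :: "nat \<times> nat => bool" where "mism p \<longleftrightarrow> cc q (fst p) \<noteq> cc q (snd p)"

text \<open>The rescaling in \<open>bvec\<close> turns the eigenvector equation into invariance
  under the swap. If the whole pairs coincide, the generator acts on \<open>hv w\<close> by the
  eigenvalue of the second letter instead of the first, so a mismatch forces the coefficient to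
  vanish.\<close>

lemma col_equal:
  assumes u: "u \<in> CB n" "Suc j < n" "u ! j = u ! Suc j"
  shows "TC q n (Suc j) * (Phi \<alpha> * mu u []) = cc q (u ! j) \<bullet> (Phi \<alpha> * mu u []) \<longleftrightarrow>
    (\<forall>w\<in>Wu u. \<alpha> (sw j w) = \<alpha> w \<and> (w ! j = w ! Suc j \<and> mism (w ! j) --> \<alpha> w = 0))"
proof -
  have len: "length u = n" using CB_length[OF u(1)] .
  have swu: "sw j u = u" using sw_same[of j u] u len by simp
  have sw2: "sw j (sw j w) = w" if "w \<in> Wu u" for w using that u(2) PW_length[of w n] by (simp add: Wu_def)
  have f: "fst (w ! j) = u ! j" "fst (w ! Suc j) = u ! j" if "w \<in> Wu u" for w
    using Wu_nth[OF that, of j] Wu_nth[OF that, of "Suc j"] u by auto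
  let ?a = "\<lambda>w. ca (w ! j) (w ! Suc j)"
  let ?b = "\<lambda>w. cb (w ! j) (w ! Suc j)"
  have "TC q n (Suc j) * (Phi \<alpha> * mu u []) = (\<Sum>w\<in>Wu u. (\<alpha> w * ?a w) \<bullet> hv w + (\<alpha> w * ?b w) \<bullet> hv (sw j w))"
    unfolding Phi_col[OF u(1)] sum_distrib_left
  proof (rule sum.cong[OF refl])
    fix w assume w: "w \<in> Wu u"
    then have "TC q n (Suc j) * hv w = ?a w \<bullet> hv w + ?b w \<bullet> hv (sw j w)"
      using hv_equal[of w j] f[OF w] u by (simp add: Wu_def)
    then show "TC q n (Suc j) * (\<alpha> w \<bullet> hv w) = (\<alpha> w * ?a w) \<bullet> hv w + (\<alpha> w * ?b w) \<bullet> hv (sw j w)"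
      by (simp add: fm.scale_right_distrib)
  qed
  also have "... = (\<Sum>w\<in>Wu u. (\<alpha> w * ?a w) \<bullet> hv w) + (\<Sum>w\<in>Wu u. (\<lambda>w. (\<alpha> (sw j w) * ?b (sw j w)) \<bullet> hv w) (sw j w))"
    unfolding sum.distrib using sw2 by (intro arg_cong2[of _ _ _ _ "(+)"] sum.cong refl) simp
  also have "... = (\<Sum>w\<in>Wu u. (\<alpha> w * ?a w) \<bullet> hv w) + (\<Sum>w\<in>Wu u. (\<alpha> (sw j w) * ?b (sw j w)) \<bullet> hv w)"
    using Wu_sum_sw[OF u(2) len, of "\<lambda>w. (\<alpha> (sw j w) * ?b (sw j w)) \<bullet> hv w"] swu by simp
  also have "... = (\<Sum>w\<in>Wu u. (\<alpha> w * ?a w + \<alpha> (sw j w) * ?b (sw j w)) \<bullet> hv w)"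
    by (simp add: sum.distrib fm.scale_left_distrib)
  finally have "TC q n (Suc j) * (Phi \<alpha> * mu u []) = (\<Sum>w\<in>Wu u. (\<alpha> w * ?a w + \<alpha> (sw j w) * ?b (sw j w)) \<bullet> hv w)" .
  moreover have "cc q (u ! j) \<bullet> (Phi \<alpha> * mu u []) = (\<Sum>w\<in>Wu u. (cc q (u ! j) * \<alpha> w) \<bullet> hv w)"
    unfolding Phi_col[OF u(1)] fm.scale_sum_right by simp
  ultimately have "TC q n (Suc j) * (Phi \<alpha> * mu u []) = cc q (u ! j) \<bullet> (Phi \<alpha> * mu u []) \<longleftrightarrow>
      (\<forall>w\<in>Wu u. \<alpha> w * ?a w + \<alpha> (sw j w) * ?b (sw j w) = cc q (u ! j) * \<alpha> w)"
    using Wu_eq_iff[OF u(1)] by simp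
  also have "... \<longleftrightarrow> (\<forall>w\<in>Wu u. \<alpha> (sw j w) = \<alpha> w \<and> (w ! j = w ! Suc j \<and> mism (w ! j) --> \<alpha> w = 0))"
  proof (rule ball_cong[OF refl])
    fix w assume w: "w \<in> Wu u"
    have lw: "length w = n" using w PW_length by (simp add: Wu_def)
    have sn: "sw j w ! j = w ! Suc j" "sw j w ! Suc j = w ! j" using nth_sw[of j w] u(2) lw by auto
    let ?c = "cc q (u ! j)"
    have c0: "?c \<noteq> 0" using cc_nonzero[OF q] .
    \<comment> \<open>The quadratic relation for the eigenvalue, divided by it.\<close>
    have qc: "q / ?c = ?c - (q - 1)" using cc_square[of q "u ! j"] c0 by (simp add: field_simps)
    note ff = f[OF w]
    show "\<alpha> w * ?a w + \<alpha> (sw j w) * ?b (sw j w) = ?c * \<alpha> w \<longleftrightarrow>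
      \<alpha> (sw j w) = \<alpha> w \<and> (w ! j = w ! Suc j \<and> mism (w ! j) --> \<alpha> w = 0)"
    proof (cases "snd (w ! j)" "snd (w ! Suc j)" rule: linorder_cases)
      case less
      then have "w ! j \<noteq> w ! Suc j" by auto
      then show ?thesis using less ff c0 by (simp add: sn ca_def cb_def mult.commute)
    next
      case equal
      then have e: "w ! j = w ! Suc j" using ff by (simp add: prod_eq_iff)
      then have "sw j w = w" using sw_same[of j w] u(2) lw by simp
      then show ?thesis using equal ff e by (auto simp: ca_def cb_def mism_def mult.commute)
    next
      case greater
      then have ne: "w ! j \<noteq> w ! Suc j" by auto
      have "\<alpha> w * (q - 1) + \<alpha> (sw j w) * (q / ?c) = ?c * \<alpha> w \<longleftrightarrow> (\<alpha> (sw j w) - \<alpha> w) * (q / ?c) = 0"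
        unfolding qc by (auto simp: algebra_simps)
      also have "... \<longleftrightarrow> \<alpha> (sw j w) = \<alpha> w" using q c0 by simp
      finally show ?thesis using greater ff ne by (simp add: sn ca_def cb_def)
    qed
  qed
  finally show ?thesis .
qed

abbreviation swi :: "nat => ((nat \<times> nat) list => 'k) => bool"
  where "swi \<equiv> swinv n ({..<2*n} \<times> {..<2*n}) mism"

abbreviation DesC :: "(nat \<times> nat) list => nat set" where "DesC \<equiv> Des n mism"

abbreviation orbC :: "(nat \<times> nat) list => (nat \<times> nat) list => 'k" where "orbC \<equiv> orb n mism"

text \<open>Commutation is tested on columns. Where \<open>u\<close> ascends at \<open>j\<close>,
  the column of \<open>sw j u\<close> must be the generator applied to the column of
  \<open>u\<close>; where the letters agree, the column must be an eigenvector; where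
  \<open>u\<close> descends, the equation follows from the ascending case and the quadratic
  relation.\<close>

lemma Phi_comm_iff:
  assumes j: "Suc j < n"
  shows "TC q n (Suc j) * Phi \<alpha> = Phi \<alpha> * TC q n (Suc j) \<longleftrightarrow> swi j \<alpha>"
proof -
  let ?T = "TC q n (Suc j)"
  have cols: "?T * Phi \<alpha> = Phi \<alpha> * ?T \<longleftrightarrow> (\<forall>u\<in>CB n. ?T * (Phi \<alpha> * mu u []) = Phi \<alpha> * (?T * mu u []))"
  proof
    assume c: "\<forall>u\<in>CB n. ?T * (Phi \<alpha> * mu u []) = Phi \<alpha> * (?T * mu u [])"
    show "?T * Phi \<alpha> = Phi \<alpha> * ?T"
      by (rule col_eqI[OF Mt_mult[OF TC_Mt Phi_Mt] Mt_mult[OF Phi_Mt TC_Mt]]) (use c in \<open>simp add: mult.assoc\<close>)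
  next
    assume c: "?T * Phi \<alpha> = Phi \<alpha> * ?T"
    show "\<forall>u\<in>CB n. ?T * (Phi \<alpha> * mu u []) = Phi \<alpha> * (?T * mu u [])" using c by (simp add: mult.assoc[symmetric])
  qed
  have swi_iff: "swi j \<alpha> \<longleftrightarrow> (\<forall>u\<in>CB n. \<forall>w\<in>Wu u. \<alpha> (sw j w) = \<alpha> w \<and> (w ! j = w ! Suc j \<and> mism (w ! j) --> \<alpha> w = 0))"
    unfolding swinv_def[OF finite_cartesian_product[OF finite_lessThan finite_lessThan]] PW_def[symmetric] Wu_def using PW_fst by blast
  show ?thesis unfolding cols swi_iff
  proof
    assume c: "\<forall>u\<in>CB n. ?T * (Phi \<alpha> * mu u []) = Phi \<alpha> * (?T * mu u [])"
    show "\<forall>u\<in>CB n. \<forall>w\<in>Wu u. \<alpha> (sw j w) = \<alpha> w \<and> (w ! j = w ! Suc j \<and> mism (w ! j) --> \<alpha> w = 0)"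
    proof (intro ballI)
      fix u w assume u: "u \<in> CB n" and w: "w \<in> Wu u"
      have len: "length u = n" "length w = n" using CB_length[OF u] w PW_length by (auto simp: Wu_def)
      have fw: "fst (w ! j) = u ! j" "fst (w ! Suc j) = u ! Suc j" using Wu_nth[OF w] j by auto
      show "\<alpha> (sw j w) = \<alpha> w \<and> (w ! j = w ! Suc j \<and> mism (w ! j) --> \<alpha> w = 0)"
      proof (cases "u ! j" "u ! Suc j" rule: linorder_cases)
        case less
        have "Phi \<alpha> * mu (sw j u) [] = ?T * (Phi \<alpha> * mu u [])" using c u TC_mu[OF u j, of q "[]"] less by simp
        then show ?thesis using col_less[OF u j less, of \<alpha>] w fw less by auto
      next
        case equal
        have "?T * (Phi \<alpha> * mu u []) = cc q (u ! j) \<bullet> (Phi \<alpha> * mu u [])"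
          using c u TC_mu[OF u j, of q "[]"] equal by simp
        then show ?thesis using col_equal[OF u j equal, of \<alpha>] w by blast
      next
        case greater
        let ?u = "sw j u"
        have su: "?u \<in> CB n" using sw_CB[OF u j] .
        have lt: "?u ! j < ?u ! Suc j" using greater j len by (simp add: nth_sw)
        have "Phi \<alpha> * mu (sw j ?u) [] = ?T * (Phi \<alpha> * mu ?u [])" using c su TC_mu[OF su j, of q "[]"] lt by simp
        then have "\<forall>w\<in>Wu ?u. \<alpha> (sw j w) = \<alpha> w" using col_less[OF su j lt, of \<alpha>] by blast
        moreover have "sw j w \<in> Wu ?u" using bij_betwE[OF Wu_sw_bij[OF j len(1)]] w by blast
        ultimately have "\<alpha> (sw j (sw j w)) = \<alpha> (sw j w)" by blast
        then show ?thesis using greater fw len j by auto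
      qed
    qed
  next
    assume c: "\<forall>u\<in>CB n. \<forall>w\<in>Wu u. \<alpha> (sw j w) = \<alpha> w \<and> (w ! j = w ! Suc j \<and> mism (w ! j) --> \<alpha> w = 0)"
    show "\<forall>u\<in>CB n. ?T * (Phi \<alpha> * mu u []) = Phi \<alpha> * (?T * mu u [])"
    proof
      fix u assume u: "u \<in> CB n"
      have len: "length u = n" using CB_length[OF u] .
      show "?T * (Phi \<alpha> * mu u []) = Phi \<alpha> * (?T * mu u [])"
      proof (cases "u ! j" "u ! Suc j" rule: linorder_cases)
        case less
        have "Phi \<alpha> * mu (sw j u) [] = ?T * (Phi \<alpha> * mu u [])" using col_less[OF u j less, of \<alpha>] c u by blast
        then show ?thesis using TC_mu[OF u j, of q "[]"] less by simp
      next
        case equal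
        have "?T * (Phi \<alpha> * mu u []) = cc q (u ! j) \<bullet> (Phi \<alpha> * mu u [])" using col_equal[OF u j equal, of \<alpha>] c u by blast
        then show ?thesis using TC_mu[OF u j, of q "[]"] equal by simp
      next
        case greater
        let ?u = "sw j u"
        have su: "?u \<in> CB n" using sw_CB[OF u j] .
        have lt: "?u ! j < ?u ! Suc j" using greater j len by (simp add: nth_sw)
        have "Phi \<alpha> * mu (sw j ?u) [] = ?T * (Phi \<alpha> * mu ?u [])" using col_less[OF su j lt, of \<alpha>] c su by blast
        then have e: "Phi \<alpha> * mu u [] = ?T * (Phi \<alpha> * mu ?u [])" using j len by simp
        have M: "Phi \<alpha> * mu ?u [] \<in> Mt (CB n) {[]}" by (rule Mt_mult[OF Phi_Mt mu_Mt[OF su]]) simp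
        have "?T * (?T * (Phi \<alpha> * mu ?u [])) = (?T * ?T) * (Phi \<alpha> * mu ?u [])" by (simp add: mult.assoc)
        also have "... = (q - 1) \<bullet> (?T * (Phi \<alpha> * mu ?u [])) + q \<bullet> (Phi \<alpha> * mu ?u [])"
          unfolding hmodD(3)[OF hmod_TC j] using idB_mult[OF finite_CB M] by (simp add: distrib_right)
        finally show ?thesis using TC_mu[OF u j, of q "[]"] greater e by (simp add: distrib_left)
      qed
    qed
  qed
qed

end

section \<open>Commuting maps, commutators and their orthogonality\<close>

definition commX :: "nat list set => (nat => 'k::field fmat) => nat list set => (nat => 'k fmat) => nat => 'k fmat set"
  where "commX B T B' T' j = {f \<in> Mt B' B. T' (Suc j) * f = f * T (Suc j)}"

definition commY :: "nat list set => (nat => 'k::field fmat) => nat list set => (nat => 'k fmat) => nat => 'k fmat set"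
  where "commY B T B' T' j = {T' (Suc j) * f - f * T (Suc j) | f. f \<in> Mt B' B}"

lemma subspace_commY: "fm.subspace (commY B T B' T' j)"
  unfolding fm.subspace_def
proof (intro conjI ballI allI)
  show "0 \<in> commY B T B' T' j" unfolding commY_def by (intro CollectI exI[of _ 0]) simp
  fix x y c assume "x \<in> commY B T B' T' j" "y \<in> commY B T B' T' j"
  then obtain f g where fg: "x = T' (Suc j) * f - f * T (Suc j)" "f \<in> Mt B' B"
    "y = T' (Suc j) * g - g * T (Suc j)" "g \<in> Mt B' B" by (auto simp: commY_def)
  have "x + y = T' (Suc j) * (f + g) - (f + g) * T (Suc j)"
    unfolding fg(1,3) by (simp add: algebra_simps)
  then show "x + y \<in> commY B T B' T' j" unfolding commY_def using Mt_add[OF fg(2,4)] by blast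
  have "c \<bullet> x = T' (Suc j) * (c \<bullet> f) - (c \<bullet> f) * T (Suc j)"
    unfolding fg(1) by (simp add: fm.scale_right_diff_distrib)
  then show "c \<bullet> x \<in> commY B T B' T' j" unfolding commY_def using Mt_scale[OF fg(2)] by blast
qed

lemma subspace_commX: "fm.subspace (commX B T B' T' j)"
  unfolding fm.subspace_def commX_def by (auto simp: distrib_left distrib_right intro: Mt_add Mt_scale)

lemma tr_commutator:
  assumes fin: "finite B" "finite B'" and T: "T \<in> Mt B B" "T' \<in> Mt B' B'" and f: "f \<in> Mt B' B" and g: "g \<in> Mt B B'"
  shows "tr B' ((T' * f - f * T) * g) = tr B' (f * (g * T' - T * g))"
proof -
  have "tr B' (T' * (f * g)) = tr B' ((f * g) * T')" by (rule tr_commute[OF fin(2,2) T(2) Mt_mult[OF f g]])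
  then show ?thesis by (simp add: left_diff_distrib right_diff_distrib tr_diff mult.assoc)
qed

text \<open>Taking the commutator is, up to sign, adjoint under the trace form to taking the
  commutator in the opposite direction. The image of the one is therefore the annihilator of the
  kernel of the other.\<close>

lemma commY_iff_orthogonal:
  fixes T :: "nat => 'k::field fmat"
  assumes fin: "finite B" "finite B'" and T: "T (Suc j) \<in> Mt B B" "T' (Suc j) \<in> Mt B' B'" and y: "y \<in> Mt B' B"
  shows "y \<in> commY B T B' T' j \<longleftrightarrow> (\<forall>x\<in>commX B' T' B T j. tr B' (y * x) = 0)"
proof
  assume "y \<in> commY B T B' T' j"
  then obtain f where f: "y = T' (Suc j) * f - f * T (Suc j)" "f \<in> Mt B' B" by (auto simp: commY_def)
  show "\<forall>x\<in>commX B' T' B T j. tr B' (y * x) = 0"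
  proof
    fix x assume "x \<in> commX B' T' B T j"
    then have x: "x \<in> Mt B B'" "T (Suc j) * x = x * T' (Suc j)" by (auto simp: commX_def)
    show "tr B' (y * x) = 0" unfolding f(1) tr_commutator[OF fin T f(2) x(1)] by (simp add: x(2) tr_def)
  qed
next
  assume o: "\<forall>x\<in>commX B' T' B T j. tr B' (y * x) = 0"
  show "y \<in> commY B T B' T' j"
  proof (rule ccontr)
    assume "y \<notin> commY B T B' T' j"
    then obtain g where g: "g \<in> Mt B B'" "\<And>u. u \<in> commY B T B' T' j \<inter> Mt B' B ==> tr B' (u * g) = 0" "tr B' (y * g) = 1"
      using trace_functional[OF fin(2,1) subspace_commY y] by metis
    have z: "tr B' (f * (g * T' (Suc j) - T (Suc j) * g)) = 0" if f: "f \<in> Mt B' B" for f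
    proof -
      have "T' (Suc j) * f - f * T (Suc j) \<in> commY B T B' T' j \<inter> Mt B' B"
        using f Mt_diff[OF Mt_mult[OF T(2) f] Mt_mult[OF f T(1)]] by (auto simp: commY_def)
      then show ?thesis using g(2) tr_commutator[OF fin T f g(1)] by simp
    qed
    have M: "g * T' (Suc j) - T (Suc j) * g \<in> Mt B B'"
      using Mt_diff[OF Mt_mult[OF g(1) T(2)] Mt_mult[OF T(1) g(1)]] .
    have "g * T' (Suc j) - T (Suc j) * g = 0"
    proof (rule trace_nondegenerate[OF fin(1) M])
      fix f :: "'k fmat" assume f: "f \<in> Mt B' B"
      show "tr B ((g * T' (Suc j) - T (Suc j) * g) * f) = 0" using z[OF f] tr_commute[OF fin(2,1) f M] by simp
    qed
    then have "g \<in> commX B' T' B T j" using g(1) by (simp add: commX_def)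
    then show False using o g(3) by simp
  qed
qed

context
  fixes q :: "'k::field" and n :: nat
  assumes q: "q \<noteq> 0"
begin

abbreviation (input) "PA \<equiv> {..<2*n} \<times> {..<2*n}"

lemma finPA: "finite PA" by simp

definition bb :: "(nat \<times> nat) list => 'k fmat" where "bb w = Phi q n (orb n (mism q) w)"

lemma Phi_lin: "Phi q n (\<lambda>v. \<Sum>w\<in>I. \<kappa> w * \<beta> w v) = (\<Sum>w\<in>I. \<kappa> w \<bullet> Phi q n (\<beta> w))"
  unfolding Phi_def[OF q] fm.scale_sum_left fm.scale_sum_right
  by (subst sum.swap) simp

lemma bb_Mt: "bb w \<in> Mt (CB n) (CB n)" unfolding bb_def using Phi_Mt[OF q] .

lemma bb_ex:
  assumes "\<phi> \<in> Mt (CB n) (CB n)"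
  shows "\<exists>\<kappa>. \<phi> = (\<Sum>w\<in>PW n. \<kappa> w \<bullet> bb w) \<and>
    (\<forall>j. Suc j < n --> TC q n (Suc j) * \<phi> = \<phi> * TC q n (Suc j) --> (\<forall>w\<in>PW n. \<kappa> w \<noteq> 0 --> j \<in> Des n (mism q) w))"
proof -
  obtain \<alpha> where \<alpha>: "\<And>w. w \<notin> PW n ==> \<alpha> w = 0" "\<phi> = Phi q n \<alpha>" using Phi_ex[OF q assms] by blast
  have \<alpha>0: "\<And>w. w \<notin> hk_words n PA ==> \<alpha> w = 0" using \<alpha>(1) by (simp add: PW_def)
  obtain \<kappa> where \<kappa>: "\<forall>v. \<alpha> v = (\<Sum>w\<in>hk_words n PA. \<kappa> w * orb n (mism q) w v)"
    "\<forall>j. Suc j < n --> swinv n PA (mism q) j \<alpha> --> (\<forall>w\<in>hk_words n PA. \<kappa> w \<noteq> 0 --> j \<in> Des n (mism q) w)"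
    using adapted_expand[OF finPA, where n = n and \<alpha> = \<alpha> and bad = "mism q", OF \<alpha>0] by blast
  have "\<alpha> = (\<lambda>v. \<Sum>w\<in>PW n. \<kappa> w * orb n (mism q) w v)" using \<kappa>(1) by (auto simp: PW_def)
  then have "\<phi> = (\<Sum>w\<in>PW n. \<kappa> w \<bullet> bb w)" unfolding \<alpha>(2) bb_def Phi_lin[symmetric] by simp
  moreover have "\<forall>j. Suc j < n --> TC q n (Suc j) * \<phi> = \<phi> * TC q n (Suc j) --> (\<forall>w\<in>PW n. \<kappa> w \<noteq> 0 --> j \<in> Des n (mism q) w)"
    unfolding \<alpha>(2) using Phi_comm_iff[OF q] \<kappa>(2) by (simp add: PW_def)
  ultimately show ?thesis by blast
qed

lemma bb_unique:
  assumes "(\<Sum>w\<in>PW n. \<kappa> w \<bullet> bb w) = 0" "w \<in> PW n"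
  shows "\<kappa> w = 0"
proof -
  have "Phi q n (\<lambda>v. \<Sum>w\<in>PW n. \<kappa> w * orb n (mism q) w v) = 0"
    unfolding Phi_lin using assms(1) by (simp add: bb_def)
  then have "(\<Sum>w\<in>hk_words n PA. \<kappa> w * orb n (mism q) w v) = 0" if "v \<in> hk_words n PA" for v
    using Phi_inj[OF q, of n "\<lambda>v. \<Sum>w\<in>PW n. \<kappa> w * orb n (mism q) w v" v] that by (simp add: PW_def)
  from adapted_unique[OF finPA this] show ?thesis using assms(2) by (simp add: PW_def)
qed

lemma bb_comm: "w \<in> PW n ==> j \<in> Des n (mism q) w ==> TC q n (Suc j) * bb w = bb w * TC q n (Suc j)"
proof -
  assume w: "w \<in> PW n" "j \<in> Des n (mism q) w"
  have j: "Suc j < n" using w(2) by (simp add: Des_def[OF finPA])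
  have "swinv n PA (mism q) j (orb n (mism q) w :: _ => 'k)"
    using orb_swinv[OF finPA, where w = w and n = n and j = j and bad = "mism q" and 'k = 'k] w by (simp add: PW_def)
  then show ?thesis unfolding bb_def using Phi_comm_iff[OF q j] by blast
qed

definition kap :: "'k fmat => (nat \<times> nat) list => 'k" where "kap \<phi> = (SOME \<kappa>. \<phi> = (\<Sum>w\<in>PW n. \<kappa> w \<bullet> bb w))"

lemma kap: "\<phi> \<in> Mt (CB n) (CB n) ==> \<phi> = (\<Sum>w\<in>PW n. kap \<phi> w \<bullet> bb w)"
proof -
  assume "\<phi> \<in> Mt (CB n) (CB n)"
  then have "\<exists>\<kappa>. \<phi> = (\<Sum>w\<in>PW n. \<kappa> w \<bullet> bb w)" using bb_ex by blast
  from someI_ex[OF this] show ?thesis unfolding kap_def .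
qed

lemma bb_sum_Mt: "(\<Sum>w\<in>PW n. \<kappa> w \<bullet> bb w) \<in> Mt (CB n) (CB n)"
  by (intro Mt_sum Mt_scale bb_Mt)

lemma kap_eq: "w \<in> PW n ==> kap (\<Sum>w\<in>PW n. \<kappa> w \<bullet> bb w) w = \<kappa> w"
proof -
  assume w: "w \<in> PW n"
  let ?\<phi> = "\<Sum>w\<in>PW n. \<kappa> w \<bullet> bb w"
  have "(\<Sum>w\<in>PW n. (kap ?\<phi> w - \<kappa> w) \<bullet> bb w) = (\<Sum>w\<in>PW n. kap ?\<phi> w \<bullet> bb w) - ?\<phi>"
    by (simp add: fm.scale_left_diff_distrib sum_subtractf)
  also have "... = 0" using kap[OF bb_sum_Mt[of \<kappa>]] by simp
  finally have "(\<Sum>w\<in>PW n. (kap ?\<phi> w - \<kappa> w) \<bullet> bb w) = 0" .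
  from bb_unique[OF this w] show ?thesis by simp
qed

lemma commX_kap:
  assumes "Suc j < n"
  shows "\<phi> \<in> commX (CB n) (TC q n) (CB n) (TC q n) j \<longleftrightarrow>
    \<phi> \<in> Mt (CB n) (CB n) \<and> (\<forall>w\<in>PW n. w \<in> {w. j \<notin> Des n (mism q) w} --> kap \<phi> w = 0)"
proof
  assume \<phi>: "\<phi> \<in> commX (CB n) (TC q n) (CB n) (TC q n) j"
  then have M: "\<phi> \<in> Mt (CB n) (CB n)" by (simp add: commX_def)
  obtain \<kappa> where \<kappa>: "\<phi> = (\<Sum>w\<in>PW n. \<kappa> w \<bullet> bb w)" "\<forall>w\<in>PW n. \<kappa> w \<noteq> 0 --> j \<in> Des n (mism q) w"
    using bb_ex[OF M] \<phi> assms by (auto simp: commX_def)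
  show "\<phi> \<in> Mt (CB n) (CB n) \<and> (\<forall>w\<in>PW n. w \<in> {w. j \<notin> Des n (mism q) w} --> kap \<phi> w = 0)"
    using M \<kappa>(2) kap_eq[of _ \<kappa>] unfolding \<kappa>(1) by auto
next
  assume a: "\<phi> \<in> Mt (CB n) (CB n) \<and> (\<forall>w\<in>PW n. w \<in> {w. j \<notin> Des n (mism q) w} --> kap \<phi> w = 0)"
  let ?X = "commX (CB n) (TC q n) (CB n) (TC q n) j"
  have "\<phi> = (\<Sum>w\<in>PW n. kap \<phi> w \<bullet> bb w)" using kap a by blast
  also have "... \<in> ?X"
  proof (rule fm.subspace_sum[OF subspace_commX])
    fix w assume w: "w \<in> PW n"
    show "kap \<phi> w \<bullet> bb w \<in> ?X"
    proof (cases "j \<in> Des n (mism q) w")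
      case True
      then have "bb w \<in> ?X" using bb_comm[OF w] bb_Mt by (simp add: commX_def)
      then show ?thesis by (rule fm.subspace_scale[OF subspace_commX])
    next
      case False
      then have "kap \<phi> w = 0" using a w by auto
      then show ?thesis using fm.subspace_0[OF subspace_commX] by simp
    qed
  qed
  finally show "\<phi> \<in> ?X" .
qed

lemma kcond_commX_std: "kcond n (commX (CB n) (TC q n) (CB n) (TC q n))"
proof (rule adapted_kcond[where \<kappa> = kap and W = "Mt (CB n) (CB n)" and I = "PW n" and Z = "\<lambda>j. {w. j \<notin> Des n (mism q) w}"])
  show "\<And>j v. Suc j < n ==> (v \<in> commX (CB n) (TC q n) (CB n) (TC q n) j) =
    (v \<in> Mt (CB n) (CB n) \<and> (\<forall>w\<in>PW n. w \<in> {w. j \<notin> Des n (mism q) w} --> kap v w = 0))" by (rule commX_kap)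
  fix u v :: "'k fmat" and w assume uv: "u \<in> Mt (CB n) (CB n)" "v \<in> Mt (CB n) (CB n)"
  then show "u + v \<in> Mt (CB n) (CB n)" by (rule Mt_add)
  have "u + v = (\<Sum>w\<in>PW n. (kap u w + kap v w) \<bullet> bb w)"
    using kap[OF uv(1)] kap[OF uv(2)] by (simp add: fm.scale_left_distrib sum.distrib)
  then show "w \<in> PW n ==> kap (u + v) w = kap u w + kap v w" using kap_eq[of w "\<lambda>w. kap u w + kap v w"] by simp
next
  fix u v :: "'k fmat" assume uv: "u \<in> Mt (CB n) (CB n)" "v \<in> Mt (CB n) (CB n)" "\<And>w. w \<in> PW n ==> kap u w = kap v w"
  have "u = (\<Sum>w\<in>PW n. kap u w \<bullet> bb w)" using kap[OF uv(1)] .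
  also have "... = (\<Sum>w\<in>PW n. kap v w \<bullet> bb w)" using uv(3) by (intro sum.cong) auto
  finally show "u = v" using kap[OF uv(2)] by simp
next
  fix c show "\<exists>v\<in>Mt (CB n) (CB n). \<forall>w\<in>PW n. kap v w = c w" using bb_sum_Mt[of c] kap_eq[of _ c] by blast
qed simp

lemma bb_dual:
  assumes w: "w \<in> PW n"
  shows "\<exists>y\<in>Mt (CB n) (CB n). \<forall>v\<in>PW n. tr (CB n) (y * bb v) = (if v = w then 1 else 0)"
proof -
  define U where "U = fm.span (bb ` (PW n - {w}))"
  have "bb w \<notin> U"
  proof
    assume "bb w \<in> U"
    define c where "c = (\<lambda>x. x \<in> U --> (\<exists>\<kappa>. x = (\<Sum>v\<in>PW n. \<kappa> v \<bullet> bb v) \<and> \<kappa> w = 0))"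
    have "\<exists>\<kappa>. x = (\<Sum>v\<in>PW n. \<kappa> v \<bullet> bb v) \<and> \<kappa> w = 0" if "x \<in> U" for x
      using that unfolding U_def
    proof (induct rule: fm.span_induct_alt)
      case base then show ?case by (rule exI[of _ "\<lambda>_. 0"]) simp
    next
      case (step a x y)
      then obtain v \<kappa> where v: "x = bb v" "v \<in> PW n" "v \<noteq> w" and \<kappa>: "y = (\<Sum>v\<in>PW n. \<kappa> v \<bullet> bb v)" "\<kappa> w = 0" by auto
      have "a \<bullet> x = (\<Sum>u\<in>PW n. (if u = v then a else 0) \<bullet> bb u)"
        using v by (simp add: if_distrib[of "\<lambda>a. a \<bullet> _"] cong: if_cong)
      then have "a \<bullet> x + y = (\<Sum>u\<in>PW n. ((if u = v then a else 0) + \<kappa> u) \<bullet> bb u)"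
        using \<kappa>(1) by (simp add: fm.scale_left_distrib sum.distrib)
      then show ?case using \<kappa>(2) v(3) by (intro exI[of _ "\<lambda>u. (if u = v then a else 0) + \<kappa> u"]) simp
    qed
    then obtain \<kappa> where \<kappa>: "bb w = (\<Sum>v\<in>PW n. \<kappa> v \<bullet> bb v)" "\<kappa> w = 0" using \<open>bb w \<in> U\<close> by blast
    have "bb w = (\<Sum>u\<in>PW n. (if u = w then 1 else 0) \<bullet> bb u)"
      using w by (simp add: if_distrib[of "\<lambda>a. a \<bullet> _"] cong: if_cong)
    then have "(\<Sum>u\<in>PW n. ((if u = w then 1 else 0) - \<kappa> u) \<bullet> bb u) = 0"
      using \<kappa>(1) by (simp add: fm.scale_left_diff_distrib sum_subtractf)
    from bb_unique[OF this w] show False using \<kappa>(2) by simp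
  qed
  then obtain g where g: "g \<in> Mt (CB n) (CB n)" "\<And>u. u \<in> U \<inter> Mt (CB n) (CB n) ==> tr (CB n) (u * g) = 0" "tr (CB n) (bb w * g) = 1"
    using trace_functional[OF finite_CB finite_CB fm.subspace_span bb_Mt] unfolding U_def by metis
  have "tr (CB n) (g * bb v) = (if v = w then 1 else 0)" if v: "v \<in> PW n" for v
  proof -
    have "tr (CB n) (g * bb v) = tr (CB n) (bb v * g)" by (rule tr_commute[OF finite_CB finite_CB g(1) bb_Mt])
    moreover have "bb v \<in> U" if "v \<noteq> w" using v that unfolding U_def by (intro fm.span_base) auto
    ultimately show ?thesis using g(2)[of "bb v"] g(3) bb_Mt by auto
  qed
  then show ?thesis using g(1) by blast
qed

text \<open>The coordinates are those of the basis dual to \<open>bb\<close> under the trace form.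
  The commutators with the generator at \<open>j\<close> annihilate precisely the span of the
  \<open>bb w\<close> with \<open>j\<close> in the descent set, so they form a coordinate subspace
  with the complementary index set.\<close>

lemma kcond_commY_std: "kcond n (commY (CB n) (TC q n) (CB n) (TC q n))"
proof (rule adapted_kcond[where \<kappa> = "\<lambda>y w. tr (CB n) (y * bb w)" and W = "Mt (CB n) (CB n)" and I = "PW n" and Z = "\<lambda>j. {w. j \<in> Des n (mism q) w}"])
  fix j and y :: "'k fmat" assume j: "Suc j < n"
  let ?Y = "commY (CB n) (TC q n) (CB n) (TC q n) j"
  let ?X = "commX (CB n) (TC q n) (CB n) (TC q n) j"
  have iff: "y \<in> ?Y \<longleftrightarrow> (\<forall>x\<in>?X. tr (CB n) (y * x) = 0)" if "y \<in> Mt (CB n) (CB n)"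
    by (rule commY_iff_orthogonal) (use that in auto)
  have YM: "y \<in> Mt (CB n) (CB n)" if "y \<in> ?Y"
    using that Mt_diff[OF Mt_mult[OF TC_Mt] Mt_mult[OF _ TC_Mt]] unfolding commY_def by blast
  show "y \<in> ?Y \<longleftrightarrow> y \<in> Mt (CB n) (CB n) \<and> (\<forall>w\<in>PW n. w \<in> {w. j \<in> Des n (mism q) w} --> tr (CB n) (y * bb w) = 0)"
  proof (intro iffI conjI)
    assume y: "y \<in> ?Y"
    show "y \<in> Mt (CB n) (CB n)" using YM y .
    show "\<forall>w\<in>PW n. w \<in> {w. j \<in> Des n (mism q) w} --> tr (CB n) (y * bb w) = 0"
      using iff[OF YM[OF y]] y bb_comm bb_Mt by (simp add: commX_def)
  next
    assume a: "y \<in> Mt (CB n) (CB n) \<and> (\<forall>w\<in>PW n. w \<in> {w. j \<in> Des n (mism q) w} --> tr (CB n) (y * bb w) = 0)"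
    have "tr (CB n) (y * x) = 0" if x: "x \<in> ?X" for x
    proof -
      have xe: "x = (\<Sum>w\<in>PW n. kap x w \<bullet> bb w)" using kap x by (simp add: commX_def)
      have "tr (CB n) (y * x) = (\<Sum>w\<in>PW n. kap x w * tr (CB n) (y * bb w))"
        by (subst xe) (simp add: sum_distrib_left tr_sum tr_scale)
      also have "... = 0"
        using a commX_kap[OF j, of x] x by (intro sum.neutral ballI) auto
      finally show ?thesis .
    qed
    then show "y \<in> ?Y" using iff a by blast
  qed
next
  fix u v :: "'k fmat" and w assume uv: "u \<in> Mt (CB n) (CB n)" "v \<in> Mt (CB n) (CB n)"
  then show "u + v \<in> Mt (CB n) (CB n)" by (rule Mt_add)
  show "w \<in> PW n ==> tr (CB n) ((u + v) * bb w) = tr (CB n) (u * bb w) + tr (CB n) (v * bb w)"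
    by (simp add: distrib_right tr_add)
next
  fix u v :: "'k fmat" assume uv: "u \<in> Mt (CB n) (CB n)" "v \<in> Mt (CB n) (CB n)" "\<And>w. w \<in> PW n ==> tr (CB n) (u * bb w) = tr (CB n) (v * bb w)"
  have "u - v = 0"
  proof (rule trace_nondegenerate[OF finite_CB Mt_diff[OF uv(1,2)]])
    fix g :: "'k fmat" assume g: "g \<in> Mt (CB n) (CB n)"
    have "tr (CB n) ((u - v) * g) = (\<Sum>w\<in>PW n. kap g w * tr (CB n) ((u - v) * bb w))"
      by (subst kap[OF g]) (simp add: sum_distrib_left tr_sum tr_scale)
    also have "... = 0" using uv(3) by (simp add: left_diff_distrib tr_diff)
    finally show "tr (CB n) ((u - v) * g) = 0" .
  qed
  then show "u = v" by simp
next
  fix c :: "(nat \<times> nat) list => 'k"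
  have "\<forall>w\<in>PW n. \<exists>y. y \<in> Mt (CB n) (CB n) \<and> (\<forall>v\<in>PW n. tr (CB n) (y * bb v) = (if v = w then 1 else 0))"
    using bb_dual by blast
  from bchoice[OF this] obtain y where y: "\<forall>w\<in>PW n. y w \<in> Mt (CB n) (CB n) \<and> (\<forall>v\<in>PW n. tr (CB n) (y w * bb v) = (if v = w then 1 else 0))" by (rule exE)
  have "(\<Sum>w\<in>PW n. c w \<bullet> y w) \<in> Mt (CB n) (CB n)" using y by (intro Mt_sum Mt_scale) auto
  moreover have "tr (CB n) ((\<Sum>w\<in>PW n. c w \<bullet> y w) * bb v) = c v" if v: "v \<in> PW n" for v
  proof -
    have "tr (CB n) ((\<Sum>w\<in>PW n. c w \<bullet> y w) * bb v) = (\<Sum>w\<in>PW n. if w = v then c w else 0)"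
      unfolding sum_distrib_right tr_sum using y v by (intro sum.cong refl) (auto simp: tr_scale)
    then show ?thesis using v by simp
  qed
  ultimately show "\<exists>v\<in>Mt (CB n) (CB n). \<forall>w\<in>PW n. tr (CB n) (v * bb w) = c w" by blast
qed simp

end

section \<open>Passage to direct summands\<close>

text \<open>The maps \<open>F i\<close> embed into several copies of the known family, and the
  \<open>G i\<close> project back. The decomposition is made in each copy separately and the results
  are added up after applying \<open>G i\<close>.\<close>

lemma kcond_transfer:
  fixes F :: "'i => 'v::ab_group_add => 'w::ab_group_add" and G :: "'i => 'w => 'v"
  assumes K: "kcond n X'" and I: "finite I"
    and FX: "\<And>i j x. i \<in> I ==> Suc j < n ==> x \<in> X j ==> F i x \<in> X' j"
    and GX: "\<And>i j x. i \<in> I ==> Suc j < n ==> x \<in> X' j ==> G i x \<in> X j"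
    and Fadd: "\<And>i x y. F i (x + y) = F i x + F i y" and Gadd: "\<And>i x y. G i (x + y) = G i x + G i y"
    and X: "\<And>j. Suc j < n ==> 0 \<in> X j" "\<And>j x y. Suc j < n ==> x \<in> X j ==> y \<in> X j ==> x + y \<in> X j"
    and id: "\<And>j x. Suc j < n ==> x \<in> X j ==> (\<Sum>i\<in>I. G i (F i x)) = x"
  shows "kcond n X"
  unfolding kcond_def
proof (intro allI impI)
  fix p \<phi> x
  assume "Suc p < n \<and> (\<forall>j. p < j \<and> Suc j < n --> \<phi> \<in> X j) \<and> (\<forall>j\<le>p. x j \<in> X j) \<and> \<phi> = (\<Sum>j\<le>p. x j)"
  then have p: "Suc p < n" and \<phi>: "\<And>j. p < j ==> Suc j < n ==> \<phi> \<in> X j"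
    and x: "\<And>j. j \<le> p ==> x j \<in> X j" and \<phi>x: "\<phi> = (\<Sum>j\<le>p. x j)" by auto
  have F0: "F i 0 = 0" and G0: "G i 0 = 0" for i using Fadd[of i 0 0] Gadd[of i 0 0] by auto
  have Fsum: "F i (\<Sum>j\<in>J. f j) = (\<Sum>j\<in>J. F i (f j))" for i J and f :: "nat => 'v"
    by (induction J rule: infinite_finite_induct) (auto simp: F0 Fadd)
  have Gsum: "G i (\<Sum>j\<in>J. f j) = (\<Sum>j\<in>J. G i (f j))" for i J and f :: "nat => 'w"
    by (induction J rule: infinite_finite_induct) (auto simp: G0 Gadd)
  have Xsum: "(\<Sum>i\<in>J. f i) \<in> X j" if "Suc j < n" "\<And>i. i \<in> J ==> f i \<in> X j" for J j and f :: "'i => 'v"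
    using that by (induction J rule: infinite_finite_induct) (auto simp: X)
  have "\<forall>i\<in>I. \<exists>sy. F i \<phi> = fst sy + (\<Sum>j<p. snd sy j) \<and> (\<forall>j<p. snd sy j \<in> X' j) \<and> (\<forall>j. p \<le> j \<and> Suc j < n --> fst sy \<in> X' j)"
  proof
    fix i assume i: "i \<in> I"
    have a: "Suc p < n \<and> (\<forall>j. p < j \<and> Suc j < n --> F i \<phi> \<in> X' j) \<and> (\<forall>j\<le>p. F i (x j) \<in> X' j) \<and> F i \<phi> = (\<Sum>j\<le>p. F i (x j))"
    proof (intro conjI)
      show "F i \<phi> = (\<Sum>j\<le>p. F i (x j))" unfolding \<phi>x by (rule Fsum)
      show "\<forall>j\<le>p. F i (x j) \<in> X' j" using p x FX[OF i] by simp
    qed (use p \<phi> FX[OF i] in auto)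
    obtain s y where "F i \<phi> = s + (\<Sum>j<p. y j) \<and> (\<forall>j<p. y j \<in> X' j) \<and> (\<forall>j. p \<le> j \<and> Suc j < n --> s \<in> X' j)"
      using K[unfolded kcond_def, rule_format, of p "F i \<phi>" "\<lambda>j. F i (x j)"] a by blast
    then show "\<exists>sy. F i \<phi> = fst sy + (\<Sum>j<p. snd sy j) \<and> (\<forall>j<p. snd sy j \<in> X' j) \<and> (\<forall>j. p \<le> j \<and> Suc j < n --> fst sy \<in> X' j)"
      by (intro exI[of _ "(s, y)"]) simp
  qed
  from bchoice[OF this] obtain S where S: "\<forall>i\<in>I. F i \<phi> = fst (S i) + (\<Sum>j<p. snd (S i) j) \<and> (\<forall>j<p. snd (S i) j \<in> X' j) \<and> (\<forall>j. p \<le> j \<and> Suc j < n --> fst (S i) \<in> X' j)"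
    by (rule exE)
  define \<psi> where "\<psi> = (\<Sum>i\<in>I. G i (fst (S i)))"
  define y where "y = (\<lambda>j. \<Sum>i\<in>I. G i (snd (S i) j))"
  have "\<phi> = (\<Sum>j\<le>p. \<Sum>i\<in>I. G i (F i (x j)))"
    unfolding \<phi>x
  proof (rule sum.cong[OF refl])
    fix j assume "j \<in> {..p}"
    then show "x j = (\<Sum>i\<in>I. G i (F i (x j)))" using id[of j "x j"] x[of j] p by simp
  qed
  also have "... = (\<Sum>i\<in>I. G i (F i \<phi>))" unfolding \<phi>x by (subst sum.swap) (simp add: Fsum Gsum)
  also have "... = (\<Sum>i\<in>I. G i (fst (S i)) + (\<Sum>j<p. G i (snd (S i) j)))"
  proof (rule sum.cong[OF refl])
    fix i assume "i \<in> I"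
    then have "F i \<phi> = fst (S i) + (\<Sum>j<p. snd (S i) j)" using S by blast
    then show "G i (F i \<phi>) = G i (fst (S i)) + (\<Sum>j<p. G i (snd (S i) j))" by (simp add: Gadd Gsum)
  qed
  also have "... = \<psi> + (\<Sum>j<p. y j)" unfolding sum.distrib \<psi>_def y_def by (subst (2) sum.swap) simp
  finally have 1: "\<phi> = \<psi> + (\<Sum>j<p. y j)" .
  have 2: "\<forall>j<p. y j \<in> X j" unfolding y_def using S GX p by (intro allI impI Xsum) auto
  have 3: "\<forall>j. p \<le> j \<and> Suc j < n --> \<psi> \<in> X j" unfolding \<psi>_def using S GX by (intro allI impI Xsum) auto
  show "\<exists>\<psi> y. \<phi> = \<psi> + (\<Sum>j<p. y j) \<and> (\<forall>j<p. y j \<in> X j) \<and> (\<forall>j. p \<le> j \<and> Suc j < n --> \<psi> \<in> X j)"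
    using 1 2 3 by blast
qed

lemma kcond_factors:
  fixes T :: "nat => 'k::field fmat"
  assumes q: "q \<noteq> 0" and H: "hmod q n B T" "hmod q n B' T'"
    and F: "factors q n B T a f g" "factors q n B' T' a' f' g'"
  shows "kcond n (commX B T B' T')" and "kcond n (commY B T B' T')"
proof -
  let ?I = "{..<a} \<times> {..<a'}"
  \<comment> \<open>Homomorphisms between two summands of sums of \<open>C\<close> form a summand of
    \<open>a * a'\<close> copies of the endomorphisms of \<open>C\<close>; the maps of one module
    act on each side.\<close>
  let ?F = "\<lambda>i x. f' (snd i) * x * g (fst i)"
  let ?G = "\<lambda>i x. g' (snd i) * x * f (fst i)"
  let ?C = "CB n" and ?T = "TC q n"
  have fg: "f s \<in> hhom n B T ?C ?T" "g s \<in> hhom n ?C ?T B T" if "s < a" for s using F(1) that by (auto simp: factors_def)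
  have fg': "f' s \<in> hhom n B' T' ?C ?T" "g' s \<in> hhom n ?C ?T B' T'" if "s < a'" for s using F(2) that by (auto simp: factors_def)
  have id: "(\<Sum>i\<in>?I. ?G i (?F i x)) = x" if "x \<in> Mt B' B" for x
  proof -
    have "(\<Sum>i\<in>?I. ?G i (?F i x)) = (\<Sum>s<a. \<Sum>t<a'. (g' t * f' t) * (x * (g s * f s)))"
      unfolding sum.cartesian_product by (intro sum.cong refl) (auto simp: mult.assoc)
    also have "... = (\<Sum>t<a'. g' t * f' t) * (x * (\<Sum>s<a. g s * f s))"
      by (simp only: sum_distrib_left sum_distrib_right)
    also have "... = x" using F that hmodD(1)[OF H(1)] hmodD(1)[OF H(2)] by (simp add: factors_def)
    finally show ?thesis .
  qed
  have FM: "?F i x \<in> Mt ?C ?C" if "i \<in> ?I" "x \<in> Mt B' B" for i x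
    using Mt_mult[OF Mt_mult[OF hhom_Mt[OF fg'(1)] that(2)] hhom_Mt[OF fg(2)], of "snd i" "fst i"] that(1) by auto
  have GM: "?G i x \<in> Mt B' B" if "i \<in> ?I" "x \<in> Mt ?C ?C" for i x
    using Mt_mult[OF Mt_mult[OF hhom_Mt[OF fg'(2)] that(2)] hhom_Mt[OF fg(1)], of "snd i" "fst i"] that(1) by auto
  have Fl: "?T (Suc j) * ?F i x = ?F i (T' (Suc j) * x)" "?F i x * ?T (Suc j) = ?F i (x * T (Suc j))"
    if "i \<in> ?I" "Suc j < n" for i j x
  proof -
    have st: "fst i < a" "snd i < a'" using that by auto
    show "?T (Suc j) * ?F i x = ?F i (T' (Suc j) * x)"
      using hhom_comm[OF fg'(1)[OF st(2)] that(2)] by (simp add: mult.assoc[symmetric])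
    show "?F i x * ?T (Suc j) = ?F i (x * T (Suc j))"
      using hhom_comm[OF fg(2)[OF st(1)] that(2)] by (simp add: mult.assoc)
  qed
  have Gl: "T' (Suc j) * ?G i x = ?G i (?T (Suc j) * x)" "?G i x * T (Suc j) = ?G i (x * ?T (Suc j))"
    if "i \<in> ?I" "Suc j < n" for i j x
  proof -
    have st: "fst i < a" "snd i < a'" using that by auto
    show "T' (Suc j) * ?G i x = ?G i (?T (Suc j) * x)"
      using hhom_comm[OF fg'(2)[OF st(2)] that(2)] by (simp add: mult.assoc[symmetric])
    show "?G i x * T (Suc j) = ?G i (x * ?T (Suc j))"
      using hhom_comm[OF fg(1)[OF st(1)] that(2)] by (simp add: mult.assoc)
  qed
  have Fd: "?F i (x - y) = ?F i x - ?F i y" "?G i (x - y) = ?G i x - ?G i y" for i x y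
    by (simp_all add: left_diff_distrib right_diff_distrib)
  show "kcond n (commX B T B' T')"
  proof (rule kcond_transfer[OF kcond_commX_std[OF q, of n], where I = ?I and F = ?F and G = ?G])
    fix i j x assume ij: "i \<in> ?I" "Suc j < n"
    show "x \<in> commX B T B' T' j ==> ?F i x \<in> commX ?C ?T ?C ?T j"
      unfolding commX_def using FM[OF ij(1), of x] Fl[OF ij, of x] by simp
    show "x \<in> commX ?C ?T ?C ?T j ==> ?G i x \<in> commX B T B' T' j"
      unfolding commX_def using GM[OF ij(1), of x] Gl[OF ij, of x] by simp
  qed (use id in \<open>auto simp: distrib_left distrib_right commX_def intro: Mt_add\<close>)
  show "kcond n (commY B T B' T')"
  proof (rule kcond_transfer[OF kcond_commY_std[OF q, of n], where I = ?I and F = ?F and G = ?G])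
    fix i j x assume ij: "i \<in> ?I" "Suc j < n"
    show "?F i x \<in> commY ?C ?T ?C ?T j" if y: "x \<in> commY B T B' T' j"
    proof -
      obtain h where h: "x = T' (Suc j) * h - h * T (Suc j)" "h \<in> Mt B' B" using y by (auto simp: commY_def)
      have "?F i x = ?T (Suc j) * ?F i h - ?F i h * ?T (Suc j)" unfolding h(1) Fd Fl[OF ij] ..
      then show ?thesis unfolding commY_def using FM[OF ij(1) h(2)] by blast
    qed
    show "?G i x \<in> commY B T B' T' j" if y: "x \<in> commY ?C ?T ?C ?T j"
    proof -
      obtain h where h: "x = ?T (Suc j) * h - h * ?T (Suc j)" "h \<in> Mt ?C ?C" using y by (auto simp: commY_def)
      have "?G i x = T' (Suc j) * ?G i h - ?G i h * T (Suc j)" unfolding h(1) Fd Gl[OF ij] ..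
      then show ?thesis unfolding commY_def using GM[OF ij(1) h(2)] by blast
    qed
  next
    fix j x y assume "Suc j < n"
    show "0 \<in> commY B T B' T' j" using fm.subspace_0[OF subspace_commY] .
    show "x \<in> commY B T B' T' j ==> y \<in> commY B T B' T' j ==> x + y \<in> commY B T B' T' j"
      by (rule fm.subspace_add[OF subspace_commY])
    show "x \<in> commY B T B' T' j ==> (\<Sum>i\<in>?I. ?G i (?F i x)) = x"
    proof (rule id)
      assume "x \<in> commY B T B' T' j"
      then show "x \<in> Mt B' B"
        unfolding commY_def using hmodD(2)[OF H(1) \<open>Suc j < n\<close>] hmodD(2)[OF H(2) \<open>Suc j < n\<close>] by (auto intro!: Mt_diff Mt_mult)
    qed
  qed (auto simp: distrib_left distrib_right)
qed

section \<open>Highest weight vectors\<close>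

lemma sw_append_left: "Suc j < length u ==> sw j (u @ v) = sw j u @ v"
  by (rule nth_equalityI) (auto simp: nth_sw nth_append)

lemma sw_append_right: "Suc j < length v ==> sw (length u + j) (u @ v) = u @ sw j v"
  by (rule nth_equalityI) (auto simp: nth_sw nth_append)

lemma inv_append_replicate:
  "(\<And>y. y \<in> set u ==> x \<le> y) ==> ninv (u @ replicate r x) = ninv u + length (filter (\<lambda>y. x < y) u) * r"
proof (induction u)
  case Nil
  show ?case by (induction r) auto
next
  case (Cons y u)
  have "length (filter (\<lambda>z. z < y) (replicate r x)) = (if x < y then r else 0)" by (induction r) auto
  then show ?case using Cons by (auto simp: algebra_simps)
qed

lemma sorted_split_letter:
  assumes "sorted (s :: nat list)"
  shows "s = filter (\<lambda>y. y < x) s @ replicate (count (mset s) x) x @ filter (\<lambda>y. x < y) s"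
  using assms
proof (induction s)
  case (Cons y s)
  have le: "\<forall>z\<in>set s. y \<le> z" and s: "sorted s" using Cons.prems by auto
  note IH = Cons.IH[OF s]
  consider "y < x" | "y = x" | "x < y" by linarith
  then show ?case
  proof cases
    case 2
    then have "filter (\<lambda>y. y < x) s = []" using le by (auto simp: filter_empty_conv)
    then show ?thesis using IH 2 by simp
  next
    case 3
    then have "filter (\<lambda>y. y < x) s = []" "count (mset s) x = 0" "filter (\<lambda>y. x < y) s = s"
      using le by (auto simp: filter_empty_conv count_eq_zero_iff filter_id_conv)
    then show ?thesis using 3 by simp
  qed (use IH in simp)
qed simp

lemma count_le_length: "count (mset xs) x \<le> length xs"
  by (induction xs) auto

lemma count_eq_length_replicate: "count (mset xs) x = length xs ==> xs = replicate (length xs) x"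
proof (induction xs)
  case (Cons y xs)
  then show ?case using count_le_length[of xs x] by (cases "y = x") auto
qed simp

lemma count_filter_greater:
  "(\<And>y. y \<in> set xs ==> (x::nat) \<le> y) ==> length (filter (\<lambda>y. x < y) xs) + count (mset xs) x = length xs"
proof (induction xs)
  case (Cons y xs)
  then have "x \<le> y" by simp
  then consider "y = x" | "x < y" by linarith
  then show ?case using Cons by cases auto
qed simp

definition rest :: "nat => (nat list => bool) => 'k::field fmat"
  where "rest n P = mk (CB n) (CB n) (\<lambda>u w. if u = w \<and> P u then 1 else 0)"

lemma rest_Mt [simp]: "rest n P \<in> Mt (CB n) (CB n)" by (simp add: rest_def)

lemma ent_rest: "ent (rest n P) u w = (if u = w \<and> u \<in> CB n \<and> P u then 1 else 0)"
  by (auto simp: rest_def)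

lemma rest_mult: "m \<in> Mt (CB n) A ==> ent (rest n P * m) u w = (if P u then ent m u w else 0)"
proof -
  assume m: "m \<in> Mt (CB n) A"
  have "ent (rest n P * m) u w = (\<Sum>v\<in>CB n. if v = u then (if P u then ent m u w else 0) else 0)"
    unfolding ent_times[OF finite_CB rest_Mt] by (intro sum.cong refl) (auto simp: ent_rest)
  then show ?thesis using m by (auto simp: Mt_zero)
qed

context
  fixes q :: "'k::field" and n :: nat
  assumes q: "q \<noteq> 0"
begin

abbreviation (input) "V0 \<equiv> Mt (CB n) {[]} :: 'k fmat set"
abbreviation (input) "T0 \<equiv> TC q n"
abbreviation (input) "cf m z \<equiv> ent m z []"

lemma TC_coeff:
  assumes m: "m \<in> V0" and z: "z \<in> CB n" and j: "Suc j < n"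
  shows "cf (T0 (Suc j) * m) z = (if z ! j < z ! Suc j then q * cf m (sw j z)
    else if z ! Suc j < z ! j then (q - 1) * cf m z + cf m (sw j z) else cc q (z ! j) * cf m z)"
proof -
  have len: "length z = n" using CB_length[OF z] .
  have sz: "sw j z \<in> CB n" using sw_CB[OF z j] .
  have nth: "sw j z ! j = z ! Suc j" "sw j z ! Suc j = z ! j" using nth_sw[of j z] j len by auto
  have inj: "z = sw j w \<longleftrightarrow> w = sw j z" if "w \<in> CB n" for w
    using sw_sw[of j z] sw_sw[of j w] j len CB_length[OF that] by metis
  have neq: "sw j z \<noteq> z" if "z ! j \<noteq> z ! Suc j" using nth that by metis
  have t: "tst q (Suc j) z w = (if w = sw j z \<and> z ! j \<noteq> z ! Suc j then (if z ! j < z ! Suc j then q else 1) else 0)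
      + (if w = z then (if z ! Suc j < z ! j then q - 1 else if z ! j = z ! Suc j then cc q (z ! j) else 0) else 0)"
    if w: "w \<in> CB n" for w
  proof (cases "z ! j = z ! Suc j")
    case True
    have "w = z" if "z = sw j w" using inj[OF w] that sw_same[of j z] True j len by simp
    then have "tst q (Suc j) z w = (if w = z then cc q (z ! j) else 0)"
      using True sw_same[of j z] j len by (auto simp: tst_def)
    then show ?thesis using True by simp
  next
    case False
    show ?thesis
    proof (cases "w = sw j z")
      case True
      then have "z = sw j w" using inj[OF w] by simp
      then show ?thesis using True False nth neq by (simp add: tst_def)
    next
      case ne: False
      then have "z \<noteq> sw j w" using inj[OF w] by simp
      then show ?thesis using ne False neq[OF False] by (auto simp: tst_def)
    qed
  qed
  have "cf (T0 (Suc j) * m) z = (\<Sum>w\<in>CB n. tst q (Suc j) z w * cf m w)"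
    unfolding ent_times[OF finite_CB TC_Mt] using z by (intro sum.cong refl) (simp add: TC_def)
  also have "... = (\<Sum>w\<in>CB n. (if w = sw j z then (if z ! j \<noteq> z ! Suc j then (if z ! j < z ! Suc j then q else 1) * cf m (sw j z) else 0) else 0)
      + (if w = z then (if z ! Suc j < z ! j then q - 1 else if z ! j = z ! Suc j then cc q (z ! j) else 0) * cf m z else 0))"
    by (intro sum.cong refl) (auto simp: t distrib_right)
  also have "... = (if z ! j \<noteq> z ! Suc j then (if z ! j < z ! Suc j then q else 1) * cf m (sw j z) else 0)
      + (if z ! Suc j < z ! j then q - 1 else if z ! j = z ! Suc j then cc q (z ! j) else 0) * cf m z"
    using sz z by (simp add: sum.distrib)
  finally show ?thesis by auto
qed

text \<open>The eigenvalue equation compares only the coefficients of \<open>z\<close> and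
  \<open>sw j z\<close>. The condition at the ascending word of the pair implies that at the
  descending one, because the eigenvalue satisfies the quadratic relation.\<close>

lemma eigen_iff:
  assumes m: "m \<in> V0" and j: "Suc j < n"
  shows "T0 (Suc j) * m = cc q x \<bullet> m \<longleftrightarrow>
    (\<forall>z\<in>CB n. (z ! j < z ! Suc j --> cf m (sw j z) = cc q x / q * cf m z) \<and>
      (z ! j = z ! Suc j --> cc q (z ! j) \<noteq> cc q x --> cf m z = 0))" (is "?L \<longleftrightarrow> ?R")
proof
  assume L: ?L
  show ?R
  proof
    fix z assume z: "z \<in> CB n"
    have "cf (T0 (Suc j) * m) z = cc q x * cf m z" using L by simp
    then show "(z ! j < z ! Suc j --> cf m (sw j z) = cc q x / q * cf m z) \<and>
      (z ! j = z ! Suc j --> cc q (z ! j) \<noteq> cc q x --> cf m z = 0)"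
      unfolding TC_coeff[OF m z j] using q by (auto simp: field_simps)
  qed
next
  assume R: ?R
  show ?L
  proof (rule Mt_eqI[OF Mt_mult[OF TC_Mt m] Mt_scale[OF m]])
    fix z w assume z: "z \<in> CB n" and w: "w \<in> {[] :: nat list}"
    have len: "length z = n" using CB_length[OF z] .
    have "cf (T0 (Suc j) * m) z = cc q x * cf m z"
    proof (cases "z ! j" "z ! Suc j" rule: linorder_cases)
      case less
      then show ?thesis unfolding TC_coeff[OF m z j] using R z q by simp
    next
      case equal
      then show ?thesis unfolding TC_coeff[OF m z j] using R z by auto
    next
      case greater
      have sz: "sw j z \<in> CB n" using sw_CB[OF z j] .
      have "sw j z ! j < sw j z ! Suc j" using greater nth_sw[of j z] j len by auto
      then have e: "cf m z = cc q x / q * cf m (sw j z)" using R sz j len by fastforce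
      have "cc q x * (cc q x / q) = (q - 1) * (cc q x / q) + 1" using cc_square[of q x] q by (simp add: field_simps)
      then have "cc q x * cf m z = ((q - 1) * (cc q x / q) + 1) * cf m (sw j z)" using e by (simp only: mult.assoc[symmetric])
      then show ?thesis unfolding TC_coeff[OF m z j] using greater e by (simp add: distrib_right mult.assoc)
    qed
    then show "ent (T0 (Suc j) * m) z w = ent (cc q x \<bullet> m) z w" using w by simp
  qed
qed

text \<open>For sorted \<open>s\<close> these are by \<open>homv\<close> the possible images of
  \<open>s\<close> under homomorphisms from the weight of \<open>s\<close> to \<open>C\<close>; they
  play the part of highest weight vectors in Schur-Weyl duality.\<close>

definition hw :: "nat list => 'k fmat => bool"
  where "hw s m \<longleftrightarrow> m \<in> V0 \<and> (\<forall>j. Suc j < n --> s ! j = s ! Suc j --> T0 (Suc j) * m = cc q (s ! j) \<bullet> m)"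

text \<open>Under a block of equal letters of \<open>s\<close>, each swap that sorts the segment
  \<open>z1\<close> contributes one factor \<open>cc q x / q\<close>. So the coefficients depend on
  the content of the segment only, up to a known power.\<close>

lemma hw_block:
  assumes m: "hw s m" and s: "length s = n" "s = p @ replicate a x @ r" and z: "p @ z1 @ z2 \<in> CB n" "length z1 = a"
  shows "cf m (p @ z1 @ z2) = (cc q x / q) ^ ninv z1 * cf m (p @ sort z1 @ z2)"
  using z
proof (induction "ninv z1" arbitrary: z1 rule: less_induct)
  case less
  show ?case
  proof (cases "\<exists>j. Suc j < a \<and> z1 ! Suc j < z1 ! j")
    case False
    then have "sorted z1" using sorted_no_desc[of z1] less.prems(2) by (metis not_le)
    moreover from this have "ninv z1 = 0" by (induction z1) (auto simp: filter_empty_conv not_less)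
    ultimately show ?thesis by (simp add: sorted_sort_id)
  next
    case True
    then obtain j where j: "Suc j < a" "z1 ! Suc j < z1 ! j" by blast
    let ?j = "length p + j"
    let ?z = "p @ sw j z1 @ z2"
    have len: "length (p @ z1 @ z2) = n" using CB_length[OF less.prems(1)] .
    have jn: "Suc ?j < n" using j less.prems(2) len by simp
    have sz: "sw ?j (p @ z1 @ z2) = ?z"
      using sw_append_right[of j "z1 @ z2" p] sw_append_left[of j z1 z2] j less.prems(2) by simp
    have zC: "?z \<in> CB n" using sw_CB[OF less.prems(1) jn] sz by simp
    have szz: "sw ?j ?z = p @ z1 @ z2" using sz jn len by (metis sw_sw)
    have nth: "?z ! ?j = z1 ! Suc j" "?z ! Suc ?j = z1 ! j"
      using nth_sw[of j z1] j less.prems(2) by (auto simp: nth_append)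
    have sj: "s ! ?j = x" "s ! Suc ?j = x" using s j by (auto simp: nth_append)
    have mV: "m \<in> V0" and ev: "T0 (Suc ?j) * m = cc q x \<bullet> m" using m sj jn by (auto simp: hw_def)
    have "cf m (sw ?j ?z) = cc q x / q * cf m ?z" using eigen_iff[OF mV jn, of x] ev zC nth j by simp
    moreover have iv: "ninv z1 = Suc (ninv (sw j z1))" using inv_sw[of j z1] j less.prems(2) by simp
    moreover have "cf m ?z = (cc q x / q) ^ ninv (sw j z1) * cf m (p @ sort (sw j z1) @ z2)"
      using less.hyps[of "sw j z1"] iv zC less.prems(2) by simp
    moreover have "sort (sw j z1) = sort z1"
      using mset_sw[of j z1] j less.prems(2) by (metis mset_sort sorted_sort properties_for_sort)
    ultimately show ?thesis using szz by simp
  qed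
qed

text \<open>A repeated letter of the wrong parity in a block would force the coefficient to vanish.\<close>
lemma hw_block_match:
  assumes m: "hw s m" and s: "length s = n" "s = p @ replicate a x @ r" and z: "p @ z1 @ z2 \<in> CB n" "length z1 = a"
    and nz: "cf m (p @ z1 @ z2) \<noteq> 0" and c: "2 \<le> count (mset z1) y"
  shows "cc q y = cc q x"
proof (rule ccontr)
  assume ne: "cc q y \<noteq> cc q x"
  define z' where "z' = y # y # sort (remove1 y (remove1 y z1))"
  have sub: "{#y, y#} \<subseteq># mset z1" using c by (auto simp: subseteq_mset_def)
  have ms: "mset z' = mset z1"
  proof -
    have "mset z' = {#y, y#} + (mset z1 - {#y, y#})" by (simp add: z'_def)
    also have "... = mset z1" using sub by (simp only: subset_mset.add_diff_inverse)
    finally show ?thesis .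
  qed
  then have srt: "sort z' = sort z1" by (metis mset_sort sorted_sort properties_for_sort)
  have len': "length z' = a" using ms z(2) by (metis size_mset)
  have zC: "p @ z' @ z2 \<in> CB n" using CB_mset[OF z(1)] ms by simp
  have nz': "cf m (p @ z' @ z2) \<noteq> 0"
    using hw_block[OF m s z] hw_block[OF m s zC len'] nz srt q cc_nonzero[OF q] by simp
  let ?j = "length p"
  have jn: "Suc ?j < n" using CB_length[OF zC] by (simp add: z'_def)
  have a2: "2 \<le> a" using len' by (simp add: z'_def)
  then have sj: "s ! ?j = x" "s ! Suc ?j = x" using s by (auto simp: nth_append)
  have mV: "m \<in> V0" and ev: "T0 (Suc ?j) * m = cc q x \<bullet> m" using m sj jn by (auto simp: hw_def)
  have "(p @ z' @ z2) ! ?j = y" "(p @ z' @ z2) ! Suc ?j = y" by (auto simp: z'_def nth_append)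
  then have "cf m (p @ z' @ z2) = 0" using eigen_iff[OF mV jn, of x] ev zC ne by auto
  then show False using nz' by simp
qed

text \<open>The eigenvalue condition ties together only \<open>z\<close> and \<open>sw j z\<close>,
  so the support may be cut along any property that is respected by the swaps inside the blocks of
  \<open>s\<close>.\<close>

lemma hw_rest:
  assumes "hw s m" "\<And>j u. Suc j < n ==> s ! j = s ! Suc j ==> u \<in> CB n ==> P (sw j u) = P u"
  shows "hw s (rest n P * m)"
proof -
  have mV: "m \<in> V0" using assms(1) by (simp add: hw_def)
  have rV: "rest n P * m \<in> V0" using Mt_mult[OF rest_Mt mV] .
  have "T0 (Suc j) * (rest n P * m) = cc q (s ! j) \<bullet> (rest n P * m)" if j: "Suc j < n" "s ! j = s ! Suc j" for j
  proof -
    have "T0 (Suc j) * m = cc q (s ! j) \<bullet> m" using assms(1) j by (simp add: hw_def)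
    then show ?thesis
      unfolding eigen_iff[OF mV j(1)] eigen_iff[OF rV j(1)] rest_mult[OF mV] using assms(2)[OF j] by auto
  qed
  then show ?thesis using rV by (simp add: hw_def)
qed

text \<open>A repetition in \<open>s\<close> never straddles the boundary of the block of
  \<open>x\<close>, so the relevant swaps preserve the content of each of the three
  segments.\<close>

lemma block_region:
  fixes s :: "nat list"
  assumes "s = p @ replicate a x @ r" "\<forall>y\<in>set p. y < x" "\<forall>y\<in>set r. x < y" "Suc j < length s" "s ! j = s ! Suc j"
  shows "Suc j < length p \<or> (length p \<le> j \<and> Suc j < length p + a) \<or> length p + a \<le> j"
proof (rule ccontr)
  assume "\<not> ?thesis"
  then consider "Suc j = length p" | "length p \<le> j" "Suc j = length p + a" by linarith
  then show False
  proof cases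
    case 1
    have "s ! j \<in> set p" using assms(1) 1 by (auto simp: nth_append)
    moreover have "s ! Suc j \<in> set (replicate a x @ r)" using assms(1,4) 1 by (auto simp: nth_append)
    then have "s ! Suc j = x \<or> s ! Suc j \<in> set r" by (auto split: if_splits)
    then have "x \<le> s ! Suc j" using assms(3) by auto
    ultimately show False using assms(2,5) by auto
  next
    case 2
    have "s ! j = x" using assms(1) 2 by (auto simp: nth_append)
    moreover have "s ! Suc j \<in> set r" using assms(1,4) 2 by (auto simp: nth_append)
    ultimately show False using assms(3,5) by auto
  qed
qed

lemma seg_sw:
  assumes "length z = n" "Suc j < n" "Suc j < l \<or> (l \<le> j \<and> Suc j < l + a) \<or> l + a \<le> j" "l + a \<le> n"
  shows "mset (take a (drop l (sw j z))) = mset (take a (drop l z))"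
proof -
  define z0 where "z0 = take l z"
  define z1 where "z1 = take a (drop l z)"
  define z2 where "z2 = drop (l + a) z"
  have z: "z = z0 @ z1 @ z2" unfolding z0_def z1_def z2_def by (metis add.commute append_take_drop_id drop_drop)
  have len: "length z0 = l" "length z1 = a" using assms(1,4) by (auto simp: z0_def z1_def)
  consider "Suc j < l" | "l \<le> j" "Suc j < l + a" | "l + a \<le> j" using assms(3) by blast
  then show ?thesis
  proof cases
    case 1
    then have "sw j z = sw j z0 @ z1 @ z2" using sw_append_left[of j z0 "z1 @ z2"] len z by simp
    then show ?thesis using len z by simp
  next
    case 2
    then have "sw j z = z0 @ sw (j - l) z1 @ z2"
      using sw_append_right[of "j - l" "z1 @ z2" z0] sw_append_left[of "j - l" z1 z2] len z by simp
    then show ?thesis using len z 2 by simp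
  next
    case 3
    then have "Suc (j - (l + a)) < length z2" using assms(1,2) len z by auto
    then have "sw j z = z0 @ z1 @ sw (j - (l + a)) z2"
      using sw_append_right[of "j - (l + a)" z2 "z0 @ z1"] len z 3 by simp
    then show ?thesis using len z by simp
  qed
qed

text \<open>The triangularity step. In the support of \<open>m\<close>, \<open>e\<close> copies of
  \<open>x\<close> are missing from the block of \<open>s\<close> and sit in the tail. The word
  \<open>t\<close> gathers them by prolonging the block to \<open>a + e\<close> letters, which makes
  it smaller than \<open>s\<close>. The vector \<open>h\<close> has weight \<open>t\<close> and
  carries the tails of \<open>m\<close> behind a full block; \<open>g\<close> sends \<open>t\<close>
  to an eigenvector \<open>v\<close> whose prolonged block has the content \<open>\<kappa>\<close>
  plus \<open>e\<close> copies of \<open>x\<close>. Then \<open>g * h\<close> agrees with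
  \<open>m\<close>, up to a nonzero constant, on the words with block content
  \<open>\<kappa>\<close>, and all its other words have fewer than \<open>e\<close> letters
  \<open>x\<close> in the tail.\<close>

lemma hw_reduce:
  assumes s: "s \<in> CB n" "sorted s" "s = p @ replicate a x @ r" and lt: "\<forall>y\<in>set p. y < x" "\<forall>y\<in>set r. x < y"
    and m: "hw s m" "m \<noteq> 0"
    and supp: "\<And>z. cf m z \<noteq> 0 ==> \<exists>z1 z2. z = p @ z1 @ z2 \<and> mset z1 = \<kappa> \<and> mset z = mset s"
    and e: "0 < e" "count \<kappa> x + e = a" "size \<kappa> = a"
  shows "\<exists>g h t c. g \<in> hhom n (CB n) T0 (CB n) T0 \<and> t \<in> CB n \<and> sorted t \<and> t < s \<and> hw s h \<and>
    (\<forall>z. cf h z \<noteq> 0 --> mset z = mset t) \<and> c \<noteq> 0 \<and>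
    (\<forall>y. cf (g * h) y \<noteq> 0 --> (\<exists>y1 y2. y = p @ y1 @ y2 \<and> length y1 = a \<and> mset y = mset s \<and>
        count (mset y2) x \<le> e \<and> (count (mset y2) x = e --> mset y1 = \<kappa>))) \<and>
    (\<forall>y1 y2. mset y1 = \<kappa> --> cf (g * h) (p @ y1 @ y2) = c * cf m (p @ y1 @ y2))"
proof -
  let ?\<gamma> = "cc q x / q"
  have \<gamma>0: "?\<gamma> \<noteq> 0" using q cc_nonzero[OF q] by simp
  have mV: "m \<in> V0" using m(1) by (simp add: hw_def)
  have sl: "length s = n" using CB_length[OF s(1)] .
  obtain z0 where z0: "cf m z0 \<noteq> 0"
  proof -
    have "\<exists>u w. ent m u w \<noteq> 0" using m(2) by (metis fmat_eqI zero_fmat.rep_eq)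
    then show thesis using that mV by (auto simp: Mt_def)
  qed
  obtain b1 b2 where b: "z0 = p @ b1 @ b2" "mset b1 = \<kappa>" "mset z0 = mset s" using supp[OF z0] by blast
  define \<rho> where "\<rho> = mset b2"
  have l1: "length b1 = a" using b(2) e(3) by (metis size_mset)
  have tot: "\<kappa> + \<rho> = replicate_mset a x + mset r" using b s(3) by (simp add: \<rho>_def)
  have ge: "x \<le> y" if "y \<in># \<kappa> + \<rho>" for y using that lt(2) unfolding tot by (auto split: if_splits)
  have c\<rho>: "count \<rho> x = e"
  proof -
    have "count \<kappa> x + count \<rho> x = a + count (mset r) x" using arg_cong[OF tot, of "\<lambda>M. count M x"] by simp
    moreover have "count (mset r) x = 0" using lt(2) by (auto simp: count_eq_zero_iff)
    ultimately show ?thesis using e(2) by simp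
  qed
  define w2 where "w2 = filter (\<lambda>y. x < y) (sort b2)"
  have sb2: "sort b2 = replicate e x @ w2"
  proof -
    have "filter (\<lambda>y. y < x) (sort b2) = []" using ge by (auto simp: filter_empty_conv \<rho>_def not_less)
    then show ?thesis using sorted_split_letter[of "sort b2" x] c\<rho> by (simp add: w2_def \<rho>_def)
  qed
  have sw2: "sorted w2" "\<forall>y\<in>set w2. x < y" 
    unfolding w2_def by (simp_all add: sorted_wrt_filter)
  have \<rho>w: "\<rho> = replicate_mset e x + mset w2" using arg_cong[OF sb2, of mset] by (simp add: \<rho>_def)
  have cw2: "count (mset w2) x = 0" using sw2(2) by (auto simp: count_eq_zero_iff)
  define u0 where "u0 = p @ replicate a x"
  have lu0: "length u0 = length p + a" by (simp add: u0_def)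
  define t where "t = p @ replicate (a + e) x @ w2"
  have t_alt: "t = u0 @ (replicate e x @ w2)" by (simp add: t_def u0_def replicate_add)
  have s_alt: "s = u0 @ r" using s(3) by (simp add: u0_def)
  have lr: "length r = length b2" using arg_cong[OF b(3), of size] b(1) s(3) l1 by simp
  have lb2: "length b2 = e + length w2" using sb2 by (metis length_append length_replicate length_sort)
  have tl: "length t = n" using sl s_alt lr lb2 by (simp add: t_alt)
  have mt: "mset t = mset u0 + \<rho>" using \<rho>w by (simp add: t_alt)
  have tC: "t \<in> CB n"
  proof -
    have "set t \<subseteq> set s"
    proof
      fix y assume "y \<in> set t"
      then consider "y \<in> set p" | "y = x" "0 < a" | "y \<in> set w2" using e by (auto simp: t_def split: if_splits)
      then show "y \<in> set s"
      proof cases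
        case 3
        then have "y \<in> set b2" by (simp add: w2_def)
        then have "y \<in> set z0" using b(1) by simp
        then show ?thesis using b(3) by (metis mset_eq_setD)
      qed (use s(3) in auto)
    qed
    then show ?thesis using s(1) tl by (auto simp: CB_def hk_words_def)
  qed
  have st: "sorted t"
    using s(2,3) sw2 lt(1) by (auto simp: t_def sorted_append) (meson less_imp_le order_less_trans)+
  have ts: "t < s"
  proof (rule list_less_nth[of t s "length u0"])
    show "length t = length s" using tl sl by simp
    show "length u0 < length s" using s_alt lr lb2 e(1) by simp
    have "t ! length u0 = x" using e(1) by (simp add: t_alt nth_append)
    moreover have "s ! length u0 \<in> set r" using s_alt lr lb2 e(1) by (simp add: nth_append)
    ultimately show "t ! length u0 < s ! length u0" using lt(2) by simp
  qed (simp add: t_alt s_alt nth_append)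
  have CBu: "u0 @ z2 \<in> CB n" if "mset z2 = \<rho>" for z2 using CB_mset[OF tC] mt that by simp
  have CBp: "p @ y1 @ y2 \<in> CB n" if "mset y1 = \<kappa>" "mset y2 = \<rho>" for y1 y2
    using CB_mset[OF s(1), of "p @ y1 @ y2"] that tot s(3) by simp
  define b1' where "b1' = sort b1"
  have lb1': "length b1' = a" "mset b1' = \<kappa>" using l1 b(2) by (auto simp: b1'_def)
  define h where "h = mk (CB n) {[]} (\<lambda>z _. if take (length u0) z = u0 \<and> mset (drop (length u0) z) = \<rho>
    then cf m (p @ b1' @ drop (length u0) z) else 0)"
  have hV: "h \<in> V0" by (simp add: h_def)
  have hcf: "cf h (u0 @ z2) = cf m (p @ b1' @ z2)" if "mset z2 = \<rho>" for z2 using CBu[OF that] that by (simp add: h_def)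
  have hform: "\<exists>z2. z = u0 @ z2 \<and> mset z2 = \<rho>" if "cf h z \<noteq> 0" for z
    using that by (auto simp: h_def split: if_splits) (metis append_take_drop_id)
  have hwh: "hw s h"
    unfolding hw_def
  proof (intro conjI hV allI impI)
    fix j assume j: "Suc j < n" "s ! j = s ! Suc j"
    have ev: "T0 (Suc j) * m = cc q (s ! j) \<bullet> m" using m(1) j by (simp add: hw_def)
    note evm = ev[unfolded eigen_iff[OF mV j(1)]]
    have reg: "Suc j < length u0 \<or> length u0 \<le> j" using block_region[OF s(3) lt, of j] j sl lu0 by auto
    show "T0 (Suc j) * h = cc q (s ! j) \<bullet> h"
      unfolding eigen_iff[OF hV j(1)]
    proof (intro ballI conjI impI)
      fix z assume z: "z \<in> CB n" "z ! j < z ! Suc j"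
      have lz: "length z = n" using CB_length[OF z(1)] .
      show "cf h (sw j z) = cc q (s ! j) / q * cf h z"
      proof (cases "Suc j < length u0")
        case True
        have no: "cf h y = 0" if "y ! j \<noteq> y ! Suc j" for y
        proof (rule ccontr)
          assume "cf h y \<noteq> 0"
          then obtain z2 where "y = u0 @ z2" using hform by blast
          then show False using that j(2) True by (simp add: s_alt nth_append)
        qed
        have "cf h z = 0" using no z(2) by simp
        moreover have "cf h (sw j z) = 0" using no[of "sw j z"] z(2) nth_sw[of j z] j(1) lz by auto
        ultimately show ?thesis by simp
      next
        case False
        then have jl: "length u0 \<le> j" using reg by blast
        define k where "k = j - length u0"
        have jk: "j = length u0 + k" using jl by (simp add: k_def)
        show ?thesis
        proof (cases "take (length u0) z = u0 \<and> mset (drop (length u0) z) = \<rho>")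
          case True
          define z2 where "z2 = drop (length u0) z"
          have zz: "z = u0 @ z2" "mset z2 = \<rho>" using True by (auto simp: z2_def) (metis append_take_drop_id)
          have k: "Suc k < length z2" using j(1) lz zz(1) jk by simp
          have swz: "sw j z = u0 @ sw k z2" using sw_append_right[OF k, of u0] zz(1) jk by simp
          let ?y = "p @ b1' @ z2"
          have yC: "?y \<in> CB n" using CBp lb1'(2) zz(2) by blast
          have L: "length (p @ b1') = length u0" using lb1' lu0 by simp
          have swy: "sw j ?y = p @ b1' @ sw k z2" using sw_append_right[OF k, of "p @ b1'"] L jk by simp
          have ny: "?y ! j = z ! j" "?y ! Suc j = z ! Suc j"
            using nth_append[of "p @ b1'" z2] nth_append[of u0 z2] zz(1) L jk by auto
          have "cf m (sw j ?y) = cc q (s ! j) / q * cf m ?y" using evm yC ny z(2) by auto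
          then show ?thesis using hcf[OF zz(2)] hcf[of "sw k z2"] zz swz swy k by simp
        next
          case False
          have "cf h z = 0" using False z(1) by (auto simp: h_def)
          moreover have "cf h (sw j z) = 0"
          proof (rule ccontr)
            assume "cf h (sw j z) \<noteq> 0"
            then obtain z2 where zz: "sw j z = u0 @ z2" "mset z2 = \<rho>" using hform by blast
            have k: "Suc k < length z2" using j(1) lz arg_cong[OF zz(1), of length] jk by simp
            have "z = sw j (u0 @ z2)" using zz(1) sw_sw[of j z] j(1) lz by simp
            then have "z = u0 @ sw k z2" using sw_append_right[OF k, of u0] jk by simp
            then show False using False zz(2) k by simp
          qed
          ultimately show ?thesis by simp
        qed
      qed
    next
      fix z assume z: "z \<in> CB n" "z ! j = z ! Suc j" "cc q (z ! j) \<noteq> cc q (s ! j)"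
      show "cf h z = 0"
      proof (rule ccontr)
        assume nz: "cf h z \<noteq> 0"
        then obtain z2 where zz: "z = u0 @ z2" "mset z2 = \<rho>" using hform by blast
        show False
        proof (cases "Suc j < length u0")
          case True
          then have "z ! j = s ! j" by (simp add: zz(1) s_alt nth_append)
          then show False using z(3) by simp
        next
          case False
          then have jl: "length u0 \<le> j" using reg by blast
          let ?y = "p @ b1' @ z2"
          have yC: "?y \<in> CB n" using CBp lb1'(2) zz(2) by blast
          have L: "length (p @ b1') = length u0" using lb1' lu0 by simp
          have ny: "?y ! j = z ! j" "?y ! Suc j = z ! Suc j"
            using nth_append[of "p @ b1'" z2] nth_append[of u0 z2] zz(1) L jl by auto
          have "cf m ?y = 0" using evm yC ny z(2,3) by auto
          then show False using nz hcf[OF zz(2)] zz(1) by simp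
        qed
      qed
    qed
  qed
  define \<mu> where "\<mu> = \<kappa> + replicate_mset e x"
  have s\<mu>: "size \<mu> = a + e" using e(3) by (simp add: \<mu>_def)
  define v where "v = mk (CB n) {[]} (\<lambda>z _. if take (length p) z = p \<and> drop (length p + (a + e)) z = w2 \<and>
      mset (take (a + e) (drop (length p) z)) = \<mu> then ?\<gamma> ^ ninv (take (a + e) (drop (length p) z)) else 0)"
  have vV: "v \<in> V0" by (simp add: v_def)
  have CBv: "p @ u @ w2 \<in> CB n" if "mset u = \<mu>" for u
    using CB_mset[OF s(1), of "p @ u @ w2"] that tot s(3) \<rho>w by (simp add: \<mu>_def add.assoc)
  have lu: "length u = a + e" if "mset u = \<mu>" for u using that s\<mu> by (metis size_mset)
  have vcf: "cf v (p @ u @ w2) = ?\<gamma> ^ ninv u" if "mset u = \<mu>" for u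
    using CBv[OF that] lu[OF that] that by (simp add: v_def)
  have vform: "\<exists>u. z = p @ u @ w2 \<and> mset u = \<mu>" if "cf v z \<noteq> 0" for z
  proof -
    let ?u = "take (a + e) (drop (length p) z)"
    have a: "take (length p) z = p" "drop (length p + (a + e)) z = w2" "mset ?u = \<mu>"
      using that by (auto simp: v_def split: if_splits)
    have "z = take (length p) z @ ?u @ drop (length p + (a + e)) z" by (metis add.commute append_take_drop_id drop_drop)
    then show ?thesis using a by auto
  qed
  have hwv: "hw t v"
    unfolding hw_def
  proof (intro conjI vV allI impI)
    fix j assume j: "Suc j < n" "t ! j = t ! Suc j"
    have reg: "Suc j < length p \<or> (length p \<le> j \<and> Suc j < length p + (a + e)) \<or> length p + (a + e) \<le> j"
      using block_region[OF t_def lt(1) sw2(2), of j] j tl by auto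
    have outer: "y ! j = t ! j \<and> y ! Suc j = t ! Suc j" if y: "cf v y \<noteq> 0" and jo: "Suc j < length p \<or> length p + (a + e) \<le> j" for y
    proof -
      obtain u where u: "y = p @ u @ w2" "mset u = \<mu>" using vform[OF y] by blast
      show ?thesis using jo lu[OF u(2)] by (auto simp: u(1) t_def nth_append)
    qed
    show "T0 (Suc j) * v = cc q (t ! j) \<bullet> v"
      unfolding eigen_iff[OF vV j(1)]
    proof (intro ballI conjI impI)
      fix z assume z: "z \<in> CB n" "z ! j < z ! Suc j"
      have lz: "length z = n" using CB_length[OF z(1)] .
      show "cf v (sw j z) = cc q (t ! j) / q * cf v z"
      proof (cases "Suc j < length p \<or> length p + (a + e) \<le> j")
        case True
        have no: "cf v y = 0" if "y ! j \<noteq> y ! Suc j" for y using outer[OF _ True, of y] that j(2) by metis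
        have "cf v z = 0" using no z(2) by simp
        moreover have "cf v (sw j z) = 0" using no[of "sw j z"] z(2) j(1) nth_sw[of j z] lz by simp
        ultimately show ?thesis by simp
      next
        case False
        then have jr: "length p \<le> j" "Suc j < length p + (a + e)" using reg by auto
        define k where "k = j - length p"
        have jk: "j = length p + k" "Suc k < a + e" using jr by (auto simp: k_def)
        have tj: "t ! j = x" using jk by (simp add: t_def nth_append)
        have swf: "sw j (p @ u @ w2) = p @ sw k u @ w2" if "mset u = \<mu>" for u
          using sw_append_right[of k "u @ w2" p] sw_append_left[of k u w2] lu[OF that] jk by simp
        show ?thesis
        proof (cases "\<exists>u. z = p @ u @ w2 \<and> mset u = \<mu>")
          case True
          then obtain u where u: "z = p @ u @ w2" "mset u = \<mu>" by blast
          have lk: "Suc k < length u" using lu[OF u(2)] jk by simp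
          have zu: "z ! j = u ! k" "z ! Suc j = u ! Suc k" using lk jk by (auto simp: u(1) nth_append)
          have "sw k u ! Suc k < sw k u ! k" using z(2) zu nth_sw[of k u] lk by simp
          then have "ninv (sw k u) = Suc (ninv u)" using inv_sw[of k "sw k u"] lk by simp
          then show ?thesis using vcf[OF u(2)] vcf[of "sw k u"] u lk swf[OF u(2)] tj by simp
        next
          case False
          have "cf v z = 0" using vform False by blast
          moreover have "cf v (sw j z) = 0"
          proof (rule ccontr)
            assume "cf v (sw j z) \<noteq> 0"
            then obtain u where u: "sw j z = p @ u @ w2" "mset u = \<mu>" using vform by blast
            have "z = sw j (p @ u @ w2)" using u(1) sw_sw[of j z] j(1) lz by simp
            then have "z = p @ sw k u @ w2" using swf[OF u(2)] by simp
            moreover have "mset (sw k u) = \<mu>" using u(2) lu[OF u(2)] jk by simp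
            ultimately show False using False by blast
          qed
          ultimately show ?thesis by simp
        qed
      qed
    next
      fix z assume z: "z \<in> CB n" "z ! j = z ! Suc j" "cc q (z ! j) \<noteq> cc q (t ! j)"
      show "cf v z = 0"
      proof (rule ccontr)
        assume nz: "cf v z \<noteq> 0"
        then obtain u where u: "z = p @ u @ w2" "mset u = \<mu>" using vform by blast
        show False
        proof (cases "Suc j < length p \<or> length p + (a + e) \<le> j")
          case True
          then show False using outer[OF nz True] z(3) by simp
        next
          case False
          then have jr: "length p \<le> j" "Suc j < length p + (a + e)" using reg by auto
          define k where "k = j - length p"
          have jk: "j = length p + k" "Suc k < length u" using jr lu[OF u(2)] by (auto simp: k_def)
          have tj: "t ! j = x" using jk lu[OF u(2)] by (simp add: t_def nth_append)
          define y where "y = z ! j"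
          have zu: "u ! k = y" "u ! Suc k = y" using jk z(2) by (auto simp: u(1) nth_append y_def)
          \<comment> \<open>A repeated letter other than \<open>x\<close> is already repeated in
            \<open>\<kappa>\<close>, where a nonzero coefficient of \<open>m\<close> forces it to
            have the eigenvalue of \<open>x\<close>. This makes \<open>v\<close> satisfy the
            vanishing condition of an eigenvector.\<close>
          have "y \<noteq> x" using z(3) tj y_def by auto
          obtain pre x' y' post where "u = pre @ x' # y' # post" "u ! k = x'" "u ! Suc k = y'" using sw_split[OF jk(2)] by metis
          then have "2 \<le> count (mset u) y" using zu by simp
          then have "2 \<le> count (mset b1) y" using u(2) b(2) \<open>y \<noteq> x\<close> by (simp add: \<mu>_def)
          then have "cc q y = cc q x"
            using hw_block_match[OF m(1) sl s(3), of b1 b2 y] z0 b(1) l1 mV MtD[of m "CB n" "{[]}" z0 "[]"] by blast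
          then show False using z(3) tj y_def by simp
        qed
      qed
    qed
  qed
  define g where "g = homv T0 n t v"
  have g: "g \<in> hhom n (CB n) T0 (CB n) T0" "g * mu t [] = v"
    unfolding g_def using homv(1,2)[OF hmod_TC tC st vV] hwv by (auto simp: hw_def)
  have gM: "g \<in> Mt (CB n) (CB n)" using hhom_Mt[OF g(1)] .
  define V where "V = (\<lambda>z2. g * mu (u0 @ z2) [])"
  define C where "C = (\<lambda>y. \<exists>y1 y2. y = p @ y1 @ y2 \<and> length y1 = a \<and> mset y = mset s \<and>
        count (mset y2) x \<le> e \<and> (count (mset y2) x = e --> mset y1 = \<kappa>))"
  have VV: "V z2 \<in> V0" if "mset z2 = \<rho>" for z2
    unfolding V_def using Mt_mult[OF gM mu_Mt[OF CBu[OF that]]] by simp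
  \<comment> \<open>For the sorted tail the image under \<open>g\<close> is \<open>v\<close> itself.
    Any other tail is reached by generators acting to the right of the block, which change neither
    the block segment \<open>y1\<close> nor the letters of the tail. On words with block content
    \<open>\<kappa>\<close> the map \<open>g\<close> thus leaves the tail as it is.\<close>
  have key: "(\<forall>y. cf (V z2) y \<noteq> 0 --> C y) \<and>
      (\<forall>y1 y2. mset y1 = \<kappa> --> cf (V z2) (p @ y1 @ y2) = (if y2 = z2 then ?\<gamma> ^ (ninv y1 + e * e) else 0))"
    if "mset z2 = \<rho>" for z2
    using that
  proof (induction "ninv z2" arbitrary: z2 rule: less_induct)
    case less
    note z2 = less.prems
    show ?case
    proof (cases "\<exists>k. Suc k < length z2 \<and> z2 ! Suc k < z2 ! k")
      case False
      then have "sorted z2" using sorted_no_desc[of z2] by (metis not_le)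
      then have z2e: "z2 = replicate e x @ w2" using z2 sb2 by (metis \<rho>_def properties_for_sort)
      have Vv: "V z2 = v" using g(2) by (simp add: V_def z2e t_alt)
      have "C y" if nzy: "cf v y \<noteq> 0" for y
      proof -
        obtain u where u: "y = p @ u @ w2" "mset u = \<mu>" using vform[OF nzy] by blast
        define u1 where "u1 = take a u"
        define u2 where "u2 = drop a u"
        have uu: "u = u1 @ u2" "length u1 = a" "length u2 = e" using lu[OF u(2)] by (auto simp: u1_def u2_def)
        have my: "mset y = mset s" using u tot s(3) \<rho>w by (simp add: \<mu>_def add.assoc)
        have c2: "count (mset u2) x \<le> e" using count_le_length[of u2 x] uu(3) by simp
        have "mset u1 = \<kappa>" if "count (mset u2) x = e"
        proof -
          have "mset u2 = replicate_mset e x" using count_eq_length_replicate[of u2 x] that uu(3) by (metis mset_replicate)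
          then show ?thesis using u(2) uu(1) by (simp add: \<mu>_def)
        qed
        moreover have cu: "count (mset (u2 @ w2)) x = count (mset u2) x" using cw2 by simp
        ultimately have "y = p @ u1 @ (u2 @ w2) \<and> length u1 = a \<and> mset y = mset s \<and> count (mset (u2 @ w2)) x \<le> e \<and>
            (count (mset (u2 @ w2)) x = e --> mset u1 = \<kappa>)"
          unfolding cu using u(1) uu(1,2) my c2 by simp
        then show ?thesis unfolding C_def by blast
      qed
      moreover have "cf v (p @ y1 @ y2) = (if y2 = z2 then ?\<gamma> ^ (ninv y1 + e * e) else 0)" if y1: "mset y1 = \<kappa>" for y1 y2
      proof -
        have ly1: "length y1 = a" using y1 e(3) by (metis size_mset)
        show ?thesis
        proof (cases "y2 = z2")
          case True
          have mu: "mset (y1 @ replicate e x) = \<mu>" using y1 by (simp add: \<mu>_def)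
          \<comment> \<open>Of the \<open>a\<close> letters of \<open>y1\<close>,
            \<open>a - e\<close> equal \<open>x\<close>, and the other \<open>e\<close> exceed it.
            Each of these is inverted with each of the \<open>e\<close> appended copies of
            \<open>x\<close>, whence the exponent \<open>e * e\<close>.\<close>
          have "length (filter (\<lambda>y. x < y) y1) = e"
            using count_filter_greater[of y1 x] ge y1 e ly1 by fastforce
          moreover have "x \<le> y" if "y \<in> set y1" for y using ge that y1 by auto
          ultimately have "ninv (y1 @ replicate e x) = ninv y1 + e * e" using inv_append_replicate[of y1 x e] by simp
          then show ?thesis using vcf[OF mu] True z2e by simp
        next
          case False
          have "cf v (p @ y1 @ y2) = 0"
          proof (rule ccontr)
            assume "cf v (p @ y1 @ y2) \<noteq> 0"
            then obtain u where u: "y1 @ y2 = u @ w2" "mset u = \<mu>" using vform by auto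
            have "take a u = y1" using arg_cong[OF u(1), of "take a"] ly1 lu[OF u(2)] by simp
            then have ud: "u = y1 @ drop a u" by (metis append_take_drop_id)
            then have "mset u = \<kappa> + mset (drop a u)" using y1 by (metis mset_append)
            then have "mset (drop a u) = replicate_mset e x" using u(2) by (simp add: \<mu>_def)
            then have "drop a u = replicate e x"
              using count_eq_length_replicate[of "drop a u" x] lu[OF u(2)] by simp
            then have "y2 = z2" using u(1) ud z2e by (metis append.assoc same_append_eq)
            then show False using False by simp
          qed
          then show ?thesis using False by simp
        qed
      qed
      ultimately show ?thesis unfolding Vv by blast
    next
      case True
      then obtain k where k: "Suc k < length z2" "z2 ! Suc k < z2 ! k" by blast
      define z' where "z' = sw k z2"
      have z'\<rho>: "mset z' = \<rho>" using z2 k by (simp add: z'_def)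
      have iz: "ninv z' < ninv z2" using inv_sw[OF k] by (simp add: z'_def)
      have nz': "z' ! k = z2 ! Suc k" "z' ! Suc k = z2 ! k" using nth_sw[of k z2] k by (auto simp: z'_def)
      have swz': "sw k z' = z2" using k by (simp add: z'_def)
      let ?j = "length u0 + k"
      have l2: "length u0 + length z2 = n" using CB_length[OF CBu[OF z2]] by simp
      have jn: "Suc ?j < n" using k l2 by simp
      have lz': "length z' = length z2" by (simp add: z'_def)
      have "T0 (Suc ?j) * mu (u0 @ z') [] = mu (u0 @ z2) []"
        using TC_mu[OF CBu[OF z'\<rho>] jn, of q "[]"] nz' k sw_append_right[of k z' u0] swz' lz' by (simp add: nth_append)
      then have VT: "V z2 = T0 (Suc ?j) * V z'"
        unfolding V_def using hhom_comm[OF g(1) jn] by (metis mult.assoc)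
      note IH = less.hyps[OF iz z'\<rho>]
      have swp: "sw ?j (p @ y1 @ y2) = p @ y1 @ sw k y2" if "length y1 = a" "Suc k < length y2" for y1 y2
        using sw_append_right[OF that(2), of "p @ y1"] that(1) lu0 by simp
      have Csw: "C (sw ?j y) \<longleftrightarrow> C y" if ly: "length y = n" for y
      proof -
        have *: "C (sw ?j y)" if "C y" "length y = n" for y
        proof -
          obtain y1 y2 where y: "y = p @ y1 @ y2" "length y1 = a" "mset y = mset s" "count (mset y2) x \<le> e" "count (mset y2) x = e --> mset y1 = \<kappa>"
            using \<open>C y\<close> unfolding C_def by blast
          have k2: "Suc k < length y2" using jn that(2) y(1,2) lu0 by simp
          have "mset (sw ?j y) = mset s" using y(3) jn that(2) by simp
          then have "sw ?j y = p @ y1 @ sw k y2 \<and> length y1 = a \<and> mset (sw ?j y) = mset s \<and>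
              count (mset (sw k y2)) x \<le> e \<and> (count (mset (sw k y2)) x = e --> mset y1 = \<kappa>)"
            using y swp[OF y(2) k2] k2 by simp
          then show ?thesis unfolding C_def by blast
        qed
        show ?thesis using *[of y] *[of "sw ?j y"] ly jn by auto
      qed
      have CBC: "length y = n" if "y \<in> CB n" for y using CB_length[OF that] .
      have 1: "C y" if nz: "cf (V z2) y \<noteq> 0" for y
      proof -
        have yC: "y \<in> CB n" using nz VV[OF z2] by (metis Mt_zero)
        have "cf (V z') y \<noteq> 0 \<or> cf (V z') (sw ?j y) \<noteq> 0"
          using nz unfolding VT TC_coeff[OF VV[OF z'\<rho>] yC jn] by (auto split: if_splits)
        then show "C y" using IH Csw[OF CBC[OF yC]] by blast
      qed
      have 2: "cf (V z2) (p @ y1 @ y2) = (if y2 = z2 then ?\<gamma> ^ (ninv y1 + e * e) else 0)" if y1: "mset y1 = \<kappa>" for y1 y2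
      proof (cases "p @ y1 @ y2 \<in> CB n")
        case False
        then have "y2 \<noteq> z2" using CBp[OF y1 z2] by auto
        moreover have "cf (V z2) (p @ y1 @ y2) = 0" using False Mt_zero[OF VV[OF z2]] by blast
        ultimately show ?thesis by simp
      next
        case True
        have ly1: "length y1 = a" using y1 e(3) by (metis size_mset)
        have ly2: "length y2 = length z2" using CB_length[OF True] l2 lu0 ly1 by simp
        have k2: "Suc k < length y2" using ly2 k by simp
        let ?y = "p @ y1 @ y2"
        have ny: "?y ! ?j = y2 ! k" "?y ! Suc ?j = y2 ! Suc k"
          using nth_append[of "p @ y1" y2] ly1 lu0 by auto
        have c1: "cf (V z') ?y = (if y2 = z' then ?\<gamma> ^ (ninv y1 + e * e) else 0)" using IH y1 by blast
        have c2: "cf (V z') (sw ?j ?y) = (if sw k y2 = z' then ?\<gamma> ^ (ninv y1 + e * e) else 0)"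
          using IH y1 swp[OF ly1 k2] by simp
        have eq: "sw k y2 = z' \<longleftrightarrow> y2 = z2" using sw_sw[OF k2] sw_sw[OF k(1)] by (metis z'_def)
        have i1: "y2 \<noteq> z'" if "\<not> y2 ! k < y2 ! Suc k" using that nz' k(2) by auto
        have i2: "y2 \<noteq> z2" if "\<not> y2 ! Suc k < y2 ! k" using that k(2) by auto
        show ?thesis
          unfolding VT TC_coeff[OF VV[OF z'\<rho>] True jn] ny c1 c2 eq using i1 i2 by (auto simp del: power_add)
      qed
      show ?thesis using 1 2 by blast
    qed
  qed
  have gh: "g * h = (\<Sum>z\<in>CB n. cf h z \<bullet> (g * mu z []))"
  proof -
    have "h = (\<Sum>z\<in>CB n. \<Sum>w\<in>{[]}. ent h z w \<bullet> mu z w)" by (rule Mt_expand) (use hV in auto)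
    then have "g * h = g * (\<Sum>z\<in>CB n. cf h z \<bullet> mu z [])" by simp
    then show ?thesis by (simp add: sum_distrib_left)
  qed
  have 1: "C y" if nz: "cf (g * h) y \<noteq> 0" for y
  proof -
    have "(\<Sum>z\<in>CB n. cf h z * cf (g * mu z []) y) \<noteq> 0" using nz by (simp add: gh ent_sum)
    then obtain z where z: "z \<in> CB n" "cf h z * cf (g * mu z []) y \<noteq> 0" by (rule sum.not_neutral_contains_not_neutral)
    then obtain z2 where "z = u0 @ z2" "mset z2 = \<rho>" using hform[of z] by auto
    then show ?thesis using key[of z2] z(2) by (auto simp: V_def)
  qed
  have 2: "cf (g * h) (p @ y1 @ y2) = ?\<gamma> ^ (e * e) * cf m (p @ y1 @ y2)" if y1: "mset y1 = \<kappa>" for y1 y2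
  proof -
    have ly1: "length y1 = a" using y1 e(3) by (metis size_mset)
    let ?y = "p @ y1 @ y2"
    have trm: "cf h z * cf (g * mu z []) ?y = (if z = u0 @ y2 then cf h z * ?\<gamma> ^ (ninv y1 + e * e) else 0)" for z
    proof (cases "cf h z = 0")
      case False
      then obtain z2 where zz: "z = u0 @ z2" "mset z2 = \<rho>" using hform[of z] by auto
      then show ?thesis using key[OF zz(2)] y1 by (simp add: V_def)
    qed auto
    have "cf (g * h) ?y = (\<Sum>z\<in>CB n. if z = u0 @ y2 then cf h z * ?\<gamma> ^ (ninv y1 + e * e) else 0)"
      by (simp add: gh ent_sum trm)
    also have "... = cf h (u0 @ y2) * ?\<gamma> ^ (ninv y1 + e * e)" using Mt_zero[OF hV, of "u0 @ y2" "[]"] by simp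
    also have "... = ?\<gamma> ^ (e * e) * cf m ?y"
    proof (cases "mset y2 = \<rho>")
      case True
      have yC: "?y \<in> CB n" using CBp[OF y1 True] .
      have "sort y1 = b1'" using y1 b(2) by (metis b1'_def mset_sort properties_for_sort sorted_sort)
      then have "cf m ?y = ?\<gamma> ^ ninv y1 * cf m (p @ b1' @ y2)" using hw_block[OF m(1) sl s(3) yC ly1] by simp
      then show ?thesis using hcf[OF True] by (simp add: power_add)
    next
      case False
      have "cf h (u0 @ y2) = 0" using False hform[of "u0 @ y2"] by auto
      moreover have "cf m ?y = 0"
      proof (rule ccontr)
        assume "cf m ?y \<noteq> 0"
        then have "mset ?y = mset s" using supp by blast
        then have "mset ?y = mset (p @ b1 @ b2)" using b(1,3) by metis
        then have "mset y2 = \<rho>" using y1 b(2) by (simp add: \<rho>_def)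
        then show False using False by simp
      qed
      ultimately show ?thesis by simp
    qed
    finally show ?thesis .
  qed
  have ht: "\<forall>z. cf h z \<noteq> 0 --> mset z = mset t" using hform mt by fastforce
  have c0: "?\<gamma> ^ (e * e) \<noteq> 0" using \<gamma>0 by simp
  have fin1: "\<forall>y. cf (g * h) y \<noteq> 0 --> C y" and fin2: "\<forall>y1 y2. mset y1 = \<kappa> --> cf (g * h) (p @ y1 @ y2) = ?\<gamma> ^ (e * e) * cf m (p @ y1 @ y2)"
    using 1 2 by blast+
  show ?thesis
    by (rule exI[of _ g], rule exI[of _ h], rule exI[of _ t], rule exI[of _ "?\<gamma> ^ (e * e)"])
      (intro conjI g(1) tC st ts hwh ht c0 fin1[unfolded C_def] fin2)
qed

end

lemma filter_less_Suc:
  assumes "sorted (s :: nat list)"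
  shows "filter (\<lambda>y. y < Suc x) s = filter (\<lambda>y. y < x) s @ replicate (count (mset s) x) x"
proof -
  have "filter (\<lambda>y. y < Suc x) (filter (\<lambda>y. y < x) s @ replicate (count (mset s) x) x @ filter (\<lambda>y. x < y) s)
    = filter (\<lambda>y. y < x) s @ replicate (count (mset s) x) x"
    by (auto simp: filter_empty_conv intro!: filter_cong)
  then show ?thesis using sorted_split_letter[OF assms, of x] by metis
qed

context
  fixes q :: "'k::field" and n :: nat
  assumes q: "q \<noteq> 0"
begin

abbreviation (input) "VC \<equiv> Mt (CB n) {[]} :: 'k fmat set"
abbreviation (input) "TQ \<equiv> TC q n"
abbreviation (input) "SC \<equiv> hhom n (CB n) TQ (CB n) TQ"

text \<open>The images of \<open>s\<close> under endomorphisms of \<open>C\<close> that pass through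
  a lexicographically smaller weight \<open>t\<close>.\<close>

definition Sg :: "nat list => 'k fmat set"
  where "Sg s = {g * h | g h. g \<in> SC \<and> hw q n s h \<and>
    (\<exists>t. t \<in> CB n \<and> sorted t \<and> t < s \<and> (\<forall>z. cf h z \<noteq> 0 --> mset z = mset t))}"

definition wt :: "nat list => 'k fmat => bool" where "wt s m \<longleftrightarrow> (\<forall>z. cf m z \<noteq> 0 --> mset z = mset s)"

text \<open>Modulo smaller weights the weight of \<open>s\<close> has only scalar endomorphisms. The
  outer induction goes down the letters: a vector whose words all begin with the letters of
  \<open>s\<close> below \<open>x\<close> is reduced to one whose words also contain the complete
  block of \<open>x\<close> in its place; for \<open>x = 2 * n\<close> only \<open>s\<close> itself
  is left. The inner induction is on a bound for the number of letters \<open>x\<close> in the tail,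
  where \<open>hw_reduce\<close> removes the top layer.\<close>

lemma hw_span:
  assumes s: "s \<in> CB n" "sorted s" and m: "hw q n s m" "wt s m"
  shows "m \<in> fm.span (insert (mu s []) (Sg s))"
proof -
  let ?G = "fm.span (insert (mu s []) (Sg s))"
  have sl: "length s = n" using CB_length[OF s(1)] .
  define p where "p = (\<lambda>x. filter (\<lambda>y. y < x) s)"
  define pure where "pure = (\<lambda>x (m :: 'k fmat). \<forall>z. cf m z \<noteq> 0 --> (\<exists>z'. z = p x @ z'))"
  have main: "\<forall>m. hw q n s m --> wt s m --> pure x m --> m \<in> ?G" if "x \<le> 2 * n" for x
    using that
  proof (induction rule: inc_induct)
    case base
    have ps: "p (2 * n) = s" unfolding p_def using s(1) by (auto simp: filter_id_conv CB_def hk_words_def)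
    show ?case
    proof (intro allI impI)
      fix m assume a: "hw q n s m" "wt s m" "pure (2 * n) m"
      have mV: "m \<in> VC" using a(1) by (simp add: hw_def[OF q])
      have "z = s" if nz: "cf m z \<noteq> 0" for z
      proof -
        obtain z' where z': "z = s @ z'" using a(3) nz ps unfolding pure_def by auto
        have "length z = n" using MtD[OF mV nz] CB_length by blast
        then show ?thesis using z' sl by simp
      qed
      then have zero: "cf m z = 0" if "z \<noteq> s" for z using that by blast
      have "m = cf m s \<bullet> mu s []"
      proof (rule Mt_eqI[OF mV])
        show "cf m s \<bullet> mu s [] \<in> VC" by (intro Mt_scale mu_Mt s(1)) simp
      qed (use zero in auto)
      moreover have "cf m s \<bullet> mu s [] \<in> ?G" by (intro fm.span_scale fm.span_base) simp
      ultimately show "m \<in> ?G" by simp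
    qed
  next
    case (step x)
    note IHx = step.IH
    define a where "a = count (mset s) x"
    define r where "r = filter (\<lambda>y. x < y) s"
    have sp: "s = p x @ replicate a x @ r" using sorted_split_letter[OF s(2), of x] by (simp add: p_def a_def r_def)
    have lt: "\<forall>y\<in>set (p x). y < x" "\<forall>y\<in>set r. x < y" by (auto simp: p_def r_def)
    have pS: "p (Suc x) = p x @ replicate a x" unfolding p_def a_def using filter_less_Suc[OF s(2)] .
    let ?l = "length (p x)"
    have la: "?l + a \<le> n" using sp sl by (metis le_add1 length_append length_replicate add.assoc)
    have dec: "z = take ?l z @ take a (drop ?l z) @ drop (?l + a) z" for z :: "nat list"
      by (metis add.commute append_take_drop_id drop_drop)
    have cnt: "count (mset (take a (drop ?l z))) x + count (mset (drop (?l + a) z)) x = a"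
      if z: "mset z = mset s" "take ?l z = p x" for z
    proof -
      have "count (mset z) x = count (mset (p x)) x + count (mset (take a (drop ?l z))) x + count (mset (drop (?l + a) z)) x"
        using arg_cong[OF dec[of z], of "\<lambda>z. count (mset z) x"] z(2) by (simp only: mset_append count_union add.assoc)
      moreover have "count (mset (p x)) x = 0" using lt(1) by (auto simp: count_eq_zero_iff)
      ultimately show ?thesis using z(1) a_def by simp
    qed
    have inner: "\<forall>m. hw q n s m --> wt s m --> pure x m -->
        (\<forall>z. cf m z \<noteq> 0 --> count (mset (drop (?l + a) z)) x \<le> e) --> m \<in> ?G" for e
    proof (induction e)
      case 0
      show ?case
      proof (intro allI impI)
        fix m assume a1: "hw q n s m" "wt s m" "pure x m" "\<forall>z. cf m z \<noteq> 0 --> count (mset (drop (?l + a) z)) x \<le> 0"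
        have mV: "m \<in> VC" using a1(1) by (simp add: hw_def[OF q])
        have "pure (Suc x) m" unfolding pure_def
        proof (intro allI impI)
          fix z assume nz: "cf m z \<noteq> 0"
          have lz: "length z = n" using MtD[OF mV nz] CB_length by blast
          have tz: "take ?l z = p x" using a1(3) nz unfolding pure_def by auto
          have mz: "mset z = mset s" using a1(2) nz unfolding wt_def by blast
          have "count (mset (drop (?l + a) z)) x = 0" using a1(4) nz by blast
          then have "count (mset (take a (drop ?l z))) x = a" using cnt[OF mz tz] by linarith
          moreover have "length (take a (drop ?l z)) = a" using lz la by simp
          ultimately have "take a (drop ?l z) = replicate a x" using count_eq_length_replicate[of "take a (drop ?l z)" x] by simp
          then have "z = p (Suc x) @ drop (?l + a) z" using dec[of z] tz pS by simp
          then show "\<exists>z'. z = p (Suc x) @ z'" by blast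
        qed
        then show "m \<in> ?G" using IHx a1(1,2) by blast
      qed
    next
      case (Suc e)
      note IHe = Suc.IH
      show ?case
      proof (intro allI impI)
        fix m assume a1: "hw q n s m" "wt s m" "pure x m" "\<forall>z. cf m z \<noteq> 0 --> count (mset (drop (?l + a) z)) x \<le> Suc e"
        have mV: "m \<in> VC" using a1(1) by (simp add: hw_def[OF q])
        define sg where "sg = (\<lambda>z :: nat list. mset (take a (drop ?l z)))"
        \<comment> \<open>The block contents that occur together with the maximal number
          \<open>Suc e\<close> of letters \<open>x\<close> in the tail. The part of \<open>m\<close>
          with other contents is covered by the inner induction hypothesis.\<close>
        define K where "K = sg ` {z \<in> CB n. cf m z \<noteq> 0 \<and> count (mset (drop (?l + a) z)) x = Suc e}"
        have fK: "finite K" by (simp add: K_def)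
        have sgP: "P (sg (sw j u)) = P (sg u)" if "Suc j < n" "s ! j = s ! Suc j" "u \<in> CB n" for P j u
          using seg_sw[OF q, where z = u and j = j and l = ?l and a = a] block_region[OF q sp lt, of j] that sl la CB_length[OF that(3)] by (simp add: sg_def)
        have rhw: "hw q n s (rest n (\<lambda>z. P (sg z)) * m')" if "hw q n s m'" for P m'
          by (rule hw_rest[OF q that]) (rule sgP)
        have rcf: "cf (rest n P * m') z = (if P z then cf m' z else 0)" if "m' \<in> VC" for P m' z
          using rest_mult[OF that] .
        have msum: "m = rest n (\<lambda>z. sg z \<notin> K) * m + (\<Sum>\<kappa>\<in>K. rest n (\<lambda>z. sg z = \<kappa>) * m)"
        proof (rule Mt_eqI[OF mV])
          show "rest n (\<lambda>z. sg z \<notin> K) * m + (\<Sum>\<kappa>\<in>K. rest n (\<lambda>z. sg z = \<kappa>) * m) \<in> VC"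
            by (intro Mt_add Mt_sum Mt_mult[OF rest_Mt mV])
          fix z and w :: "nat list" assume w: "w \<in> {[]}"
          have "(\<Sum>\<kappa>\<in>K. cf (rest n (\<lambda>z. sg z = \<kappa>) * m) z) = (\<Sum>\<kappa>\<in>K. if sg z = \<kappa> then cf m z else 0)"
            by (simp add: rcf[OF mV])
          also have "... = (if sg z \<in> K then cf m z else 0)" using fK by simp
          finally show "ent m z w = ent (rest n (\<lambda>z. sg z \<notin> K) * m + (\<Sum>\<kappa>\<in>K. rest n (\<lambda>z. sg z = \<kappa>) * m)) z w"
            using w by (simp add: ent_sum rcf[OF mV])
        qed
        have first: "rest n (\<lambda>z. sg z \<notin> K) * m \<in> ?G"
        proof (rule IHe[rule_format])
          show "hw q n s (rest n (\<lambda>z. sg z \<notin> K) * m)" using rhw[OF a1(1), of "\<lambda>k. k \<notin> K"] .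
          show "wt s (rest n (\<lambda>z. sg z \<notin> K) * m)" using a1(2) unfolding wt_def rcf[OF mV] by simp
          show "pure x (rest n (\<lambda>z. sg z \<notin> K) * m)" using a1(3) unfolding pure_def rcf[OF mV] by simp
          fix z assume "cf (rest n (\<lambda>z. sg z \<notin> K) * m) z \<noteq> 0"
          then have nz: "cf m z \<noteq> 0" "sg z \<notin> K" by (auto simp: rcf[OF mV] split: if_splits)
          have "z \<in> CB n" using MtD[OF mV nz(1)] by blast
          then have "count (mset (drop (?l + a) z)) x \<noteq> Suc e" using nz by (auto simp: K_def)
          then show "count (mset (drop (?l + a) z)) x \<le> e" using a1(4) nz(1) le_SucE by blast
        qed
        have second: "rest n (\<lambda>z. sg z = \<kappa>) * m \<in> ?G" if \<kappa>: "\<kappa> \<in> K" for \<kappa>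
        proof -
          define m' where "m' = rest n (\<lambda>z. sg z = \<kappa>) * m"
          have m'V: "m' \<in> VC" unfolding m'_def using Mt_mult[OF rest_Mt mV] .
          have m'hw: "hw q n s m'" unfolding m'_def using rhw[OF a1(1), of "\<lambda>k. k = \<kappa>"] .
          have m'cf: "cf m' z = (if sg z = \<kappa> then cf m z else 0)" for z unfolding m'_def rcf[OF mV] ..
          show ?thesis
          proof (cases "m' = 0")
            case True
            then show ?thesis using fm.span_zero by (simp add: m'_def[symmetric])
          next
            case False
            obtain z0 where z0: "z0 \<in> CB n" "cf m z0 \<noteq> 0" "count (mset (drop (?l + a) z0)) x = Suc e" "\<kappa> = sg z0"
              using \<kappa> by (auto simp: K_def)
            have t0: "take ?l z0 = p x" "mset z0 = mset s" using a1(2,3) z0(2) unfolding pure_def wt_def by auto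
            have c\<kappa>: "count \<kappa> x + Suc e = a" using cnt[OF t0(2,1)] z0(3,4) by (simp add: sg_def)
            have s\<kappa>: "size \<kappa> = a" using z0(4) CB_length[OF z0(1)] la by (simp add: sg_def)
            have supp: "\<exists>z1 z2. z = p x @ z1 @ z2 \<and> mset z1 = \<kappa> \<and> mset z = mset s" if nz: "cf m' z \<noteq> 0" for z
            proof -
              have nz': "cf m z \<noteq> 0" "sg z = \<kappa>" using nz by (auto simp: m'cf split: if_splits)
              then have "take ?l z = p x" "mset z = mset s" using a1(2,3) unfolding pure_def wt_def by auto
              then show ?thesis using dec[of z] nz'(2) unfolding sg_def by metis
            qed
            obtain g h t c where gh: "g \<in> SC" "t \<in> CB n" "sorted t" "t < s" "hw q n s h"
              "\<forall>z. cf h z \<noteq> 0 --> mset z = mset t" "c \<noteq> 0"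
              and g1: "\<forall>y. cf (g * h) y \<noteq> 0 --> (\<exists>y1 y2. y = p x @ y1 @ y2 \<and> length y1 = a \<and> mset y = mset s \<and>
                count (mset y2) x \<le> Suc e \<and> (count (mset y2) x = Suc e --> mset y1 = \<kappa>))"
              and g2: "\<forall>y1 y2. mset y1 = \<kappa> --> cf (g * h) (p x @ y1 @ y2) = c * cf m' (p x @ y1 @ y2)"
              using hw_reduce[OF q s sp lt m'hw False supp zero_less_Suc c\<kappa> s\<kappa>] by metis
            have hV: "h \<in> VC" using gh(5) by (simp add: hw_def[OF q])
            have ghV: "g * h \<in> VC" using Mt_mult[OF hhom_Mt[OF gh(1)] hV] .
            have ghhw: "hw q n s (g * h)" unfolding hw_def[OF q]
            proof (intro conjI ghV allI impI)
              fix j assume j: "Suc j < n" "s ! j = s ! Suc j"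
              have "TQ (Suc j) * (g * h) = g * (TQ (Suc j) * h)" using hhom_comm[OF gh(1) j(1)] by (simp add: mult.assoc[symmetric])
              then show "TQ (Suc j) * (g * h) = cc q (s ! j) \<bullet> (g * h)" using gh(5) j by (simp add: hw_def[OF q])
            qed
            \<comment> \<open>The part of \<open>g * h\<close> away from the block content
              \<open>\<kappa>\<close>; it has at most \<open>e\<close> letters \<open>x\<close> in
              each tail, so the inner induction hypothesis applies.\<close>
            define d where "d = rest n (\<lambda>z. sg z \<noteq> \<kappa>) * (g * h)"
            have dcf: "cf d z = (if sg z \<noteq> \<kappa> then cf (g * h) z else 0)" for z unfolding d_def rcf[OF ghV] ..
            have form: "\<exists>y2. y = p x @ take a (drop ?l y) @ y2 \<and> y2 = drop (?l + a) y \<and> mset y = mset s \<and>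
                count (mset y2) x \<le> Suc e \<and> (count (mset y2) x = Suc e --> sg y = \<kappa>)" if nz: "cf (g * h) y \<noteq> 0" for y
            proof -
              obtain y1 y2 where y: "y = p x @ y1 @ y2" "length y1 = a" "mset y = mset s"
                "count (mset y2) x \<le> Suc e" "count (mset y2) x = Suc e --> mset y1 = \<kappa>" using g1 nz by blast
              have "take a (drop ?l y) = y1" "drop (?l + a) y = y2" using y(1,2) by auto
              then show ?thesis using y by (intro exI[of _ y2]) (simp add: sg_def)
            qed
            have dG: "d \<in> ?G"
            proof (rule IHe[rule_format])
              show "hw q n s d" unfolding d_def using rhw[OF ghhw, of "\<lambda>k. k \<noteq> \<kappa>"] .
              show "wt s d" unfolding wt_def dcf using form by auto
              show "pure x d" unfolding pure_def dcf using form by auto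
              fix z assume "cf d z \<noteq> 0"
              then have nz: "sg z \<noteq> \<kappa>" "cf (g * h) z \<noteq> 0" by (auto simp: dcf split: if_splits)
              then have "count (mset (drop (?l + a) z)) x \<le> Suc e" "count (mset (drop (?l + a) z)) x \<noteq> Suc e"
                using form[OF nz(2)] by auto
              then show "count (mset (drop (?l + a) z)) x \<le> e" by simp
            qed
            have ghG: "g * h \<in> ?G"
              by (rule fm.span_base) (use gh in \<open>auto simp: Sg_def\<close>)
            have "m' = inverse c \<bullet> (g * h - d)"
            proof (rule Mt_eqI[OF m'V])
              show "inverse c \<bullet> (g * h - d) \<in> VC" unfolding d_def
                by (intro Mt_scale Mt_diff ghV Mt_mult[OF rest_Mt ghV])
              fix z and w :: "nat list" assume w: "w \<in> {[]}"
              have "c * cf m' z = cf (g * h) z - cf d z"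
              proof (cases "sg z = \<kappa>")
                case True
                show ?thesis
                proof (cases "take ?l z = p x")
                  case t: True
                  then have "z = p x @ take a (drop ?l z) @ drop (?l + a) z" using dec[of z] by simp
                  then have "cf (g * h) z = c * cf m' z" using g2 True unfolding sg_def by metis
                  then show ?thesis using True by (simp add: dcf)
                next
                  case f: False
                  have np: "z \<noteq> p x @ y" for y using f by auto
                  have "cf (g * h) z = 0" using form[of z] np by blast
                  moreover have "cf m' z = 0" using supp[of z] np by blast
                  ultimately show ?thesis using True by (simp add: dcf)
                qed
              next
                case False
                then show ?thesis by (simp add: dcf m'cf)
              qed
              then show "ent m' z w = ent (inverse c \<bullet> (g * h - d)) z w" using w gh(7) by (simp add: field_simps)
            qed
            then show ?thesis unfolding m'_def[symmetric] using ghG dG by (simp add: fm.span_scale fm.span_diff)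
          qed
        qed
        show "m \<in> ?G" by (subst msum) (intro fm.span_add fm.span_sum first second)
      qed
    qed
    show ?case
    proof (intro allI impI)
      fix m assume a1: "hw q n s m" "wt s m" "pure x m"
      have "\<forall>z. cf m z \<noteq> 0 --> count (mset (drop (?l + a) z)) x \<le> n"
      proof (intro allI impI)
        fix z assume nz: "cf m z \<noteq> 0"
        have "m \<in> VC" using a1(1) by (simp add: hw_def[OF q])
        then have "length z = n" using MtD[OF _ nz] CB_length by blast
        then show "count (mset (drop (?l + a) z)) x \<le> n" using count_le_length[of "drop (?l + a) z" x] by simp
      qed
      then show "m \<in> ?G" using inner[of n] a1 by blast
    qed
  qed
  have "pure 0 m" by (simp add: pure_def p_def)
  then show ?thesis using main[of 0] m by blast
qed

end

section \<open>Self-duality\<close>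

context
  fixes q :: "'k::field" and n :: nat
  assumes q: "q \<noteq> 0"
begin

definition dg :: "(nat list => 'k) => 'k fmat" where "dg d = mk (CB n) (CB n) (\<lambda>u w. if u = w then d u else 0)"

lemma dg_Mt [simp]: "dg d \<in> Mt (CB n) (CB n)" by (simp add: dg_def)

lemma dg_mult: "f \<in> Mt (CB n) A ==> ent (dg d * f) u w = d u * ent f u w"
proof -
  assume f: "f \<in> Mt (CB n) A"
  have "ent (dg d * f) u w = (\<Sum>v\<in>CB n. if v = u then d u * ent f u w else 0)"
    unfolding ent_times[OF finite_CB dg_Mt] by (intro sum.cong refl) (auto simp: dg_def)
  then show ?thesis using Mt_zero[OF f] by simp
qed

lemma mult_dg: "f \<in> Mt A (CB n) ==> ent (f * dg d) u w = ent f u w * d w"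
proof -
  assume f: "f \<in> Mt A (CB n)"
  have "ent (f * dg d) u w = (\<Sum>v\<in>CB n. if v = w then ent f u w * d w else 0)"
    unfolding ent_times'[OF finite_CB dg_Mt] by (intro sum.cong refl) (auto simp: dg_def)
  then show ?thesis using Mt_zero[OF f] by simp
qed

text \<open>Gram matrix of a form on \<open>C\<close> for which the generators are symmetric: they
  take an ascent to a descent with coefficient 1 and back with coefficient \<open>q\<close>, which a
  factor \<open>q\<close> per inversion balances.\<close>

definition Qm :: "'k fmat" where "Qm = dg (\<lambda>u. q ^ ninv u)"
definition Qi :: "'k fmat" where "Qi = dg (\<lambda>u. inverse (q ^ ninv u))"

lemma Q_Mt [simp]: "Qm \<in> Mt (CB n) (CB n)" "Qi \<in> Mt (CB n) (CB n)" by (simp_all add: Qm_def Qi_def)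

lemma QQ: "Qm * Qi = idB (CB n)" "Qi * Qm = idB (CB n)"
  by (rule fmat_eqI; use q in \<open>auto simp: Qm_def Qi_def dg_mult[OF dg_Mt]\<close>; auto simp: dg_def)+

lemma QQ_cancel: "f \<in> Mt (CB n) A ==> Qm * (Qi * f) = f" "f \<in> Mt (CB n) A ==> Qi * (Qm * f) = f"
  by (simp_all add: mult.assoc[symmetric] QQ)

lemma tst_sym:
  assumes "u \<in> CB n" "w \<in> CB n" "Suc j < n"
  shows "q ^ ninv u * tst q (Suc j) u w = tst q (Suc j) w u * q ^ ninv w"
proof (cases "u = w")
  case False
  have len: "length u = n" "length w = n" using assms CB_length by auto
  have iff: "u = sw j w \<longleftrightarrow> w = sw j u" using sw_sw[of j w] sw_sw[of j u] assms(3) len by metis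
  show ?thesis
  proof (cases "u = sw j w")
    case True
    then have w: "w = sw j u" using iff by simp
    have nth: "w ! j = u ! Suc j" "w ! Suc j = u ! j" using w nth_sw[of j u] assms(3) len by auto
    have ne: "w ! j \<noteq> w ! Suc j" using False True sw_same[of j w] assms(3) len by auto
    then consider "w ! j < w ! Suc j" | "w ! Suc j < w ! j" by linarith
    then show ?thesis
    proof cases
      case 1
      have "ninv u = Suc (ninv w)" using inv_sw[of j u] 1 nth w assms(3) len by simp
      then show ?thesis using 1 nth True[symmetric] w[symmetric] by (simp add: tst_def)
    next
      case 2
      have "ninv w = Suc (ninv u)" using inv_sw[of j w] 2 True assms(3) len by simp
      then show ?thesis using 2 nth True[symmetric] w[symmetric] by (simp add: tst_def)
    qed
  next
    case f: False
    then have "tst q (Suc j) u w = 0" "tst q (Suc j) w u = 0" using False iff by (auto simp: tst_def)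
    then show ?thesis by simp
  qed
qed simp

lemma Qm_TC: "Suc j < n ==> Qm * TC q n (Suc j) = trp (TC q n (Suc j)) * Qm"
proof (rule Mt_eqI[OF Mt_mult[OF Q_Mt(1) TC_Mt] Mt_mult[OF trp_Mt[OF TC_Mt] Q_Mt(1)]])
  fix u w assume "Suc j < n" "u \<in> CB n" "w \<in> CB n"
  then show "ent (Qm * TC q n (Suc j)) u w = ent (trp (TC q n (Suc j)) * Qm) u w"
    unfolding Qm_def dg_mult[OF TC_Mt] mult_dg[OF trp_Mt[OF TC_Mt]] using tst_sym[of u w j] by (simp add: TC_def)
qed

lemma TC_Qi: "Suc j < n ==> TC q n (Suc j) * Qi = Qi * trp (TC q n (Suc j))"
proof -
  assume j: "Suc j < n"
  have "Qi * (Qm * TC q n (Suc j)) * Qi = Qi * (trp (TC q n (Suc j)) * Qm) * Qi" using Qm_TC[OF j] by simp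
  moreover have "Qi * (Qm * TC q n (Suc j)) = TC q n (Suc j)" by (rule QQ_cancel(2)[OF TC_Mt])
  moreover have "Qi * (trp (TC q n (Suc j)) * Qm) * Qi = Qi * (trp (TC q n (Suc j)) * (Qm * Qi))" by (simp add: mult.assoc)
  ultimately show ?thesis by (simp add: QQ mult_idB[OF finite_CB trp_Mt[OF TC_Mt]])
qed

text \<open>The adjoint for the form \<open>Qm\<close>. It is an anti-involution of the endomorphism
  algebra that fixes the projections \<open>xi s\<close> onto weights.\<close>

definition star :: "'k fmat => 'k fmat" where "star c = Qi * (trp c * Qm)"

abbreviation (input) "CC \<equiv> Mt (CB n) (CB n) :: 'k fmat set"
abbreviation (input) "SS \<equiv> hhom n (CB n) (TC q n) (CB n) (TC q n)"

lemma star_Mt: "c \<in> CC ==> star c \<in> CC"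
  unfolding star_def using Mt_mult[OF Q_Mt(2) Mt_mult[OF trp_Mt Q_Mt(1)]] .

lemma ent_star: "c \<in> CC ==> ent (star c) u w = inverse (q ^ ninv u) * ent c w u * q ^ ninv w"
  unfolding star_def Qi_def Qm_def dg_mult[OF Mt_mult[OF trp_Mt dg_Mt]] mult_dg[OF trp_Mt] by simp

lemma star_star: "c \<in> CC ==> star (star c) = c"
  by (rule fmat_eqI) (use q in \<open>simp add: ent_star star_Mt field_simps\<close>)

lemma star_mult: "c \<in> CC ==> d \<in> CC ==> star (c * d) = star d * star c"
proof -
  assume cd: "c \<in> CC" "d \<in> CC"
  have "star d * star c = Qi * (trp d * (Qm * (Qi * (trp c * Qm))))" by (simp add: star_def mult.assoc)
  also have "... = Qi * (trp d * (trp c * Qm))" using QQ_cancel(1)[OF Mt_mult[OF trp_Mt[OF cd(1)] Q_Mt(1)]] by simp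
  finally show ?thesis by (simp add: star_def trp_mult mult.assoc)
qed

lemma star_diff: "star (c - d) = star c - star d"
  by (simp add: star_def trp_diff left_diff_distrib right_diff_distrib)

lemma star_add: "star (c + d) = star c + star d"
  by (simp add: star_def trp_add distrib_left distrib_right)

lemma star_scale: "star (\<alpha> \<bullet> c) = \<alpha> \<bullet> star c" by (simp add: star_def trp_scale)

lemma star_SS: "c \<in> SS ==> star c \<in> SS"
proof -
  assume c: "c \<in> SS"
  have cM: "c \<in> CC" using hhom_Mt[OF c] .
  have "TC q n (Suc j) * star c = star c * TC q n (Suc j)" if j: "Suc j < n" for j
  proof -
    have "TC q n (Suc j) * star c = (TC q n (Suc j) * Qi) * (trp c * Qm)" by (simp add: star_def mult.assoc)
    also have "... = Qi * (trp (c * TC q n (Suc j)) * Qm)" unfolding TC_Qi[OF j] by (simp add: trp_mult mult.assoc)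
    also have "... = Qi * (trp c * (trp (TC q n (Suc j)) * Qm))" unfolding hhom_comm[OF c j, symmetric] by (simp add: trp_mult mult.assoc)
    also have "... = star c * TC q n (Suc j)" unfolding Qm_TC[OF j, symmetric] by (simp add: star_def mult.assoc)
    finally show ?thesis .
  qed
  then show ?thesis using star_Mt[OF cM] by (simp add: hhom_def)
qed

lemma star_rest: "star (rest n P) = rest n P"
  by (rule fmat_eqI) (use q in \<open>auto simp: ent_star ent_rest\<close>)

lemma rest_SS: "(\<And>j u. Suc j < n ==> u \<in> CB n ==> P (sw j u) = P u) ==> rest n P \<in> SS"
proof -
  assume P: "\<And>j u. Suc j < n ==> u \<in> CB n ==> P (sw j u) = P u"
  have rest_dg: "rest n P = dg (\<lambda>u. if P u then 1 else 0)" by (rule fmat_eqI) (auto simp: ent_rest dg_def)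
  have "TC q n (Suc j) * rest n P = rest n P * TC q n (Suc j)" if j: "Suc j < n" for j
  proof (rule Mt_eqI[OF Mt_mult[OF TC_Mt rest_Mt] Mt_mult[OF rest_Mt TC_Mt]])
    fix u w assume uw: "u \<in> CB n" "w \<in> CB n"
    have "P u = P w" if "tst q (Suc j) u w \<noteq> 0"
      using that P[OF j uw(2)] by (auto simp: tst_def split: if_splits)
    then show "ent (TC q n (Suc j) * rest n P) u w = ent (rest n P * TC q n (Suc j)) u w"
      unfolding rest_dg mult_dg[OF TC_Mt] dg_mult[OF TC_Mt] using uw by (auto simp: TC_def)
  qed
  then show ?thesis by (simp add: hhom_def)
qed

definition xi :: "nat list => 'k fmat" where "xi s = rest n (\<lambda>u. mset u = mset s)"

lemma xi_SS: "xi s \<in> SS" unfolding xi_def by (rule rest_SS) (simp add: CB_length)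

lemma xi_mu: "u \<in> CB n ==> xi s * mu u [] = (if mset u = mset s then mu u [] else 0)"
proof -
  assume u: "u \<in> CB n"
  have "(mu u [] :: 'k fmat) \<in> Mt (CB n) {[]}" using u by (intro mu_Mt) auto
  from rest_mult[OF this] show ?thesis by (intro fmat_eqI) (auto simp: xi_def)
qed

lemma xi_mult: "f \<in> Mt (CB n) A ==> ent (xi s * f) u w = (if mset u = mset s then ent f u w else 0)"
  unfolding xi_def by (rule rest_mult)

lemma star_xi: "star (xi s) = xi s" unfolding xi_def by (rule star_rest)

text \<open>\<open>hw_span\<close> translated from vectors to endomorphisms:
  \<open>xi s * c * xi s\<close> is determined by its value at \<open>s\<close>, which is an
  eigenvector of weight \<open>s\<close>. The subspace \<open>J\<close> stands for the maps through
  smaller weights; keeping it abstract allows a choice that is described by the action on a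
  module.\<close>

lemma weight_scalar:
  assumes s: "s \<in> CB n" "sorted s" and c: "c \<in> SS"
    and J: "fm.subspace J" "\<And>t g h. t \<in> CB n ==> sorted t ==> t < s ==> g \<in> SS ==> h \<in> SS ==> g * (xi t * h) \<in> J"
  shows "\<exists>\<alpha>. xi s * c * xi s - \<alpha> \<bullet> xi s \<in> J"
proof -
  define m where "m = xi s * (c * mu s [])"
  have muV: "(mu s [] :: 'k fmat) \<in> Mt (CB n) {[]}" using s by (intro mu_Mt) auto
  have cmV: "c * mu s [] \<in> Mt (CB n) {[]}" using Mt_mult[OF hhom_Mt[OF c] muV] .
  have mV: "m \<in> Mt (CB n) {[]}" unfolding m_def using Mt_mult[OF hhom_Mt[OF xi_SS] cmV] .
  have hwm: "hw q n s m" unfolding hw_def[OF q]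
  proof (intro conjI mV allI impI)
    fix j assume j: "Suc j < n" "s ! j = s ! Suc j"
    have "TC q n (Suc j) * m = (TC q n (Suc j) * xi s) * (c * mu s [])" by (simp add: m_def mult.assoc)
    also have "... = xi s * ((TC q n (Suc j) * c) * mu s [])" unfolding hhom_comm[OF xi_SS[of s] j(1)] by (simp only: mult.assoc)
    also have "... = xi s * (c * (TC q n (Suc j) * mu s []))" unfolding hhom_comm[OF c j(1)] by (simp only: mult.assoc)
    also have "... = cc q (s ! j) \<bullet> m" using TC_mu[OF s(1) j(1), of q "[]"] j(2) by (simp add: m_def)
    finally show "TC q n (Suc j) * m = cc q (s ! j) \<bullet> m" .
  qed
  have wtm: "wt s m" unfolding wt_def[OF q] m_def xi_mult[OF cmV] by simp
  \<comment> \<open>Every vector of the span is lifted to an endomorphism with this value at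
    \<open>s\<close> and zero on the other weights, and the lift is scalar modulo
    \<open>J\<close>.\<close>
  define P where "P = (\<lambda>v. \<exists>D \<alpha>. D \<in> SS \<and> D * mu s [] = v \<and> (\<forall>u\<in>CB n. mset u \<noteq> mset s --> D * mu u [] = 0) \<and> D - \<alpha> \<bullet> xi s \<in> J)"
  have P: "P v" if "v \<in> fm.span (insert (mu s []) (Sg q n s))" for v
    using that
  proof (induct rule: fm.span_induct_alt)
    case base
    show ?case unfolding P_def
      by (rule exI[of _ 0], rule exI[of _ 0]) (use fm.subspace_0[OF J(1)] fm.subspace_0[OF subspace_hhom] in simp)
  next
    case (step b x y)
    obtain D \<alpha> where D: "D \<in> SS" "D * mu s [] = y" "\<forall>u\<in>CB n. mset u \<noteq> mset s --> D * mu u [] = 0" "D - \<alpha> \<bullet> xi s \<in> J"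
      using step(2) unfolding P_def by blast
    have "P x"
    proof (cases "x = mu s []")
      case True
      show ?thesis unfolding P_def
        by (rule exI[of _ "xi s"], rule exI[of _ 1]) (use True xi_SS xi_mu s(1) fm.subspace_0[OF J(1)] in auto)
    next
      case False
      then obtain g h t where gh: "x = g * h" "g \<in> SS" "hw q n s h" "t \<in> CB n" "sorted t" "t < s" "\<forall>z. ent h z [] \<noteq> 0 --> mset z = mset t"
        using step(1) by (auto simp: Sg_def[OF q])
      have hV: "h \<in> Mt (CB n) {[]}" and ev: "\<And>j. Suc j < n ==> s ! j = s ! Suc j ==> TC q n (Suc j) * h = cc q (s ! j) \<bullet> h"
        using gh(3) by (auto simp: hw_def[OF q])
      define H where "H = homv (TC q n) n s h"
      have Hp1: "H \<in> SS" unfolding H_def by (rule homv(1)[OF hmod_TC s hV]) (rule ev)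
      have Hp2: "H * mu s [] = h" unfolding H_def by (rule homv(2)[OF hmod_TC s hV]) (rule ev)
      have Hp3: "H * mu u [] = 0" if "u \<in> CB n" "mset u \<noteq> mset s" for u
        unfolding H_def by (rule homv(3)[OF hmod_TC s hV _ that]) (rule ev)
      have xh: "xi t * h = h"
        by (rule Mt_eqI[OF Mt_mult[OF hhom_Mt[OF xi_SS] hV] hV]) (use gh(7) in \<open>auto simp: xi_mult[OF hV]\<close>)
      have xHS: "xi t * H \<in> SS" using hhom_mult[OF Hp1 xi_SS] .
      have "xi t * H = H"
      proof (rule col_eqI[OF hhom_Mt[OF xHS] hhom_Mt[OF Hp1]])
        fix u assume u: "u \<in> CB n"
        show "xi t * H * mu u [] = H * mu u []"
        proof (cases "mset u = mset s")
          case True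
          have "xi t * H * mu s [] = H * mu s []" using Hp2 xh by (simp add: mult.assoc)
          from hhom_determined[OF xHS Hp1 s(2) this u True] show ?thesis .
        next
          case f: False
          show ?thesis using Hp3[OF u f] by (simp add: mult.assoc)
        qed
      qed
      then have "g * H \<in> J" using J(2)[OF gh(4-6,2) Hp1] by simp
      then show ?thesis unfolding P_def
        by (intro exI[of _ "g * H"] exI[of _ 0]) (use hhom_mult[OF Hp1 gh(2)] gh(1) Hp2 Hp3 in \<open>simp add: mult.assoc\<close>)
    qed
    then obtain E \<beta> where E: "E \<in> SS" "E * mu s [] = x" "\<forall>u\<in>CB n. mset u \<noteq> mset s --> E * mu u [] = 0" "E - \<beta> \<bullet> xi s \<in> J"
      unfolding P_def by blast
    have "(b \<bullet> E + D) - (b * \<beta> + \<alpha>) \<bullet> xi s = b \<bullet> (E - \<beta> \<bullet> xi s) + (D - \<alpha> \<bullet> xi s)"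
      by (simp add: fm.scale_right_diff_distrib fm.scale_left_distrib)
    then have "(b \<bullet> E + D) - (b * \<beta> + \<alpha>) \<bullet> xi s \<in> J"
      using fm.subspace_add[OF J(1) fm.subspace_scale[OF J(1) E(4), of b] D(4)] by (simp only:)
    moreover have "b \<bullet> E + D \<in> SS" using E(1) D(1) fm.subspace_add[OF subspace_hhom] fm.subspace_scale[OF subspace_hhom] by blast
    ultimately show ?case unfolding P_def
      by (intro exI[of _ "b \<bullet> E + D"] exI[of _ "b * \<beta> + \<alpha>"]) (use E D in \<open>simp add: distrib_right\<close>)
  qed
  have "P m" using P hw_span[OF q s hwm wtm] by blast
  then obtain D \<alpha> where D: "D \<in> SS" "D * mu s [] = m" "\<forall>u\<in>CB n. mset u \<noteq> mset s --> D * mu u [] = 0" "D - \<alpha> \<bullet> xi s \<in> J"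
    unfolding P_def by blast
  have xcx: "xi s * c * xi s \<in> SS" using hhom_mult[OF xi_SS hhom_mult[OF c xi_SS]] by (simp add: mult.assoc)
  have "D = xi s * c * xi s"
  proof (rule col_eqI[OF hhom_Mt[OF D(1)] hhom_Mt[OF xcx]])
    fix u assume u: "u \<in> CB n"
    show "D * mu u [] = xi s * c * xi s * mu u []"
    proof (cases "mset u = mset s")
      case True
      have "D * mu s [] = xi s * c * xi s * mu s []" using D(2) xi_mu[OF s(1), of s] by (simp add: m_def mult.assoc)
      from hhom_determined[OF D(1) xcx s(2) this u True] show ?thesis .
    next
      case False
      then show ?thesis using D(3) u xi_mu[OF u, of s] by (simp add: mult.assoc)
    qed
  qed
  then show ?thesis using D(4) by blast
qed

end

section \<open>Invariant forms on submodules of Hom(N, C), and the dimension of Hom\<close>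

context
  fixes q :: "'k::field" and n :: nat and BN :: "nat list set" and TN :: "nat => 'k fmat"
  assumes q: "q \<noteq> 0" and finBN: "finite BN"
begin

abbreviation (input) "HN \<equiv> hhom n BN TN (CB n) (TC q n)"
abbreviation (input) "SR \<equiv> hhom n (CB n) (TC q n) (CB n) (TC q n)"

definition smod :: "'k fmat set => bool"
  where "smod X \<longleftrightarrow> fm.subspace X \<and> X \<subseteq> HN \<and> (\<forall>c\<in>SR. \<forall>x\<in>X. c * x \<in> X)"

lemma smodD: "smod X ==> fm.subspace X" "smod X ==> X \<subseteq> HN" "smod X ==> c \<in> SR ==> x \<in> X ==> c * x \<in> X"
  by (auto simp: smod_def)

lemma smod_fdim: "smod X ==> fm.fdim X"
  using fm.fdim_subset[OF fdim_hhom[OF finBN finite_CB]] smodD(2) by blast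

lemma smod_generate:
  assumes Y: "smod Y" and X: "smod X" and YX: "Y \<subseteq> X" and x: "x \<in> X"
  shows "smod {c * x + y | c y. c \<in> SR \<and> y \<in> Y}" (is "smod ?Z")
    and "{c * x + y | c y. c \<in> SR \<and> y \<in> Y} \<subseteq> X" and "Y \<subseteq> {c * x + y | c y. c \<in> SR \<and> y \<in> Y}"
    and "x \<in> {c * x + y | c y. c \<in> SR \<and> y \<in> Y}"
proof -
  note Y0 = fm.subspace_0[OF smodD(1)[OF Y]] and S0 = fm.subspace_0[OF subspace_hhom[of n "CB n" "TC q n" "CB n" "TC q n"]]
  show ZX: "?Z \<subseteq> X" using smodD(3)[OF X _ x] YX fm.subspace_add[OF smodD(1)[OF X]] by blast
  show "Y \<subseteq> ?Z"
  proof
    fix y assume "y \<in> Y"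
    then show "y \<in> ?Z" using S0 by (intro CollectI exI[of _ 0] exI[of _ y]) simp
  qed
  have "x \<in> Mt (CB n) BN" using x smodD(2)[OF X] hhom_Mt by blast
  then have "idB (CB n) * x + 0 = x" by simp
  then show "x \<in> ?Z" using idB_hhom[OF hmod_TC] Y0 by (intro CollectI exI[of _ "idB (CB n)"] exI[of _ 0]) simp
  show "smod ?Z" unfolding smod_def fm.subspace_def
  proof (intro conjI ballI allI)
    show "0 \<in> ?Z" using \<open>Y \<subseteq> ?Z\<close> Y0 by blast
    show "?Z \<subseteq> HN" using ZX smodD(2)[OF X] by blast
    fix u v \<alpha> assume "u \<in> ?Z" "v \<in> ?Z"
    then obtain c y c' y' where u: "u = c * x + y" "c \<in> SR" "y \<in> Y" and v: "v = c' * x + y'" "c' \<in> SR" "y' \<in> Y" by blast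
    have "u + v = (c + c') * x + (y + y')" unfolding u v by (simp add: distrib_right algebra_simps)
    then show "u + v \<in> ?Z" using fm.subspace_add[OF subspace_hhom u(2) v(2)] fm.subspace_add[OF smodD(1)[OF Y] u(3) v(3)] by blast
    have "\<alpha> \<bullet> u = (\<alpha> \<bullet> c) * x + \<alpha> \<bullet> y" unfolding u by (simp add: fm.scale_right_distrib)
    then show "\<alpha> \<bullet> u \<in> ?Z" using fm.subspace_scale[OF subspace_hhom u(2)] fm.subspace_scale[OF smodD(1)[OF Y] u(3)] by blast
  next
    fix d u assume d: "d \<in> SR" and "u \<in> ?Z"
    then obtain c y where u: "u = c * x + y" "c \<in> SR" "y \<in> Y" by blast
    have "d * u = (d * c) * x + d * y" unfolding u by (simp add: distrib_left mult.assoc)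
    then show "d * u \<in> ?Z" using hhom_mult[OF u(2) d] smodD(3)[OF Y d u(3)] by blast
  qed
qed

lemma weight_sum:
  assumes "(x :: 'k fmat) \<in> Mt (CB n) A"
  shows "(\<Sum>t\<in>{t\<in>CB n. sorted t}. xi n t * x) = x"
proof (rule fmat_eqI)
  fix u w
  have iff: "mset u = mset t \<longleftrightarrow> t = sort u" if "sorted t" for t :: "nat list"
    using that properties_for_sort[of t u] by auto
  have "ent (\<Sum>t\<in>{t\<in>CB n. sorted t}. xi n t * x) u w = (\<Sum>t\<in>{t\<in>CB n. sorted t}. if t = sort u then ent x u w else 0)"
    unfolding ent_sum by (intro sum.cong refl) (use iff in \<open>simp add: xi_mult[OF q assms]\<close>)
  also have "... = (if sort u \<in> CB n then ent x u w else 0)" by simp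
  also have "... = ent x u w" using Mt_zero[OF assms, of u w] by (auto simp: CB_def hk_words_def)
  finally show "ent (\<Sum>t\<in>{t\<in>CB n. sorted t}. xi n t * x) u w = ent x u w" .
qed

text \<open>The simple quotients of a submodule of \<open>Hom(N, C)\<close> carry an invariant symmetric form.\<close>
lemma invariant_form:
  assumes X: "smod X" "X \<noteq> {0}"
  obtains Y \<beta> where "smod Y" "Y \<subset> X"
    "\<And>y y' z. y \<in> X ==> y' \<in> X ==> z \<in> X ==> \<beta> (y + y') z = \<beta> y z + \<beta> y' (z :: 'k fmat)"
    "\<And>\<alpha> y z. y \<in> X ==> z \<in> X ==> \<beta> (\<alpha> \<bullet> y) z = \<alpha> * \<beta> y z"
    "\<And>y z. y \<in> X ==> z \<in> X ==> \<beta> y z = \<beta> z y"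
    "\<And>c y z. c \<in> SR ==> y \<in> X ==> z \<in> X ==> \<beta> (c * y) z = \<beta> y (star q n c * z)"
    "\<And>y. y \<in> X ==> (\<forall>z\<in>X. \<beta> y z = 0) \<longleftrightarrow> y \<in> Y"
proof -
  let ?P = "\<lambda>Y. smod Y \<and> Y \<subset> X"
  have X0: "0 \<in> X" using fm.subspace_0[OF smodD(1)[OF X(1)]] .
  have "smod {0}" unfolding smod_def using fm.subspace_0[OF subspace_hhom] by (auto simp: fm.subspace_def)
  then have P0: "?P {0}" using X(2) X0 by auto
  have bd: "fm.dim Y \<le> fm.dim X" if "?P Y" for Y
    using that smodD(1) smod_fdim[OF X(1)] X(1) by (intro fm.dim_mono_fdim) auto
  \<comment> \<open>A proper submodule of maximal dimension: the quotient of \<open>X\<close> by it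
    is simple, a fact used in the form \<open>gen\<close> without forming the quotient.\<close>
  have "\<exists>Y. ?P Y \<and> (\<forall>Z. ?P Z --> fm.dim Z \<le> fm.dim Y)"
    by (rule ex_has_greatest_nat[where P = ?P and f = fm.dim and b = "Suc (fm.dim X)", OF P0])
      (intro allI impI le_imp_less_Suc bd)
  then obtain Y where Y: "?P Y" and Ymax: "\<And>Z. ?P Z ==> fm.dim Z \<le> fm.dim Y" by (elim exE conjE) simp
  have sY: "smod Y" and YX: "Y \<subseteq> X" using Y by auto
  note Yadd = fm.subspace_add[OF smodD(1)[OF sY]] and Ydiff = fm.subspace_diff[OF smodD(1)[OF sY]]
    and Yscale = fm.subspace_scale[OF smodD(1)[OF sY]] and Ymul = smodD(3)[OF sY] and Xmul = smodD(3)[OF X(1)]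
  have Xadd: "x + y \<in> X" if "x \<in> X" "y \<in> X" for x y using fm.subspace_add[OF smodD(1)[OF X(1)] that] .
  have gen: "\<exists>c y. c \<in> SR \<and> y \<in> Y \<and> z = c * x + y" if x: "x \<in> X" "x \<notin> Y" and z: "z \<in> X" for x z
  proof -
    let ?Z = "{c * x + y | c y. c \<in> SR \<and> y \<in> Y}"
    note Z = smod_generate[OF sY X(1) YX x(1)]
    have "?Z = X"
    proof (rule ccontr)
      assume "?Z \<noteq> X"
      then have "?P ?Z" using Z by blast
      then have "fm.dim ?Z \<le> fm.dim Y" using Ymax by blast
      then have "Y = ?Z" by (intro fm.dim_eq_subspace smodD(1) sY Z(1,3) smod_fdim)
      then show False using x(2) Z(4) by blast
    qed
    then show ?thesis using z by blast
  qed
  \<comment> \<open>The weights that occur in the simple quotient. For its minimum \<open>s\<close>,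
    all smaller weights act as zero modulo \<open>Y\<close>, as \<open>weight_scalar\<close>
    requires.\<close>
  let ?S = "{t \<in> CB n. sorted t \<and> (\<exists>x\<in>X. xi n t * x \<notin> Y)}"
  have finS: "finite ?S" by simp
  have "?S \<noteq> {}"
  proof
    assume e: "?S = {}"
    obtain x where x: "x \<in> X" "x \<notin> Y" using Y by blast
    have "x \<in> Mt (CB n) BN" using x smodD(2)[OF X(1)] hhom_Mt by blast
    from weight_sum[OF this] have "x = (\<Sum>t\<in>{t\<in>CB n. sorted t}. xi n t * x)" by simp
    moreover have "(\<Sum>t\<in>{t\<in>CB n. sorted t}. xi n t * x) \<in> Y"
      by (rule fm.subspace_sum[OF smodD(1)[OF sY]]) (use e x(1) in blast)
    ultimately show False using x by simp
  qed
  define s where "s = Min ?S"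
  have "s \<in> ?S" unfolding s_def using Min_in[OF finS \<open>?S \<noteq> {}\<close>] .
  then obtain x1 where s: "s \<in> CB n" "sorted s" and x1: "x1 \<in> X" "xi n s * x1 \<notin> Y" by blast
  have low: "xi n t * x \<in> Y" if "t \<in> CB n" "sorted t" "t < s" "x \<in> X" for t x
    using that Min_le[OF finS, of t] unfolding s_def by fastforce
  define x0 where "x0 = xi n s * x1"
  note xS = xi_SS[OF q, of n]
  have xi_idem: "xi n s * (xi n s * x) = xi n s * x" if "x \<in> X" for x
  proof -
    have xM: "x \<in> Mt (CB n) BN" using that smodD(2)[OF X(1)] hhom_Mt by blast
    show ?thesis by (rule fmat_eqI) (simp add: xi_mult[OF q Mt_mult[OF hhom_Mt[OF xS] xM]] xi_mult[OF q xM])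
  qed
  have x0: "x0 \<in> X" "x0 \<notin> Y" "xi n s * x0 = x0" unfolding x0_def using x1 Xmul[OF xS x1(1)] xi_idem by auto
  \<comment> \<open>Elements that act as zero on the quotient together with their adjoints. Since
    \<open>star\<close> fixes \<open>xi s\<close>, one and the same scalar then describes
    \<open>c\<close> and \<open>star c\<close> on \<open>x0\<close>.\<close>
  define J where "J = {D. \<forall>x\<in>X. D * x \<in> Y \<and> star q n D * x \<in> Y}"
  have star0: "star q n 0 = 0" by (simp add: star_def[OF q])
  have sJ: "fm.subspace J" unfolding fm.subspace_def J_def
    using fm.subspace_0[OF smodD(1)[OF sY]] Yadd Yscale
    by (auto simp: star_add[OF q] star_scale[OF q] distrib_right star0)
  have Jlow: "g * (xi n t * h) \<in> J" if t: "t \<in> CB n" "sorted t" "t < s" "g \<in> SR" "h \<in> SR" for t g h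
    unfolding J_def
  proof (intro CollectI ballI conjI)
    fix x assume x: "x \<in> X"
    have "g * (xi n t * h) * x = g * (xi n t * (h * x))" by (simp only: mult.assoc)
    then show "g * (xi n t * h) * x \<in> Y" using Ymul[OF t(4) low[OF t(1-3) Xmul[OF t(5) x]]] by simp
    have "star q n (g * (xi n t * h)) = star q n h * (xi n t * star q n g)"
      using star_mult[OF q hhom_Mt[OF t(4)] hhom_Mt[OF hhom_mult[OF t(5) xS]]] star_mult[OF q hhom_Mt[OF xS] hhom_Mt[OF t(5)], of t]
        star_xi[OF q] by (simp add: mult.assoc)
    then have "star q n (g * (xi n t * h)) * x = star q n h * (xi n t * (star q n g * x))" by (simp only: mult.assoc)
    then show "star q n (g * (xi n t * h)) * x \<in> Y"
      using Ymul[OF star_SS[OF q t(5)] low[OF t(1-3) Xmul[OF star_SS[OF q t(4)] x]]] by simp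
  qed
  have scal: "\<exists>\<alpha>. xi n s * (c * x0) - \<alpha> \<bullet> x0 \<in> Y \<and> xi n s * (star q n c * x0) - \<alpha> \<bullet> x0 \<in> Y" if c: "c \<in> SR" for c
  proof -
    obtain \<alpha> where a: "xi n s * c * xi n s - \<alpha> \<bullet> xi n s \<in> J" using weight_scalar[OF q s c sJ Jlow] by blast
    have cM: "c \<in> Mt (CB n) (CB n)" and xM: "(xi n s :: 'k fmat) \<in> Mt (CB n) (CB n)" using hhom_Mt[OF c] hhom_Mt[OF xS] by auto
    have "star q n (xi n s * c * xi n s - \<alpha> \<bullet> xi n s) = xi n s * star q n c * xi n s - \<alpha> \<bullet> xi n s"
      unfolding star_diff[OF q] star_scale[OF q] star_mult[OF q Mt_mult[OF xM cM] xM] star_mult[OF q xM cM] star_xi[OF q]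
      by (simp only: mult.assoc)
    then have "(xi n s * c * xi n s - \<alpha> \<bullet> xi n s) * x0 \<in> Y" "(xi n s * star q n c * xi n s - \<alpha> \<bullet> xi n s) * x0 \<in> Y"
      using a x0(1) unfolding J_def by force+
    then have "xi n s * (c * x0) - \<alpha> \<bullet> x0 \<in> Y" "xi n s * (star q n c * x0) - \<alpha> \<bullet> x0 \<in> Y"
      by (simp_all only: left_diff_distrib fsm_mult_left mult.assoc x0(3))
    then show ?thesis by blast
  qed
  have uniq: "\<alpha> = \<beta>" if a: "y - \<alpha> \<bullet> x0 \<in> Y" and b: "y - \<beta> \<bullet> x0 \<in> Y" for y \<alpha> \<beta>
  proof (rule ccontr)
    assume ne: "\<alpha> \<noteq> \<beta>"
    have "(\<beta> - \<alpha>) \<bullet> x0 \<in> Y" using Ydiff[OF a b] by (simp add: fm.scale_left_diff_distrib)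
    from Yscale[OF this, of "inverse (\<beta> - \<alpha>)"] show False using x0(2) ne by simp
  qed
  have ex_l: "\<exists>\<alpha>. xi n s * y - \<alpha> \<bullet> x0 \<in> Y" if y: "y \<in> X" for y
  proof -
    obtain c z where c: "c \<in> SR" "z \<in> Y" "y = c * x0 + z" using gen[OF x0(1,2) y] by blast
    obtain \<alpha> where a: "xi n s * (c * x0) - \<alpha> \<bullet> x0 \<in> Y" using scal[OF c(1)] by blast
    have "xi n s * y - \<alpha> \<bullet> x0 = (xi n s * (c * x0) - \<alpha> \<bullet> x0) + xi n s * z" unfolding c(3) by (simp add: distrib_left)
    then have "xi n s * y - \<alpha> \<bullet> x0 \<in> Y" using Yadd[OF a Ymul[OF xS c(2)]] by (simp only:)
    then show ?thesis by blast
  qed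
  \<comment> \<open>Modulo \<open>Y\<close> the weight \<open>s\<close> is the line through
    \<open>x0\<close>; \<open>l\<close> reads off the coordinate on it.\<close>
  define l where "l = (\<lambda>y. SOME \<alpha>. xi n s * y - \<alpha> \<bullet> x0 \<in> Y)"
  have l: "xi n s * y - l y \<bullet> x0 \<in> Y" if "y \<in> X" for y unfolding l_def using someI_ex[OF ex_l[OF that]] .
  have l_eq: "l y = \<alpha>" if "y \<in> X" "xi n s * y - \<alpha> \<bullet> x0 \<in> Y" for y \<alpha> using uniq[OF l[OF that(1)] that(2)] .
  have l_add: "l (y + z) = l y + l z" if yz: "y \<in> X" "z \<in> X" for y z
  proof (rule l_eq[OF Xadd[OF yz]])
    have "xi n s * (y + z) - (l y + l z) \<bullet> x0 = (xi n s * y - l y \<bullet> x0) + (xi n s * z - l z \<bullet> x0)"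
      by (simp add: distrib_left fm.scale_left_distrib)
    then show "xi n s * (y + z) - (l y + l z) \<bullet> x0 \<in> Y" using Yadd[OF l[OF yz(1)] l[OF yz(2)]] by (simp only:)
  qed
  have l_scale: "l (\<alpha> \<bullet> y) = \<alpha> * l y" if y: "y \<in> X" for \<alpha> y
  proof (rule l_eq)
    show "\<alpha> \<bullet> y \<in> X" using fm.subspace_scale[OF smodD(1)[OF X(1)] y] .
    have "xi n s * (\<alpha> \<bullet> y) - (\<alpha> * l y) \<bullet> x0 = \<alpha> \<bullet> (xi n s * y - l y \<bullet> x0)" by (simp add: fm.scale_right_diff_distrib)
    then show "xi n s * (\<alpha> \<bullet> y) - (\<alpha> * l y) \<bullet> x0 \<in> Y" using Yscale[OF l[OF y]] by (simp only:)
  qed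
  have l_Y: "l y = 0" if "y \<in> Y" for y
    using l_eq[of y 0] that YX Ymul[OF xS that] by auto
  have l_x0: "l x0 = 1" using l_eq[of x0 1] x0 fm.subspace_0[OF smodD(1)[OF sY]] by simp
  have l_star: "l (star q n c * x0) = l (c * x0)" if c: "c \<in> SR" for c
  proof -
    obtain \<alpha> where "xi n s * (c * x0) - \<alpha> \<bullet> x0 \<in> Y" "xi n s * (star q n c * x0) - \<alpha> \<bullet> x0 \<in> Y" using scal[OF c] by blast
    then show ?thesis using l_eq[OF Xmul[OF c x0(1)]] l_eq[OF Xmul[OF star_SS[OF q c] x0(1)]] by simp
  qed
  define pk where "pk = (\<lambda>y. SOME c. c \<in> SR \<and> y - c * x0 \<in> Y)"
  have pk: "pk y \<in> SR \<and> y - pk y * x0 \<in> Y" if y: "y \<in> X" for y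
  proof -
    obtain c z where "c \<in> SR" "z \<in> Y" "y = c * x0 + z" using gen[OF x0(1,2) y] by blast
    then have "\<exists>c. c \<in> SR \<and> y - c * x0 \<in> Y" by (intro exI[of _ c]) simp
    then show ?thesis unfolding pk_def by (rule someI_ex)
  qed
  \<comment> \<open>For \<open>y = d * x0\<close> and \<open>z = c * x0\<close> modulo
    \<open>Y\<close> the value is \<open>l (star c * d * x0)\<close>. It does not depend on the
    choice of \<open>c\<close>, and symmetry holds because \<open>l_star\<close> allows the product
    to be replaced by its adjoint.\<close>
  define \<beta> where "\<beta> = (\<lambda>y z. l (star q n (pk z) * y))"
  have lcong: "l y = l z" if yz: "y \<in> X" "z \<in> X" "y - z \<in> Y" for y z
    using l_add[OF yz(2) subsetD[OF YX yz(3)]] l_Y[OF yz(3)] by simp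
  have form: "\<beta> y z = l (star q n c * d * x0)"
    if c: "c \<in> SR" "z - c * x0 \<in> Y" and d: "d \<in> SR" "y - d * x0 \<in> Y" and yz: "y \<in> X" "z \<in> X" for y z c d
  proof -
    note p = pk[OF yz(2)]
    have step: "l (star q n e * y) = l (star q n d * e * x0)" if e: "e \<in> SR" for e
    proof -
      have eS: "star q n e \<in> SR" using star_SS[OF q e] .
      have "star q n e * y - star q n e * (d * x0) \<in> Y" using Ymul[OF eS d(2)] by (simp add: right_diff_distrib)
      then have "l (star q n e * y) = l (star q n e * (d * x0))"
        by (rule lcong[OF Xmul[OF eS yz(1)] Xmul[OF eS Xmul[OF d(1) x0(1)]]])
      also have "... = l (star q n (star q n e * d) * x0)"
        using l_star[OF hhom_mult[OF d(1) eS]] by (simp add: mult.assoc)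
      also have "star q n (star q n e * d) = star q n d * e"
        using star_mult[OF q hhom_Mt[OF eS] hhom_Mt[OF d(1)]] star_star[OF q hhom_Mt[OF e]] by simp
      finally show ?thesis .
    qed
    have dS: "star q n d \<in> SR" using star_SS[OF q d(1)] .
    have "pk z * x0 - c * x0 \<in> Y" using Ydiff[OF c(2) conjunct2[OF p]] by simp
    then have "star q n d * pk z * x0 - star q n d * c * x0 \<in> Y"
      using Ymul[OF dS] by (metis right_diff_distrib mult.assoc)
    then have "l (star q n d * pk z * x0) = l (star q n d * c * x0)"
      by (rule lcong[OF Xmul[OF hhom_mult[OF conjunct1[OF p] dS] x0(1)] Xmul[OF hhom_mult[OF c(1) dS] x0(1)]])
    also have "... = l (star q n (star q n d * c) * x0)" using l_star[OF hhom_mult[OF c(1) dS]] by simp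
    also have "star q n (star q n d * c) = star q n c * d"
      using star_mult[OF q hhom_Mt[OF dS] hhom_Mt[OF c(1)]] star_star[OF q hhom_Mt[OF d(1)]] by simp
    finally show ?thesis using step[OF conjunct1[OF p]] by (simp add: \<beta>_def)
  qed
  have form': "\<beta> y z = l (star q n c * y)" if c: "c \<in> SR" "z - c * x0 \<in> Y" and yz: "y \<in> X" "z \<in> X" for y z c
  proof -
    note p = pk[OF yz(1)] and cS = star_SS[OF q c(1)]
    have "star q n c * y - star q n c * pk y * x0 \<in> Y"
      using Ymul[OF cS conjunct2[OF p]] by (simp add: right_diff_distrib mult.assoc)
    then have "l (star q n c * y) = l (star q n c * pk y * x0)"
      by (rule lcong[OF Xmul[OF cS yz(1)] Xmul[OF hhom_mult[OF conjunct1[OF p] cS] x0(1)]])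
    then show ?thesis using form[OF c conjunct1[OF p] conjunct2[OF p] yz] by simp
  qed
  have sym: "\<beta> y z = \<beta> z y" if yz: "y \<in> X" "z \<in> X" for y z
  proof -
    note py = conjunct1[OF pk[OF yz(1)]] conjunct2[OF pk[OF yz(1)]] and pz = conjunct1[OF pk[OF yz(2)]] conjunct2[OF pk[OF yz(2)]]
    note zS = star_SS[OF q pz(1)]
    have "\<beta> y z = l (star q n (pk z) * pk y * x0)" using form[OF pz py yz] .
    also have "... = l (star q n (star q n (pk z) * pk y) * x0)" using l_star[OF hhom_mult[OF py(1) zS]] by simp
    also have "star q n (star q n (pk z) * pk y) = star q n (pk y) * pk z"
      using star_mult[OF q hhom_Mt[OF zS] hhom_Mt[OF py(1)]] star_star[OF q hhom_Mt[OF pz(1)]] by simp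
    finally show ?thesis using form[OF py pz yz(2,1)] by simp
  qed
  show thesis
  proof (rule that[of Y \<beta>])
    show "smod Y" "Y \<subset> X" using Y by auto
    fix y y' z assume a: "y \<in> X" "y' \<in> X" "z \<in> X"
    note zS = star_SS[OF q conjunct1[OF pk[OF a(3)]]]
    show "\<beta> (y + y') z = \<beta> y z + \<beta> y' z"
      unfolding \<beta>_def distrib_left by (rule l_add[OF Xmul[OF zS a(1)] Xmul[OF zS a(2)]])
  next
    fix \<alpha> y z assume a: "y \<in> X" "z \<in> X"
    note zS = star_SS[OF q conjunct1[OF pk[OF a(2)]]]
    show "\<beta> (\<alpha> \<bullet> y) z = \<alpha> * \<beta> y z" unfolding \<beta>_def fsm_mult_right by (rule l_scale[OF Xmul[OF zS a(1)]])
  next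
    fix y z assume "y \<in> X" "z \<in> X" then show "\<beta> y z = \<beta> z y" by (rule sym)
  next
    fix c y z assume a: "c \<in> SR" "y \<in> X" "z \<in> X"
    note pz = conjunct1[OF pk[OF a(3)]] conjunct2[OF pk[OF a(3)]] and cS = star_SS[OF q a(1)]
    have "star q n c * z - (star q n c * pk z) * x0 \<in> Y"
      using Ymul[OF cS pz(2)] by (simp add: right_diff_distrib mult.assoc)
    from form'[OF hhom_mult[OF pz(1) cS] this a(2) Xmul[OF cS a(3)]]
    have "\<beta> y (star q n c * z) = l (star q n (star q n c * pk z) * y)" .
    also have "star q n (star q n c * pk z) = star q n (pk z) * c"
      using star_mult[OF q hhom_Mt[OF cS] hhom_Mt[OF pz(1)]] star_star[OF q hhom_Mt[OF a(1)]] by simp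
    finally show "\<beta> (c * y) z = \<beta> y (star q n c * z)" by (simp add: \<beta>_def mult.assoc)
  next
    fix y assume y: "y \<in> X"
    show "(\<forall>z\<in>X. \<beta> y z = 0) \<longleftrightarrow> y \<in> Y"
    proof
      assume "y \<in> Y"
      then show "\<forall>z\<in>X. \<beta> y z = 0" unfolding \<beta>_def using l_Y Ymul[OF star_SS[OF q]] pk by blast
    next
      assume z: "\<forall>z\<in>X. \<beta> y z = 0"
      show "y \<in> Y"
      proof (rule ccontr)
        assume "y \<notin> Y"
        then obtain c w where c: "c \<in> SR" "w \<in> Y" "x0 = c * y + w" using gen[OF y _ x0(1)] by blast
        note cS = star_SS[OF q c(1)]
        have "\<beta> y (star q n c * x0) = l (star q n (star q n c) * y)"
          by (rule form'[OF cS _ y Xmul[OF cS x0(1)]]) (simp add: fm.subspace_0[OF smodD(1)[OF sY]])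
        then have "l (c * y) = 0" using z Xmul[OF cS x0(1)] star_star[OF q hhom_Mt[OF c(1)]] by simp
        moreover have "l x0 = l (c * y) + l w" unfolding c(3) by (rule l_add[OF Xmul[OF c(1) y] subsetD[OF YX c(2)]])
        ultimately show False using l_x0 l_Y[OF c(2)] by simp
      qed
    qed
  qed
qed

text \<open>The part of Hom(N, M) that belongs to the submodule \<open>X\<close> of Hom(N, C), where
  \<open>M\<close> is a summand of \<open>a\<close> copies of \<open>C\<close> via \<open>f\<close>:
  all components of the map have to lie in \<open>X\<close>.\<close>

definition XM :: "nat list set => (nat => 'k fmat) => nat => (nat => 'k fmat) => 'k fmat set => 'k fmat set"
  where "XM B T a f X = {\<psi> \<in> hhom n BN TN B T. \<forall>s<a. f s * \<psi> \<in> X}"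

lemma subspace_XM: "fm.subspace X ==> fm.subspace (XM B T a f X)"
  unfolding XM_def using subspace_hhom[of n BN TN B T] unfolding fm.subspace_def by (auto simp: distrib_left)

lemma fdim_XM: "finite B ==> fm.fdim (XM B T a f X)"
  by (rule fm.fdim_subset[OF fdim_hhom[OF finBN, of B n TN T]]) (auto simp: XM_def)

text \<open>The form on \<open>X\<close>, summed over the components, pairs the parts of
  \<open>X\<close> for two modules. The hypothesis \<open>dual\<close> says that \<open>star\<close>
  followed by transposition carries the idempotent matrix of the one module to that of the other.
  This identifies the radical with the part that belongs to \<open>Y\<close>.\<close>

lemma pairing_step:
  assumes XY: "smod X" "smod Y" "Y \<subseteq> X"
    and add: "\<And>y y' z. y \<in> X ==> y' \<in> X ==> z \<in> X ==> \<beta> (y + y') z = \<beta> y z + \<beta> y' (z :: 'k fmat)"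
    and scale: "\<And>\<alpha> y z. y \<in> X ==> z \<in> X ==> \<beta> (\<alpha> \<bullet> y) z = \<alpha> * \<beta> y z"
    and sym: "\<And>y z. y \<in> X ==> z \<in> X ==> \<beta> y z = \<beta> z y"
    and adj: "\<And>c y z. c \<in> SR ==> y \<in> X ==> z \<in> X ==> \<beta> (c * y) z = \<beta> y (star q n c * z)"
    and rad: "\<And>y. y \<in> X ==> (\<forall>z\<in>X. \<beta> y z = 0) \<longleftrightarrow> y \<in> Y"
    and B: "finite B" and F: "factors q n B T a f g" and F': "factors q n B T' a f' g'"
    and dual: "\<And>s t. s < a ==> t < a ==> star q n (f s * g t) = f' t * g' s"
  shows "fm.dim (XM B T' a f' X) + fm.dim (XM B T a f Y) \<le> fm.dim (XM B T' a f' Y) + fm.dim (XM B T a f X)"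
proof (rule fm.pairing_dim_le[where \<beta> = "\<lambda>\<psi> \<psi>'. \<Sum>s<a. \<beta> (f s * \<psi>) (f' s * \<psi>')"])
  have add2: "\<beta> z (y + y') = \<beta> z y + \<beta> z y'" if a: "y \<in> X" "y' \<in> X" "z \<in> X" for y y' z
    using add[OF a] sym[OF a(3,1)] sym[OF a(3,2)] sym[OF a(3) fm.subspace_add[OF smodD(1)[OF XY(1)] a(1,2)]] by simp
  have scale2: "\<beta> z (\<alpha> \<bullet> y) = \<alpha> * \<beta> z y" if a: "y \<in> X" "z \<in> X" for \<alpha> y z
    using scale[OF a] sym[OF a(2,1)] sym[OF a(2) fm.subspace_scale[OF smodD(1)[OF XY(1)] a(1)]] by simp
  note subspace_XM[OF smodD(1)[OF XY(1)]] subspace_XM[OF smodD(1)[OF XY(2)]]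
  then show "fm.subspace (XM B T a f X)" "fm.subspace (XM B T a f Y)" "fm.subspace (XM B T' a f' X)" by auto
  show "fm.fdim (XM B T a f X)" "fm.fdim (XM B T' a f' X)" using fdim_XM[OF B] by auto
  show "XM B T a f Y \<subseteq> XM B T a f X" "XM B T' a f' Y \<subseteq> XM B T' a f' X" using XY(3) by (auto simp: XM_def)
  fix x x' y y' and c :: 'k
  show "x \<in> XM B T a f X ==> x' \<in> XM B T a f X ==> y \<in> XM B T' a f' X ==>
    (\<Sum>s<a. \<beta> (f s * (x + x')) (f' s * y)) = (\<Sum>s<a. \<beta> (f s * x) (f' s * y)) + (\<Sum>s<a. \<beta> (f s * x') (f' s * y))"
    unfolding sum.distrib[symmetric] distrib_left by (rule sum.cong[OF refl], rule add) (auto simp: XM_def)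
  show "x \<in> XM B T a f X ==> y \<in> XM B T' a f' X ==>
    (\<Sum>s<a. \<beta> (f s * (c \<bullet> x)) (f' s * y)) = c * (\<Sum>s<a. \<beta> (f s * x) (f' s * y))"
    unfolding sum_distrib_left fsm_mult_right by (rule sum.cong[OF refl], rule scale) (auto simp: XM_def)
  show "x \<in> XM B T a f X ==> y \<in> XM B T' a f' X ==> y' \<in> XM B T' a f' X ==>
    (\<Sum>s<a. \<beta> (f s * x) (f' s * (y + y'))) = (\<Sum>s<a. \<beta> (f s * x) (f' s * y)) + (\<Sum>s<a. \<beta> (f s * x) (f' s * y'))"
    unfolding sum.distrib[symmetric] distrib_left by (rule sum.cong[OF refl], rule add2) (auto simp: XM_def)
  show "x \<in> XM B T a f X ==> y \<in> XM B T' a f' X ==>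
    (\<Sum>s<a. \<beta> (f s * x) (f' s * (c \<bullet> y))) = c * (\<Sum>s<a. \<beta> (f s * x) (f' s * y))"
    unfolding sum_distrib_left fsm_mult_right by (rule sum.cong[OF refl], rule scale2) (auto simp: XM_def)
  have rad0: "\<beta> y z = 0" if "y \<in> Y" "z \<in> X" for y z using rad[of y] that XY(3) by blast
  show "x \<in> XM B T a f Y ==> y \<in> XM B T' a f' X ==> (\<Sum>s<a. \<beta> (f s * x) (f' s * y)) = 0"
    by (rule sum.neutral) (auto simp: XM_def intro: rad0)
  show "x \<in> XM B T a f X ==> y \<in> XM B T' a f' Y ==> (\<Sum>s<a. \<beta> (f s * x) (f' s * y)) = 0"
  proof (rule sum.neutral, intro ballI)
    fix s assume "x \<in> XM B T a f X" "y \<in> XM B T' a f' Y" "s \<in> {..<a}"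
    then have "f s * x \<in> X" "f' s * y \<in> Y" by (auto simp: XM_def)
    then show "\<beta> (f s * x) (f' s * y) = 0" using rad0 sym XY(3) by (metis subsetD)
  qed
  assume y: "y \<in> XM B T' a f' X" and z: "\<And>x. x \<in> XM B T a f X ==> (\<Sum>s<a. \<beta> (f s * x) (f' s * y)) = 0"
  have yM: "y \<in> Mt B BN" using y hhom_Mt unfolding XM_def by blast
  have "f' t * y \<in> Y" if t: "t < a" for t
  proof -
    have fty: "f' t * y \<in> X" using y t by (auto simp: XM_def)
    \<comment> \<open>Testing with \<open>g t * x\<close> moves the product \<open>f s * g t\<close>
      to the other side as its adjoint, where the sum of the \<open>g' s * f' s\<close> collapses to
      the identity.\<close>
    have "\<beta> x (f' t * y) = 0" if x: "x \<in> X" for x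
    proof -
      have fg: "f s * g t \<in> SR" if "s < a" for s using F that t hhom_mult unfolding factors_def by blast
      have xH: "x \<in> HN" using x smodD(2)[OF XY(1)] by blast
      have "g t * x \<in> hhom n BN TN B T" using F t hhom_mult[OF xH] unfolding factors_def by blast
      moreover have "f s * (g t * x) \<in> X" if "s < a" for s
        using smodD(3)[OF XY(1) fg[OF that] x] by (simp add: mult.assoc)
      ultimately have "g t * x \<in> XM B T a f X" by (simp add: XM_def)
      then have "0 = (\<Sum>s<a. \<beta> (f s * (g t * x)) (f' s * y))" using z by simp
      also have "... = (\<Sum>s<a. \<beta> x (f' t * (g' s * (f' s * y))))"
      proof (rule sum.cong[OF refl])
        fix s assume "s \<in> {..<a}"
        then have s: "s < a" by simp
        have "f' s * y \<in> X" using y s by (auto simp: XM_def)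
        from adj[OF fg[OF s] x this] show "\<beta> (f s * (g t * x)) (f' s * y) = \<beta> x (f' t * (g' s * (f' s * y)))"
          by (simp add: dual[OF s t] mult.assoc)
      qed
      also have "... = \<beta> x (\<Sum>s<a. f' t * (g' s * (f' s * y)))"
      proof -
        have inX: "f' t * (g' s * (f' s * y)) \<in> X" if s: "s < a" for s
        proof -
          have "f' t * g' s \<in> SR" using F' s t hhom_mult unfolding factors_def by blast
          moreover have "f' s * y \<in> X" using y s by (auto simp: XM_def)
          ultimately show ?thesis using smodD(3)[OF XY(1)] by (metis mult.assoc)
        qed
        have "(\<Sum>s<b. \<beta> x (f' t * (g' s * (f' s * y)))) = \<beta> x (\<Sum>s<b. f' t * (g' s * (f' s * y))) \<and> (\<Sum>s<b. f' t * (g' s * (f' s * y))) \<in> X" if "b \<le> a" for b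
          using that
        proof (induction b)
          case 0
          have 0: "(0 :: 'k fmat) \<in> X" using fm.subspace_0[OF smodD(1)[OF XY(1)]] .
          then show ?case using scale2[OF 0 x, of 0] by simp
        next
          case (Suc b)
          then show ?case using inX[of b] add2[OF _ _ x] fm.subspace_add[OF smodD(1)[OF XY(1)]] by simp
        qed
        then show ?thesis by simp
      qed
      also have "(\<Sum>s<a. f' t * (g' s * (f' s * y))) = f' t * ((\<Sum>s<a. g' s * f' s) * y)"
        by (simp add: sum_distrib_left sum_distrib_right mult.assoc)
      also have "... = f' t * y" using F' B yM by (simp add: factors_def)
      finally show ?thesis by simp
    qed
    then show ?thesis using rad[OF fty] sym fty by metis
  qed
  then show "y \<in> XM B T' a f' Y" using y by (auto simp: XM_def)
qed

text \<open>Induction along a composition series of \<open>X\<close>. Over a simple quotient, the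
  pairing used in both orders shows that the two parts grow by the same amount.\<close>

lemma dim_XM_dual:
  assumes B: "finite B" and F: "factors q n B T a f g" and F': "factors q n B T' a f' g'"
    and dual: "\<And>s t. s < a ==> t < a ==> star q n (f s * g t) = f' t * g' s"
    and X: "smod X"
  shows "fm.dim (XM B T a f X) = fm.dim (XM B T' a f' X)"
  using X
proof (induction "fm.dim X" arbitrary: X rule: less_induct)
  case less
  have dual': "star q n (f' s * g' t) = f t * g s" if st: "s < a" "t < a" for s t
  proof -
    have "f t * g s \<in> SR" using F st hhom_mult unfolding factors_def by blast
    then show ?thesis using dual[OF st(2,1)] star_star[OF q hhom_Mt] by metis
  qed
  show ?case
  proof (cases "X = {0}")
    case True
    have "XM B S a h {0} = {0}" if H: "factors q n B S a h k" for S h k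
    proof -
      have "\<psi> = 0" if p: "\<psi> \<in> XM B S a h {0}" for \<psi>
      proof -
        have "\<psi> \<in> Mt B BN" using p hhom_Mt unfolding XM_def by blast
        then have "\<psi> = (\<Sum>s<a. k s * h s) * \<psi>" using H B by (simp add: factors_def)
        also have "... = (\<Sum>s<a. k s * (h s * \<psi>))" by (simp add: sum_distrib_right mult.assoc)
        also have "... = 0" using p by (intro sum.neutral) (auto simp: XM_def)
        finally show ?thesis .
      qed
      then show ?thesis using fm.subspace_0[OF subspace_XM[of "{0}"]] by auto
    qed
    then show ?thesis using True F F' by simp
  next
    case False
    show ?thesis
    proof (rule invariant_form[OF less.prems False])
    fix Y \<beta> assume Y: "smod Y" "Y \<subset> X"
      and form: "\<And>y y' z. y \<in> X ==> y' \<in> X ==> z \<in> X ==> \<beta> (y + y') z = \<beta> y z + \<beta> y' (z :: 'k fmat)"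
      "\<And>\<alpha> y z. y \<in> X ==> z \<in> X ==> \<beta> (\<alpha> \<bullet> y) z = \<alpha> * \<beta> y z"
      "\<And>y z. y \<in> X ==> z \<in> X ==> \<beta> y z = \<beta> z y"
      "\<And>c y z. c \<in> SR ==> y \<in> X ==> z \<in> X ==> \<beta> (c * y) z = \<beta> y (star q n c * z)"
      "\<And>y. y \<in> X ==> (\<forall>z\<in>X. \<beta> y z = 0) \<longleftrightarrow> y \<in> Y"
    have YX: "Y \<subseteq> X" using Y by blast
    have "fm.dim Y < fm.dim X"
      using fm.dim_eq_subspace[OF smodD(1)[OF Y(1)] smodD(1)[OF less.prems] smod_fdim[OF less.prems] YX] Y(2) by force
    then have "fm.dim (XM B T a f Y) = fm.dim (XM B T' a f' Y)" using less.hyps Y(1) by blast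
    moreover have "fm.dim (XM B T' a f' X) + fm.dim (XM B T a f Y) \<le> fm.dim (XM B T' a f' Y) + fm.dim (XM B T a f X)"
      by (rule pairing_step[OF less.prems Y(1) YX form B F F' dual])
    moreover have "fm.dim (XM B T a f X) + fm.dim (XM B T' a f' Y) \<le> fm.dim (XM B T a f Y) + fm.dim (XM B T' a f' X)"
      by (rule pairing_step[OF less.prems Y(1) YX form B F' F dual'])
    ultimately show ?thesis by linarith
    qed
  qed
qed

text \<open>The matrices \<open>trp (T i)\<close> describe the dual module, made a left module by
  the anti-automorphism that fixes the generators. As \<open>Qm\<close> identifies \<open>C\<close>
  with its dual, the transposes of \<open>f\<close> and \<open>g\<close>, corrected by
  \<open>Qi\<close> and \<open>Qm\<close>, factor the dual module through \<open>C\<close>. The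
  result compares dimensions only and constructs no isomorphism of a module with its dual.\<close>

lemma dim_hhom_dual:
  assumes B: "finite B" and F: "factors q n B T a f g"
  shows "fm.dim (hhom n BN TN B T) = fm.dim (hhom n BN TN B (\<lambda>i. trp (T i)))"
proof -
  let ?T = "\<lambda>i. trp (T i)"
  define f' where "f' = (\<lambda>s. Qi q n * trp (g s))"
  define g' where "g' = (\<lambda>s. trp (f s) * Qm q n)"
  have fh: "f s \<in> hhom n B T (CB n) (TC q n)" and gh: "g s \<in> hhom n (CB n) (TC q n) B T" if "s < a" for s
    using F that by (auto simp: factors_def)
  note QM = Q_Mt(1)[OF q, of n] and QI = Q_Mt(2)[OF q, of n]
  have f'h: "f' s \<in> hhom n B ?T (CB n) (TC q n)" if s: "s < a" for s
    unfolding hhom_def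
  proof (intro CollectI conjI allI impI)
    show "f' s \<in> Mt (CB n) B" unfolding f'_def using Mt_mult[OF QI trp_Mt[OF hhom_Mt[OF gh[OF s]]]] .
    fix j assume j: "Suc j < n"
    have "TC q n (Suc j) * f' s = Qi q n * trp (g s * TC q n (Suc j))"
      unfolding f'_def mult.assoc[symmetric] TC_Qi[OF q j] by (simp add: trp_mult mult.assoc)
    also have "... = f' s * trp (T (Suc j))" unfolding hhom_comm[OF gh[OF s] j, symmetric] by (simp add: f'_def trp_mult mult.assoc)
    finally show "TC q n (Suc j) * f' s = f' s * trp (T (Suc j))" .
  qed
  have g'h: "g' s \<in> hhom n (CB n) (TC q n) B ?T" if s: "s < a" for s
    unfolding hhom_def
  proof (intro CollectI conjI allI impI)
    show "g' s \<in> Mt B (CB n)" unfolding g'_def using Mt_mult[OF trp_Mt[OF hhom_Mt[OF fh[OF s]]] QM] .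
    fix j assume j: "Suc j < n"
    have "g' s * TC q n (Suc j) = trp (TC q n (Suc j) * f s) * Qm q n"
      unfolding g'_def mult.assoc Qm_TC[OF q j] by (simp add: trp_mult mult.assoc)
    also have "... = trp (T (Suc j)) * g' s" unfolding hhom_comm[OF fh[OF s] j] by (simp add: g'_def trp_mult mult.assoc)
    finally show "trp (T (Suc j)) * g' s = g' s * TC q n (Suc j)" by simp
  qed
  have "(\<Sum>s<a. g' s * f' s) = trp (\<Sum>s<a. g s * f s)"
  proof -
    have "g' s * f' s = trp (g s * f s)" if s: "s < a" for s
      using QQ_cancel(1)[OF q trp_Mt[OF hhom_Mt[OF gh[OF s]]]] by (simp add: g'_def f'_def trp_mult mult.assoc)
    then show ?thesis by (simp add: trp_sum)
  qed
  also have "... = idB B" using F B by (simp add: factors_def)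
  finally have F': "factors q n B ?T a f' g'" using f'h g'h by (simp add: factors_def)
  have dual: "star q n (f s * g t) = f' t * g' s" if "s < a" "t < a" for s t
    by (simp add: star_def[OF q] f'_def g'_def trp_mult mult.assoc)
  have sH: "smod HN" unfolding smod_def using subspace_hhom hhom_mult by blast
  have "XM B T a f HN = hhom n BN TN B T" using fh hhom_mult unfolding XM_def by blast
  moreover have "XM B ?T a f' HN = hhom n BN TN B ?T" using f'h hhom_mult unfolding XM_def by blast
  ultimately show ?thesis using dim_XM_dual[OF B F F' dual sH] by simp
qed

end

text \<open>Self-duality of the induced modules makes the dimension of \<open>Hom\<close> symmetric in its arguments.\<close>
lemma dim_hhom_sym:
  fixes q :: "'k::field"
  assumes q: "q \<noteq> 0" and B: "finite B" "finite B'" and F: "factors q n B T a f g" and F': "factors q n B' T' a' f' g'"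
  shows "fm.dim (hhom n B T B' T') = fm.dim (hhom n B' T' B T)"
proof -
  interpret p: vspace_pair "fsm :: 'k => _" fsm by unfold_locales
  have im: "trp ` hhom n B T B' (\<lambda>i. trp (T' i)) \<subseteq> hhom n B' T' B (\<lambda>i. trp (T i))"
    for B B' and T T' :: "nat => 'k fmat"
  proof
    fix h assume "h \<in> trp ` hhom n B T B' (\<lambda>i. trp (T' i))"
    then obtain \<psi> where p: "h = trp \<psi>" "\<psi> \<in> hhom n B T B' (\<lambda>i. trp (T' i))" by blast
    have "trp (T (Suc j)) * h = h * T' (Suc j)" if j: "Suc j < n" for j
      using arg_cong[OF hhom_comm[OF p(2) j], of trp] by (simp add: p(1) trp_mult)
    then show "h \<in> hhom n B' T' B (\<lambda>i. trp (T i))" using trp_Mt[OF hhom_Mt[OF p(2)]] by (simp add: hhom_def p(1))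
  qed
  have "trp ` hhom n B T B' (\<lambda>i. trp (T' i)) = hhom n B' T' B (\<lambda>i. trp (T i))"
  proof
    show "hhom n B' T' B (\<lambda>i. trp (T i)) \<subseteq> trp ` hhom n B T B' (\<lambda>i. trp (T' i))"
    proof
      fix h assume "h \<in> hhom n B' T' B (\<lambda>i. trp (T i))"
      then have "trp h \<in> hhom n B T B' (\<lambda>i. trp (T' i))" using im by blast
      then show "h \<in> trp ` hhom n B T B' (\<lambda>i. trp (T' i))" by (metis image_eqI trp_trp)
    qed
  qed (rule im)
  moreover have "fm.dim (trp ` hhom n B T B' (\<lambda>i. trp (T' i))) = fm.dim (hhom n B T B' (\<lambda>i. trp (T' i)))"
  proof (rule p.dim_image_inj_on[OF subspace_hhom fdim_hhom[OF B]])
    fix x :: "'k fmat" assume "trp x = 0" then show "x = 0" by (metis trp_trp trp_zero)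
  qed (simp_all add: trp_add trp_scale)
  ultimately show ?thesis
    using dim_hhom_dual[OF q B(1,2) F', of T] dim_hhom_dual[OF q B(2,1) F, of T'] by simp
qed

section \<open>Quadratic algebras\<close>

lemma lspan_eq: "lspan S = fs.span S"
proof -
  have "(\<lambda>w. \<Sum>s\<in>F. c s * s w) = (\<Sum>s\<in>F. fsc (c s) s)" for F :: "('a list => 'b) set" and c
    by (rule ext) (simp add: fun_sum_apply fsc_def)
  then show ?thesis unfolding lspan_def fs.span_explicit by simp
qed

lemma vdim_eq:
  assumes U: "fs.subspace U" "fs.fdim U"
  shows "vdim U = fs.dim U"
proof -
  obtain B where "finite B" "fs.independent B" "B \<subseteq> U" "fs.span B = U" "card B = fs.dim U"
    by (rule fs.fdim_basis[OF U])
  then show ?thesis unfolding vdim_def lspan_eq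
    by (intro Least_equality) (auto intro!: fs.dim_le_card)
qed

definition dl :: "'a => 'a => 'k::field" where "dl w = (\<lambda>v. if v = w then 1 else 0)"

lemma subspace_vecs: "fs.subspace (vecs n X)"
  by (auto simp: fs.subspace_def vecs_def fsc_def)

lemma fdim_vecs: "finite X ==> fs.fdim (vecs n X :: ('x list => 'k::field) set)"
  unfolding fs.fdim_def
proof (intro exI[of _ "dl ` hk_words n X"] conjI subsetI)
  assume X: "finite X"
  show "finite ((dl :: 'x list => 'x list => 'k) ` hk_words n X)" using X by simp
  fix f :: "'x list => 'k" assume f: "f \<in> vecs n X"
  have "f = (\<Sum>w\<in>hk_words n X. fsc (f w) (dl w))"
  proof
    fix v
    have "(\<Sum>w\<in>hk_words n X. fsc (f w) (dl w)) v = (\<Sum>w\<in>hk_words n X. if v = w then f v else 0)"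
      unfolding fun_sum_apply by (intro sum.cong refl) (simp add: fsc_def dl_def)
    also have "... = f v" using f X by (simp add: vecs_def)
    finally show "f v = (\<Sum>w\<in>hk_words n X. fsc (f w) (dl w)) v" by simp
  qed
  moreover have "... \<in> fs.span (dl ` hk_words n X)" by (intro fs.span_sum fs.span_scale fs.span_base) simp
  ultimately show "f \<in> fs.span (dl ` hk_words n X)" by (simp only:)
qed

lemma vecsI: "(\<And>w. f w \<noteq> 0 ==> w \<in> hk_words n X) ==> f \<in> vecs n X" unfolding vecs_def by blast
lemma vecsD: "f \<in> vecs n X ==> f w \<noteq> 0 ==> w \<in> hk_words n X" unfolding vecs_def by blast

lemma subspace_pull:
  fixes U :: "('a => 'k::field) set" and h :: "'a => 'b"
  assumes U: "fs.subspace U"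
  shows "fs.subspace {f. (\<lambda>v. f (h v)) \<in> U}"
proof -
  have "(\<lambda>v. (f + g) (h v)) = (\<lambda>v. f (h v)) + (\<lambda>v. g (h v))" "(\<lambda>v. fsc c f (h v)) = fsc c (\<lambda>v. f (h v))"
    "(\<lambda>v. (0 :: 'b => 'k) (h v)) = 0" for f g :: "'b => 'k" and c
    by (auto simp: fsc_def)
  then show ?thesis using U unfolding fs.subspace_def by simp
qed

lemma subspace_slices:
  "fs.subspace U ==> fs.subspace {f \<in> vecs m X. \<forall>s. P s --> (\<lambda>v. f (h s v)) \<in> U}"
proof -
  assume U: "fs.subspace U"
  have "{f \<in> vecs m X. \<forall>s. P s --> (\<lambda>v. f (h s v)) \<in> U} = vecs m X \<inter> \<Inter> ((\<lambda>s. {f. (\<lambda>v. f (h s v)) \<in> U}) ` {s. P s})" by auto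
  moreover have "fs.subspace (vecs m X \<inter> \<Inter> ((\<lambda>s. {f. (\<lambda>v. f (h s v)) \<in> U}) ` {s. P s}))"
    by (intro fs.subspace_inter subspace_vecs fs.subspace_Inter) (auto intro: subspace_pull[OF U])
  ultimately show ?thesis by (simp only:)
qed

lemma hk_words_append: "u \<in> hk_words p X ==> v \<in> hk_words r X ==> u @ v \<in> hk_words (p + r) X"
  by (auto simp: hk_words_def)

lemma tens_vecs: "f \<in> vecs p X ==> g \<in> vecs r X ==> tens p f g \<in> vecs (p + r) X"
proof (rule vecsI)
  fix w assume fg: "f \<in> vecs p X" "g \<in> vecs r X" "tens p f g w \<noteq> 0"
  then have "take p w \<in> hk_words p X" "drop p w \<in> hk_words r X" by (auto simp: tens_def dest: vecsD)
  from hk_words_append[OF this] show "w \<in> hk_words (p + r) X" by simp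
qed

text \<open>Membership in a tensor product with a full factor can be tested on slices, obtained by
  fixing the letters in that factor. In this form intersections and iterated tensor products become
  conditions on function values.\<close>

lemma tsp_left:
  assumes X: "finite X" and U: "fs.subspace U" "U \<subseteq> vecs p X"
  shows "tsp p U (vecs r X) = {f \<in> vecs (p + r) X. \<forall>s. length s = r --> (\<lambda>v. f (v @ s)) \<in> U}" (is "_ = ?R")
proof
  show "tsp p U (vecs r X) \<subseteq> ?R" unfolding tsp_def lspan_eq
  proof (rule fs.span_minimal[OF _ subspace_slices[OF U(1)]], rule subsetI)
    fix z assume "z \<in> {tens p f g | f g. f \<in> U \<and> g \<in> vecs r X}"
    then obtain u g where z: "z = tens p u g" "u \<in> U" "g \<in> vecs r X" by blast
    have zv: "z \<in> vecs (p + r) X" unfolding z(1) using tens_vecs z(2,3) U(2) by blast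
    have "(\<lambda>v. z (v @ s)) = fsc (g s) u" if s: "length s = r" for s
    proof
      fix v
      show "z (v @ s) = fsc (g s) u v"
      proof (cases "length v = p")
        case True
        then show ?thesis by (simp add: z tens_def fsc_def)
      next
        case False
        have "z (v @ s) = 0" using False s zv by (auto simp: vecs_def hk_words_def)
        moreover have "u v = 0" using False z(2) U(2) by (auto simp: vecs_def hk_words_def)
        ultimately show ?thesis by (simp add: fsc_def)
      qed
    qed
    then show "z \<in> ?R" using zv fs.subspace_scale[OF U(1) z(2)] by simp
  qed
  show "?R \<subseteq> tsp p U (vecs r X)" unfolding tsp_def lspan_eq
  proof
    fix f assume f: "f \<in> ?R"
    have "f = (\<Sum>s\<in>hk_words r X. tens p (\<lambda>v. f (v @ s)) (dl s))"
    proof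
      fix w
      have "(\<Sum>s\<in>hk_words r X. tens p (\<lambda>v. f (v @ s)) (dl s)) w = (\<Sum>s\<in>hk_words r X. if drop p w = s then f w else 0)"
        unfolding fun_sum_apply by (intro sum.cong refl) (auto simp: tens_def dl_def)
      also have "... = (if drop p w \<in> hk_words r X then f w else 0)" using X by simp
      also have "... = f w" using vecsD[of f "p + r" X w] f set_drop_subset[of p w] by (cases "f w = 0") (auto simp: hk_words_def)
      finally show "f w = (\<Sum>s\<in>hk_words r X. tens p (\<lambda>v. f (v @ s)) (dl s)) w" by simp
    qed
    also have "... \<in> fs.span {tens p f g | f g. f \<in> U \<and> g \<in> vecs r X}"
    proof (intro fs.span_sum fs.span_base)
      fix s assume s: "s \<in> hk_words r X"
      have "dl s \<in> vecs r X" using s by (simp add: vecs_def dl_def)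
      moreover have "(\<lambda>v. f (v @ s)) \<in> U" using f s by (simp add: hk_words_def)
      ultimately show "tens p (\<lambda>v. f (v @ s)) (dl s) \<in> {tens p f g | f g. f \<in> U \<and> g \<in> vecs r X}" by blast
    qed
    finally show "f \<in> fs.span {tens p f g | f g. f \<in> U \<and> g \<in> vecs r X}" .
  qed
qed

lemma tsp_right:
  assumes X: "finite X" and U: "fs.subspace U" "U \<subseteq> vecs r X"
  shows "tsp p (vecs p X) U = {f \<in> vecs (p + r) X. \<forall>s. length s = p --> (\<lambda>v. f (s @ v)) \<in> U}" (is "_ = ?R")
proof
  show "tsp p (vecs p X) U \<subseteq> ?R" unfolding tsp_def lspan_eq
  proof (rule fs.span_minimal[OF _ subspace_slices[OF U(1)]], rule subsetI)
    fix z assume "z \<in> {tens p f g | f g. f \<in> vecs p X \<and> g \<in> U}"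
    then obtain u g where z: "z = tens p u g" "u \<in> vecs p X" "g \<in> U" by blast
    have zv: "z \<in> vecs (p + r) X" unfolding z(1) using tens_vecs z(2,3) U(2) by blast
    have "(\<lambda>v. z (s @ v)) = fsc (u s) g" if s: "length s = p" for s
      using s by (auto simp: z tens_def fsc_def)
    then show "z \<in> ?R" using zv fs.subspace_scale[OF U(1) z(3)] by simp
  qed
  show "?R \<subseteq> tsp p (vecs p X) U" unfolding tsp_def lspan_eq
  proof
    fix f assume f: "f \<in> ?R"
    have "f = (\<Sum>s\<in>hk_words p X. tens p (dl s) (\<lambda>v. f (s @ v)))"
    proof
      fix w
      have "(\<Sum>s\<in>hk_words p X. tens p (dl s) (\<lambda>v. f (s @ v))) w = (\<Sum>s\<in>hk_words p X. if take p w = s then f w else 0)"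
        unfolding fun_sum_apply by (intro sum.cong refl) (auto simp: tens_def dl_def)
      also have "... = (if take p w \<in> hk_words p X then f w else 0)" using X by simp
      also have "... = f w" using vecsD[of f "p + r" X w] f set_take_subset[of p w] by (cases "f w = 0") (auto simp: hk_words_def)
      finally show "f w = (\<Sum>s\<in>hk_words p X. tens p (dl s) (\<lambda>v. f (s @ v))) w" by simp
    qed
    also have "... \<in> fs.span {tens p f g | f g. f \<in> vecs p X \<and> g \<in> U}"
    proof (intro fs.span_sum fs.span_base)
      fix s assume s: "s \<in> hk_words p X"
      have "dl s \<in> vecs p X" using s by (simp add: vecs_def dl_def)
      moreover have "(\<lambda>v. f (s @ v)) \<in> U" using f s by (simp add: hk_words_def)
      ultimately show "tens p (dl s) (\<lambda>v. f (s @ v)) \<in> {tens p f g | f g. f \<in> vecs p X \<and> g \<in> U}" by blast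
    qed
    finally show "f \<in> fs.span {tens p f g | f g. f \<in> vecs p X \<and> g \<in> U}" .
  qed
qed

lemma tens_add: "tens p (f + f') g = tens p f g + tens p f' g" "tens p f (g + g') = tens p f g + tens p f g'"
  and tens_scale: "tens p (fsc c f) g = fsc c (tens p f g)" "tens p f (fsc c g) = fsc c (tens p f g)"
  by (auto simp: tens_def fsc_def algebra_simps)

lemma slice_vecs: "f \<in> vecs m X ==> length s + length t + r = m ==> (\<lambda>v. f (s @ v @ t)) \<in> vecs r X"
  by (rule vecsI) (auto simp: hk_words_def dest!: vecsD)

text \<open>The coefficient functionals of a basis of \<open>U\<^sub>1\<close> extending one of \<open>U\<close> show that
  \<open>(U\<^sub>1 \<otimes> D) \<inter> (U \<otimes> W\<^sup>\<otimes>\<^sup>r) = U \<otimes> D\<close>.\<close>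
lemma dim_tsp_restrict:
  assumes U1: "fs.subspace U1" "fs.fdim U1" "U1 \<subseteq> vecs p X" and U: "fs.subspace U" "U \<subseteq> U1"
    and D: "fs.subspace D" "fs.fdim D" "D \<subseteq> vecs r (X :: 'x set)"
  shows "fs.dim {f \<in> tsp p U1 D. \<forall>s. length s = r --> (\<lambda>v. f (v @ s)) \<in> (U :: ('x list => 'k::field) set)} = fs.dim U * fs.dim D"
    (is "fs.dim ?W = _")
proof -
  obtain Bd where Bd: "finite Bd" "fs.independent Bd" "Bd \<subseteq> D" "fs.span Bd = D" "card Bd = fs.dim D"
    by (rule fs.fdim_basis[OF D(1,2)])
  obtain Bu where Bu: "finite Bu" "fs.independent Bu" "Bu \<subseteq> U" "fs.span Bu = U" "card Bu = fs.dim U"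
    by (rule fs.fdim_basis[OF U(1) fs.fdim_subset[OF U1(2) U(2)]])
  obtain B where B: "Bu \<subseteq> B" "B \<subseteq> U1" "fs.independent B" "U1 \<subseteq> fs.span B"
    using fs.maximal_independent_subset_extend[of Bu U1] Bu U(2) by blast
  have fB: "finite B" using fs.fdim_independent_finite[OF U1(2) B(3,2)] .
  define t where "t = (\<lambda>bd. tens p (fst bd) (snd bd :: 'x list => 'k))"
  have slice: "(\<lambda>v. (\<Sum>bd\<in>B \<times> Bd. fsc (c bd) (t bd)) (v @ s)) = (\<Sum>b\<in>B. fsc (\<Sum>d\<in>Bd. c (b, d) * d s) b)"
    if s: "length s = r" for c s
  proof
    fix v
    have "c (b, d) * t (b, d) (v @ s) = c (b, d) * d s * b v" if "b \<in> B" "d \<in> Bd" for b d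
    proof (cases "length v = p")
      case True then show ?thesis by (simp add: t_def tens_def)
    next
      case False
      have b: "b \<in> vecs p X" "d \<in> vecs r X" using that B(2) U1(3) Bd(3) D(3) by auto
      have "b v = 0" using False b by (auto simp: vecs_def hk_words_def)
      moreover have "t (b, d) (v @ s) = 0" using False s tens_vecs[OF b] by (auto simp: t_def vecs_def hk_words_def)
      ultimately show ?thesis by simp
    qed
    then have "(\<Sum>b\<in>B. \<Sum>d\<in>Bd. c (b, d) * t (b, d) (v @ s)) = (\<Sum>b\<in>B. \<Sum>d\<in>Bd. c (b, d) * d s * b v)"
      by (intro sum.cong refl)
    then show "(\<Sum>bd\<in>B \<times> Bd. fsc (c bd) (t bd)) (v @ s) = (\<Sum>b\<in>B. fsc (\<Sum>d\<in>Bd. c (b, d) * d s) b) v"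
      by (simp add: fun_sum_apply fsc_def sum_distrib_right sum.cartesian_product')
  qed
  have coef: "c (b, d) = 0" if b: "b \<in> B" "d \<in> Bd" and z: "\<And>s. length s = r ==> (\<Sum>d\<in>Bd. c (b, d) * d s) = 0" for b d c
  proof -
    have "(\<Sum>d\<in>Bd. fsc (c (b, d)) d) = 0"
    proof
      fix s
      show "(\<Sum>d\<in>Bd. fsc (c (b, d)) d) s = 0 s"
      proof (cases "length s = r")
        case True then show ?thesis using z by (simp add: fun_sum_apply fsc_def)
      next
        case False
        then have "d s = 0" if "d \<in> Bd" for d using that Bd(3) D(3) by (auto simp: vecs_def hk_words_def)
        then show ?thesis by (auto simp: fun_sum_apply fsc_def intro!: sum.neutral)
      qed
    qed
    from fs.independentD[OF Bd(2,1) subset_refl this b(2)] show ?thesis .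
  qed
  have ind0: "c bd = 0" if z: "(\<Sum>bd\<in>B \<times> Bd. fsc (c bd) (t bd)) = 0" and bd: "bd \<in> B \<times> Bd" for c bd
  proof -
    obtain b d where bd': "bd = (b, d)" "b \<in> B" "d \<in> Bd" using bd by blast
    have "(\<Sum>d\<in>Bd. c (b, d) * d s) = 0" if s: "length s = r" for s
    proof (rule fs.independentD[OF B(3) fB subset_refl _ bd'(2)])
      show "(\<Sum>b\<in>B. fsc (\<Sum>d\<in>Bd. c (b, d) * d s) b) = 0" unfolding slice[OF s, symmetric] z by auto
    qed
    then show ?thesis using coef[OF bd'(2,3)] bd' by blast
  qed
  have inj: "inj_on t (B \<times> Bd)"
  proof (rule inj_onI, rule ccontr)
    fix x y assume xy: "x \<in> B \<times> Bd" "y \<in> B \<times> Bd" "t x = t y" "x \<noteq> y"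
    let ?c = "\<lambda>z. if z = x then 1 else if z = y then - 1 else 0 :: 'k"
    have "(\<Sum>z\<in>B \<times> Bd. fsc (?c z) (t z)) = (\<Sum>z\<in>{x, y}. fsc (?c z) (t z))"
      using xy fB Bd(1) by (intro sum.mono_neutral_right) (auto simp: fsc_def)
    also have "... = 0" using xy(3,4) by (auto simp: fsc_def)
    finally show False using ind0[of ?c x] xy(1) by simp
  qed
  have ind: "fs.independent (t ` (Bu \<times> Bd))"
  proof (rule fs.independent_mono)
    show "t ` (Bu \<times> Bd) \<subseteq> t ` (B \<times> Bd)" using B(1) by blast
    show "fs.independent (t ` (B \<times> Bd))"
    proof (rule fs.independent_if_scalars_zero)
      show "finite (t ` (B \<times> Bd))" using fB Bd(1) by simp
      fix f x assume "(\<Sum>x\<in>t ` (B \<times> Bd). fsc (f x) x) = 0" "x \<in> t ` (B \<times> Bd)"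
      then show "f x = 0" using ind0[of "\<lambda>bd. f (t bd)"] by (auto simp: sum.reindex[OF inj])
    qed
  qed
  have gen: "tens p f g \<in> fs.span (t ` (A \<times> Bd))" if "f \<in> fs.span A" "g \<in> fs.span Bd" for f g A
  proof (rule fs.span_induct_alt[OF that(1)])
    let ?S = "fs.span (t ` (A \<times> Bd))"
    have tens0: "tens p 0 g = 0" "tens p b 0 = (0 :: 'x list => 'k)" for b by (auto simp: tens_def)
    show "tens p 0 g \<in> ?S" by (simp only: tens0 fs.span_zero)
    fix c b y assume b: "b \<in> A" and y: "tens p y g \<in> ?S"
    have "tens p b g \<in> ?S"
    proof (rule fs.span_induct_alt[OF that(2)])
      show "tens p b 0 \<in> ?S" by (simp only: tens0 fs.span_zero)
      fix c' d z assume d: "d \<in> Bd" and z: "tens p b z \<in> ?S"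
      have "tens p b d \<in> t ` (A \<times> Bd)" using b d by (force simp: t_def)
      then show "tens p b (fsc c' d + z) \<in> ?S" unfolding tens_add tens_scale by (intro fs.span_add fs.span_scale fs.span_base z)
    qed
    then show "tens p (fsc c b + y) g \<in> ?S" unfolding tens_add tens_scale by (intro fs.span_add fs.span_scale y)
  qed
  have "fs.span (t ` (Bu \<times> Bd)) = ?W"
  proof
    have sW: "fs.subspace ?W"
    proof -
      have "tsp p U1 D \<subseteq> vecs (p + r) X" unfolding tsp_def lspan_eq
        by (rule fs.span_minimal[OF _ subspace_vecs]) (use tens_vecs U1(3) D(3) in blast)
      then have "?W = tsp p U1 D \<inter> {f \<in> vecs (p + r) X. \<forall>s. length s = r --> (\<lambda>v. f (v @ s)) \<in> U}" by blast
      moreover have "fs.subspace (tsp p U1 D \<inter> {f \<in> vecs (p + r) X. \<forall>s. length s = r --> (\<lambda>v. f (v @ s)) \<in> U})"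
        by (intro fs.subspace_inter subspace_slices U(1)) (simp add: tsp_def lspan_eq)
      ultimately show ?thesis by (simp only:)
    qed
    show "fs.span (t ` (Bu \<times> Bd)) \<subseteq> ?W"
    proof (rule fs.span_minimal[OF _ sW], rule subsetI)
      fix z assume "z \<in> t ` (Bu \<times> Bd)"
      then obtain u d where z: "z = tens p u d" "u \<in> Bu" "d \<in> Bd" by (auto simp: t_def)
      have "u \<in> U1" "d \<in> D" "u \<in> U" using z(2,3) Bu(3) U(2) Bd(3) by auto
      then have zt: "z \<in> tsp p U1 D" unfolding tsp_def lspan_eq z(1) by (intro fs.span_base) blast
      have zv: "z \<in> vecs (p + r) X" unfolding z(1) using tens_vecs \<open>u \<in> U1\<close> \<open>d \<in> D\<close> U1(3) D(3) by blast
      have "(\<lambda>v. z (v @ s)) = fsc (d s) u" if s: "length s = r" for s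
      proof
        fix v
        show "z (v @ s) = fsc (d s) u v"
        proof (cases "length v = p")
          case True then show ?thesis by (simp add: z tens_def fsc_def)
        next
          case False
          have "z (v @ s) = 0" using False s zv by (auto simp: vecs_def hk_words_def)
          moreover have "u v = 0" using False \<open>u \<in> U1\<close> U1(3) by (auto simp: vecs_def hk_words_def)
          ultimately show ?thesis by (simp add: fsc_def)
        qed
      qed
      then show "z \<in> ?W" using zt fs.subspace_scale[OF U(1) \<open>u \<in> U\<close>] by simp
    qed
    show "?W \<subseteq> fs.span (t ` (Bu \<times> Bd))"
    proof
      fix f assume f: "f \<in> ?W"
      have "tsp p U1 D \<subseteq> fs.span (t ` (B \<times> Bd))" unfolding tsp_def lspan_eq
        by (rule fs.span_minimal[OF _ fs.subspace_span]) (use gen[of _ B] B(4) Bd(4) in blast)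
      then have "f \<in> fs.span (t ` (B \<times> Bd))" using f by blast
      then obtain c' where "f = (\<Sum>x\<in>t ` (B \<times> Bd). fsc (c' x) x)"
        using fs.span_finite[of "t ` (B \<times> Bd)"] fB Bd(1) by auto
      then have fc: "f = (\<Sum>bd\<in>B \<times> Bd. fsc (c' (t bd)) (t bd))" by (simp add: sum.reindex[OF inj])
      have "c' (t (b, d)) = 0" if b: "b \<in> B" "b \<notin> Bu" "d \<in> Bd" for b d
      proof (rule coef[OF b(1,3), where c = "\<lambda>bd. c' (t bd)"])
        fix s :: "'x list" assume s: "length s = r"
        have "(\<Sum>b\<in>B. fsc (\<Sum>d\<in>Bd. c' (t (b, d)) * d s) b) \<in> fs.span Bu"
          using f s unfolding slice[OF s, of "\<lambda>bd. c' (t bd)", symmetric] fc[symmetric] Bu(4) by blast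
        then obtain e where e: "(\<Sum>b\<in>B. fsc (\<Sum>d\<in>Bd. c' (t (b, d)) * d s) b) = (\<Sum>b\<in>Bu. fsc (e b) b)"
          using fs.span_finite[OF Bu(1)] by auto
        have "(\<Sum>b\<in>Bu. fsc (e b) b) = (\<Sum>b\<in>B. fsc (if b \<in> Bu then e b else 0) b)"
          by (rule sum.mono_neutral_cong_left[OF fB B(1)]) (auto simp: fsc_def)
        then have "(\<Sum>b\<in>B. fsc ((\<Sum>d\<in>Bd. c' (t (b, d)) * d s) - (if b \<in> Bu then e b else 0)) b) = 0"
          using e by (simp add: fs.scale_left_diff_distrib sum_subtractf)
        from fs.independentD[OF B(3) fB subset_refl this b(1)] show "(\<Sum>d\<in>Bd. c' (t (b, d)) * d s) = 0" using b(2) by simp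
      qed
      then have "f = (\<Sum>bd\<in>Bu \<times> Bd. fsc (c' (t bd)) (t bd))" unfolding fc
        using fB Bd(1) B(1) by (intro sum.mono_neutral_right) (auto simp: fsc_def)
      also have "... \<in> fs.span (t ` (Bu \<times> Bd))" by (intro fs.span_sum fs.span_scale fs.span_base) simp
      finally show "f \<in> fs.span (t ` (Bu \<times> Bd))" .
    qed
  qed
  then have "fs.dim ?W = card (t ` (Bu \<times> Bd))" using fs.dim_eq_card_basis[OF ind] by simp
  also have "... = card (Bu \<times> Bd)" using inj B(1) by (intro card_image) (auto intro: inj_on_subset)
  finally show ?thesis using Bu(5) Bd(5) by (simp add: card_cartesian_product)
qed

lemma span_UN_sum:
  assumes X: "\<And>j. j \<le> p ==> fs.subspace (X (j :: nat))" and f: "f \<in> fs.span (\<Union>j\<in>{..p}. X j)"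
  shows "\<exists>x. (\<forall>j\<le>p. x j \<in> X j) \<and> f = (\<Sum>j\<le>p. x j)"
proof (rule fs.span_induct_alt[OF f])
  show "\<exists>x. (\<forall>j\<le>p. x j \<in> X j) \<and> 0 = (\<Sum>j\<le>p. x j)"
    by (rule exI[of _ "\<lambda>_. 0"]) (use fs.subspace_0[OF X] in simp)
  fix c b y assume "b \<in> (\<Union>j\<in>{..p}. X j)" and "\<exists>x. (\<forall>j\<le>p. x j \<in> X j) \<and> y = (\<Sum>j\<le>p. x j)"
  then obtain x i where x: "\<forall>j\<le>p. x j \<in> X j" "y = (\<Sum>j\<le>p. x j)" and i: "i \<le> p" "b \<in> X i" by blast
  define x' where "x' = (\<lambda>j. x j + (if j = i then fsc c b else 0))"
  have "fsc c b + y = (\<Sum>j\<le>p. x' j)" unfolding x'_def sum.distrib using i(1) x(2) by simp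
  moreover have "x' j \<in> X j" if "j \<le> p" for j
    using that x(1) i fs.subspace_add[OF X[OF that]] fs.subspace_scale[OF X[OF i(1)] i(2)] by (cases "j = i") (simp_all add: x'_def)
  ultimately show "\<exists>x. (\<forall>j\<le>p. x j \<in> X j) \<and> fsc c b + y = (\<Sum>j\<le>p. x j)" by blast
qed

section \<open>The Koszul complex in terms of intersections and sums of relation pieces\<close>

definition PP :: "'x set => ('x list => 'k::field) set => nat => nat => ('x list => 'k) set"
  where "PP X I2 m k = {f \<in> vecs m X. \<forall>j. k \<le> j \<and> j + 2 \<le> m --> f \<in> rel_piece X I2 m j}"

text \<open>Relations inside the first \<open>k\<close> letters, that is, the ideal in degree
  \<open>k\<close> tensored with the free rest (\<open>tsp_qideal\<close>). In contrast
  \<open>PP X I2 m k\<close> imposes all relations inside the last \<open>m - k\<close> letters,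
  that is, it is the free part in degree \<open>k\<close> tensored with the dual coalgebra
  (\<open>tsp_kdual\<close>).\<close>

definition SP :: "'x set => ('x list => 'k::field) set => nat => nat => ('x list => 'k) set"
  where "SP X I2 m k = fs.span (\<Union>j\<in>{j. j + 2 \<le> k}. rel_piece X I2 m j)"

context
  fixes X :: "'x set" and I2 :: "('x list => 'k::field) set"
  assumes X: "finite X" and I2: "fs.subspace I2" "I2 \<subseteq> vecs 2 X"
begin

lemma rel_piece_eq:
  assumes "j + 2 \<le> n"
  shows "rel_piece X I2 n j = {f \<in> vecs n X. \<forall>s t. length s = j --> length t = n - 2 - j --> (\<lambda>v. f (s @ v @ t)) \<in> I2}"
proof -
  let ?U = "{f \<in> vecs (2 + (n - 2 - j)) X. \<forall>s. length s = n - 2 - j --> (\<lambda>v. f (v @ s)) \<in> I2}"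
  have "rel_piece X I2 n j = {f \<in> vecs (j + (2 + (n - 2 - j))) X. \<forall>s. length s = j --> (\<lambda>v. f (s @ v)) \<in> ?U}"
    unfolding rel_piece_def tsp_left[OF X I2] by (rule tsp_right[OF X subspace_slices[OF I2(1)]]) blast
  moreover have "(\<lambda>v. f (s @ v)) \<in> vecs (2 + (n - 2 - j)) X" if "f \<in> vecs n X" "length s = j" for f :: "'x list => 'k" and s
    using slice_vecs[OF that(1), of s "[]"] that(2) assms by simp
  moreover have nj: "j + (2 + (n - 2 - j)) = n" using assms by simp
  ultimately show ?thesis unfolding nj by auto
qed

lemma subspace_rel_piece: "fs.subspace (rel_piece X I2 n j)"
  unfolding rel_piece_def tsp_def lspan_eq by simp

lemma rel_piece_vecs: "j + 2 \<le> n ==> rel_piece X I2 n j \<subseteq> vecs n X" by (auto simp: rel_piece_eq)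

lemma kdual_eq: "kdual X I2 i = PP X I2 i 0"
proof (cases "i < 2")
  case True then show ?thesis by (auto simp: kdual_def PP_def)
next
  case False
  then have "f \<in> vecs i X" if "f \<in> (\<Inter>j\<in>{j. j + 2 \<le> i}. rel_piece X I2 i j)" for f
    using that rel_piece_vecs[of 0 i] by fastforce
  then show ?thesis using False unfolding kdual_def PP_def by auto
qed

lemma subspace_PP: "fs.subspace (PP X I2 m k)"
proof -
  have "PP X I2 m k = vecs m X \<inter> \<Inter> (rel_piece X I2 m ` {j. k \<le> j \<and> j + 2 \<le> m})" by (auto simp: PP_def)
  moreover have "fs.subspace (vecs m X \<inter> \<Inter> (rel_piece X I2 m ` {j. k \<le> j \<and> j + 2 \<le> m}))"
    by (intro fs.subspace_inter subspace_vecs fs.subspace_Inter) (auto intro: subspace_rel_piece)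
  ultimately show ?thesis by (simp only:)
qed

lemma PP_vecs: "PP X I2 m k \<subseteq> vecs m X" by (auto simp: PP_def)

lemma subspace_SP: "fs.subspace (SP X I2 m k)" by (simp add: SP_def)

lemma SP_vecs: "k \<le> m ==> SP X I2 m k \<subseteq> vecs m X"
  unfolding SP_def by (rule fs.span_minimal[OF _ subspace_vecs], rule UN_least, rule rel_piece_vecs) simp

lemma qideal_eq: "qideal X I2 k = SP X I2 k k" by (simp add: qideal_def SP_def lspan_eq)

lemma tsp_kdual:
  assumes "i \<le> m"
  shows "tsp (m - i) (vecs (m - i) X) (kdual X I2 i) = PP X I2 m (m - i)"
proof -
  have "tsp (m - i) (vecs (m - i) X) (kdual X I2 i) = {f \<in> vecs (m - i + i) X. \<forall>s. length s = m - i --> (\<lambda>v. f (s @ v)) \<in> PP X I2 i 0}"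
    unfolding kdual_eq by (rule tsp_right[OF X subspace_PP PP_vecs])
  also have "... = PP X I2 m (m - i)"
  proof (intro equalityI subsetI)
    fix f assume f: "f \<in> {f \<in> vecs (m - i + i) X. \<forall>s. length s = m - i --> (\<lambda>v. f (s @ v)) \<in> PP X I2 i 0}"
    then have fv: "f \<in> vecs m X" using assms by simp
    have "f \<in> rel_piece X I2 m j" if j: "m - i \<le> j" "j + 2 \<le> m" for j
      unfolding rel_piece_eq[OF j(2)]
    proof (intro CollectI conjI fv allI impI)
      fix s t :: "'x list" assume st: "length s = j" "length t = m - 2 - j"
      define s1 s2 where "s1 = take (m - i) s" and "s2 = drop (m - i) s"
      have s: "s = s1 @ s2" "length s1 = m - i" "length s2 = j - (m - i)" using st j by (auto simp: s1_def s2_def)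
      have j': "j - (m - i) + 2 \<le> i" using j assms by simp
      have "(\<lambda>v. f (s1 @ v)) \<in> rel_piece X I2 i (j - (m - i))" using f s(2) j' by (auto simp: PP_def)
      moreover have "length t = i - 2 - (j - (m - i))" using st j assms by simp
      ultimately have "(\<lambda>v. f (s1 @ s2 @ v @ t)) \<in> I2" using s(3) unfolding rel_piece_eq[OF j'] by blast
      then show "(\<lambda>v. f (s @ v @ t)) \<in> I2" using s(1) by simp
    qed
    then show "f \<in> PP X I2 m (m - i)" using fv by (simp add: PP_def)
  next
    fix f assume f: "f \<in> PP X I2 m (m - i)"
    then have fv: "f \<in> vecs m X" using PP_vecs by blast
    have "(\<lambda>v. f (s @ v)) \<in> PP X I2 i 0" if s: "length s = m - i" for s
    proof -
      have sv: "(\<lambda>v. f (s @ v)) \<in> vecs i X" using slice_vecs[OF fv, of s "[]" i] s assms by simp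
      have "(\<lambda>v. f (s @ v)) \<in> rel_piece X I2 i j" if j: "j + 2 \<le> i" for j
        unfolding rel_piece_eq[OF j]
      proof (intro CollectI conjI sv allI impI)
        fix s' t :: "'x list" assume st: "length s' = j" "length t = i - 2 - j"
        have j': "m - i + j + 2 \<le> m" using j assms by simp
        have "f \<in> rel_piece X I2 m (m - i + j)" using f j' by (simp add: PP_def)
        then have "(\<lambda>v. f ((s @ s') @ v @ t)) \<in> I2"
          unfolding rel_piece_eq[OF j'] using s st assms j by (auto simp del: append_assoc)
        then show "(\<lambda>v. f (s @ s' @ v @ t)) \<in> I2" by simp
      qed
      then show ?thesis using sv by (simp add: PP_def)
    qed
    then show "f \<in> {f \<in> vecs (m - i + i) X. \<forall>s. length s = m - i --> (\<lambda>v. f (s @ v)) \<in> PP X I2 i 0}" using fv assms by simp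
  qed
  finally show ?thesis .
qed

lemma tsp_rel_piece:
  assumes "j + 2 \<le> k" "k \<le> m"
  shows "tsp k (rel_piece X I2 k j) (vecs (m - k) X) = rel_piece X I2 m j"
proof -
  have jm: "j + 2 \<le> m" and km: "k + (m - k) = m" using assms by auto
  have "tsp k (rel_piece X I2 k j) (vecs (m - k) X) = {f \<in> vecs (k + (m - k)) X. \<forall>s. length s = m - k --> (\<lambda>v. f (v @ s)) \<in> rel_piece X I2 k j}"
    by (rule tsp_left[OF X subspace_rel_piece rel_piece_vecs[OF assms(1)]])
  also have "... = rel_piece X I2 m j"
  proof (intro equalityI subsetI)
    fix f assume f: "f \<in> {f \<in> vecs (k + (m - k)) X. \<forall>s. length s = m - k --> (\<lambda>v. f (v @ s)) \<in> rel_piece X I2 k j}"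
    show "f \<in> rel_piece X I2 m j" unfolding rel_piece_eq[OF jm]
    proof (intro CollectI conjI allI impI)
      show "f \<in> vecs m X" using f km by simp
      fix s t :: "'x list" assume st: "length s = j" "length t = m - 2 - j"
      define t1 t2 where "t1 = take (k - 2 - j) t" and "t2 = drop (k - 2 - j) t"
      have t: "t = t1 @ t2" "length t1 = k - 2 - j" "length t2 = m - k" using st assms by (auto simp: t1_def t2_def)
      have "(\<lambda>v. f (v @ t2)) \<in> rel_piece X I2 k j" using f t(3) by blast
      then have "(\<lambda>v. f ((s @ v @ t1) @ t2)) \<in> I2" unfolding rel_piece_eq[OF assms(1)] using st t(2) by blast
      then show "(\<lambda>v. f (s @ v @ t)) \<in> I2" using t(1) by simp
    qed
  next
    fix f assume f: "f \<in> rel_piece X I2 m j"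
    then have fv: "f \<in> vecs m X" using rel_piece_vecs[OF jm] by blast
    have "(\<lambda>v. f (v @ u)) \<in> rel_piece X I2 k j" if u: "length u = m - k" for u
      unfolding rel_piece_eq[OF assms(1)]
    proof (intro CollectI conjI allI impI)
      show "(\<lambda>v. f (v @ u)) \<in> vecs k X" using slice_vecs[OF fv, of "[]" u k] u assms by simp
      fix s t :: "'x list" assume st: "length s = j" "length t = k - 2 - j"
      have "length (t @ u) = m - 2 - j" using st u assms by simp
      then have "(\<lambda>v. f (s @ v @ (t @ u))) \<in> I2" using f st unfolding rel_piece_eq[OF jm] by blast
      then show "(\<lambda>v. f ((s @ v @ t) @ u)) \<in> I2" by simp
    qed
    then show "f \<in> {f \<in> vecs (k + (m - k)) X. \<forall>s. length s = m - k --> (\<lambda>v. f (v @ s)) \<in> rel_piece X I2 k j}" using fv km by simp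
  qed
  finally show ?thesis .
qed

lemma tsp_qideal:
  assumes "k \<le> m"
  shows "tsp k (qideal X I2 k) (vecs (m - k) X) = SP X I2 m k"
proof
  show "tsp k (qideal X I2 k) (vecs (m - k) X) \<subseteq> SP X I2 m k" unfolding tsp_def lspan_eq
  proof (rule fs.span_minimal[OF _ subspace_SP], rule subsetI)
    fix z assume "z \<in> {tens k f g | f g. f \<in> qideal X I2 k \<and> g \<in> vecs (m - k) X}"
    then obtain f g where z: "z = tens k f g" "f \<in> qideal X I2 k" "g \<in> vecs (m - k) X" by blast
    have "tens k f g \<in> SP X I2 m k"
    proof (rule fs.span_induct_alt[OF z(2)[unfolded qideal_def lspan_eq]])
      have tens0: "tens k 0 g = 0" by (auto simp: tens_def)
      show "tens k 0 g \<in> SP X I2 m k" unfolding tens0 by (rule fs.subspace_0[OF subspace_SP])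
      fix c b y assume "b \<in> (\<Union>j\<in>{j. j + 2 \<le> k}. rel_piece X I2 k j)" and y: "tens k y g \<in> SP X I2 m k"
      then obtain j where j: "j + 2 \<le> k" "b \<in> rel_piece X I2 k j" by blast
      have "tens k b g \<in> tsp k (rel_piece X I2 k j) (vecs (m - k) X)" unfolding tsp_def lspan_eq
        by (rule fs.span_base) (use j(2) z(3) in blast)
      then have "tens k b g \<in> SP X I2 m k" unfolding tsp_rel_piece[OF j(1) assms] SP_def by (intro fs.span_base) (use j(1) in blast)
      then show "tens k (fsc c b + y) g \<in> SP X I2 m k"
        unfolding tens_add tens_scale by (intro fs.subspace_add[OF subspace_SP] fs.subspace_scale[OF subspace_SP] y)
    qed
    then show "z \<in> SP X I2 m k" using z(1) by simp
  qed
  have "rel_piece X I2 m j \<subseteq> tsp k (qideal X I2 k) (vecs (m - k) X)" if j: "j + 2 \<le> k" for j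
  proof -
    have "rel_piece X I2 k j \<subseteq> qideal X I2 k" unfolding qideal_def lspan_eq
      by (rule subset_trans[OF _ fs.span_superset]) (use j in blast)
    then show ?thesis unfolding tsp_rel_piece[OF j assms, symmetric] tsp_def lspan_eq by (intro fs.span_mono) blast
  qed
  then show "SP X I2 m k \<subseteq> tsp k (qideal X I2 k) (vecs (m - k) X)"
    unfolding SP_def by (intro fs.span_minimal) (auto simp: tsp_def lspan_eq)
qed

lemma KN_eq: "i \<le> m ==> KN X I2 m i = SP X I2 m (m - i)"
  using tsp_qideal[of "m - i" m] by (simp add: KN_def)

lemma KU_eq: "i \<le> m ==> KU X I2 m i = {x + y | x y. x \<in> PP X I2 m (m - i) \<and> y \<in> SP X I2 m (m - i)}"
  unfolding KU_def by (simp add: KN_eq tsp_kdual lspan_eq fs.span_Un fs.span_eq_iff[THEN iffD2, OF subspace_PP] fs.span_eq_iff[THEN iffD2, OF subspace_SP])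

lemma PP_KU: "i \<le> m ==> f \<in> PP X I2 m (m - i) ==> f \<in> KU X I2 m i"
  unfolding KU_eq by (rule CollectI, rule exI[of _ f], rule exI[of _ 0]) (use fs.subspace_0[OF subspace_SP] in simp)

text \<open>This is \<open>kcond\<close> at \<open>p = k\<close>: the pieces within the first
  \<open>k + 2\<close> letters are those with index at most \<open>k\<close>, and \<open>PP\<close>
  at \<open>Suc k\<close> is the intersection of the later ones.\<close>

lemma exactness:
  assumes K: "kcond m (rel_piece X I2 m)" and k: "k + 1 < m" and a: "a \<in> PP X I2 m (Suc k)" "a \<in> SP X I2 m (Suc (Suc k))"
  shows "\<exists>x y. a = x + y \<and> x \<in> PP X I2 m k \<and> y \<in> SP X I2 m (Suc k)"
proof -
  have "a \<in> fs.span (\<Union>j\<in>{..k}. rel_piece X I2 m j)" using a(2) by (simp add: SP_def atMost_def)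
  from span_UN_sum[OF subspace_rel_piece this] obtain x where x: "\<forall>j\<le>k. x j \<in> rel_piece X I2 m j" "a = (\<Sum>j\<le>k. x j)" by blast
  have "\<forall>j. k < j \<and> Suc j < m --> a \<in> rel_piece X I2 m j" using a(1) by (simp add: PP_def)
  then obtain \<psi> y where y: "a = \<psi> + (\<Sum>j<k. y j)" "\<forall>j<k. y j \<in> rel_piece X I2 m j" "\<forall>j. k \<le> j \<and> Suc j < m --> \<psi> \<in> rel_piece X I2 m j"
    using K[unfolded kcond_def, rule_format, of k a x] x k by auto
  have "\<psi> \<in> rel_piece X I2 m k" using y(3) k by simp
  then have "\<psi> \<in> PP X I2 m k" using y(3) rel_piece_vecs[of k m] k by (auto simp: PP_def)
  moreover have "(\<Sum>j<k. y j) \<in> SP X I2 m (Suc k)" unfolding SP_def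
  proof (intro fs.span_sum fs.span_base)
    fix j assume "j \<in> {..<k}"
    then show "y j \<in> (\<Union>j\<in>{j. j + 2 \<le> Suc k}. rel_piece X I2 m j)" using y(2) by (intro UN_I[of j]) auto
  qed
  ultimately show ?thesis using y(1) by blast
qed

lemma PP_mono: "k \<le> l ==> PP X I2 m k \<subseteq> PP X I2 m l" by (auto simp: PP_def)
lemma SP_mono: "k \<le> l ==> SP X I2 m k \<subseteq> SP X I2 m l" unfolding SP_def by (intro fs.span_mono UN_mono) auto
lemma SP_small: "k < 2 ==> SP X I2 m k = {0}"
proof -
  assume "k < 2"
  then have "{j. j + 2 \<le> k} = {}" by auto
  then show ?thesis by (simp add: SP_def)
qed

text \<open>The differential is induced by the identity, so a cycle in homological degree
  \<open>i\<close> differs by an element of \<open>SP X I2 m (m - i)\<close> from an element of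
  \<open>PP X I2 m (m - i)\<close> that lies in \<open>SP X I2 m (Suc (m - i))\<close>. With
  \<open>m - i = Suc k\<close> this is the situation of \<open>exactness\<close>.\<close>

lemma koszul_of_kcond:
  assumes K: "\<And>m. kcond m (rel_piece X I2 m)"
  shows "koszul X I2"
proof -
  have ssum: "ssum U U' = {x + y | x y. x \<in> U \<and> y \<in> U'}" for U U' :: "('x list => 'k) set"
    by (simp add: ssum_def plus_fun_def)
  have z: "(\<lambda>w. 0) = (0 :: 'x list => 'k)" by (simp add: zero_fun_def)
  have "f \<in> ssum (KU X I2 m (i + 1)) (KN X I2 m i)" if i: "1 \<le> i" and f: "f \<in> KU X I2 m i" "f \<in> KN X I2 m (i - 1)" for f m i
  proof (cases "i \<le> m")
    case False
    then have "f = 0" using f(1) by (simp add: KU_def z)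
    then show ?thesis using False unfolding ssum by (simp add: KU_def KN_def z)
  next
    case im: True
    obtain a b where ab: "f = a + b" "a \<in> PP X I2 m (m - i)" "b \<in> SP X I2 m (m - i)" using f(1) KU_eq[OF im] by blast
    have fS: "f \<in> SP X I2 m (Suc (m - i))" using f(2) KN_eq[of "i - 1" m] i im by (simp add: Suc_diff_le)
    show ?thesis
    proof (cases "m - i")
      \<comment> \<open>The left end of the complex, \<open>i = m\<close>: a single letter carries
        no relations, so the cycle is zero.\<close>
      case 0
      then have "f = 0" using fS SP_small[of "Suc 0" m] by simp
      moreover have "0 \<in> KU X I2 m (i + 1)" using 0 im by (simp add: KU_def z)
      moreover have "0 \<in> KN X I2 m i" unfolding KN_eq[OF im] by (rule fs.subspace_0[OF subspace_SP])
      ultimately show ?thesis unfolding ssum by (intro CollectI exI[of _ 0]) simp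
    next
      case (Suc k)
      have "b \<in> SP X I2 m (Suc (m - i))" using ab(3) SP_mono[of "m - i" "Suc (m - i)"] by auto
      then have "a \<in> SP X I2 m (Suc (m - i))" using fs.subspace_diff[OF subspace_SP fS] ab(1) by (metis add_diff_cancel_right')
      then obtain x y where xy: "a = x + y" "x \<in> PP X I2 m k" "y \<in> SP X I2 m (Suc k)"
        using exactness[OF K _ ab(2)[unfolded Suc]] Suc i im by (metis Suc_eq_plus1 diff_less less_le_trans zero_less_one)
      have "x \<in> KU X I2 m (i + 1)"
      proof -
        have "i + 1 \<le> m" "m - (i + 1) = k" using Suc by auto
        then show ?thesis using PP_KU[of "i + 1" m x] xy(2) by simp
      qed
      moreover have "y + b \<in> KN X I2 m i" unfolding KN_eq[OF im] Suc
        using fs.subspace_add[OF subspace_SP xy(3)] ab(3) Suc by simp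
      moreover have "f = x + (y + b)" using ab(1) xy(1) by (simp add: add.assoc)
      ultimately show ?thesis unfolding ssum by blast
    qed
  qed
  moreover have "KU X I2 m 0 \<subseteq> ssum (KU X I2 m 1) (KN X I2 m 0)" if m: "1 \<le> m" for m
  proof
    fix f assume "f \<in> KU X I2 m 0"
    then obtain a b where ab: "f = a + b" "a \<in> PP X I2 m m" "b \<in> SP X I2 m m" using KU_eq[of 0 m] by auto
    have "a \<in> PP X I2 m (m - 1)" using ab(2) m by (auto simp: PP_def)
    then have "a \<in> KU X I2 m 1" using PP_KU[of 1 m a] m by simp
    moreover have "b \<in> KN X I2 m 0" using KN_eq[of 0 m] ab(3) by simp
    ultimately show "f \<in> ssum (KU X I2 m 1) (KN X I2 m 0)" unfolding ssum using ab(1) by blast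
  qed
  ultimately show ?thesis unfolding koszul_def by blast
qed

lemma fdim_PP: "fs.fdim (PP X I2 m k)" by (rule fs.fdim_subset[OF fdim_vecs[OF X] PP_vecs])

text \<open>Here \<open>e k\<close> is the dimension of the term of the complex whose factor from
  the algebra has degree \<open>k\<close>, and \<open>z k\<close> the dimension of its image under
  the differential. Exactness gives \<open>e (Suc k) = z (Suc k) + z k\<close>, so the alternating
  sum telescopes, with \<open>e 0 = z 0\<close> and \<open>e m = z (m - 1)\<close> at the two
  ends.\<close>

lemma euler_char:
  assumes K: "kcond m (rel_piece X I2 m)" and m: "1 \<le> m"
  shows "(\<Sum>k\<le>m. (-1) ^ k * (int (fs.dim (vecs k X :: ('x list => 'k) set)) - int (fs.dim (qideal X I2 k))) * int (fs.dim (kdual X I2 (m - k)))) = 0"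
proof -
  define e where "e = (\<lambda>k. int (fs.dim (PP X I2 m k)) - int (fs.dim (PP X I2 m k \<inter> SP X I2 m k)))"
  define z where "z = (\<lambda>k. int (fs.dim (PP X I2 m k)) - int (fs.dim (PP X I2 m k \<inter> SP X I2 m (Suc k))))"
  have e0: "e 0 = z 0" by (simp add: e_def z_def SP_small)
  have PPm: "PP X I2 m m = PP X I2 m (m - 1)" using m by (auto simp: PP_def)
  then have em: "e m = z (m - 1)" using m by (simp add: e_def z_def)
  have ek: "e (Suc k) = z (Suc k) + z k" if k: "Suc k < m" for k
  proof -
    let ?U = "PP X I2 m k" and ?V = "PP X I2 m (Suc k) \<inter> SP X I2 m (Suc k)"
    have sV: "fs.subspace ?V" by (intro fs.subspace_inter subspace_PP subspace_SP)
    have sum: "{x + y | x y. x \<in> ?U \<and> y \<in> ?V} = PP X I2 m (Suc k) \<inter> SP X I2 m (Suc (Suc k))"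
    proof (intro equalityI subsetI)
      fix a assume "a \<in> {x + y | x y. x \<in> ?U \<and> y \<in> ?V}"
      then obtain x y where xy: "a = x + y" "x \<in> ?U" "y \<in> ?V" by blast
      have "x \<in> rel_piece X I2 m k" using xy(2) k by (simp add: PP_def)
      then have "x \<in> SP X I2 m (Suc (Suc k))" unfolding SP_def by (intro fs.span_base) auto
      moreover have "x \<in> PP X I2 m (Suc k)" using xy(2) PP_mono[of k "Suc k"] by auto
      moreover have "y \<in> SP X I2 m (Suc (Suc k))" using xy(3) SP_mono[of "Suc k" "Suc (Suc k)"] by auto
      ultimately show "a \<in> PP X I2 m (Suc k) \<inter> SP X I2 m (Suc (Suc k))"
        unfolding xy(1) using xy(3) fs.subspace_add[OF subspace_PP] fs.subspace_add[OF subspace_SP] by blast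
    next
      fix a assume a: "a \<in> PP X I2 m (Suc k) \<inter> SP X I2 m (Suc (Suc k))"
      obtain x y where xy: "a = x + y" "x \<in> PP X I2 m k" "y \<in> SP X I2 m (Suc k)" using exactness[OF K, of k a] a k by auto
      have "x \<in> PP X I2 m (Suc k)" using xy(2) PP_mono[of k "Suc k"] by auto
      then have "y \<in> PP X I2 m (Suc k)" using a xy(1) fs.subspace_diff[OF subspace_PP, of a m "Suc k" x] by auto
      then show "a \<in> {x + y | x y. x \<in> ?U \<and> y \<in> ?V}" using xy by blast
    qed
    have int: "?U \<inter> ?V = PP X I2 m k \<inter> SP X I2 m (Suc k)" using PP_mono[of k "Suc k" m] by auto
    have fd: "fs.fdim {x + y | x y. x \<in> ?U \<and> y \<in> ?V}" unfolding sum by (rule fs.fdim_subset[OF fdim_PP]) blast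
    have "fs.dim (PP X I2 m (Suc k) \<inter> SP X I2 m (Suc (Suc k))) + fs.dim (PP X I2 m k \<inter> SP X I2 m (Suc k)) = fs.dim ?U + fs.dim ?V"
      using fs.dim_sums_Int_fdim[OF subspace_PP sV fd] unfolding sum int .
    then show ?thesis unfolding e_def z_def by linarith
  qed
  have part: "(\<Sum>k\<le>l. (-1) ^ k * e k) = (-1) ^ l * z l" if "l < m" for l
    using that by (induction l) (simp_all add: e0 ek algebra_simps)
  obtain l where l: "m = Suc l" using m by (cases m) auto
  have "(\<Sum>k\<le>m. (-1) ^ k * e k) = 0" using part[of l] em unfolding l by simp
  moreover have "e k = (int (fs.dim (vecs k X :: ('x list => 'k) set)) - int (fs.dim (qideal X I2 k))) * int (fs.dim (kdual X I2 (m - k)))"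
    if k: "k \<le> m" for k
  proof -
    let ?D = "kdual X I2 (m - k)"
    have D: "fs.subspace ?D" "fs.fdim ?D" "?D \<subseteq> vecs (m - k) X"
      unfolding kdual_eq by (rule subspace_PP fdim_PP PP_vecs)+
    have q: "fs.subspace (qideal X I2 k)" "qideal X I2 k \<subseteq> vecs k X" unfolding qideal_eq by (simp_all add: subspace_SP SP_vecs)
    have P: "tsp k (vecs k X) ?D = PP X I2 m k" using tsp_kdual[of "m - k" m] k by simp
    have sl: "(\<lambda>v. f (v @ s)) \<in> vecs k X" if "f \<in> PP X I2 m k" "length s = m - k" for f s
      using slice_vecs[of f m X "[]" s k] that PP_vecs k by auto
    have "{f \<in> tsp k (vecs k X) ?D. \<forall>s. length s = m - k --> (\<lambda>v. f (v @ s)) \<in> vecs k X} = PP X I2 m k"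
      unfolding P using sl by blast
    with dim_tsp_restrict[OF subspace_vecs fdim_vecs[OF X] subset_refl subspace_vecs subset_refl D, of k]
    have 1: "fs.dim (PP X I2 m k) = fs.dim (vecs k X :: ('x list => 'k) set) * fs.dim ?D" by simp
    have "SP X I2 m k = {f \<in> vecs m X. \<forall>s. length s = m - k --> (\<lambda>v. f (v @ s)) \<in> qideal X I2 k}"
      using tsp_qideal[OF k] tsp_left[OF X q, of "m - k"] k by simp
    then have "{f \<in> tsp k (vecs k X) ?D. \<forall>s. length s = m - k --> (\<lambda>v. f (v @ s)) \<in> qideal X I2 k} = PP X I2 m k \<inter> SP X I2 m k"
      unfolding P using PP_vecs by blast
    with dim_tsp_restrict[OF subspace_vecs fdim_vecs[OF X] subset_refl q D]
    have 2: "fs.dim (PP X I2 m k \<inter> SP X I2 m k) = fs.dim (qideal X I2 k) * fs.dim ?D" by simp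
    show ?thesis unfolding e_def 1 2 by (simp add: algebra_simps)
  qed
  ultimately show ?thesis by (simp add: mult.assoc)
qed

end

section \<open>Tensor powers as Hecke modules\<close>

abbreviation wds :: "nat => nat => nat list set" where "wds d n \<equiv> hk_words n {..<d}"

text \<open>The operator \<open>N\<close> on \<open>k\<close> letters, acting at positions \<open>j+1, ..., j+k\<close>.\<close>
definition emb :: "nat => nat => nat => nat => 'k::field fmat => 'k fmat"
  where "emb d n j k N = mk (wds d n) (wds d n) (\<lambda>u w. if take j u = take j w \<and> drop (j + k) u = drop (j + k) w
    then ent N (take k (drop j u)) (take k (drop j w)) else 0)"

lemma emb_Mt [simp]: "emb d n j k N \<in> Mt (wds d n) (wds d n)" by (simp add: emb_def)

lemma split3:
  assumes "u \<in> wds d n" "j + k \<le> n"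
  obtains p t s where "u = p @ t @ s" "p \<in> wds d j" "t \<in> wds d k" "s \<in> wds d (n - j - k)"
proof
  show "u = take j u @ take k (drop j u) @ drop (j + k) u" by (metis add.commute append_take_drop_id drop_drop)
  have "set (take j u) \<subseteq> set u" "set (take k (drop j u)) \<subseteq> set u" "set (drop (j + k) u) \<subseteq> set u"
    using set_take_subset set_drop_subset by (auto dest!: in_set_takeD in_set_dropD)
  then show "take j u \<in> wds d j" "take k (drop j u) \<in> wds d k" "drop (j + k) u \<in> wds d (n - j - k)"
    using assms by (auto simp: hk_words_def)
qed

lemma join3: "p \<in> wds d j ==> t \<in> wds d k ==> s \<in> wds d (n - j - k) ==> j + k \<le> n ==> p @ t @ s \<in> wds d n"
  by (auto simp: hk_words_def)

lemma ent_emb_append: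
  assumes "p \<in> wds d j" "t \<in> wds d k" "s \<in> wds d (n - j - k)" "p' \<in> wds d j" "t' \<in> wds d k" "s' \<in> wds d (n - j - k)" "j + k \<le> n"
  shows "ent (emb d n j k N) (p @ t @ s) (p' @ t' @ s') = (if p = p' \<and> s = s' then ent N t t' else 0)"
proof -
  have "length p = j" "length t = k" "length p' = j" "length t' = k" using assms by (auto simp: hk_words_def)
  then show ?thesis using join3[OF assms(1-3,7)] join3[OF assms(4-7)] by (simp add: emb_def)
qed

lemma emb_mult:
  assumes "p \<in> wds d j" "t \<in> wds d k" "s \<in> wds d (n - j - k)" "j + k \<le> n"
  shows "ent (emb d n j k N * M) (p @ t @ s) w = (\<Sum>t'\<in>wds d k. ent N t t' * ent M (p @ t' @ s) w)"
proof -
  have "ent (emb d n j k N * M) (p @ t @ s) w = (\<Sum>v\<in>wds d n. ent (emb d n j k N) (p @ t @ s) v * ent M v w)"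
    by (rule ent_times[OF _ emb_Mt]) simp
  also have "... = (\<Sum>v\<in>(\<lambda>t'. p @ t' @ s) ` wds d k. ent (emb d n j k N) (p @ t @ s) v * ent M v w)"
  proof (rule sum.mono_neutral_right)
    show "(\<lambda>t'. p @ t' @ s) ` wds d k \<subseteq> wds d n" using join3 assms by auto
    show "\<forall>v\<in>wds d n - (\<lambda>t'. p @ t' @ s) ` wds d k. ent (emb d n j k N) (p @ t @ s) v * ent M v w = 0"
    proof
      fix v assume v: "v \<in> wds d n - (\<lambda>t'. p @ t' @ s) ` wds d k"
      then obtain p' t' s' where v': "v = p' @ t' @ s'" "p' \<in> wds d j" "t' \<in> wds d k" "s' \<in> wds d (n - j - k)"
        using split3[OF _ assms(4)] by (metis DiffD1)
      then have "\<not> (p = p' \<and> s = s')" using v by blast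
      then have "ent (emb d n j k N) (p @ t @ s) v = 0" unfolding v'(1) ent_emb_append[OF assms(1-3) v'(2-4) assms(4)]
        by (cases "p = p'") simp_all
      then show "ent (emb d n j k N) (p @ t @ s) v * ent M v w = 0" by simp
    qed
  qed simp
  also have "... = (\<Sum>t'\<in>wds d k. ent (emb d n j k N) (p @ t @ s) (p @ t' @ s) * ent M (p @ t' @ s) w)"
    by (subst sum.reindex) (auto simp: inj_on_def)
  also have "... = (\<Sum>t'\<in>wds d k. ent N t t' * ent M (p @ t' @ s) w)"
    by (intro sum.cong refl) (simp add: ent_emb_append[OF assms(1-3) assms(1) _ assms(3,4)])
  finally show ?thesis .
qed

lemma mult_emb:
  assumes "p \<in> wds d j" "t \<in> wds d k" "s \<in> wds d (n - j - k)" "j + k \<le> n"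
  shows "ent (M * emb d n j k N) w (p @ t @ s) = (\<Sum>t'\<in>wds d k. ent M w (p @ t' @ s) * ent N t' t)"
proof -
  have tr: "trp (emb d n j k N) = emb d n j k (trp N)" by (rule fmat_eqI) (auto simp: emb_def)
  have "ent (M * emb d n j k N) w (p @ t @ s) = ent (trp (M * emb d n j k N)) (p @ t @ s) w" by simp
  also have "... = (\<Sum>t'\<in>wds d k. ent (trp N) t t' * ent (trp M) (p @ t' @ s) w)"
    unfolding trp_mult tr by (rule emb_mult[OF assms])
  finally show ?thesis by (simp add: mult.commute)
qed

lemma emb_emb:
  assumes N: "N \<in> Mt (wds d k) (wds d k)" and jk: "j + k \<le> n"
  shows "emb d n j k N * emb d n j k N' = emb d n j k (N * N')"
proof (rule Mt_eqI[OF Mt_mult[OF emb_Mt emb_Mt] emb_Mt])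
  fix u w assume "u \<in> wds d n" "w \<in> wds d n"
  then obtain p t s p' t' s' where u: "u = p @ t @ s" "p \<in> wds d j" "t \<in> wds d k" "s \<in> wds d (n - j - k)"
    and w: "w = p' @ t' @ s'" "p' \<in> wds d j" "t' \<in> wds d k" "s' \<in> wds d (n - j - k)" using split3[OF _ jk] by metis
  have "ent (emb d n j k N * emb d n j k N') u w = (\<Sum>x\<in>wds d k. ent N t x * (if p = p' \<and> s = s' then ent N' x t' else 0))"
    unfolding u(1) w(1) emb_mult[OF u(2-4) jk]
    by (intro sum.cong refl) (simp add: ent_emb_append[OF u(2) _ u(4) w(2-4) jk])
  also have "... = ent (emb d n j k (N * N')) u w"
    unfolding u(1) w(1) ent_emb_append[OF u(2-4) w(2-4) jk] using ent_times[OF _ N, of N' t t']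
    by (cases "p = p'"; cases "s = s'"; simp)
  finally show "ent (emb d n j k N * emb d n j k N') u w = ent (emb d n j k (N * N')) u w" .
qed

lemma emb_add: "emb d n j k (N + N') = emb d n j k N + emb d n j k N'"
  and emb_scale: "emb d n j k (c \<bullet> N) = c \<bullet> emb d n j k N"
  by (rule fmat_eqI, auto simp: emb_def)+

lemma emb_idB: "j + k \<le> n ==> emb d n j k (idB (wds d k)) = idB (wds d n)"
proof (rule Mt_eqI[OF emb_Mt idB_Mt])
  fix u w assume jk: "j + k \<le> n" and "u \<in> wds d n" "w \<in> wds d n"
  then obtain p t s p' t' s' where u: "u = p @ t @ s" "p \<in> wds d j" "t \<in> wds d k" "s \<in> wds d (n - j - k)"
    and w: "w = p' @ t' @ s'" "p' \<in> wds d j" "t' \<in> wds d k" "s' \<in> wds d (n - j - k)" using split3[OF _ jk] by metis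
  have "u = w \<longleftrightarrow> p = p' \<and> t = t' \<and> s = s'" using u w by (auto simp: hk_words_def)
  then show "ent (emb d n j k (idB (wds d k))) u w = ent (idB (wds d n)) u w"
    unfolding u(1) w(1) ent_emb_append[OF u(2-4) w(2-4) jk] using join3[OF u(2-4) jk] u(3) by auto
qed

definition Tm :: "(nat \<times> nat => nat \<times> nat => 'k::field) => nat => nat => nat => 'k fmat"
  where "Tm R d n i = mk (wds d n) (wds d n) (Rat R i)"

lemma Tm_Mt [simp]: "Tm R d n i \<in> Mt (wds d n) (wds d n)" by (simp add: Tm_def)

lemma Tm_emb:
  assumes jk: "j + k \<le> n" and i: "0 < i" "i < k"
  shows "Tm R d n (j + i) = emb d n j k (Tm R d k i)"
proof (rule Mt_eqI[OF Tm_Mt emb_Mt])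
  fix u w assume uw: "u \<in> wds d n" "w \<in> wds d n"
  then obtain p t s p' t' s' where u: "u = p @ t @ s" "p \<in> wds d j" "t \<in> wds d k" "s \<in> wds d (n - j - k)"
    and w: "w = p' @ t' @ s'" "p' \<in> wds d j" "t' \<in> wds d k" "s' \<in> wds d (n - j - k)" using split3[OF _ jk] by metis
  have len: "length p = j" "length p' = j" "length t = k" "length t' = k" "length s = n - j - k" "length s' = n - j - k" "length u = n"
    using u w uw by (auto simp: hk_words_def)
  have at: "u ! (j + l) = t ! l" "w ! (j + l) = t' ! l" if "l < k" for l
    using that len by (auto simp: u(1) w(1) nth_append)
  let ?Q = "\<lambda>l. l \<noteq> j + i - 1 \<and> l \<noteq> j + i --> u ! l = w ! l"
  have "(\<forall>l<n. ?Q l) \<longleftrightarrow> (\<forall>l<j. ?Q l) \<and> (\<forall>l<k. ?Q (j + l)) \<and> (\<forall>l<n - j - k. ?Q (j + k + l))" (is "?L \<longleftrightarrow> ?M")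
  proof
    assume ?L then show ?M using jk by auto
  next
    assume M: ?M
    have "?Q l" if l: "l < n" for l
    proof -
      consider "l < j" | "j \<le> l" "l - j < k" | "j + k \<le> l" by linarith
      then show ?thesis
      proof cases
        case 1 then show ?thesis using M by blast
      next
        case 2
        then have "?Q (j + (l - j))" using M by blast
        then show ?thesis using 2 by simp
      next
        case 3
        then have "?Q (j + k + (l - j - k))" using M l by (metis diff_diff_left diff_less_mono)
        then show ?thesis using 3 by simp
      qed
    qed
    then show ?L by blast
  qed
  moreover have "(\<forall>l<j. ?Q l) \<longleftrightarrow> p = p'" using len i by (auto simp: list_eq_iff_nth_eq u(1) w(1) nth_append)
  moreover have "(\<forall>l<n - j - k. ?Q (j + k + l)) \<longleftrightarrow> s = s'" using len i by (auto simp: list_eq_iff_nth_eq u(1) w(1) nth_append)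
  moreover have "(\<forall>l<k. ?Q (j + l)) \<longleftrightarrow> (\<forall>l<k. l \<noteq> i - 1 \<and> l \<noteq> i --> t ! l = t' ! l)" using at i by auto
  ultimately have cond: "(\<forall>l<n. ?Q l) \<longleftrightarrow> p = p' \<and> (\<forall>l<k. l \<noteq> i - 1 \<and> l \<noteq> i --> t ! l = t' ! l) \<and> s = s'" by simp
  have at': "u ! (j + i - 1) = t ! (i - 1)" "w ! (j + i - 1) = t' ! (i - 1)" using at[of "i - 1"] i by auto
  have "ent (Tm R d n (j + i)) u w = (if \<forall>l<n. ?Q l then R (t ! (i - 1), t ! i) (t' ! (i - 1), t' ! i) else 0)"
  proof -
    have "ent (Tm R d n (j + i)) u w = Rat R (j + i) u w" using uw by (simp add: Tm_def)
    then show ?thesis unfolding Rat_def len(7) at(1)[OF i(2)] at(2)[OF i(2)] at' .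
  qed
  also have "... = ent (emb d n j k (Tm R d k i)) u w"
    unfolding cond unfolding u(1) w(1) ent_emb_append[OF u(2-4) w(2-4) jk] using u(3) w(3) len by (auto simp: Tm_def Rat_def)
  finally show "ent (Tm R d n (j + i)) u w = ent (emb d n j k (Tm R d k i)) u w" .
qed

text \<open>The quadratic and the braid relation are local and are carried by \<open>emb\<close>
  from two and three letters to \<open>n\<close>. Commutation of distant generators is an exchange
  of two summations over disjoint pairs of positions.\<close>

lemma hmod_tensor:
  assumes H: "hecke_symmetry q d R"
  shows "hmod q n (wds d n) (Tm R d n)"
  unfolding hmod_def
proof (intro conjI allI impI)
  have "i = 1" if "i \<in> {1..<2}" for i :: nat using that by auto
  then have "hecke_mod q 2 (wds d 2) (Rat R)" using H unfolding hecke_mod_def hecke_symmetry_def by fastforce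
  then have "hmod q 2 (wds d 2) (Tm R d 2)" unfolding hecke_mod_iff Tm_def .
  from hmodD(3)[OF this, of 0] have quad: "Tm R d 2 1 * Tm R d 2 1 = (q - 1) \<bullet> Tm R d 2 1 + q \<bullet> idB (wds d 2)" by simp
  have braid: "Tm R d 3 1 * (Tm R d 3 2 * Tm R d 3 1) = Tm R d 3 2 * (Tm R d 3 1 * Tm R d 3 2)"
    using H unfolding Tm_def hecke_symmetry_def by (simp add: mk_mult mk_eq_iff)
  show "finite (wds d n)" by simp
  fix j
  show "Tm R d n (Suc j) \<in> Mt (wds d n) (wds d n)" by simp
  {
    assume j: "Suc j < n"
    then have "Tm R d n (Suc j) = emb d n j 2 (Tm R d 2 1)" using Tm_emb[of j 2 n 1 R d] by simp
    then show "Tm R d n (Suc j) * Tm R d n (Suc j) = (q - 1) \<bullet> Tm R d n (Suc j) + q \<bullet> idB (wds d n)"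
      using emb_emb[OF Tm_Mt, of j 2 n d R 1 "Tm R d 2 1"] quad j by (simp add: emb_add emb_scale emb_idB)
  }
  {
    assume j: "Suc (Suc j) < n"
    then have e: "Tm R d n (Suc j) = emb d n j 3 (Tm R d 3 1)" "Tm R d n (Suc (Suc j)) = emb d n j 3 (Tm R d 3 2)" and j3: "j + 3 \<le> n"
      using Tm_emb[of j 3 n 1 R d] Tm_emb[of j 3 n 2 R d] by simp_all
    show "Tm R d n (Suc j) * (Tm R d n (Suc (Suc j)) * Tm R d n (Suc j)) = Tm R d n (Suc (Suc j)) * (Tm R d n (Suc j) * Tm R d n (Suc (Suc j)))"
      unfolding e emb_emb[OF Tm_Mt j3] braid ..
  }
  fix k assume jk: "Suc j < k \<and> Suc k < n"
  let ?N = "Tm R d 2 1"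
  have e: "Tm R d n (Suc j) = emb d n j 2 ?N" "Tm R d n (Suc k) = emb d n k 2 ?N" and j2: "j + 2 \<le> n" "k + 2 \<le> n"
    using Tm_emb[of j 2 n 1 R d] Tm_emb[of k 2 n 1 R d] jk by simp_all
  show "Tm R d n (Suc j) * Tm R d n (Suc k) = Tm R d n (Suc k) * Tm R d n (Suc j)"
  proof (rule Mt_eqI[OF Mt_mult[OF Tm_Mt Tm_Mt] Mt_mult[OF Tm_Mt Tm_Mt]])
    fix u w assume u: "u \<in> wds d n" and w: "w \<in> wds d n"
    obtain p t r where p: "u = p @ t @ r" "p \<in> wds d j" "t \<in> wds d 2" "r \<in> wds d (n - j - 2)" using split3[OF u j2(1)] by metis
    have "(k - j - 2) + 2 \<le> n - j - 2" using jk by linarith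
    then obtain m x s where m: "r = m @ x @ s" "m \<in> wds d (k - j - 2)" "x \<in> wds d 2" "s \<in> wds d (n - j - 2 - (k - j - 2) - 2)"
      using split3[OF p(4)] by metis
    have "n - j - 2 - (k - j - 2) - 2 = n - k - 2" using jk by linarith
    then have sW: "s \<in> wds d (n - k - 2)" using m(4) by (simp only:)
    have kW: "p @ t' @ m \<in> wds d k" if "t' \<in> wds d 2" for t' using that p(2) m(2) jk by (auto simp: hk_words_def)
    have rW: "m @ x' @ s \<in> wds d (n - j - 2)" if "x' \<in> wds d 2" for x'
      using that m(2) sW jk by (auto simp: hk_words_def)
    \<comment> \<open>Multiplying by the identity on the right lets \<open>emb_mult\<close>, which
      expands the left factor of a product, be applied to both generators in turn.\<close>
    let ?I = "idB (wds d n) :: 'a fmat"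
    have A: "ent (emb d n j 2 ?N * M) (p @ t @ m @ y @ s) w = (\<Sum>t'\<in>wds d 2. ent ?N t t' * ent M (p @ t' @ m @ y @ s) w)" if "y \<in> wds d 2" for M y
      using emb_mult[OF p(2,3) rW[OF that] j2(1), of ?N M w] by simp
    have C: "ent (emb d n k 2 ?N * M) (p @ y @ m @ x @ s) w = (\<Sum>x'\<in>wds d 2. ent ?N x x' * ent M (p @ y @ m @ x' @ s) w)" if "y \<in> wds d 2" for M y
      using emb_mult[OF kW[OF that] m(3) sW j2(2), of ?N M w] by simp
    have "ent (emb d n j 2 ?N * (emb d n k 2 ?N * ?I)) u w = (\<Sum>t'\<in>wds d 2. \<Sum>x'\<in>wds d 2. ent ?N t t' * (ent ?N x x' * ent ?I (p @ t' @ m @ x' @ s) w))"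
      unfolding p(1) m(1) A[OF m(3)] by (intro sum.cong refl) (simp only: C sum_distrib_left)
    also have "... = (\<Sum>x'\<in>wds d 2. \<Sum>t'\<in>wds d 2. ent ?N x x' * (ent ?N t t' * ent ?I (p @ t' @ m @ x' @ s) w))"
      by (subst sum.swap) (simp only: mult.left_commute)
    also have "... = ent (emb d n k 2 ?N * (emb d n j 2 ?N * ?I)) u w"
      unfolding p(1) m(1) C[OF p(3)] by (intro sum.cong refl) (simp only: A sum_distrib_left)
    finally show "ent (Tm R d n (Suc j) * Tm R d n (Suc k)) u w = ent (Tm R d n (Suc k) * Tm R d n (Suc j)) u w"
      unfolding e by (simp add: mult_idB[OF _ emb_Mt])
  qed
qed

text \<open>A matrix between tensor powers is cut into matrices on two letters by fixing the row and
  column words outside the two positions concerned. These slices correspond to the slices of tensors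
  in \<open>rel_piece_eq\<close>.\<close>

definition slc :: "nat => nat => nat list => nat list => nat list => nat list => 'k::field fmat => 'k fmat"
  where "slc d d' p s p' s' F = mk (wds d 2) (wds d' 2) (\<lambda>t t'. ent F (p @ t @ s) (p' @ t' @ s'))"

context
  fixes R R' :: "nat \<times> nat => nat \<times> nat => 'k::field" and d d' n j :: nat
  assumes j: "j + 2 \<le> n"
begin

definition ctx :: "nat list => nat list => nat list => nat list => bool"
  where "ctx p s p' s' \<longleftrightarrow> p \<in> wds d j \<and> s \<in> wds d (n - j - 2) \<and> p' \<in> wds d' j \<and> s' \<in> wds d' (n - j - 2)"

lemma slc_commutator:
  assumes c: "ctx p s p' s'"
  shows "slc d d' p s p' s' (Tm R d n (Suc j) * F - F * Tm R' d' n (Suc j))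
    = Tm R d 2 1 * slc d d' p s p' s' F - slc d d' p s p' s' F * Tm R' d' 2 1"
proof (rule Mt_eqI)
  note cc = c[unfolded ctx_def]
  have e: "Tm R d n (Suc j) = emb d n j 2 (Tm R d 2 1)" "Tm R' d' n (Suc j) = emb d' n j 2 (Tm R' d' 2 1)"
    using Tm_emb[of j 2 n 1 R d] Tm_emb[of j 2 n 1 R' d'] j by simp_all
  show "slc d d' p s p' s' (Tm R d n (Suc j) * F - F * Tm R' d' n (Suc j)) \<in> Mt (wds d 2) (wds d' 2)" by (simp add: slc_def)
  have sM: "slc d d' p s p' s' F \<in> Mt (wds d 2) (wds d' 2)" by (simp add: slc_def)
  show "Tm R d 2 1 * slc d d' p s p' s' F - slc d d' p s p' s' F * Tm R' d' 2 1 \<in> Mt (wds d 2) (wds d' 2)"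
    by (intro Mt_diff Mt_mult[OF Tm_Mt sM] Mt_mult[OF sM Tm_Mt])
  fix t t' assume t: "t \<in> wds d 2" "t' \<in> wds d' 2"
  have 1: "ent (emb d n j 2 (Tm R d 2 1) * F) (p @ t @ s) (p' @ t' @ s') = (\<Sum>x\<in>wds d 2. ent (Tm R d 2 1) t x * ent F (p @ x @ s) (p' @ t' @ s'))"
    by (rule emb_mult) (use cc t j in auto)
  have 2: "ent (F * emb d' n j 2 (Tm R' d' 2 1)) (p @ t @ s) (p' @ t' @ s') = (\<Sum>x\<in>wds d' 2. ent F (p @ t @ s) (p' @ x @ s') * ent (Tm R' d' 2 1) x t')"
    by (rule mult_emb) (use cc t j in auto)
  have "ent (Tm R d 2 1 * slc d d' p s p' s' F) t t' = (\<Sum>x\<in>wds d 2. ent (Tm R d 2 1) t x * ent F (p @ x @ s) (p' @ t' @ s'))"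
    by (subst ent_times[OF _ Tm_Mt]) (use t in \<open>auto simp: slc_def\<close>)
  moreover have "ent (slc d d' p s p' s' F * Tm R' d' 2 1) t t' = (\<Sum>x\<in>wds d' 2. ent F (p @ t @ s) (p' @ x @ s') * ent (Tm R' d' 2 1) x t')"
    by (subst ent_times'[OF _ Tm_Mt]) (use t in \<open>auto simp: slc_def\<close>)
  moreover have "ent (slc d d' p s p' s' (emb d n j 2 (Tm R d 2 1) * F - F * emb d' n j 2 (Tm R' d' 2 1))) t t'
      = ent (emb d n j 2 (Tm R d 2 1) * F) (p @ t @ s) (p' @ t' @ s') - ent (F * emb d' n j 2 (Tm R' d' 2 1)) (p @ t @ s) (p' @ t' @ s')"
    using t by (simp add: slc_def)
  ultimately show "ent (slc d d' p s p' s' (Tm R d n (Suc j) * F - F * Tm R' d' n (Suc j))) t t' =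
      ent (Tm R d 2 1 * slc d d' p s p' s' F - slc d d' p s p' s' F * Tm R' d' 2 1) t t'"
    unfolding e 1 2 by simp
qed

lemma slc_eqI:
  assumes F: "F \<in> Mt (wds d n) (wds d' n)" "G \<in> Mt (wds d n) (wds d' n)"
    and eq: "\<And>p s p' s'. ctx p s p' s' ==> slc d d' p s p' s' F = slc d d' p s p' s' G"
  shows "F = (G :: 'k fmat)"
proof (rule Mt_eqI[OF F])
  fix u w assume "u \<in> wds d n" "w \<in> wds d' n"
  then obtain p t s p' t' s' where u: "u = p @ t @ s" "p \<in> wds d j" "t \<in> wds d 2" "s \<in> wds d (n - j - 2)"
    and w: "w = p' @ t' @ s'" "p' \<in> wds d' j" "t' \<in> wds d' 2" "s' \<in> wds d' (n - j - 2)" using split3[OF _ j] by metis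
  have "ctx p s p' s'" using u w by (simp add: ctx_def)
  from arg_cong[OF eq[OF this], of "\<lambda>M. ent M t t'"] show "ent F u w = ent G u w" using u w by (simp add: slc_def)
qed

lemma commX_iff_slc:
  assumes F: "F \<in> Mt (wds d n) (wds d' n)"
  shows "F \<in> commX (wds d' n) (Tm R' d' n) (wds d n) (Tm R d n) j \<longleftrightarrow>
    (\<forall>p s p' s'. ctx p s p' s' --> Tm R d 2 1 * slc d d' p s p' s' F = slc d d' p s p' s' F * Tm R' d' 2 1)"
proof -
  let ?C = "Tm R d n (Suc j) * F - F * Tm R' d' n (Suc j)"
  have CM: "?C \<in> Mt (wds d n) (wds d' n)" by (intro Mt_diff Mt_mult[OF Tm_Mt F] Mt_mult[OF F Tm_Mt])
  have s0: "slc d d' p s p' s' 0 = (0 :: 'k fmat)" for p s p' s' by (rule fmat_eqI) (simp add: slc_def)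
  have "F \<in> commX (wds d' n) (Tm R' d' n) (wds d n) (Tm R d n) j \<longleftrightarrow> ?C = 0" using F by (simp add: commX_def)
  also have "... \<longleftrightarrow> (\<forall>p s p' s'. ctx p s p' s' --> slc d d' p s p' s' ?C = 0)"
    using slc_eqI[OF CM Mt_0] s0 by auto
  also have "... \<longleftrightarrow> (\<forall>p s p' s'. ctx p s p' s' --> Tm R d 2 1 * slc d d' p s p' s' F = slc d d' p s p' s' F * Tm R' d' 2 1)"
    using slc_commutator by simp
  finally show ?thesis .
qed

text \<open>Multiplication by a generator acts on each slice separately, so solutions of the
  commutator equation on the slices can be chosen independently and glued to one matrix
  \<open>G\<close>.\<close>

lemma commY_iff_slc:
  assumes F: "F \<in> Mt (wds d n) (wds d' n)"
  shows "F \<in> commY (wds d' n) (Tm R' d' n) (wds d n) (Tm R d n) j \<longleftrightarrow>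
    (\<forall>p s p' s'. ctx p s p' s' --> (\<exists>H\<in>Mt (wds d 2) (wds d' 2). slc d d' p s p' s' F = Tm R d 2 1 * H - H * Tm R' d' 2 1))"
    (is "_ \<longleftrightarrow> ?A")
proof
  assume "F \<in> commY (wds d' n) (Tm R' d' n) (wds d n) (Tm R d n) j"
  then obtain G where G: "F = Tm R d n (Suc j) * G - G * Tm R' d' n (Suc j)" by (auto simp: commY_def)
  show ?A
  proof (intro allI impI)
    fix p s p' s' assume "ctx p s p' s'"
    from slc_commutator[OF this, of G] show "\<exists>H\<in>Mt (wds d 2) (wds d' 2). slc d d' p s p' s' F = Tm R d 2 1 * H - H * Tm R' d' 2 1"
      unfolding G by (intro bexI[of _ "slc d d' p s p' s' G"]) (simp_all add: slc_def)
  qed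
next
  assume A: ?A
  define h where "h = (\<lambda>p s p' s'. SOME H. H \<in> Mt (wds d 2) (wds d' 2) \<and> slc d d' p s p' s' F = Tm R d 2 1 * H - H * Tm R' d' 2 1)"
  have h: "h p s p' s' \<in> Mt (wds d 2) (wds d' 2) \<and> slc d d' p s p' s' F = Tm R d 2 1 * h p s p' s' - h p s p' s' * Tm R' d' 2 1"
    if c: "ctx p s p' s'" for p s p' s'
  proof -
    have "\<exists>H. H \<in> Mt (wds d 2) (wds d' 2) \<and> slc d d' p s p' s' F = Tm R d 2 1 * H - H * Tm R' d' 2 1" using A c by blast
    then show ?thesis unfolding h_def by (rule someI_ex)
  qed
  define G where "G = mk (wds d n) (wds d' n) (\<lambda>u w. ent (h (take j u) (drop (j + 2) u) (take j w) (drop (j + 2) w))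
    (take 2 (drop j u)) (take 2 (drop j w)))"
  have GM: "G \<in> Mt (wds d n) (wds d' n)" by (simp add: G_def)
  have sG: "slc d d' p s p' s' G = h p s p' s'" if c: "ctx p s p' s'" for p s p' s'
  proof (rule Mt_eqI)
    show "slc d d' p s p' s' G \<in> Mt (wds d 2) (wds d' 2)" by (simp add: slc_def)
    show "h p s p' s' \<in> Mt (wds d 2) (wds d' 2)" using h[OF c] by blast
    fix t t' assume t: "t \<in> wds d 2" "t' \<in> wds d' 2"
    note cc = c[unfolded ctx_def]
    have "p @ t @ s \<in> wds d n" "p' @ t' @ s' \<in> wds d' n" using cc t j by (auto intro!: join3)
    moreover have "length p = j" "length t = 2" "length p' = j" "length t' = 2" using cc t by (auto simp: hk_words_def)
    ultimately show "ent (slc d d' p s p' s' G) t t' = ent (h p s p' s') t t'"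
      using t by (simp add: slc_def G_def)
  qed
  have "F = Tm R d n (Suc j) * G - G * Tm R' d' n (Suc j)"
  proof (rule slc_eqI[OF F])
    show "Tm R d n (Suc j) * G - G * Tm R' d' n (Suc j) \<in> Mt (wds d n) (wds d' n)"
      by (intro Mt_diff Mt_mult[OF Tm_Mt GM] Mt_mult[OF GM Tm_Mt])
    fix p s p' s' assume c: "ctx p s p' s'"
    show "slc d d' p s p' s' F = slc d d' p s p' s' (Tm R d n (Suc j) * G - G * Tm R' d' n (Suc j))"
      unfolding slc_commutator[OF c] sG[OF c] using h[OF c] by blast
  qed
  then show "F \<in> commY (wds d' n) (Tm R' d' n) (wds d n) (Tm R d n) j" unfolding commY_def using GM by blast
qed

end

text \<open>Tensors in \<open>(V'\<^sup>* \<otimes> V)\<^sup>\<otimes>\<^sup>n\<close> as linear maps \<open>V'\<^sup>\<otimes>\<^sup>n \<rightarrow> V\<^sup>\<otimes>\<^sup>n\<close>.\<close>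
definition Ph :: "nat => nat => nat => ((nat \<times> nat) list => 'k::field) => 'k fmat"
  where "Ph d' d n f = mk (wds d n) (wds d' n) (\<lambda>u w. f (zip w u))"

definition Pinv :: "nat => nat => nat => 'k::field fmat => (nat \<times> nat) list => 'k"
  where "Pinv d' d n M = (\<lambda>w. if w \<in> hk_words n (Wbasis d' d) then ent M (map snd w) (map fst w) else 0)"

lemma Ph_Mt [simp]: "Ph d' d n f \<in> Mt (wds d n) (wds d' n)" by (simp add: Ph_def)
lemma Pinv_vecs [simp]: "Pinv d' d n M \<in> vecs n (Wbasis d' d)" by (simp add: Pinv_def vecs_def)

lemma zip_words: "u \<in> wds d n ==> w \<in> wds d' n ==> zip w u \<in> hk_words n (Wbasis d' d)"
  by (auto simp: hk_words_def Wbasis_def dest: set_zip_leftD set_zip_rightD)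

lemma words_unzip: "w \<in> hk_words n (Wbasis d' d) ==> map snd w \<in> wds d n \<and> map fst w \<in> wds d' n"
  by (force simp: hk_words_def Wbasis_def)

lemma Ph_Pinv: "M \<in> Mt (wds d n) (wds d' n) ==> Ph d' d n (Pinv d' d n M) = M"
  by (rule Mt_eqI[OF Ph_Mt]) (auto simp: Ph_def Pinv_def zip_words, simp add: hk_words_def)

lemma Pinv_Ph: "f \<in> vecs n (Wbasis d' d) ==> Pinv d' d n (Ph d' d n f) = f"
proof
  fix w assume f: "f \<in> vecs n (Wbasis d' d)"
  show "Pinv d' d n (Ph d' d n f) w = f w"
    using f words_unzip[of w n d' d] by (auto simp: Pinv_def Ph_def vecs_def zip_map_fst_snd)
qed

lemma Ph_add: "Ph d' d n (f + g) = Ph d' d n f + Ph d' d n g"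
  and Ph_scale: "Ph d' d n (fsc c f) = c \<bullet> Ph d' d n f"
  and Pinv_add: "Pinv d' d n (M + M') = Pinv d' d n M + Pinv d' d n M'"
  by (rule fmat_eqI, simp add: Ph_def fsc_def)+ (auto simp: Pinv_def)

text \<open>Zipping row and column words turns the slices of a tensor into the slices of its matrix,
  so a relation space described by a property \<open>Q\<close> of matrices on two letters has its
  pieces described slice by slice.\<close>

lemma rel_piece_iff_slc:
  fixes I2 :: "((nat \<times> nat) list => 'k::field) set"
  assumes I2: "fs.subspace I2" "\<And>g. g \<in> I2 \<longleftrightarrow> g \<in> vecs 2 (Wbasis d' d) \<and> Q (Ph d' d 2 g)" and j: "j + 2 \<le> n"
    and f: "f \<in> vecs n (Wbasis d' d)"
  shows "f \<in> rel_piece (Wbasis d' d) I2 n j \<longleftrightarrow> (\<forall>p s p' s'. ctx d d' n j p s p' s' --> Q (slc d d' p s p' s' (Ph d' d n f)))"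
proof -
  have W: "finite (Wbasis d' d)" by (simp add: Wbasis_def)
  have sub: "I2 \<subseteq> vecs 2 (Wbasis d' d)" using I2(2) by blast
  have sl: "Ph d' d 2 (\<lambda>v. f (zip p' p @ v @ zip s' s)) = slc d d' p s p' s' (Ph d' d n f)" if c: "ctx d d' n j p s p' s'" for p s p' s'
  proof (rule Mt_eqI[OF Ph_Mt])
    show "slc d d' p s p' s' (Ph d' d n f) \<in> Mt (wds d 2) (wds d' 2)" by (simp add: slc_def)
    fix t t' assume t: "t \<in> wds d 2" "t' \<in> wds d' 2"
    note cc = c[unfolded ctx_def[OF j]]
    have "p @ t @ s \<in> wds d n" "p' @ t' @ s' \<in> wds d' n" using cc t j by (auto intro!: join3)
    moreover have "zip (p' @ t' @ s') (p @ t @ s) = zip p' p @ zip t' t @ zip s' s" using cc t by (simp add: hk_words_def)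
    ultimately show "ent (Ph d' d 2 (\<lambda>v. f (zip p' p @ v @ zip s' s))) t t' = ent (slc d d' p s p' s' (Ph d' d n f)) t t'"
      using t by (simp add: Ph_def slc_def)
  qed
  have len: "length s + length t + 2 = n" if "length s = j" "length t = n - 2 - j" for s t :: "(nat \<times> nat) list" using that j by simp
  have "f \<in> rel_piece (Wbasis d' d) I2 n j \<longleftrightarrow> (\<forall>s t. length s = j --> length t = n - 2 - j --> (\<lambda>v. f (s @ v @ t)) \<in> I2)"
    unfolding rel_piece_eq[OF W I2(1) sub j] using f by simp
  also have "... \<longleftrightarrow> (\<forall>p s p' s'. ctx d d' n j p s p' s' --> Q (slc d d' p s p' s' (Ph d' d n f)))" (is "?A \<longleftrightarrow> ?B")
  proof
    assume A: ?A
    show ?B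
    proof (intro allI impI)
      fix p s p' s' assume c: "ctx d d' n j p s p' s'"
      then have "length (zip p' p) = j" "length (zip s' s) = n - 2 - j" by (auto simp: ctx_def[OF j] hk_words_def)
      then have "(\<lambda>v. f (zip p' p @ v @ zip s' s)) \<in> I2" using A by blast
      then show "Q (slc d d' p s p' s' (Ph d' d n f))" using I2(2) sl[OF c] by simp
    qed
  next
    assume B: ?B
    show ?A
    proof (intro allI impI)
      fix s t :: "(nat \<times> nat) list" assume l: "length s = j" "length t = n - 2 - j"
      show "(\<lambda>v. f (s @ v @ t)) \<in> I2"
      proof (cases "s \<in> hk_words j (Wbasis d' d) \<and> t \<in> hk_words (n - j - 2) (Wbasis d' d)")
        case True
        then have c: "ctx d d' n j (map snd s) (map snd t) (map fst s) (map fst t)"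
          using words_unzip[of s j d' d] words_unzip[of t "n - j - 2" d' d] by (simp add: ctx_def[OF j])
        have "Ph d' d 2 (\<lambda>v. f (s @ v @ t)) = slc d d' (map snd s) (map snd t) (map fst s) (map fst t) (Ph d' d n f)"
          using sl[OF c] by (simp add: zip_map_fst_snd)
        then show ?thesis using B c I2(2) slice_vecs[OF f len[OF l]] by simp
      next
        case False
        have "(\<lambda>v. f (s @ v @ t)) = 0"
        proof
          fix v
          have "s @ v @ t \<notin> hk_words n (Wbasis d' d)" using False l by (auto simp: hk_words_def)
          then show "f (s @ v @ t) = 0 v" using f by (simp add: vecs_def)
        qed
        then show ?thesis using fs.subspace_0[OF I2(1)] by simp
      qed
    qed
  qed
  finally show ?thesis .
qed

lemma Rat1: "length u = 2 ==> Rat R 1 u w = R (u ! 0, u ! 1) (w ! 0, w ! 1)"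
  by (auto simp: Rat_def less_Suc_eq numeral_2_eq_2)

lemma ent_Tm2: "u \<in> wds d 2 ==> w \<in> wds d 2 ==> ent (Tm R d 2 (Suc 0)) u w = R (u ! 0, u ! Suc 0) (w ! 0, w ! Suc 0)"
proof -
  assume uw: "u \<in> wds d 2" "w \<in> wds d 2"
  then have "length u = 2" by (simp add: hk_words_def)
  then show ?thesis using uw Rat1[of u R w] by (simp add: Tm_def)
qed

lemma bij_pairs: "bij_betw (\<lambda>a. [fst a, snd a]) ({..<d} \<times> {..<d}) (wds d 2)"
  by (rule bij_betw_byWitness[where f' = "\<lambda>w. (w ! 0, w ! 1)"]) (auto simp: hk_words_def length_Suc_conv numeral_2_eq_2)

lemma sum_wds2: "(\<Sum>w\<in>wds d 2. f w) = (\<Sum>a\<in>{..<d} \<times> {..<d}. f [fst a, snd a])"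
  by (rule sum.reindex_bij_betw[OF bij_pairs, symmetric])

lemma ball_wds2: "(\<forall>w\<in>wds d 2. P w) \<longleftrightarrow> (\<forall>a\<in>{..<d} \<times> {..<d}. P [fst a, snd a])"
  using bij_betw_imp_surj_on[OF bij_pairs, of d] by (metis (no_types, lifting) image_iff)

text \<open>The indices are exchanged: \<open>Rdual_inv\<close> inverts the transpose of the
  operator, and its transpose is the inverse of the operator itself.\<close>

definition conv :: "nat => (nat \<times> nat => nat \<times> nat => 'k::field) => 'k fmat"
  where "conv d S = mk (wds d 2) (wds d 2) (\<lambda>b w. S (w ! 0, w ! 1) (b ! 0, b ! 1))"

lemma conv_Mt [simp]: "conv d S \<in> Mt (wds d 2) (wds d 2)" by (simp add: conv_def)

lemma Tm2_conv:
  fixes R :: "nat \<times> nat => nat \<times> nat => 'k::field"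
  defines "M \<equiv> \<lambda>a b. R b a"
  shows "meq ({..<d} \<times> {..<d}) ({..<d} \<times> {..<d}) (mmul ({..<d} \<times> {..<d}) S M) idm \<longleftrightarrow> Tm R d 2 1 * conv d S = idB (wds d 2)"
    and "meq ({..<d} \<times> {..<d}) ({..<d} \<times> {..<d}) (mmul ({..<d} \<times> {..<d}) M S) idm \<longleftrightarrow> conv d S * Tm R d 2 1 = idB (wds d 2)"
proof -
  let ?D = "{..<d} \<times> {..<d}"
  have r: "Rat R 1 [fst b, snd b] w = R b (w ! 0, w ! 1)" for b w using Rat1[of "[fst b, snd b]" R w] by simp
  have i: "idm [x, y] [x', y'] = (idm (x', y') (x, y) :: 'k)" for x y x' y' :: nat by (auto simp: idm_def)
  have c: "(\<Sum>x\<in>?D. S a x * R b x) = (\<Sum>x\<in>?D. R b x * S a x)" for a b by (simp add: mult.commute)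
  have "Tm R d 2 1 * conv d S = idB (wds d 2) \<longleftrightarrow> (\<forall>b\<in>?D. \<forall>a\<in>?D. (\<Sum>x\<in>?D. R b x * S a x) = idm a b)"
    unfolding Tm_def conv_def idB_conv by (simp add: mk_mult mk_eq_iff meq_def mmul_def ball_wds2 sum_wds2 r[simplified] i)
  then show "meq ?D ?D (mmul ?D S M) idm \<longleftrightarrow> Tm R d 2 1 * conv d S = idB (wds d 2)"
    unfolding meq_def mmul_def M_def c by blast
  have c': "(\<Sum>x\<in>?D. R x a * S x b) = (\<Sum>x\<in>?D. S x b * R x a)" for a b by (simp add: mult.commute)
  have "conv d S * Tm R d 2 1 = idB (wds d 2) \<longleftrightarrow> (\<forall>b\<in>?D. \<forall>a\<in>?D. (\<Sum>x\<in>?D. S x b * R x a) = idm a b)"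
    unfolding Tm_def conv_def idB_conv by (simp add: mk_mult mk_eq_iff meq_def mmul_def ball_wds2 sum_wds2 r[simplified] i)
  then show "meq ?D ?D (mmul ?D M S) idm \<longleftrightarrow> conv d S * Tm R d 2 1 = idB (wds d 2)"
    unfolding meq_def mmul_def M_def c' by blast
qed

text \<open>The quadratic relation supplies an inverse, and any left inverse equals it; this makes
  the description in \<open>minv\<close> unique.\<close>

lemma Rdual_inv_inverse:
  fixes R :: "nat \<times> nat => nat \<times> nat => 'k::field"
  assumes H: "hecke_symmetry q d R"
  shows "Tm R d 2 1 * conv d (Rdual_inv d R) = idB (wds d 2)" "conv d (Rdual_inv d R) * Tm R d 2 1 = idB (wds d 2)"
proof -
  let ?D = "{..<d} \<times> {..<d}" and ?N = "Tm R d 2 1"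
  define S0 where "S0 = inverse q \<bullet> (Tm R d 2 (Suc 0) - (q - 1) \<bullet> idB (wds d 2))"
  have q: "q \<noteq> 0" using H by (simp add: hecke_symmetry_def)
  have S0: "S0 \<in> Mt (wds d 2) (wds d 2)" "S0 * ?N = idB (wds d 2)" "?N * S0 = idB (wds d 2)"
    using hmod_inverse[OF hmod_tensor[OF H] q, of 0 2] by (simp_all add: S0_def)
  define S where "S = (\<lambda>a b. if a \<in> ?D \<and> b \<in> ?D then ent S0 [fst b, snd b] [fst a, snd a] else 0)"
  have pw: "[w ! 0, w ! 1] = w \<and> (w ! 0, w ! 1) \<in> ?D" if "w \<in> wds d 2" for w
    using that by (auto simp: hk_words_def length_Suc_conv numeral_2_eq_2)
  have cS: "conv d S = S0"
  proof (rule Mt_eqI[OF conv_Mt S0(1)])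
    fix b w assume "b \<in> wds d 2" "w \<in> wds d 2"
    then show "ent (conv d S) b w = ent S0 b w" using pw[of b] pw[of w] by (simp add: conv_def S_def)
  qed
  have "Rdual_inv d R = S" unfolding Rdual_inv_def minv_def
  proof (rule the_equality, intro conjI allI impI)
    show "a \<notin> ?D \<or> b \<notin> ?D ==> S a b = 0" for a b by (auto simp: S_def)
    show "meq ?D ?D (mmul ?D S (\<lambda>a b. R b a)) idm" unfolding Tm2_conv(1) cS by (rule S0(3))
    show "meq ?D ?D (mmul ?D (\<lambda>a b. R b a) S) idm" unfolding Tm2_conv(2) cS by (rule S0(2))
    fix S' assume S': "(\<forall>a b. a \<notin> ?D \<or> b \<notin> ?D --> S' a b = 0) \<and> meq ?D ?D (mmul ?D S' (\<lambda>a b. R b a)) idm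
      \<and> meq ?D ?D (mmul ?D (\<lambda>a b. R b a) S') idm"
    then have left: "conv d S' * ?N = idB (wds d 2)" unfolding Tm2_conv(2) by blast
    have "conv d S' = conv d S' * (?N * S0)" unfolding S0(3) by (simp add: mult_idB[OF _ conv_Mt])
    also have "... = S0" unfolding mult.assoc[symmetric] left using S0(1) by simp
    finally have eq: "conv d S' = conv d S" using cS by simp
    show "S' = S"
    proof (intro ext)
      fix a b
      show "S' a b = S a b"
      proof (cases "a \<in> ?D \<and> b \<in> ?D")
        case True
        then have "[fst a, snd a] \<in> wds d 2" "[fst b, snd b] \<in> wds d 2" by (auto simp: hk_words_def)
        then show ?thesis using arg_cong[OF eq, of "\<lambda>M. ent M [fst b, snd b] [fst a, snd a]"] by (simp add: conv_def)
      next
        case False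
        then have "S' a b = 0" using conjunct1[OF S'] by blast
        moreover have "S a b = 0" using False by (auto simp: S_def)
        ultimately show ?thesis by simp
      qed
    qed
  qed
  then show "?N * conv d (Rdual_inv d R) = idB (wds d 2)" "conv d (Rdual_inv d R) * ?N = idB (wds d 2)"
    using cS S0(2,3) by simp_all
qed

lemma sum_words_zip:
  "(\<Sum>v\<in>hk_words n (Wbasis d' d). f v) = (\<Sum>a\<in>wds d n. \<Sum>b\<in>wds d' n. f (zip b a))"
proof -
  have "(\<Sum>v\<in>hk_words n (Wbasis d' d). f v) = (\<Sum>ab\<in>wds d n \<times> wds d' n. f (zip (snd ab) (fst ab)))"
  proof (rule sum.reindex_bij_witness[where i = "\<lambda>ab. zip (snd ab) (fst ab)" and j = "\<lambda>v. (map snd v, map fst v)"])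
    fix ab assume "ab \<in> wds d n \<times> wds d' n"
    then show "zip (snd ab) (fst ab) \<in> hk_words n (Wbasis d' d)" "(map snd (zip (snd ab) (fst ab)), map fst (zip (snd ab) (fst ab))) = ab"
      by (auto simp: zip_words) (auto simp: hk_words_def)
  qed (use words_unzip in \<open>auto simp: zip_map_fst_snd\<close>)
  then show ?thesis by (simp add: sum.cartesian_product split_beta)
qed

context
  fixes q :: "'k::field" and d d' :: nat and R R' :: "nat \<times> nat => nat \<times> nat => 'k"
  assumes H: "hecke_symmetry q d R" and H': "hecke_symmetry q d' R'"
begin

abbreviation (input) "WB \<equiv> Wbasis d' d"
abbreviation (input) "TV \<equiv> Tm R d"
abbreviation (input) "TV' \<equiv> Tm R' d'"
abbreviation (input) "NI \<equiv> conv d' (Rdual_inv d' R')"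

lemma calR_vecs: "calR_minus_id d' R' d R g \<in> vecs 2 WB"
  by (simp add: calR_minus_id_def linmap_def vecs_def)

text \<open>On a map \<open>G\<close> between the tensor squares, the operator acts as
  \<open>G\<close> to \<open>R G R'^-1\<close>: the factor on the dual space becomes multiplication
  from the right.\<close>

lemma Ph_calR: "Ph d' d 2 (calR_minus_id d' R' d R g) = TV 2 1 * (Ph d' d 2 g * NI) - Ph d' d 2 g"
proof (rule Mt_eqI[OF Ph_Mt])
  have GN: "Ph d' d 2 g * NI \<in> Mt (wds d 2) (wds d' 2)" by (rule Mt_mult[OF Ph_Mt conv_Mt])
  show "TV 2 1 * (Ph d' d 2 g * NI) - Ph d' d 2 g \<in> Mt (wds d 2) (wds d' 2)"
    by (intro Mt_diff Mt_mult[OF Tm_Mt GN] Ph_Mt)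
  fix u w assume u: "u \<in> wds d 2" and w: "w \<in> wds d' 2"
  let ?Y = "hk_words 2 WB"
  have fW: "finite ?Y" by (simp add: Wbasis_def)
  have l: "length a = 2" if "a \<in> wds c 2" for a c using that by (simp add: hk_words_def)
  have "ent (Ph d' d 2 (calR_minus_id d' R' d R g)) u w = (\<Sum>v\<in>?Y. (calR d' R' R (zip w u) v - idm (zip w u) v) * g v)"
    using u w zip_words[OF u w] by (simp add: Ph_def calR_minus_id_def linmap_def)
  also have "... = (\<Sum>v\<in>?Y. calR d' R' R (zip w u) v * g v) - (\<Sum>v\<in>?Y. if zip w u = v then g v else 0)"
    unfolding sum_subtractf[symmetric] by (intro sum.cong refl) (auto simp: idm_def left_diff_distrib)
  also have "... = (\<Sum>v\<in>?Y. calR d' R' R (zip w u) v * g v) - g (zip w u)" using zip_words[OF u w] fW by simp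
  also have "(\<Sum>v\<in>?Y. calR d' R' R (zip w u) v * g v)
      = (\<Sum>a\<in>wds d 2. \<Sum>b\<in>wds d' 2. R (u ! 0, u ! 1) (a ! 0, a ! 1) * (g (zip b a) * Rdual_inv d' R' (w ! 0, w ! 1) (b ! 0, b ! 1)))"
    unfolding sum_words_zip by (intro sum.cong refl) (use l u w in \<open>simp add: calR_def mult_ac\<close>)
  also have "... = ent (TV 2 1 * (Ph d' d 2 g * NI)) u w"
  proof -
    have "ent (Ph d' d 2 g * NI) a w = (\<Sum>b\<in>wds d' 2. g (zip b a) * Rdual_inv d' R' (w ! 0, w ! 1) (b ! 0, b ! 1))" if a: "a \<in> wds d 2" for a
      by (subst ent_times[OF _ Ph_Mt]) (use a w in \<open>auto simp: Ph_def conv_def\<close>)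
    then show ?thesis using u by (simp add: ent_times[OF _ Tm_Mt] ent_Tm2 sum_distrib_left)
  qed
  finally show "ent (Ph d' d 2 (calR_minus_id d' R' d R g)) u w = ent (TV 2 1 * (Ph d' d 2 g * NI) - Ph d' d 2 g) u w"
    using u w by (simp add: Ph_def)
qed

abbreviation (input) "XC n \<equiv> commX (wds d' n) (TV' n) (wds d n) (TV n)"
abbreviation (input) "YC n \<equiv> commY (wds d' n) (TV' n) (wds d n) (TV n)"

lemma Ph_eq_0_iff: "f \<in> vecs n WB ==> Ph d' d n f = 0 \<longleftrightarrow> f = 0"
proof
  assume f: "f \<in> vecs n WB" and "Ph d' d n f = 0"
  then have "f = Pinv d' d n 0" using Pinv_Ph[OF f] by simp
  then show "f = 0" by (auto simp: Pinv_def)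
next
  assume "f = 0" then show "Ph d' d n f = 0" by (auto simp: Ph_def intro!: fmat_eqI)
qed

text \<open>The fixed vectors of \<open>G\<close> to \<open>R G R'^-1\<close> are the maps with
  \<open>R G = G R'\<close>.\<close>

lemma relE_iff: "g \<in> relE d' R' d R \<longleftrightarrow> g \<in> vecs 2 WB \<and> Ph d' d 2 g \<in> XC 2 0"
proof -
  let ?G = "Ph d' d 2 g" and ?N = "TV 2 1" and ?N' = "TV' 2 1"
  note I = Rdual_inv_inverse[OF H']
  have "calR_minus_id d' R' d R g = (\<lambda>u. 0) \<longleftrightarrow> ?N * (?G * NI) = ?G"
    using Ph_eq_0_iff[OF calR_vecs, of g] unfolding Ph_calR by (simp add: zero_fun_def)
  also have "... \<longleftrightarrow> ?N * ?G = ?G * ?N'"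
  proof
    assume "?N * (?G * NI) = ?G"
    then have "?N * (?G * NI) * ?N' = ?G * ?N'" by simp
    then show "?N * ?G = ?G * ?N'" by (simp only: mult.assoc I mult_idB[OF _ Ph_Mt] finite_hk_words finite_lessThan)
  next
    assume "?N * ?G = ?G * ?N'"
    then have "?N * ?G * NI = ?G * ?N' * NI" by simp
    then show "?N * (?G * NI) = ?G" by (simp only: mult.assoc I mult_idB[OF _ Ph_Mt] finite_hk_words finite_lessThan)
  qed
  finally show ?thesis by (auto simp: relE_def commX_def)
qed

text \<open>With \<open>H = G R'^-1\<close> one has \<open>R G R'^-1 - G = R H - H R'\<close>, and
  \<open>H\<close> ranges over all maps as \<open>G\<close> does.\<close>

lemma relA_iff: "g \<in> relA d' R' d R \<longleftrightarrow> g \<in> vecs 2 WB \<and> Ph d' d 2 g \<in> YC 2 0"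
proof
  let ?N = "TV 2 1" and ?N' = "TV' 2 1"
  note I = Rdual_inv_inverse[OF H']
  {
    assume "g \<in> relA d' R' d R"
    then obtain f where f: "g = calR_minus_id d' R' d R f" by (auto simp: relA_def)
    let ?H = "Ph d' d 2 f * NI"
    have "?H * ?N' = Ph d' d 2 f" by (simp only: mult.assoc I mult_idB[OF _ Ph_Mt] finite_hk_words finite_lessThan)
    then have "Ph d' d 2 g = ?N * ?H - ?H * ?N'" unfolding f Ph_calR by simp
    moreover have "?H \<in> Mt (wds d 2) (wds d' 2)" by (rule Mt_mult[OF Ph_Mt conv_Mt])
    ultimately have "Ph d' d 2 g \<in> YC 2 0" unfolding commY_def One_nat_def by blast
    then show "g \<in> vecs 2 WB \<and> Ph d' d 2 g \<in> YC 2 0" using calR_vecs f by simp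
  }
  assume g: "g \<in> vecs 2 WB \<and> Ph d' d 2 g \<in> YC 2 0"
  then obtain X where X: "X \<in> Mt (wds d 2) (wds d' 2)" "Ph d' d 2 g = ?N * X - X * ?N'" by (auto simp: commY_def)
  define f where "f = Pinv d' d 2 (X * ?N')"
  have Pf: "Ph d' d 2 f = X * ?N'" unfolding f_def by (rule Ph_Pinv[OF Mt_mult[OF X(1) Tm_Mt]])
  have "X * ?N' * NI = X" using X(1) by (simp only: mult.assoc I mult_idB finite_hk_words finite_lessThan)
  then have "Ph d' d 2 (calR_minus_id d' R' d R f) = Ph d' d 2 g" unfolding Ph_calR Pf X(2) by simp
  then have "calR_minus_id d' R' d R f = g" using Pinv_Ph[OF calR_vecs] Pinv_Ph[of g 2 d' d] g by metis
  then show "g \<in> relA d' R' d R" unfolding relA_def f_def using Pinv_vecs by blast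
qed

lemma subspace_Ph: "fm.subspace (Z :: 'k fmat set) ==> fs.subspace {g \<in> vecs n WB. Ph d' d n g \<in> Z}"
proof -
  assume Z: "fm.subspace Z"
  have P0: "Ph d' d n 0 = (0 :: 'k fmat)" by (rule fmat_eqI) (simp add: Ph_def)
  have V: "fs.subspace (vecs n WB :: ((nat \<times> nat) list => 'k) set)" by (rule subspace_vecs)
  show ?thesis using Z V unfolding fs.subspace_def fm.subspace_def by (simp add: Ph_add Ph_scale P0)
qed

lemma subspace_relE: "fs.subspace (relE d' R' d R)"
  using subspace_Ph[OF subspace_commX] relE_iff by (metis (no_types, lifting) Collect_cong Collect_mem_eq)

lemma subspace_relA: "fs.subspace (relA d' R' d R)"
  using subspace_Ph[OF subspace_commY] relA_iff by (metis (no_types, lifting) Collect_cong Collect_mem_eq)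

lemma rel_sub: "relE d' R' d R \<subseteq> vecs 2 WB" "relA d' R' d R \<subseteq> vecs 2 WB" using relE_iff relA_iff by blast+

lemma fin_WB: "finite WB" by (simp add: Wbasis_def)

lemma slc_Mt: "slc d d' p s p' s' F \<in> Mt (wds d 2) (wds d' 2)" by (simp add: slc_def)

lemma rel_piece_relE: "j + 2 \<le> n ==> f \<in> vecs n WB ==> f \<in> rel_piece WB (relE d' R' d R) n j \<longleftrightarrow> Ph d' d n f \<in> XC n j"
  unfolding rel_piece_iff_slc[where Q = "\<lambda>M. M \<in> XC 2 0", OF subspace_relE relE_iff] commX_iff_slc[OF _ Ph_Mt]
  by (simp add: commX_def slc_Mt)

lemma YC_iff: "M \<in> YC 2 0 \<longleftrightarrow> (\<exists>X\<in>Mt (wds d 2) (wds d' 2). M = TV 2 1 * X - X * TV' 2 1)"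
  unfolding commY_def One_nat_def by blast

lemma rel_piece_relA: "j + 2 \<le> n ==> f \<in> vecs n WB ==> f \<in> rel_piece WB (relA d' R' d R) n j \<longleftrightarrow> Ph d' d n f \<in> YC n j"
  unfolding rel_piece_iff_slc[where Q = "\<lambda>M. M \<in> YC 2 0", OF subspace_relA relA_iff] commY_iff_slc[OF _ Ph_Mt]
  by (simp only: YC_iff)

lemma kcond_rel_piece:
  fixes I2 :: "((nat \<times> nat) list => 'k) set"
  assumes I2: "fs.subspace I2" "I2 \<subseteq> vecs 2 WB"
    and Z: "\<And>j f. j + 2 \<le> n ==> f \<in> vecs n WB ==> f \<in> rel_piece WB I2 n j \<longleftrightarrow> Ph d' d n f \<in> Z j"
    and ZM: "\<And>j. j + 2 \<le> n ==> Z j \<subseteq> Mt (wds d n) (wds d' n)" and K: "kcond n Z"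
  shows "kcond n (rel_piece WB I2 n)"
proof (rule kcond_transfer[OF K, where I = "{()}" and F = "\<lambda>_. Ph d' d n" and G = "\<lambda>_. Pinv d' d n"])
  note v = rel_piece_vecs[OF fin_WB I2] and sub = subspace_rel_piece[OF fin_WB I2]
  fix j x y assume j: "Suc j < n"
  then have j2: "j + 2 \<le> n" by simp
  show "x \<in> rel_piece WB I2 n j ==> Ph d' d n x \<in> Z j" using Z[OF j2] v[OF j2] by blast
  show "x \<in> rel_piece WB I2 n j ==> (\<Sum>i\<in>{()}. Pinv d' d n (Ph d' d n x)) = x" by (simp add: Pinv_Ph subsetD[OF v[OF j2]])
  show "0 \<in> rel_piece WB I2 n j" using fs.subspace_0[OF sub] .
  show "x \<in> rel_piece WB I2 n j ==> y \<in> rel_piece WB I2 n j ==> x + y \<in> rel_piece WB I2 n j" using fs.subspace_add[OF sub] .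
next
  fix j and x :: "'k fmat" assume j: "Suc j < n" and x: "x \<in> Z j"
  then have j2: "j + 2 \<le> n" by simp
  show "Pinv d' d n x \<in> rel_piece WB I2 n j" using Z[OF j2 Pinv_vecs, of x] ZM[OF j2] x Ph_Pinv by fastforce
qed (simp_all add: Ph_add Pinv_add)

lemma commXY_Mt: "XC n j \<subseteq> Mt (wds d n) (wds d' n)" "YC n j \<subseteq> Mt (wds d n) (wds d' n)"
  by (auto simp: commX_def commY_def intro!: Mt_diff Mt_mult[OF Tm_Mt] Mt_mult[OF _ Tm_Mt])

lemma dim_Ph:
  fixes U :: "((nat \<times> nat) list => 'k) set"
  assumes "fs.subspace U" "U \<subseteq> vecs n WB"
  shows "fm.dim (Ph d' d n ` U) = fs.dim U"
proof -
  interpret p: vspace_pair "fsc :: 'k => ((nat \<times> nat) list => 'k) => _" fsm by unfold_locales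
  show ?thesis
    by (rule p.dim_image_inj_on[OF assms(1) fs.fdim_subset[OF fdim_vecs[OF fin_WB] assms(2)]])
      (use assms(2) Ph_eq_0_iff in \<open>auto simp: Ph_add Ph_scale\<close>)
qed

lemma Ph_image: "Ph d' d n ` {f \<in> vecs n WB. Ph d' d n f \<in> (Z :: 'k fmat set)} = Z \<inter> Mt (wds d n) (wds d' n)"
proof (intro equalityI subsetI)
  fix M assume "M \<in> Z \<inter> Mt (wds d n) (wds d' n)"
  then show "M \<in> Ph d' d n ` {f \<in> vecs n WB. Ph d' d n f \<in> Z}"
    by (intro image_eqI[of _ _ "Pinv d' d n M"]) (simp_all add: Ph_Pinv)
qed auto

lemma dim_vecs: "fs.dim (vecs n WB :: ((nat \<times> nat) list => 'k) set) = fm.dim (Mt (wds d n) (wds d' n) :: 'k fmat set)"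
  using dim_Ph[OF subspace_vecs subset_refl, of n] Ph_image[of n UNIV] by simp

lemma dim_kdual_relE: "fs.dim (kdual WB (relE d' R' d R) n) = fm.dim (hhom n (wds d' n) (TV' n) (wds d n) (TV n))"
proof -
  have "kdual WB (relE d' R' d R) n = {f \<in> vecs n WB. Ph d' d n f \<in> hhom n (wds d' n) (TV' n) (wds d n) (TV n)}"
    unfolding kdual_eq[OF fin_WB subspace_relE rel_sub(1)] PP_def
    using rel_piece_relE[of _ n] by (auto simp: hhom_def commX_def)
  then have "Ph d' d n ` kdual WB (relE d' R' d R) n = hhom n (wds d' n) (TV' n) (wds d n) (TV n)"
    using Ph_image[of n "hhom n (wds d' n) (TV' n) (wds d n) (TV n)"] hhom_Mt by fastforce
  moreover have "fs.subspace (kdual WB (relE d' R' d R) n)" "kdual WB (relE d' R' d R) n \<subseteq> vecs n WB"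
    unfolding kdual_eq[OF fin_WB subspace_relE rel_sub(1)]
    using subspace_PP[OF fin_WB subspace_relE rel_sub(1)] PP_vecs[OF fin_WB subspace_relE rel_sub(1)] by auto
  ultimately show ?thesis using dim_Ph by metis
qed

lemma dim_qideal_relA:
  "fs.dim (qideal WB (relA d' R' d R) n) = fm.dim (fm.span (\<Union>j\<in>{j. j + 2 \<le> n}. YC n j))"
proof -
  interpret p: vspace_pair "fsc :: 'k => ((nat \<times> nat) list => 'k) => _" fsm by unfold_locales
  have lin: "Vector_Spaces.linear fsc fsm (Ph d' d n :: _ => 'k fmat)"
    by unfold_locales (simp_all add: Ph_add Ph_scale)
  note sub = fin_WB subspace_relA rel_sub(2)
  have im: "Ph d' d n ` rel_piece WB (relA d' R' d R) n j = YC n j" if j: "j + 2 \<le> n" for j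
  proof -
    have "rel_piece WB (relA d' R' d R) n j = {f \<in> vecs n WB. Ph d' d n f \<in> YC n j}"
      using rel_piece_relA[OF j] rel_piece_vecs[OF sub j] by blast
    then show ?thesis using Ph_image[of n "YC n j"] commXY_Mt(2) by blast
  qed
  have "Ph d' d n ` qideal WB (relA d' R' d R) n = fm.span (\<Union>j\<in>{j. j + 2 \<le> n}. YC n j)"
    unfolding qideal_def lspan_eq p.linear_span_image[OF lin, symmetric] image_UN using im by simp
  moreover have "fs.subspace (qideal WB (relA d' R' d R) n)" "qideal WB (relA d' R' d R) n \<subseteq> vecs n WB"
    unfolding qideal_eq[OF sub] using subspace_SP[OF sub] SP_vecs[OF sub] by auto
  ultimately show ?thesis using dim_Ph by metis
qed

text \<open>By \<open>tr_commutator\<close>, a map in the opposite direction is orthogonal to all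
  commutators exactly when it commutes with every generator. So the span, whose quotient is the
  degree \<open>n\<close> part of \<open>A\<close>, and this Hom space have complementary
  dimensions; each inequality is one use of \<open>pairing_dim_le\<close>, with the arguments of the
  form in either order.\<close>

lemma dim_perp:
  "fm.dim (fm.span (\<Union>j\<in>{j. j + 2 \<le> n}. YC n j)) + fm.dim (hhom n (wds d n) (TV n) (wds d' n) (TV' n))
    = fm.dim (Mt (wds d n) (wds d' n) :: 'k fmat set)"
proof -
  interpret p: vspace_pair "fsm :: 'k => _" fsm by unfold_locales
  let ?S = "fm.span (\<Union>j\<in>{j. j + 2 \<le> n}. YC n j)" and ?B = "wds d n" and ?B' = "wds d' n"
  let ?H = "hhom n ?B (TV n) ?B' (TV' n)" and ?M = "Mt ?B ?B' :: 'k fmat set" and ?M' = "Mt ?B' ?B :: 'k fmat set"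
  have SM: "?S \<subseteq> ?M" by (rule fm.span_minimal[OF _ subspace_Mt]) (use commXY_Mt(2) in blast)
  have HM: "?H \<subseteq> ?M'" using hhom_Mt by blast
  have fM: "fm.fdim ?M" "fm.fdim ?M'" by (simp_all add: fdim_Mt)
  have d0: "fm.dim {0 :: 'k fmat} = 0" using fm.dim_eq_card[of "{}" "{0}"] fm.independent_empty by simp
  have tr0: "tr ?B (0 :: 'k fmat) = 0" by (simp add: tr_def)
  have comm: "tr ?B ((TV n (Suc j) * x - x * TV' n (Suc j)) * y) = tr ?B (x * (y * TV n (Suc j) - TV' n (Suc j) * y))"
    if "x \<in> ?M" "y \<in> ?M'" for x y j
    by (rule tr_commutator[OF _ _ Tm_Mt Tm_Mt that]) simp_all
  have perp: "tr ?B (x * y) = 0" if x: "x \<in> ?S" and y: "y \<in> ?H" for x y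
  proof -
    have "?S \<subseteq> {x. tr ?B (x * y) = 0}"
    proof (rule fm.span_minimal)
      show "fm.subspace {x. tr ?B (x * y) = 0}" unfolding fm.subspace_def
        by (auto simp: distrib_right tr_add tr_scale) (simp add: tr_def)
      show "(\<Union>j\<in>{j. j + 2 \<le> n}. YC n j) \<subseteq> {x. tr ?B (x * y) = 0}"
      proof
        fix z assume "z \<in> (\<Union>j\<in>{j. j + 2 \<le> n}. YC n j)"
        then obtain j x where j: "j + 2 \<le> n" "x \<in> ?M" "z = TV n (Suc j) * x - x * TV' n (Suc j)" by (auto simp: commY_def)
        have "y * TV n (Suc j) - TV' n (Suc j) * y = 0" using hhom_comm[OF y, of j] j(1) by simp
        then show "z \<in> {x. tr ?B (x * y) = 0}" using comm[OF j(2) subsetD[OF HM y], of j] j(3) by (simp add: tr_def)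
      qed
    qed
    then show ?thesis using x by blast
  qed
  have "fm.dim ?M' + fm.dim {0 :: 'k fmat} \<le> fm.dim ?H + fm.dim ?S"
  proof (rule fm.pairing_dim_le[where \<beta> = "\<lambda>x y. tr ?B (x * y)"])
    show "fm.fdim ?S" by (rule fm.fdim_subset[OF fM(1) SM])
    fix y assume y: "y \<in> ?M'" and z: "\<And>x. x \<in> ?S ==> tr ?B (x * y) = 0"
    have "TV' n (Suc j) * y = y * TV n (Suc j)" if j: "Suc j < n" for j
    proof -
      let ?f = "y * TV n (Suc j) - TV' n (Suc j) * y"
      have fM': "?f \<in> ?M'" by (intro Mt_diff Mt_mult[OF y Tm_Mt] Mt_mult[OF Tm_Mt y])
      have "tr ?B' (?f * x) = 0" if x: "x \<in> ?M" for x
      proof -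
        have m: "TV n (Suc j) * x - x * TV' n (Suc j) \<in> ?S"
          by (rule fm.span_base, rule UN_I[of j]) (use x j in \<open>auto simp: commY_def\<close>)
        have "tr ?B (x * ?f) = 0" using z[OF m] unfolding comm[OF x y] .
        then show ?thesis using tr_commute[OF _ _ x fM'] by simp
      qed
      then have "?f = 0" using trace_nondegenerate[OF _ fM'] by simp
      then show ?thesis by simp
    qed
    then show "y \<in> ?H" using y by (simp add: hhom_def)
  qed (use perp HM fM(2) in \<open>auto simp: distrib_left distrib_right tr_add tr_scale fm.span_zero tr0 subspace_Mt fm.subspace_single_0\<close>)
  moreover have "fm.dim ?S + fm.dim ?H \<le> fm.dim {0 :: 'k fmat} + fm.dim ?M'"
  proof (rule fm.pairing_dim_le[where \<beta> = "\<lambda>y x. tr ?B (x * y)"])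
    show "fm.fdim ?S" by (rule fm.fdim_subset[OF fM(1) SM])
    fix x assume x: "x \<in> ?S" and z: "\<And>y. y \<in> ?M' ==> tr ?B (x * y) = 0"
    show "x \<in> {0}" using trace_nondegenerate[OF _ subsetD[OF SM x] z] by simp
  qed (use perp HM fM(2) in \<open>auto simp: distrib_left distrib_right tr_add tr_scale fm.span_zero tr0 subspace_Mt subspace_hhom\<close>)
  moreover have "fm.dim ?M' = fm.dim ?M"
  proof -
    have "trp ` ?M = ?M'"
    proof (intro equalityI subsetI)
      fix y :: "'k fmat" assume "y \<in> ?M'"
      then show "y \<in> trp ` ?M" by (intro image_eqI[of _ _ "trp y"]) (auto intro: trp_Mt)
    qed (auto intro: trp_Mt)
    moreover have "fm.dim (trp ` ?M) = fm.dim ?M"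
    proof (rule p.dim_image_inj_on[OF subspace_Mt fM(1)])
      fix x :: "'k fmat" assume "trp x = 0" then show "x = 0" by (metis trp_trp trp_zero)
    qed (simp_all add: trp_add trp_scale)
    ultimately show ?thesis by simp
  qed
  ultimately show ?thesis using d0 by simp
qed

end

theorem theorem6p2:
  fixes q :: "'k::field" and d d' :: nat and R R' :: "nat \<times> nat \<Rightarrow> nat \<times> nat \<Rightarrow> 'k"
  assumes "hecke_symmetry q d R" and "hecke_symmetry q d' R'"
    and "one_dim_source q d R" and "one_dim_source q d' R'"
  shows "koszul (Wbasis d' d) (relA d' R' d R)
       \<and> koszul (Wbasis d' d) (relE d' R' d R)
       \<and> hilb (Wbasis d' d) (relA d' R' d R)
           * Abs_fps (\<lambda>n. (-1) ^ n * fps_nth (hilb (Wbasis d' d) (relE d' R' d R)) n) = 1"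
proof -
  let ?W = "Wbasis d' d" and ?A = "relA d' R' d R" and ?E = "relE d' R' d R"
  note H = assms(1,2)
  have q: "q \<noteq> 0" using H(1) by (simp add: hecke_symmetry_def)
  note fin = fin_WB[OF H] and sE = subspace_relE[OF H] rel_sub(1)[OF H] and sA = subspace_relA[OF H] rel_sub(2)[OF H]
  have fact: "\<exists>a f g. factors q n (wds d n) (Tm R d n) a f g" if "0 < n" "hecke_symmetry q d R" "one_dim_source q d R"
    for n d and R :: "nat \<times> nat \<Rightarrow> nat \<times> nat \<Rightarrow> 'k"
    using source_factors[OF q that(3,1)] hmod_tensor[OF that(2), of n] unfolding Tm_def by blast
  \<comment> \<open>The source condition concerns only \<open>n > 0\<close>. For
    \<open>n = 0\<close> there are no generators, and both Hom spaces are the same space of matrices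
    on the empty word.\<close>
  have K: "kcond n (commX (wds d' n) (Tm R' d' n) (wds d n) (Tm R d n))
      \<and> kcond n (commY (wds d' n) (Tm R' d' n) (wds d n) (Tm R d n))
      \<and> fm.dim (hhom n (wds d n) (Tm R d n) (wds d' n) (Tm R' d' n)) = fm.dim (hhom n (wds d' n) (Tm R' d' n) (wds d n) (Tm R d n))" for n
  proof (cases "n = 0")
    case True
    have "hk_words 0 X = {[]}" for X :: "nat set" by (auto simp: hk_words_def)
    then show ?thesis using True by (simp add: kcond_def hhom_def)
  next
    case False
    then obtain a f g a' f' g' where F: "factors q n (wds d n) (Tm R d n) a f g" "factors q n (wds d' n) (Tm R' d' n) a' f' g'"
      using fact[of n d R] fact[of n d' R'] assms by blast
    show ?thesis
      using kcond_factors[OF q hmod_tensor[OF H(2)] hmod_tensor[OF H(1)] F(2,1)] dim_hhom_sym[OF q _ _ F] by simp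
  qed
  have KA: "kcond n (rel_piece ?W ?A n)" for n
    using K[of n] by (intro kcond_rel_piece[OF H sA, of n, OF rel_piece_relA[OF H] commXY_Mt(2)[OF H]]) blast+
  have KE: "kcond n (rel_piece ?W ?E n)" for n
    using K[of n] by (intro kcond_rel_piece[OF H sE, of n, OF rel_piece_relE[OF H] commXY_Mt(1)[OF H]]) blast+
  have vd: "vdim (vecs n ?W :: ((nat \<times> nat) list \<Rightarrow> 'k) set) = fs.dim (vecs n ?W :: ((nat \<times> nat) list \<Rightarrow> 'k) set)" for n
    by (rule vdim_eq[OF subspace_vecs fdim_vecs[OF fin]])
  have vq: "vdim (qideal ?W I2 n) = fs.dim (qideal ?W I2 n)" if s: "fs.subspace I2" "I2 \<subseteq> vecs 2 ?W" for I2 :: "((nat \<times> nat) list \<Rightarrow> 'k) set" and n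
    unfolding qideal_eq[OF fin s]
    by (rule vdim_eq[OF subspace_SP[OF fin s] fs.fdim_subset[OF fdim_vecs[OF fin] SP_vecs[OF fin s order_refl]]])
  have hE: "fps_nth (hilb ?W ?E) n = int (fs.dim (vecs n ?W :: ((nat \<times> nat) list \<Rightarrow> 'k) set)) - int (fs.dim (qideal ?W ?E n))" for n
    by (simp add: hilb_def vd vq[OF sE])
  \<comment> \<open>\<open>dim_perp\<close> identifies the coefficient with the dimension of the
    Hecke maps from the tensor power of \<open>V\<close> to that of \<open>V'\<close>, the dual of
    \<open>E\<close> with those in the opposite direction; the symmetry in \<open>K\<close> joins
    the two.\<close>
  have hA: "fps_nth (hilb ?W ?A) n = int (fs.dim (kdual ?W ?E n))" for n
  proof -
    have "fs.dim (qideal ?W ?A n) + fs.dim (kdual ?W ?E n) = fs.dim (vecs n ?W :: ((nat \<times> nat) list \<Rightarrow> 'k) set)"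
      unfolding dim_qideal_relA[OF H] dim_kdual_relE[OF H] dim_vecs[OF H] using dim_perp[OF H, of n] K[of n] by simp
    then show ?thesis by (simp add: hilb_def vd vq[OF sA])
  qed
  have d0: "fs.dim (vecs 0 ?W :: ((nat \<times> nat) list \<Rightarrow> 'k) set) = 1"
  proof -
    have "fs.span {dl []} = (vecs 0 ?W :: ((nat \<times> nat) list \<Rightarrow> 'k) set)"
    proof (intro equalityI subsetI)
      fix f :: "(nat \<times> nat) list \<Rightarrow> 'k" assume f: "f \<in> vecs 0 ?W"
      have "f = fsc (f []) (dl [])"
      proof
        fix w show "f w = fsc (f []) (dl []) w" using f by (cases w) (auto simp: fsc_def dl_def vecs_def hk_words_def)
      qed
      then show "f \<in> fs.span {dl []}" by (simp add: fs.span_singleton)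
    next
      have "(dl [] :: (nat \<times> nat) list \<Rightarrow> 'k) \<in> vecs 0 ?W" by (auto simp: dl_def vecs_def hk_words_def)
      then show "f \<in> vecs 0 ?W" if "f \<in> fs.span {dl []}" for f :: "(nat \<times> nat) list \<Rightarrow> 'k"
        using that fs.span_minimal[OF _ subspace_vecs, of "{dl []}" 0 ?W] by blast
    qed
    moreover have "dl [] \<noteq> (0 :: (nat \<times> nat) list \<Rightarrow> 'k)" by (auto simp: dl_def fun_eq_iff)
    ultimately show ?thesis using fs.dim_eq_card_basis[of "{dl []}"] fs.dependent_single by fastforce
  qed
  have "hilb ?W ?A * Abs_fps (\<lambda>n. (-1) ^ n * fps_nth (hilb ?W ?E) n) = 1"
  proof (rule fps_ext)
    fix m
    have "fps_nth (hilb ?W ?A * Abs_fps (\<lambda>n. (-1) ^ n * fps_nth (hilb ?W ?E) n)) m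
        = (\<Sum>k\<le>m. (-1) ^ k * (int (fs.dim (vecs k ?W :: ((nat \<times> nat) list \<Rightarrow> 'k) set)) - int (fs.dim (qideal ?W ?E k))) * int (fs.dim (kdual ?W ?E (m - k))))"
      by (subst mult.commute) (simp add: fps_mult_nth hE hA atLeast0AtMost)
    also have "\<dots> = fps_nth 1 m"
    proof (cases "m = 0")
      case True
      have "kdual ?W ?E 0 = vecs 0 ?W" by (simp add: kdual_def)
      moreover have "fs.dim (qideal ?W ?E 0) = 0"
        using fs.dim_eq_card[of "{}" "{0}"] fs.independent_empty by (simp add: qideal_def lspan_eq)
      ultimately show ?thesis using True d0 by simp
    next
      case False
      then show ?thesis using euler_char[OF fin sE KE, of m] by simp
    qed
    finally show "fps_nth (hilb ?W ?A * Abs_fps (\<lambda>n. (-1) ^ n * fps_nth (hilb ?W ?E) n)) m = fps_nth 1 m" .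
  qed
  then show ?thesis using koszul_of_kcond[OF fin sA KA] koszul_of_kcond[OF fin sE KE] by blast
qed

end
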